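(* Let $\tau<0$. Let $X$ be a compact connected Riemann surface and let $\omega_X$ be a Kähler form on $X$ satisfying $\int_X\omega_X=1$. Let $(L,\overline\partial_L)$ be a holomorphic line bundle over $X$. Let $E$ be a holomorphic bundle over $X\times\Delta$ which is an extension of $\underline{\mathbb{C}}_{X\times\Delta}$ by $p^\ast L\otimes q^\ast L_{-2}$, and let $\overline\partial_E$ be the Dolbeault operator of $E$; identify $E$ with $p^\ast L\otimes q^\ast L_{-2}\oplus\underline{\mathbb{C}}_{X\times\Delta}$ by a smooth splitting, with the $SU(1,1)$-action described in the context. On $X\times\Delta$ consider the Kähler form $$\Omega_\tau=\Big(-\frac\tau2p^\ast\omega_X\Big)\oplus q^\ast\omega_{\mathrm{Poi}}.$$ (i) If $(E,\overline\partial_E)$ is an $SU(1,1)$-equivariant holomorphic bundle, then there exists a holomorphic section $\phi$ of $(L,\overline\partial_L)$ such that $$\overline\partial_E=\begin{pmatrix}p^\ast\overline\partial_L\otimes\mathrm{Id}+\mathrm{Id}\otimes q^\ast\overline\partial_\Delta&\sqrt{-\frac1\tau}\cdot p^\ast\phi\otimes q^\ast\alpha\\0&\overline\partial_{X\times\Delta}\end{pmatrix}.$$ (ii) Let $h_E$ be a pseudo-Hermitian metric of signature $(1,1)$ on $E$. If $h_E$ is $SU(1,1)$-invariant, then there exist Hermitian metrics $h_L$ on $L$ and $h_X$ on $\underline{\mathbb{C}}_X$ such that $$h_E=\begin{pmatrix}C_0\cdot p^\ast(h_Xh_L)\otimes q^\ast h^{(-2)}&0\\0&C_1\cdot p^\ast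 h_X\end{pmatrix}$$ where $(C_0,C_1)=(1,-1)$ or $(-1,1)$. (iii) Let $(E,\overline\partial_E)$ be an $SU(1,1)$-equivariant holomorphic bundle and $h_E$ an $SU(1,1)$-invariant pseudo-Hermitian metric of signature $(1,1)$ on $E$, with $\phi$ and $h_L$ as in the displayed forms of $\overline\partial_E$ and $h_E$ in (i) and (ii), and let $\nabla_{h_E}$ be the connection compatible with $h_E$ with $\nabla^{0,1}_{h_E}=\overline\partial_E$. If $h_E$ is a pseudo-Hermitian-Einstein metric of $(E,\overline\partial_E)$ with respect to $\Omega_\tau$, or equivalently, if $\nabla_{h_E}$ is a pseudo-Hermitian-Yang-Mills connection, then: - the triple $((L,\overline\partial_L),\phi,h_L)$ satisfies Manton's exotic $\tau$-vortex equation; - the constant $\lambda$ in the equation $\sqrt{-1}\Lambda_{\Omega_\tau}F_{h_E}=\lambda\,\mathrm{Id}_E$ satisfies $\lambda=\frac12\big(1-\frac{4\pi}{\tau}\deg L\big)$.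
   Context: Vortex equation: for $\tau\in\mathbb{R}$, $((L,\overline\partial_L),\phi,h_L)$ satisfies Manton's exotic $\tau$-vortex equation if $\sqrt{-1}\Lambda_{\omega_X}F_{h_L}-\frac12|\phi|^2_{h_L}-\frac\tau2=0$, where $F_{h_L}$ is the curvature of the Chern connection of $(\overline\partial_L,h_L)$ and $\Lambda_{\omega_X}$ is contraction with $\omega_X$. Notation: $\Delta=\{z\in\mathbb{C}:|z|<1\}$; $p:X\times\Delta\to X$, $q:X\times\Delta\to\Delta$ are the projections; $\underline{\mathbb{C}}_M$ is the trivial holomorphic line bundle over $M$, and a Hermitian metric on it is a smooth positive function; $\overline\partial_{X\times\Delta}$, $\overline\partial_\Delta$ are the standard Dolbeault operators. $SU(1,1)=\Big\{g=\begin{pmatrix}a&b\\\overline b&\overline a\end{pmatrix}:|a|^2-|b|^2=1\Big\}$ acts on $\Delta$ by $g\cdot z=\frac{az+b}{\overline bz+\overline a}$. For $n\in\mathbb{Z}$, $L_n$ is the trivial holomorphic line bundle $(\underline{\mathbb{C}}_\Delta,\overline\partial_\Delta)$ with canonical frame $e_n$ and $SU(1,1)$-action $g\cdot(e_n)_z=\frac{1}{(\overline bz+\overline a)^n}(e_n)_{g\cdot z}$; $h^{(n)}$ is the $SU(1,1)$-invariant Hermitian metric on $L_n$ with $h^{(n)}_z(e_n,e_n)=(1-|z|^2)^{-n}$. $\alpha:=\frac{1}{(1-|z|^2)^2}d\overline z\otimes e_{-2}\in A^{0,1}(L_{-2})$. $\omega_{\mathrm{Poi}}=\frac{2\sqrt{-1}\,dz\wedge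 d\overline z}{(1-|z|^2)^2}$ is the Kähler form of the Poincaré metric. The bundle $E$ and its action: the holomorphic extension $0\to p^\ast L\otimes q^\ast L_{-2}\to E\to\underline{\mathbb{C}}_{X\times\Delta}\to0$ splits smoothly, and $E$ is identified as a smooth bundle with $p^\ast L\otimes q^\ast L_{-2}\oplus\underline{\mathbb{C}}_{X\times\Delta}$. $SU(1,1)$ acts on $X\times\Delta$ trivially on $X$ and on $\Delta$ by $g\cdot z=\frac{az+b}{\overline bz+\overline a}$ for $g=\begin{pmatrix}a&b\\\overline b&\overline a\end{pmatrix}\in SU(1,1)$; it acts on $E$ (via this identification) through the action on $L_{-2}$, trivially on the factors pulled back from $X$ (and on $\underline{\mathbb{C}}_{X\times\Delta}$ by the action on the base). $(E,\overline\partial_E)$ is an $SU(1,1)$-equivariant holomorphic bundle if every $g\in SU(1,1)$ acts by a biholomorphic map of the total space of $(E,\overline\partial_E)$. A Hermitian form $h$ on $E$ is $SU(1,1)$-invariant if $h_{gx}(g\cdot,g\cdot)=h_x(\cdot,\cdot)$ for all $g$ and $x$. Pseudo-Hermitian metrics: a pseudo-Hermitian metric of signature $(p,q)$ on a complex vector bundle $E$ is a smooth non-degenerate Hermitian form on $E$ of signature $(p,q)$ on every fibre. A connection $D$ is compatible with $h$ if $dh(\cdot,\cdot)=h(D\cdot,\cdot)+h(\cdot,D\cdot)$. For a holomorphic structure $\overline\partial_E$ there is a unique connection $\nabla_h$ compatible with $h$ with $\nabla_h^{0,1}=\overline\partial_E$; put $F_h=(\nabla_h)^2$. For a Kähler form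 $\omega$ on the base, $h$ is a pseudo-Hermitian-Einstein metric of $(E,\overline\partial_E)$ with respect to $\omega$, and $\nabla_h$ is a pseudo-Hermitian-Yang-Mills connection, if $\sqrt{-1}\Lambda_\omega F_h=\lambda\,\mathrm{Id}_E$ for some constant $\lambda$. *)

theory Defs
  imports "HOL-Analysis.Analysis"
begin

section \<open>Smooth and holomorphic functions on open subsets of complex coordinate space\<close>

text \<open>Smoothness is real smoothness: every iterated directional derivative exists as a Frechet
  derivative and is continuous.  It is only used on open sets.\<close>

primrec Ck_on :: "nat \<Rightarrow> ('a::real_normed_vector \<Rightarrow> 'b::real_normed_vector) \<Rightarrow> 'a set \<Rightarrow> bool" where
  "Ck_on 0 f S \<longleftrightarrow> continuous_on S f"
| "Ck_on (Suc k) f S \<longleftrightarrow> (\<forall>x\<in>S. f differentiable (at x)) \<and>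
     (\<forall>v. Ck_on k (\<lambda>x. frechet_derivative f (at x) v) S)"

definition smooth_on :: "'a::real_normed_vector set \<Rightarrow> ('a \<Rightarrow> 'b::real_normed_vector) \<Rightarrow> bool" where
  "smooth_on S f \<longleftrightarrow> (\<forall>k. Ck_on k f S)"

definition hol_on :: "(complex^'n) set \<Rightarrow> (complex^'n \<Rightarrow> complex^'k) \<Rightarrow> bool" where
  "hol_on S f \<longleftrightarrow> (\<forall>x\<in>S. \<exists>J :: complex^'n^'k. (f has_derivative (\<lambda>v. J *v v)) (at x))"

text \<open>The Wirtinger derivatives: index \<open>Inl j\<close> is the derivative in \<open>z\<^sub>j\<close>, index \<open>Inr j\<close> the one
  in the conjugate of \<open>z\<^sub>j\<close>.  They are set to zero where \<open>f\<close> is not differentiable, so that the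
  chain rule for changes of coordinates holds for all functions without exception.\<close>

fun wirtinger :: "'n + 'n \<Rightarrow> (complex^'n \<Rightarrow> complex) \<Rightarrow> complex^'n \<Rightarrow> complex" where
  "wirtinger (Inl j) f x = (if f differentiable (at x) then
     (frechet_derivative f (at x) (axis j 1) - \<i> * frechet_derivative f (at x) (axis j \<i>)) / 2 else 0)"
| "wirtinger (Inr j) f x = (if f differentiable (at x) then
     (frechet_derivative f (at x) (axis j 1) + \<i> * frechet_derivative f (at x) (axis j \<i>)) / 2 else 0)"


section \<open>Complex manifolds\<close>

text \<open>A manifold is given by its atlas; the point set is the union of the chart domains and the
  topology is the one determined by the charts.\<close>

type_synonym ('m, 'n) chart = "'m set \<times> ('m \<Rightarrow> complex^'n)"
type_synonym ('m, 'n) atlas = "('m, 'n) chart set"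

definition points :: "('m, 'n::finite) atlas \<Rightarrow> 'm set" where
  "points A = (\<Union>(U, c)\<in>A. U)"

definition complex_atlas :: "('m, 'n::finite) atlas \<Rightarrow> bool" where
  "complex_atlas A \<longleftrightarrow>
     (\<forall>(U, c)\<in>A. inj_on c U \<and> open (c ` U)) \<and>
     (\<forall>(U, c)\<in>A. \<forall>(V, d)\<in>A. open (c ` (U \<inter> V)) \<and> hol_on (c ` (U \<inter> V)) (d \<circ> the_inv_into U c))"

definition atlas_topology :: "('m, 'n::finite) atlas \<Rightarrow> 'm topology" where
  "atlas_topology A = topology (\<lambda>W. W \<subseteq> points A \<and> (\<forall>(U, c)\<in>A. open (c ` (U \<inter> W))))"

lemma openin_atlas_topology:
  assumes "complex_atlas A"
  shows "openin (atlas_topology A) W \<longleftrightarrow> W \<subseteq> points A \<and> (\<forall>(U, c)\<in>A. open (c ` (U \<inter> W)))"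
proof -
  have "istopology (\<lambda>W. W \<subseteq> points A \<and> (\<forall>(U, c)\<in>A. open (c ` (U \<inter> W))))"
    unfolding istopology_def
  proof (intro conjI allI impI)
    fix S T assume S: "S \<subseteq> points A \<and> (\<forall>(U, c)\<in>A. open (c ` (U \<inter> S)))"
      and T: "T \<subseteq> points A \<and> (\<forall>(U, c)\<in>A. open (c ` (U \<inter> T)))"
    show "S \<inter> T \<subseteq> points A" using S by blast
    have "open (c ` (U \<inter> (S \<inter> T)))" if "(U, c) \<in> A" for U c
    proof -
      have "inj_on c U" using assms that by (auto simp: complex_atlas_def)
      then have "c ` (U \<inter> (S \<inter> T)) = c ` (U \<inter> S) \<inter> c ` (U \<inter> T)"
        by (auto simp: inj_on_def)
      then show ?thesis using S T that by auto
    qed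
    then show "\<forall>(U, c)\<in>A. open (c ` (U \<inter> (S \<inter> T)))" by blast
  next
    fix K assume K: "\<forall>S\<in>K. S \<subseteq> points A \<and> (\<forall>(U, c)\<in>A. open (c ` (U \<inter> S)))"
    then show "\<Union> K \<subseteq> points A" by blast
    have "open (c ` (U \<inter> \<Union> K))" if "(U, c) \<in> A" for U c
    proof -
      have "c ` (U \<inter> \<Union> K) = (\<Union>S\<in>K. c ` (U \<inter> S))" by blast
      moreover have "open (c ` (U \<inter> S))" if "S \<in> K" for S
        using K that \<open>(U, c) \<in> A\<close> by fast
      ultimately show ?thesis by (simp add: open_UN)
    qed
    then show "\<forall>(U, c)\<in>A. open (c ` (U \<inter> \<Union> K))" by blast
  qed
  then show ?thesis by (simp add: atlas_topology_def)
qed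

definition complex_manifold :: "('m, 'n::finite) atlas \<Rightarrow> bool" where
  "complex_manifold A \<longleftrightarrow> complex_atlas A \<and> Hausdorff_space (atlas_topology A)"

definition compact_connected_riemann_surface :: "('m, 1) atlas \<Rightarrow> bool" where
  "compact_connected_riemann_surface A \<longleftrightarrow>
     complex_manifold A \<and> points A \<noteq> {} \<and>
     compact_space (atlas_topology A) \<and> connected_space (atlas_topology A)"

definition smooth_fun :: "('m, 'n::finite) atlas \<Rightarrow> 'm set \<Rightarrow> ('m \<Rightarrow> 'b::real_normed_vector) \<Rightarrow> bool" where
  "smooth_fun A W f \<longleftrightarrow> (\<forall>(U, c)\<in>A. smooth_on (c ` (U \<inter> W)) (f \<circ> the_inv_into U c))"

definition holomorphic_fun :: "('m, 'n::finite) atlas \<Rightarrow> 'm set \<Rightarrow> ('m \<Rightarrow> complex^'k) \<Rightarrow> bool" where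
  "holomorphic_fun A W f \<longleftrightarrow> (\<forall>(U, c)\<in>A. hol_on (c ` (U \<inter> W)) (f \<circ> the_inv_into U c))"

definition holomorphic_map ::
  "('m, 'n::finite) atlas \<Rightarrow> ('p, 'k::finite) atlas \<Rightarrow> ('m \<Rightarrow> 'p) \<Rightarrow> bool" where
  "holomorphic_map A B f \<longleftrightarrow> f ` points A \<subseteq> points B \<and>
     (\<forall>(U, c)\<in>A. \<forall>(V, d)\<in>B. open (c ` (U \<inter> f -` V)) \<and>
        hol_on (c ` (U \<inter> f -` V)) (d \<circ> f \<circ> the_inv_into U c))"

definition biholomorphic ::
  "('m, 'n::finite) atlas \<Rightarrow> ('p, 'k::finite) atlas \<Rightarrow> ('m \<Rightarrow> 'p) \<Rightarrow> bool" where
  "biholomorphic A B f \<longleftrightarrow> bij_betw f (points A) (points B) \<and> holomorphic_map A B f \<and>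
     holomorphic_map B A (the_inv_into (points A) f)"


section \<open>Complexified tangent vectors and differential forms\<close>

text \<open>Complexified tangent vectors are derivations, acting on complex functions.
  \<open>coord_vec C k p\<close> is the coordinate vector field of type (1,0) or (0,1) of the chart \<open>C\<close>,
  according to whether \<open>k\<close> is \<open>Inl j\<close> or \<open>Inr j\<close>.\<close>

type_synonym 'm tangent = "('m \<Rightarrow> complex) \<Rightarrow> complex"

definition coord_vec :: "('m, 'n::finite) chart \<Rightarrow> 'n + 'n \<Rightarrow> 'm \<Rightarrow> 'm tangent" where
  "coord_vec C k p = (\<lambda>f. wirtinger k (f \<circ> the_inv_into (fst C) (snd C)) (snd C p))"

definition tangent_space :: "('m, 'n::finite) atlas \<Rightarrow> 'm \<Rightarrow> 'm tangent set" where
  "tangent_space A p = {v. \<exists>C\<in>A. p \<in> fst C \<and>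
     (\<exists>a :: 'n + 'n \<Rightarrow> complex. v = (\<lambda>f. \<Sum>k\<in>UNIV. a k * coord_vec C k p f))}"

definition tangent10 :: "('m, 'n::finite) atlas \<Rightarrow> 'm \<Rightarrow> 'm tangent set" where
  "tangent10 A p = {v. \<exists>C\<in>A. p \<in> fst C \<and>
     (\<exists>a :: 'n \<Rightarrow> complex. v = (\<lambda>f. \<Sum>j\<in>UNIV. a j * coord_vec C (Inl j) p f))}"

definition tangent01 :: "('m, 'n::finite) atlas \<Rightarrow> 'm \<Rightarrow> 'm tangent set" where
  "tangent01 A p = {v. \<exists>C\<in>A. p \<in> fst C \<and>
     (\<exists>a :: 'n \<Rightarrow> complex. v = (\<lambda>f. \<Sum>j\<in>UNIV. a j * coord_vec C (Inr j) p f))}"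

definition conj_vec :: "'m tangent \<Rightarrow> 'm tangent" where
  "conj_vec v = (\<lambda>f. cnj (v (\<lambda>q. cnj (f q))))"

definition push :: "('m \<Rightarrow> 'p) \<Rightarrow> 'm tangent \<Rightarrow> 'p tangent" where
  "push f v = (\<lambda>g. v (g \<circ> f))"

text \<open>Forms are evaluated without combinatorial factors: the value of a wedge product of one-forms
  \<open>a\<close>, \<open>b\<close> on \<open>(v, w)\<close> is \<open>a v * b w - a w * b v\<close>.\<close>

type_synonym 'm form2 = "'m \<Rightarrow> 'm tangent \<Rightarrow> 'm tangent \<Rightarrow> complex"

definition two_form :: "('m, 'n::finite) atlas \<Rightarrow> 'm form2 \<Rightarrow> bool" where
  "two_form A F \<longleftrightarrow>
     (\<forall>p\<in>points A. \<forall>u\<in>tangent_space A p. \<forall>v\<in>tangent_space A p. \<forall>w\<in>tangent_space A p. \<forall>a b.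
        F p v w = - F p w v \<and>
        F p (\<lambda>f. a * u f + b * v f) w = a * F p u w + b * F p v w) \<and>
     (\<forall>C\<in>A. \<forall>k l. smooth_fun A (fst C) (\<lambda>p. F p (coord_vec C k p) (coord_vec C l p)))"

definition closed_form2 :: "('m, 'n::finite) atlas \<Rightarrow> 'm form2 \<Rightarrow> bool" where
  "closed_form2 A F \<longleftrightarrow> (\<forall>C\<in>A. \<forall>p\<in>fst C. \<forall>k l m.
     coord_vec C k p (\<lambda>q. F q (coord_vec C l q) (coord_vec C m q)) +
     coord_vec C l p (\<lambda>q. F q (coord_vec C m q) (coord_vec C k q)) +
     coord_vec C m p (\<lambda>q. F q (coord_vec C k q) (coord_vec C l q)) = 0)"

definition kahler_form :: "('m, 'n::finite) atlas \<Rightarrow> 'm form2 \<Rightarrow> bool" where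
  "kahler_form A \<omega> \<longleftrightarrow> two_form A \<omega> \<and> closed_form2 A \<omega> \<and>
     (\<forall>p\<in>points A.
        (\<forall>v\<in>tangent_space A p. \<forall>w\<in>tangent_space A p.
           cnj (\<omega> p v w) = \<omega> p (conj_vec v) (conj_vec w)) \<and>
        (\<forall>v\<in>tangent10 A p. \<forall>w\<in>tangent10 A p. \<omega> p v w = 0) \<and>
        (\<forall>v\<in>tangent10 A p. v \<noteq> (\<lambda>_. 0) \<longrightarrow> (\<exists>r::real. 0 < r \<and> \<omega> p v (conj_vec v) = \<i> * of_real r)))"

text \<open>The matrix of coefficients of the contraction with \<open>\<omega>\<close>, normalised by
  \<open>\<Lambda>\<^sub>\<omega> \<omega> = n\<close>: for a two-form \<open>F\<close> with (1,1)-coefficient matrix \<open>F\<^sub>j\<^sub>k\<close> in the chart \<open>C\<close>,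
  the contraction is the sum of the \<open>contraction_matrix \<omega> C p $ k $ j * F\<^sub>j\<^sub>k\<close>.\<close>

definition contraction_matrix :: "'m form2 \<Rightarrow> ('m, 'n::finite) chart \<Rightarrow> 'm \<Rightarrow> complex^'n^'n" where
  "contraction_matrix \<omega> C p =
     matrix_inv (\<chi> j k. \<omega> p (coord_vec C (Inl j) p) (coord_vec C (Inr k) p))"

definition contraction :: "'m form2 \<Rightarrow> 'm form2 \<Rightarrow> ('m, 'n::finite) chart \<Rightarrow> 'm \<Rightarrow> complex" where
  "contraction \<omega> F C p = (\<Sum>j\<in>UNIV. \<Sum>k\<in>UNIV.
     contraction_matrix \<omega> C p $ k $ j * F p (coord_vec C (Inl j) p) (coord_vec C (Inr k) p))"

definition partition_of_unity ::
  "('m, 'n::finite) atlas \<Rightarrow> ('m, 'n) chart set \<Rightarrow> (('m, 'n) chart \<Rightarrow> 'm \<Rightarrow> real) \<Rightarrow> bool" where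
  "partition_of_unity A K \<rho> \<longleftrightarrow> finite K \<and> K \<subseteq> A \<and>
     (\<forall>C\<in>K. smooth_fun A (points A) (\<rho> C) \<and> (\<forall>p\<in>points A. 0 \<le> \<rho> C p) \<and>
        atlas_topology A closure_of {p \<in> points A. \<rho> C p \<noteq> 0} \<subseteq> fst C) \<and>
     (\<forall>p\<in>points A. (\<Sum>C\<in>K. \<rho> C p) = 1)"

text \<open>The integral of a two-form over a compact Riemann surface, by a partition of unity.  The
  factor \<open>-2\<i>\<close> comes from \<open>dz \<and> d\<bar>z = -2\<i> dx \<and> dy\<close>; \<open>lborel\<close> is
  Lebesgue measure on the real plane underlying \<open>complex^1\<close>.\<close>

definition surface_integral :: "('m, 1) atlas \<Rightarrow> 'm form2 \<Rightarrow> complex" where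
  "surface_integral A F = (THE I. \<exists>K \<rho>. partition_of_unity A K \<rho> \<and>
     I = (\<Sum>C\<in>K. LINT y : snd C ` fst C | lborel.
            (let p = the_inv_into (fst C) (snd C) y in
              of_real (\<rho> C p) * F p (coord_vec C (Inl 1) p) (coord_vec C (Inr 1) p) * (- 2 * \<i>))))"


section \<open>Vector bundles\<close>

text \<open>A bundle is given by the projection of its total space and by local trivialisations
  \<open>(W, T)\<close>, where \<open>T\<close> maps every fibre over \<open>W\<close> bijectively onto \<open>complex^'r\<close>.  Elements of
  the type \<open>'e\<close> that do not lie over the base are irrelevant.\<close>

record ('m, 'e, 'r::finite) vbundle =
  proj :: "'e \<Rightarrow> 'm"
  triv :: "('m set \<times> ('e \<Rightarrow> complex^'r)) set"

definition bundle_with ::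
  "(('m set \<Rightarrow> ('m \<Rightarrow> complex^'r^'r) \<Rightarrow> bool)) \<Rightarrow> ('m, 'n::finite) atlas \<Rightarrow> ('m, 'e, 'r::finite) vbundle \<Rightarrow> bool" where
  "bundle_with P A E \<longleftrightarrow>
     (\<Union>(W, T)\<in>triv E. W) = points A \<and>
     (\<forall>(W, T)\<in>triv E. openin (atlas_topology A) W \<and> (\<forall>x\<in>W. bij_betw T {e. proj E e = x} UNIV)) \<and>
     (\<forall>(W, T)\<in>triv E. \<forall>(W', T')\<in>triv E. \<exists>g. P (W \<inter> W') g \<and>
        (\<forall>e. proj E e \<in> W \<inter> W' \<longrightarrow> T' e = g (proj E e) *v T e))"

definition smooth_bundle :: "('m, 'n::finite) atlas \<Rightarrow> ('m, 'e, 'r::finite) vbundle \<Rightarrow> bool" where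
  "smooth_bundle A = bundle_with (smooth_fun A) A"

definition holomorphic_bundle :: "('m, 'n::finite) atlas \<Rightarrow> ('m, 'e, 'r::finite) vbundle \<Rightarrow> bool" where
  "holomorphic_bundle A = bundle_with (\<lambda>W g. \<forall>i. holomorphic_fun A W (\<lambda>x. g x $ i)) A"

text \<open>\<open>H\<close> is a holomorphic structure on the smooth bundle \<open>E\<close>: both have the same total space and
  the local holomorphic frames of \<open>H\<close> are smooth frames of \<open>E\<close>.\<close>

definition holomorphic_structure ::
  "('m, 'n::finite) atlas \<Rightarrow> ('m, 'e, 'r::finite) vbundle \<Rightarrow> ('m, 'e, 'r) vbundle \<Rightarrow> bool" where
  "holomorphic_structure A E H \<longleftrightarrow> proj H = proj E \<and> holomorphic_bundle A H \<and>
     smooth_bundle A (E\<lparr>triv := triv E \<union> triv H\<rparr>)"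

text \<open>The vector in the fibre over \<open>x\<close> whose coordinates in every local trivialisation \<open>T\<close> are
  \<open>F T\<close>.  This expresses the fibrewise linear operations.\<close>

definition fibre_vec ::
  "('m, 'e, 'r::finite) vbundle \<Rightarrow> 'm \<Rightarrow> (('e \<Rightarrow> complex^'r) \<Rightarrow> complex^'r) \<Rightarrow> 'e" where
  "fibre_vec E x F = (THE e. proj E e = x \<and> (\<forall>(W, T)\<in>triv E. x \<in> W \<longrightarrow> T e = F T))"

definition smooth_section ::
  "('m, 'n::finite) atlas \<Rightarrow> ('m, 'e, 'r::finite) vbundle \<Rightarrow> 'm set \<Rightarrow> ('m \<Rightarrow> 'e) \<Rightarrow> bool" where
  "smooth_section A E W s \<longleftrightarrow> (\<forall>x\<in>W. proj E (s x) = x) \<and>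
     (\<forall>(W', T)\<in>triv E. smooth_fun A (W \<inter> W') (\<lambda>x. T (s x)))"

definition holomorphic_section ::
  "('m, 'n::finite) atlas \<Rightarrow> ('m, 'e, 'r::finite) vbundle \<Rightarrow> ('m \<Rightarrow> 'e) \<Rightarrow> bool" where
  "holomorphic_section A H s \<longleftrightarrow> (\<forall>x\<in>points A. proj H (s x) = x) \<and>
     (\<forall>(W, T)\<in>triv H. holomorphic_fun A W (\<lambda>x. T (s x)))"

definition total_space :: "('m, 'n::finite) atlas \<Rightarrow> ('m, 'e, 'r::finite) vbundle \<Rightarrow> ('e, 'n + 'r) atlas" where
  "total_space A H = {(proj H -` (U \<inter> W),
      \<lambda>e. \<chi> i. case i of Inl j \<Rightarrow> c (proj H e) $ j | Inr k \<Rightarrow> T e $ k) | U c W T.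
      (U, c) \<in> A \<and> (W, T) \<in> triv H}"

text \<open>The Dolbeault operator of a holomorphic bundle; \<open>dolbeault H s p v\<close> is the value of the
  bundle-valued (0,1)-form \<open>\<bar>\<partial> s\<close> at \<open>p\<close> on a tangent vector \<open>v\<close> of type (0,1).\<close>

definition dolbeault :: "('m, 'e, 'r::finite) vbundle \<Rightarrow> ('m \<Rightarrow> 'e) \<Rightarrow> 'm \<Rightarrow> 'm tangent \<Rightarrow> 'e" where
  "dolbeault H s p v = fibre_vec H p (\<lambda>T. \<chi> i. v (\<lambda>q. T (s q) $ i))"


section \<open>Connections, curvature and pseudo-Hermitian metrics\<close>

text \<open>A connection acts on the smooth sections over open sets, compatibly with restriction;
  \<open>D s p v\<close> is the covariant derivative of \<open>s\<close> at \<open>p\<close> along \<open>v\<close>.\<close>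

type_synonym ('m, 'e) derivation_op = "('m \<Rightarrow> 'e) \<Rightarrow> 'm \<Rightarrow> 'm tangent \<Rightarrow> 'e"

definition connection ::
  "('m, 'n::finite) atlas \<Rightarrow> ('m, 'e, 'r::finite) vbundle \<Rightarrow> ('m, 'e) derivation_op \<Rightarrow> bool" where
  "connection A E D \<longleftrightarrow> (\<forall>W s. openin (atlas_topology A) W \<and> smooth_section A E W s \<longrightarrow>
     (\<forall>p\<in>W. \<forall>v\<in>tangent_space A p. proj E (D s p v) = p) \<and>
     (\<forall>p\<in>W. \<forall>v\<in>tangent_space A p. \<forall>w\<in>tangent_space A p. \<forall>a b.
        D s p (\<lambda>f. a * v f + b * w f) =
          fibre_vec E p (\<lambda>T. a *s T (D s p v) + b *s T (D s p w))) \<and>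
     (\<forall>C\<in>A. \<forall>k. smooth_section A E (W \<inter> fst C) (\<lambda>p. D s p (coord_vec C k p))) \<and>
     (\<forall>V t. openin (atlas_topology A) V \<and> V \<subseteq> W \<and> (\<forall>q\<in>V. t q = s q) \<longrightarrow>
        (\<forall>p\<in>V. \<forall>v\<in>tangent_space A p. D t p v = D s p v)) \<and>
     (\<forall>t. smooth_section A E W t \<longrightarrow> (\<forall>p\<in>W. \<forall>v\<in>tangent_space A p.
        D (\<lambda>q. fibre_vec E q (\<lambda>T. T (s q) + T (t q))) p v =
          fibre_vec E p (\<lambda>T. T (D s p v) + T (D t p v)))) \<and>
     (\<forall>f. smooth_fun A W f \<longrightarrow> (\<forall>p\<in>W. \<forall>v\<in>tangent_space A p.
        D (\<lambda>q. fibre_vec E q (\<lambda>T. f q *s T (s q))) p v =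
          fibre_vec E p (\<lambda>T. v f *s T (s p) + f p *s T (D s p v)))))"

text \<open>The curvature \<open>D\<^sup>2\<close> evaluated on the pair of coordinate vector fields with indices \<open>k\<close>, \<open>l\<close> of
  the chart \<open>C\<close>; there is no Lie bracket term because these vector fields commute.\<close>

definition curvature ::
  "('m, 'e, 'r::finite) vbundle \<Rightarrow> ('m, 'e) derivation_op \<Rightarrow> ('m, 'n::finite) chart \<Rightarrow>
     'n + 'n \<Rightarrow> 'n + 'n \<Rightarrow> ('m \<Rightarrow> 'e) \<Rightarrow> 'm \<Rightarrow> 'e" where
  "curvature E D C k l s p = fibre_vec E p (\<lambda>T.
     T (D (\<lambda>q. D s q (coord_vec C l q)) p (coord_vec C k p)) -
     T (D (\<lambda>q. D s q (coord_vec C k q)) p (coord_vec C l p)))"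

text \<open>For a line bundle the curvature is a scalar two-form.\<close>

definition curvature_form ::
  "('m, 'n::finite) atlas \<Rightarrow> ('m, 'e, 1) vbundle \<Rightarrow> ('m, 'e) derivation_op \<Rightarrow> 'm form2 \<Rightarrow> bool" where
  "curvature_form A L D F \<longleftrightarrow> two_form A F \<and>
     (\<forall>C\<in>A. \<forall>k l W s. openin (atlas_topology A) W \<and> smooth_section A L W s \<longrightarrow>
        (\<forall>p\<in>W \<inter> fst C. curvature L D C k l s p =
           fibre_vec L p (\<lambda>T. F p (coord_vec C k p) (coord_vec C l p) *s T (s p))))"

definition hermitian_form ::
  "('m, 'n::finite) atlas \<Rightarrow> ('m, 'e, 'r::finite) vbundle \<Rightarrow> ('e \<Rightarrow> 'e \<Rightarrow> complex) \<Rightarrow> bool" where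
  "hermitian_form A E h \<longleftrightarrow>
     (\<forall>x\<in>points A. \<forall>u v w. proj E u = x \<and> proj E v = x \<and> proj E w = x \<longrightarrow>
        h w u = cnj (h u w) \<and>
        (\<forall>a b. h (fibre_vec E x (\<lambda>T. a *s T u + b *s T v)) w = a * h u w + b * h v w)) \<and>
     (\<forall>W s t. openin (atlas_topology A) W \<and> smooth_section A E W s \<and> smooth_section A E W t \<longrightarrow>
        smooth_fun A W (\<lambda>x. h (s x) (t x)))"

definition hermitian_metric ::
  "('m, 'n::finite) atlas \<Rightarrow> ('m, 'e, 'r::finite) vbundle \<Rightarrow> ('e \<Rightarrow> 'e \<Rightarrow> complex) \<Rightarrow> bool" where
  "hermitian_metric A E h \<longleftrightarrow> hermitian_form A E h \<and>
     (\<forall>(W, T)\<in>triv E. \<forall>u. proj E u \<in> W \<and> T u \<noteq> 0 \<longrightarrow> 0 < Re (h u u))"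

text \<open>The signature on a fibre is read off from an orthonormal basis; having one, with as many
  elements as the rank, makes the form non-degenerate.\<close>

definition pseudo_hermitian_metric ::
  "nat \<times> nat \<Rightarrow> ('m, 'n::finite) atlas \<Rightarrow> ('m, 'e, 'r::finite) vbundle \<Rightarrow> ('e \<Rightarrow> 'e \<Rightarrow> complex) \<Rightarrow> bool" where
  "pseudo_hermitian_metric sg A E h \<longleftrightarrow> hermitian_form A E h \<and>
     (\<forall>x\<in>points A. \<exists>(b :: 'r \<Rightarrow> 'e) P. (\<forall>i. proj E (b i) = x) \<and>
        (card P, card (- P)) = sg \<and>
        (\<forall>i j. h (b i) (b j) = (if i \<noteq> j then 0 else if i \<in> P then 1 else - 1)))"

definition compatible ::
  "('m, 'n::finite) atlas \<Rightarrow> ('m, 'e, 'r::finite) vbundle \<Rightarrow> ('e \<Rightarrow> 'e \<Rightarrow> complex) \<Rightarrow> ('m, 'e) derivation_op \<Rightarrow> bool" where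
  "compatible A E h D \<longleftrightarrow> (\<forall>W s t. openin (atlas_topology A) W \<and>
     smooth_section A E W s \<and> smooth_section A E W t \<longrightarrow>
     (\<forall>p\<in>W. \<forall>v\<in>tangent_space A p.
        v (\<lambda>q. h (s q) (t q)) = h (D s p v) (t p) + h (s p) (D t p (conj_vec v))))"

text \<open>The Chern connection of \<open>h\<close> on the smooth bundle \<open>E\<close> with holomorphic structure \<open>H\<close>.\<close>

definition chern_connection ::
  "('m, 'n::finite) atlas \<Rightarrow> ('m, 'e, 'r::finite) vbundle \<Rightarrow> ('m, 'e, 'r) vbundle \<Rightarrow>
     ('e \<Rightarrow> 'e \<Rightarrow> complex) \<Rightarrow> ('m, 'e) derivation_op \<Rightarrow> bool" where
  "chern_connection A E H h D \<longleftrightarrow> connection A E D \<and> compatible A E h D \<and>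
     (\<forall>W s. openin (atlas_topology A) W \<and> smooth_section A E W s \<longrightarrow>
        (\<forall>p\<in>W. \<forall>v\<in>tangent01 A p. D s p v = dolbeault H s p v))"

text \<open>The equation \<open>\<i> \<Lambda>\<^sub>\<omega> D\<^sup>2 = \<lambda> Id\<close>.\<close>

definition einstein_equation ::
  "('m, 'n::finite) atlas \<Rightarrow> ('m, 'e, 'r::finite) vbundle \<Rightarrow> 'm form2 \<Rightarrow> ('m, 'e) derivation_op \<Rightarrow> complex \<Rightarrow> bool" where
  "einstein_equation A E \<omega> D lam \<longleftrightarrow>
     (\<forall>C\<in>A. \<forall>W s. openin (atlas_topology A) W \<and> smooth_section A E W s \<longrightarrow> (\<forall>p\<in>W \<inter> fst C.
        fibre_vec E p (\<lambda>T. \<Sum>j\<in>UNIV. \<Sum>k\<in>UNIV.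
          (\<i> * contraction_matrix \<omega> C p $ k $ j) *s T (curvature E D C (Inl j) (Inr k) s p)) =
        fibre_vec E p (\<lambda>T. lam *s T (s p))))"

definition pseudo_hermitian_yang_mills ::
  "('m, 'n::finite) atlas \<Rightarrow> ('m, 'e, 'r::finite) vbundle \<Rightarrow> 'm form2 \<Rightarrow> ('m, 'e) derivation_op \<Rightarrow> bool" where
  "pseudo_hermitian_yang_mills A E \<omega> D \<longleftrightarrow> (\<exists>lam. einstein_equation A E \<omega> D lam)"

definition pseudo_hermitian_einstein ::
  "('m, 'n::finite) atlas \<Rightarrow> ('m, 'e, 'r::finite) vbundle \<Rightarrow> ('m, 'e, 'r) vbundle \<Rightarrow>
     'm form2 \<Rightarrow> ('e \<Rightarrow> 'e \<Rightarrow> complex) \<Rightarrow> bool" where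
  "pseudo_hermitian_einstein A E H \<omega> h \<longleftrightarrow>
     (\<exists>D. chern_connection A E H h D \<and> (\<exists>lam. einstein_equation A E \<omega> D lam))"

text \<open>The degree is the integral of the first Chern form of any Hermitian metric.\<close>

definition bundle_degree :: "('m, 1) atlas \<Rightarrow> ('m, 'e, 1) vbundle \<Rightarrow> real" where
  "bundle_degree A L = (THE d. \<exists>h D F. hermitian_metric A L h \<and> chern_connection A L L h D \<and>
     curvature_form A L D F \<and> complex_of_real d = \<i> / (2 * of_real pi) * surface_integral A F)"

definition exotic_vortex ::
  "real \<Rightarrow> ('m, 1) atlas \<Rightarrow> 'm form2 \<Rightarrow> ('m, 'e, 1) vbundle \<Rightarrow> ('m \<Rightarrow> 'e) \<Rightarrow> ('e \<Rightarrow> 'e \<Rightarrow> complex) \<Rightarrow> bool" where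
  "exotic_vortex \<tau> A \<omega> L \<phi> h \<longleftrightarrow>
     (\<exists>D F. chern_connection A L L h D \<and> curvature_form A L D F \<and>
        (\<forall>C\<in>A. \<forall>x\<in>fst C.
           \<i> * contraction \<omega> F C x - 1 / 2 * h (\<phi> x) (\<phi> x) - of_real \<tau> / 2 = 0))"


section \<open>The disc and the action of SU(1,1)\<close>

abbreviation \<Delta> :: "complex set" where
  "\<Delta> \<equiv> {z. cmod z < 1}"

definition SU11 :: "(complex^2^2) set" where
  "SU11 = {g. \<exists>a b. g = vector [vector [a, b], vector [cnj b, cnj a]] \<and> (cmod a)\<^sup>2 - (cmod b)\<^sup>2 = 1}"

definition moebius :: "complex^2^2 \<Rightarrow> complex \<Rightarrow> complex" where
  "moebius g z = (g $ 1 $ 1 * z + g $ 1 $ 2) / (g $ 2 $ 1 * z + g $ 2 $ 2)"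

text \<open>\<open>g\<close> maps the frame vector of \<open>L\<^sub>n\<close> at \<open>z\<close> to \<open>factor n g z\<close> times the one at \<open>g z\<close>.\<close>

definition factor :: "int \<Rightarrow> complex^2^2 \<Rightarrow> complex \<Rightarrow> complex" where
  "factor n g z = 1 / ((g $ 2 $ 1 * z + g $ 2 $ 2) powi n)"

text \<open>The square length of the frame \<open>e\<^sub>n\<close> in the invariant metric on \<open>L\<^sub>n\<close>.\<close>

definition disc_metric :: "int \<Rightarrow> complex \<Rightarrow> real" where
  "disc_metric n z = (1 - (cmod z)\<^sup>2) powi (- n)"

text \<open>The coefficient of \<open>e\<^sub>-\<^sub>2\<close> in the form \<open>\<alpha>\<close>.  Here \<open>d\<bar>z (v) = v cnj\<close> for a
  tangent vector \<open>v\<close> of the disc, and likewise \<open>dz (v) = v (\<lambda>z. z)\<close> below.\<close>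

definition alpha :: "complex \<Rightarrow> complex tangent \<Rightarrow> complex" where
  "alpha z v = 1 / of_real ((1 - (cmod z)\<^sup>2)\<^sup>2) * v cnj"

definition poincare_form :: "complex form2" where
  "poincare_form z v w =
     2 * \<i> / of_real ((1 - (cmod z)\<^sup>2)\<^sup>2) * (v (\<lambda>z. z) * w cnj - w (\<lambda>z. z) * v cnj)"


section \<open>The bundle over the product with the disc\<close>

definition times_disc :: "('x, 1) atlas \<Rightarrow> ('x \<times> complex, 2) atlas" where
  "times_disc A = {(U \<times> \<Delta>, \<lambda>(x, z). vector [c x $ 1, z]) | U c. (U, c) \<in> A}"

definition Omega :: "real \<Rightarrow> 'x form2 \<Rightarrow> ('x \<times> complex) form2" where
  "Omega \<tau> \<omega> p v w = of_real (- \<tau> / 2) * \<omega> (fst p) (push fst v) (push fst w) +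
     poincare_form (snd p) (push snd v) (push snd w)"

text \<open>The pair \<open>(l, z)\<close> stands for the vector \<open>l \<otimes> e\<^sub>-\<^sub>2\<close> over \<open>(x, z)\<close>, where \<open>l\<close> is in the fibre of
  \<open>L\<close> at \<open>x\<close> and \<open>e\<^sub>-\<^sub>2\<close> is the canonical (global holomorphic) frame of \<open>L\<^sub>-\<^sub>2\<close> at \<open>z\<close>.  With these
  holomorphic trivialisations the Dolbeault operator of \<open>twisted L\<close> is the one of the tensor product
  of the two pullbacks.\<close>

definition twisted :: "('x, 'l, 1) vbundle \<Rightarrow> ('x \<times> complex, 'l \<times> complex, 1) vbundle" where
  "twisted L = \<lparr>proj = (\<lambda>(l, z). (proj L l, z)),
     triv = {(W \<times> \<Delta>, \<lambda>(l, z). T l) | W T. (W, T) \<in> triv L}\<rparr>"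

definition trivial_line :: "'m set \<Rightarrow> ('m, 'm \<times> complex, 1) vbundle" where
  "trivial_line M = \<lparr>proj = fst, triv = {(M, \<lambda>(p, w). vector [w])}\<rparr>"

text \<open>The smooth bundle underlying \<open>E\<close>: the triple \<open>(l, z, w)\<close> stands for the vector
  \<open>l \<otimes> e\<^sub>-\<^sub>2 \<oplus> w\<close> over \<open>(x, z)\<close>.\<close>

definition sum_bundle :: "('x, 'l, 1) vbundle \<Rightarrow> ('x \<times> complex, 'l \<times> complex \<times> complex, 2) vbundle" where
  "sum_bundle L = \<lparr>proj = (\<lambda>(l, z, w). (proj L l, z)),
     triv = {(W \<times> \<Delta>, \<lambda>(l, z, w). vector [T l $ 1, w]) | W T. (W, T) \<in> triv L}\<rparr>"

text \<open>\<open>H\<close> is a holomorphic structure on the sum for which the inclusion of the first summand and the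
  projection to the second one are holomorphic, that is, a holomorphic extension of the trivial line
  bundle by \<open>twisted L\<close> together with a smooth splitting.\<close>

definition holomorphic_extension ::
  "('x, 1) atlas \<Rightarrow> ('x, 'l, 1) vbundle \<Rightarrow> ('x \<times> complex, 'l \<times> complex \<times> complex, 2) vbundle \<Rightarrow> bool" where
  "holomorphic_extension A L H \<longleftrightarrow>
     holomorphic_structure (times_disc A) (sum_bundle L) H \<and>
     holomorphic_map (total_space (times_disc A) (twisted L)) (total_space (times_disc A) H)
       (\<lambda>(l, z). (l, z, 0)) \<and>
     holomorphic_map (total_space (times_disc A) H)
       (total_space (times_disc A) (trivial_line (points (times_disc A))))
       (\<lambda>(l, z, w). ((proj L l, z), w))"

definition action ::
  "('x, 'l, 1) vbundle \<Rightarrow> complex^2^2 \<Rightarrow> 'l \<times> complex \<times> complex \<Rightarrow> 'l \<times> complex \<times> complex" where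
  "action L g = (\<lambda>(l, z, w). (fibre_vec L (proj L l) (\<lambda>T. factor (- 2) g z *s T l), moebius g z, w))"

definition equivariant_holomorphic ::
  "('x, 1) atlas \<Rightarrow> ('x, 'l, 1) vbundle \<Rightarrow> ('x \<times> complex, 'l \<times> complex \<times> complex, 2) vbundle \<Rightarrow> bool" where
  "equivariant_holomorphic A L H \<longleftrightarrow>
     (\<forall>g\<in>SU11. biholomorphic (total_space (times_disc A) H) (total_space (times_disc A) H) (action L g))"

definition invariant_form ::
  "('x, 1) atlas \<Rightarrow> ('x, 'l, 1) vbundle \<Rightarrow>
     ('l \<times> complex \<times> complex \<Rightarrow> 'l \<times> complex \<times> complex \<Rightarrow> complex) \<Rightarrow> bool" where
  "invariant_form A L h \<longleftrightarrow> (\<forall>g\<in>SU11. \<forall>u v.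
     proj (sum_bundle L) u = proj (sum_bundle L) v \<and> proj (sum_bundle L) u \<in> points (times_disc A) \<longrightarrow>
     h (action L g u) (action L g v) = h u v)"

text \<open>The displayed matrix form of the Dolbeault operator, evaluated on a local section with
  components \<open>\<sigma>\<close> and \<open>f\<close>.\<close>

definition dolbeault_matrix_form ::
  "real \<Rightarrow> ('x, 1) atlas \<Rightarrow> ('x, 'l, 1) vbundle \<Rightarrow>
     ('x \<times> complex, 'l \<times> complex \<times> complex, 2) vbundle \<Rightarrow> ('x \<Rightarrow> 'l) \<Rightarrow> bool" where
  "dolbeault_matrix_form \<tau> A L H \<phi> \<longleftrightarrow>
     (\<forall>W s. openin (atlas_topology (times_disc A)) W \<and>
        smooth_section (times_disc A) (sum_bundle L) W s \<longrightarrow>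
        (\<forall>p\<in>W. \<forall>v\<in>tangent01 (times_disc A) p.
           let \<sigma> = (\<lambda>q. case s q of (l, z, w) \<Rightarrow> (l, z));
               f = (\<lambda>q. case s q of (l, z, w) \<Rightarrow> w)
           in dolbeault H s p v =
             (fibre_vec L (fst p) (\<lambda>T. T (fst (dolbeault (twisted L) \<sigma> p v)) +
                (of_real (sqrt (- (1 / \<tau>))) * alpha (snd p) (push snd v) * f p) *s T (\<phi> (fst p))),
              snd p,
              v f)))"

definition metric_matrix_form ::
  "('x, 1) atlas \<Rightarrow> ('x, 'l, 1) vbundle \<Rightarrow>
     ('l \<times> complex \<times> complex \<Rightarrow> 'l \<times> complex \<times> complex \<Rightarrow> complex) \<Rightarrow>
     ('l \<Rightarrow> 'l \<Rightarrow> complex) \<Rightarrow> ('x \<Rightarrow> real) \<Rightarrow> real \<Rightarrow> real \<Rightarrow> bool" where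
  "metric_matrix_form A L hE hL hX C0 C1 \<longleftrightarrow>
     (\<forall>x\<in>points A. \<forall>z\<in>\<Delta>. \<forall>l l' w w'. proj L l = x \<and> proj L l' = x \<longrightarrow>
        hE (l, z, w) (l', z, w') =
          of_real C0 * (of_real (hX x) * hL l l') * of_real (disc_metric (- 2) z) +
          of_real C1 * of_real (hX x) * (w * cnj w'))"

text \<open>A Hermitian metric on the trivial line bundle.\<close>

definition positive_function :: "('x, 1) atlas \<Rightarrow> ('x \<Rightarrow> real) \<Rightarrow> bool" where
  "positive_function A hX \<longleftrightarrow> smooth_fun A (points A) hX \<and> (\<forall>x\<in>points A. 0 < hX x)"

end

theory Submission
 imports Defs "HOL-Complex_Analysis.Cauchy_Integral_Formula"
begin

text \<open>The group acts transitively on the disc, so an invariant object over \<open>X \<times> \<Delta>\<close> is known once it is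
known over \<open>X \<times> {0}\<close>, and there the stabiliser of the origin restricts it further. The stabiliser enters only through
one element, the rotation by \<open>\<pi>\<close> (\<open>half_turn\<close>): it is trivial on \<open>X\<close> and on the trivial summand and it is \<open>-1\<close>
on \<open>L\<^sub>-\<^sub>2\<close> over the origin.

(i) The sub and the quotient being holomorphic, the only freedom in the Dolbeault operator of the extension is a (0,1)-form
with values in the sub, the second fundamental form (\<open>second_form\<close>, \<open>dolbeault_section\<close>). Equivariance makes it invariant
(\<open>second_form_equivariant\<close>). The half turn kills its component along \<open>X\<close> over \<open>z = 0\<close>, hence everywhere, and the
component along the disc is transported from \<open>z = 0\<close> by the factor \<open>(1 - |z|\<^sup>2)\<^sup>-\<^sup>2\<close>, the coefficient of \<open>\<alpha>\<close>
(\<open>second_form_invariant\<close>). Its value at \<open>z = 0\<close> is a multiple of \<open>\<phi>\<close>; that \<open>\<phi>\<close> is holomorphic is the integrability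
of the operator (\<open>second_form_holomorphic\<close>).

(ii) The half turn makes the two summands orthogonal over \<open>z = 0\<close>, transitivity spreads this and shows that both diagonal
entries come from \<open>X\<close> up to the weight of \<open>L\<^sub>-\<^sub>2\<close> (\<open>invariant_metric\<close>). The signature gives them opposite signs, and
by connectedness of \<open>X\<close> these are constant.

(iii) In the smooth frame of the splitting the Chern connection is explicit (\<open>chern_local_sum\<close>), and so are the diagonal
entries of its curvature (\<open>curvature_frames\<close>). The Kaehler form has no mixed part, so over \<open>z = 0\<close> the Einstein equation
becomes two scalar equations on \<open>X\<close> (\<open>einstein_local\<close>). Their difference is the vortex equation. Their sum expresses the
curvature of \<open>L\<close> by \<open>\<lambda> \<omega>\<close> and the form with coefficient \<open>lap\<close> of \<open>log h\<^sub>X\<close>; integration removes the last term by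
Stokes' theorem (\<open>partition_integral_lap\<close>) and turns the first one into the degree.

The degree is a definite description, so it must also be shown that a line bundle with metric has a Chern connection
(\<open>line_connection_chern\<close>) and that the integral of the curvature depends neither on the partition of unity
(\<open>partition_integral_unique\<close>) nor on the metric (\<open>curvature_integral_unique\<close>).\<close>

text \<open>The coordinate vectors with index \<open>1\<close>: the only ones on a Riemann surface, and the ones along \<open>X\<close> on the product with the disc.\<close>

abbreviation dz :: "('m, 'n::{finite,one}) chart => 'm => 'm tangent" where
 "dz C == coord_vec C (Inl 1)"

abbreviation dbar :: "('m, 'n::{finite,one}) chart => 'm => 'm tangent" where
 "dbar C == coord_vec C (Inr 1)"

abbreviation open_in :: "('m, 'n::finite) atlas => 'm set => bool" where
 "open_in A == openin (atlas_topology A)"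

abbreviation fderiv :: "('a::real_normed_vector => 'b::real_normed_vector) => 'a => 'a => 'b" where
 "fderiv f x == frechet_derivative f (at x)"

abbreviation sproj :: "('x, 'l, 1) vbundle => 'l \<times> complex \<times> complex => 'x \<times> complex" where
 "sproj L == proj (sum_bundle L)"

abbreviation sum_section where
 "sum_section A L == smooth_section (times_disc A) (sum_bundle L)"

section \<open>Calculus of smooth functions\<close>

lemma Ck_on_subset: "Ck_on k f S ==> T\<subseteq>S ==> Ck_on k f T"
 by (induction k arbitrary: f) (auto intro: continuous_on_subset)

lemma Ck_on_Suc_lower: "Ck_on (Suc k) f S ==> Ck_on k f S"
proof (induction k arbitrary: f)
 case 0
 then have "\<forall>x\<in>S. isCont f x" by (simp add: differentiable_imp_continuous_within)
 then show ?case by (simp add: continuous_at_imp_continuous_on)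
next
 case (Suc k)
 show ?case
  unfolding Ck_on.simps(2)[of k f]
 proof (intro conjI allI)
  show "\<forall>x\<in>S. f differentiable at x" using Suc.prems by simp
  fix v show "Ck_on k (%x. fderiv f x v) S"
   using Suc.prems by (intro Suc.IH) (simp only: Ck_on.simps(2)[of "Suc k" f])
 qed
qed

lemma frechet_derivative_cong_open:
 assumes "open S" "x\<in>S" "!!y. y\<in>S ==> f y = g y"
 shows "f differentiable (at x)\<longleftrightarrow>g differentiable (at x)"
  "fderiv f x = fderiv g x"
proof -
 have *: "(f has_derivative D) (at x)\<longleftrightarrow>(g has_derivative D) (at x)" for D
 proof
  assume "(f has_derivative D) (at x)"
  then show "(g has_derivative D) (at x)"
   by (rule has_derivative_transform_within_open[OF _ assms])
 next
  assume "(g has_derivative D) (at x)"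
  then show "(f has_derivative D) (at x)"
   by (rule has_derivative_transform_within_open[OF _ assms(1,2) assms(3)[symmetric]])
 qed
 show "f differentiable (at x)\<longleftrightarrow>g differentiable (at x)"
  by (simp only: differentiable_def *)
 show "fderiv f x = fderiv g x"
  by (simp only: frechet_derivative_def *)
qed

lemma Ck_on_cong:
 assumes "open S" "!!y. y\<in>S ==> f y = g y"
 shows "Ck_on k f S\<longleftrightarrow>Ck_on k g S"
 using assms(2)
proof (induction k arbitrary: f g)
 case 0
 then show ?case by (simp cong: continuous_on_cong)
next
 case (Suc k)
 have "Ck_on k (%x. fderiv f x v) S\<longleftrightarrow>Ck_on k (%x. fderiv g x v) S" for v
  using frechet_derivative_cong_open[OF assms(1) _ Suc.prems] by (intro Suc.IH) simp
 then show ?case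
  using frechet_derivative_cong_open[OF assms(1) _ Suc.prems] by simp
qed

lemma frechet_derivative_eqI: "(f has_derivative D) (at x) ==> fderiv f x = D"
 by (rule frechet_derivative_at[symmetric])

lemma Ck_on_SucI:
 assumes "open S" "!!x. x\<in>S ==> (f has_derivative f' x) (at x)"
  "!!v. Ck_on k (%x. f' x v) S"
 shows "Ck_on (Suc k) f S"
proof -
 have "fderiv f x = f' x" if "x\<in>S" for x
  using assms(2)[OF that] by (rule frechet_derivative_eqI)
 then have "Ck_on k (%x. fderiv f x v) S" for v
  using assms(3)[of v] Ck_on_cong[OF assms(1),of "%x. fderiv f x v" "%x. f' x v"] by simp
 moreover have "\<forall>x\<in>S. f differentiable at x" using assms(2) by (auto simp: differentiable_def)
 ultimately show ?thesis by simp
qed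

lemma Ck_on_SucD:
 assumes "Ck_on (Suc k) f S" "x\<in>S"
 shows "(f has_derivative fderiv f x) (at x)"
  "Ck_on k (%x. fderiv f x v) S"
 using assms by (auto simp: frechet_derivative_works)

lemma Ck_on_const: "Ck_on k (%x. a) S"
 by (induction k arbitrary: a) simp_all

lemma Ck_on_bounded_linear: "bounded_linear L ==> Ck_on k L S"
proof (induction k)
 case 0
 then show ?case by (simp add: linear_continuous_on)
next
 case (Suc k)
 have "(L has_derivative L) (at x)" for x
  using Suc.prems by (rule bounded_linear_imp_has_derivative)
 then have "fderiv L x = L" "L differentiable (at x)" for x
  by (rule frechet_derivative_eqI,rule differentiableI)
 then show ?case by (simp add: Ck_on_const)
qed

lemma Ck_on_linear_compose:
 assumes "bounded_linear L" "open S" "Ck_on k f S"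
 shows "Ck_on k (%x. L (f x)) S"
 using assms(3)
proof (induction k arbitrary: f)
 case 0
 then show ?case
  using bounded_linear.continuous_on[OF assms(1)] by simp
next
 case (Suc k)
 show ?case
 proof (rule Ck_on_SucI[OF assms(2)])
  fix x assume "x\<in>S"
  show "((%x. L (f x)) has_derivative (%v. L (fderiv f x v))) (at x)"
   using bounded_linear.has_derivative[OF assms(1)] Ck_on_SucD(1)[OF Suc.prems \<open>x\<in>S\<close>] by blast
 next
  fix v show "Ck_on k (%x. L (fderiv f x v)) S"
   using Suc.prems by (intro Suc.IH) simp
 qed
qed

lemma Ck_on_add:
 assumes "open S" "Ck_on k f S" "Ck_on k g S"
 shows "Ck_on k (%x. f x+g x) S"
 using assms(2,3)
proof (induction k arbitrary: f g)
 case 0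
 then show ?case by (simp add: continuous_on_add)
next
 case (Suc k)
 show ?case
 proof (rule Ck_on_SucI[OF assms(1)])
  fix x assume "x\<in>S"
  show "((%x. f x+g x) has_derivative (%v. fderiv f x v+fderiv g x v)) (at x)"
   by (intro has_derivative_add Ck_on_SucD(1)[OF Suc.prems(1) \<open>x\<in>S\<close>] Ck_on_SucD(1)[OF Suc.prems(2) \<open>x\<in>S\<close>])
 next
  fix v show "Ck_on k (%x. fderiv f x v+fderiv g x v) S"
   using Suc.prems by (intro Suc.IH) simp_all
 qed
qed

lemma Ck_on_sum:
 assumes "open S" "!!i. i\<in>I ==> Ck_on k (f i) S"
 shows "Ck_on k (%x. \<Sum>i\<in>I. f i x) S"
 using assms(2)
 by (induction I rule: infinite_finite_induct) (auto intro!: Ck_on_const Ck_on_add assms(1))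

lemma Ck_on_bilinear:
 assumes "bounded_bilinear B" "open S" "Ck_on k f S" "Ck_on k g S"
 shows "Ck_on k (%x. B (f x) (g x)) S"
 using assms(3,4)
proof (induction k arbitrary: f g)
 case 0
 then show ?case using bounded_bilinear.continuous_on[OF assms(1)] by simp
next
 case (Suc k)
 show ?case
 proof (rule Ck_on_SucI[OF assms(2)])
  fix x assume "x\<in>S"
  show "((%x. B (f x) (g x)) has_derivative
    (%v. B (f x) (fderiv g x v)+B (fderiv f x v) (g x))) (at x)"
   by (intro bounded_bilinear.FDERIV[OF assms(1)] Ck_on_SucD(1)[OF Suc.prems(1) \<open>x\<in>S\<close>]
     Ck_on_SucD(1)[OF Suc.prems(2) \<open>x\<in>S\<close>])
 next
  fix v show "Ck_on k (%x. B (f x) (fderiv g x v)+B (fderiv f x v) (g x)) S"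
   using Suc.prems Ck_on_Suc_lower[OF Suc.prems(1)] Ck_on_Suc_lower[OF Suc.prems(2)]
   by (intro Ck_on_add assms Suc.IH) auto
 qed
qed

lemma Ck_on_inverse:
 fixes f :: "'a::real_normed_vector => 'b::real_normed_field"
 assumes "open S" "Ck_on k f S" "!!x. x\<in>S ==> f x ~= 0"
 shows "Ck_on k (%x. inverse (f x)) S"
 using assms(2)
proof (induction k)
 case 0
 then show ?case using assms(3) by (simp add: continuous_on_inverse)
next
 case (Suc k)
 show ?case
 proof (rule Ck_on_SucI[OF assms(1)])
  fix x assume "x\<in>S"
  show "((%x. inverse (f x)) has_derivative
    (%v. - (inverse (f x) * fderiv f x v * inverse (f x)))) (at x)"
   by (rule Deriv.has_derivative_inverse[OF assms(3)[OF \<open>x\<in>S\<close>] Ck_on_SucD(1)[OF Suc.prems \<open>x\<in>S\<close>]])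
 next
  have inv: "Ck_on k (%x. inverse (f x)) S" by (intro Suc.IH Ck_on_Suc_lower[OF Suc.prems])
  fix v
  have "Ck_on k (%x. inverse (f x) * fderiv f x v * inverse (f x)) S"
   using Suc.prems by (intro Ck_on_bilinear[OF bounded_bilinear_mult assms(1)] inv) auto
  then show "Ck_on k (%x. - (inverse (f x) * fderiv f x v * inverse (f x))) S"
   by (rule Ck_on_linear_compose[OF bounded_linear_minus[OF bounded_linear_ident] assms(1)])
 qed
qed

text \<open>Differentiability and continuity at a point only see a neighbourhood of it.\<close>

lemma Ck_on_local:
 assumes "!!x. x\<in>S ==> \<exists>N. open N\<and>x\<in>N\<and>Ck_on k f (S\<inter>N)"
 shows "Ck_on k f S"
 using assms
proof (induction k arbitrary: f)
 case 0
 have "continuous (at x within S) f" if xS: "x\<in>S" for x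
 proof -
  obtain N where "open N" "x\<in>N" "continuous_on (S\<inter>N) f"
   using 0[OF xS] unfolding Ck_on.simps by metis
  then have "continuous (at x within (S\<inter>N)) f"
   using xS by (simp add: continuous_on_eq_continuous_within)
  moreover have "at x within (S\<inter>N) = at x within S"
   by (rule at_within_nhd[OF \<open>x\<in>N\<close> \<open>open N\<close>]) auto
  ultimately show ?thesis by simp
 qed
 then show ?case by (simp add: continuous_on_eq_continuous_within)
next
 case (Suc k)
 have "f differentiable at x" if "x\<in>S" for x
  using Suc.prems[OF that] that by auto
 moreover have "Ck_on k (%x. fderiv f x v) S" for v
 proof (rule Suc.IH)
  fix x assume "x\<in>S"
  then obtain N where "open N" "x\<in>N" "Ck_on (Suc k) f (S\<inter>N)" using Suc.prems by metis
  then show "\<exists>N. open N\<and>x\<in>N\<and>Ck_on k (%x. fderiv f x v) (S\<inter>N)" by auto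
 qed
 ultimately show ?case by simp
qed

text \<open>The chain rule expresses the derivative of \<open>g (f x)\<close> in a direction as a sum, over the basis, of
 products of derivatives, which lowers \<open>k\<close>.\<close>

lemma Ck_on_compose:
 fixes g :: "'a::euclidean_space => 'b::euclidean_space" and f :: "'b => 'c::real_normed_vector"
 assumes "open S" "open T" "g ` S\<subseteq>T" "Ck_on k f T" "Ck_on k g S"
 shows "Ck_on k (%x. f (g x)) S"
 using assms(4,5)
proof (induction k arbitrary: f)
 case 0
 then show ?case using continuous_on_compose2 assms(3) by auto
next
 case (Suc k)
 show ?case
 proof (rule Ck_on_SucI[OF assms(1)])
  fix x assume x: "x\<in>S"
  then have gx: "g x\<in>T" using assms(3) by auto
  have Df: "(f has_derivative fderiv f (g x)) (at (g x))"
   by (rule Ck_on_SucD(1)[OF Suc.prems(1) gx])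
  have lin: "bounded_linear (fderiv f (g x))"
   using Df by (rule has_derivative_bounded_linear)
  have *: "((%x. f (g x)) has_derivative (%v. fderiv f (g x) (fderiv g x v))) (at x)"
   by (rule has_derivative_compose[OF Ck_on_SucD(1)[OF Suc.prems(2) x] Df])
  have rep: "fderiv f (g x) w = (\<Sum>b\<in>Basis. (w \<bullet> b) *\<^sub>R fderiv f (g x) b)" for w
  proof -
   have "fderiv f (g x) (\<Sum>b\<in>Basis. (w \<bullet> b) *\<^sub>R b) = (\<Sum>b\<in>Basis. (w \<bullet> b) *\<^sub>R fderiv f (g x) b)"
    using lin by (simp add: linear_sum bounded_linear.linear linear_cmul linear_scale)
   then show ?thesis by (simp add: euclidean_representation)
  qed
  have "(%v. \<Sum>b\<in>Basis. (fderiv g x v \<bullet> b) *\<^sub>R fderiv f (g x) b)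
    = (%v. fderiv f (g x) (fderiv g x v))"
   by (rule ext) (rule rep[symmetric])
  with * show "((%x. f (g x)) has_derivative (%v. \<Sum>b\<in>Basis. (fderiv g x v \<bullet> b) *\<^sub>R fderiv f (g x) b)) (at x)"
   by (simp only:)
 next
  fix v
  show "Ck_on k (%x. \<Sum>b\<in>Basis. (fderiv g x v \<bullet> b) *\<^sub>R fderiv f (g x) b) S"
  proof (rule Ck_on_sum[OF assms(1)],rule Ck_on_bilinear[OF bounded_bilinear_scaleR assms(1)])
   fix b :: 'b
   show "Ck_on k (%x. fderiv g x v \<bullet> b) S"
    by (rule Ck_on_linear_compose[OF bounded_linear_inner_left assms(1)]) (use Suc.prems(2) in simp)
   show "Ck_on k (%x. fderiv f (g x) b) S"
    by (rule Suc.IH[OF _ Ck_on_Suc_lower[OF Suc.prems(2)]]) (use Suc.prems(1) in simp)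
  qed
 qed
qed

lemma smooth_on_differentiable:
 "smooth_on S f ==> x\<in>S ==> f differentiable (at x)"
 unfolding smooth_on_def by (drule spec[of _ "Suc 0"]) simp

lemma smooth_on_continuous: "smooth_on S f ==> continuous_on S f"
 unfolding smooth_on_def by (drule spec[of _ 0]) simp

lemma smooth_on_frechet: "smooth_on S f ==> smooth_on S (%x. fderiv f x v)"
 unfolding smooth_on_def
proof
 fix k assume "\<forall>k. Ck_on k f S"
 then have "Ck_on (Suc k) f S" by (rule spec)
 then show "Ck_on k (%x. fderiv f x v) S" by simp
qed

lemma smooth_on_cong:
 assumes "open S" "!!y. y\<in>S ==> f y = g y"
 shows "smooth_on S f\<longleftrightarrow>smooth_on S g"
 using Ck_on_cong[OF assms] by (simp add: smooth_on_def)

lemma smooth_on_subset: "smooth_on S f ==> T\<subseteq>S ==> smooth_on T f"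
 unfolding smooth_on_def using Ck_on_subset by blast

lemma smooth_on_const: "smooth_on S (%x. a)"
 by (simp add: smooth_on_def Ck_on_const)

lemma smooth_on_bounded_linear: "bounded_linear L ==> smooth_on S L"
 by (simp add: smooth_on_def Ck_on_bounded_linear)

lemma smooth_on_linear_compose:
 "bounded_linear L ==> open S ==> smooth_on S f ==> smooth_on S (%x. L (f x))"
 by (simp add: smooth_on_def Ck_on_linear_compose)

lemma smooth_on_add: "open S ==> smooth_on S f ==> smooth_on S g ==> smooth_on S (%x. f x+g x)"
 by (simp add: smooth_on_def Ck_on_add)

lemma smooth_on_sum:
 "open S ==> (!!i. i\<in>I ==> smooth_on S (f i)) ==> smooth_on S (%x. \<Sum>i\<in>I. f i x)"
 by (simp add: smooth_on_def Ck_on_sum)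

lemma smooth_on_bilinear:
 "bounded_bilinear B ==> open S ==> smooth_on S f ==> smooth_on S g ==> smooth_on S (%x. B (f x) (g x))"
 by (simp add: smooth_on_def Ck_on_bilinear)

lemmas smooth_on_mult = smooth_on_bilinear[OF bounded_bilinear_mult]

lemma smooth_on_inverse:
 fixes f :: "'a::real_normed_vector => 'b::real_normed_field"
 shows "open S ==> smooth_on S f ==> (!!x. x\<in>S ==> f x ~= 0) ==> smooth_on S (%x. inverse (f x))"
 by (simp add: smooth_on_def Ck_on_inverse)

lemma smooth_on_local:
 assumes "!!x. x\<in>S ==> \<exists>N. open N\<and>x\<in>N\<and>smooth_on (S\<inter>N) f"
 shows "smooth_on S f"
 unfolding smooth_on_def
proof (intro allI Ck_on_local)
 fix k x assume "x\<in>S"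
 from assms[OF this] show "\<exists>N. open N\<and>x\<in>N\<and>Ck_on k f (S\<inter>N)"
  by (auto simp: smooth_on_def)
qed

lemma smooth_on_compose:
 fixes g :: "'a::euclidean_space => 'b::euclidean_space" and f :: "'b => 'c::real_normed_vector"
 assumes "open S" "open T" "g ` S\<subseteq>T" "smooth_on T f" "smooth_on S g"
 shows "smooth_on S (%x. f (g x))"
 using Ck_on_compose[OF assms(1-3)] assms(4,5) unfolding smooth_on_def by metis

lemma bounded_linear_axis: "bounded_linear (axis i :: 'b::real_normed_vector => 'b ^ 'n::finite)"
proof (rule bounded_linear_intro[where K = 1])
 fix x :: 'b
 have "norm (axis i x :: 'b ^ 'n)\<le>(\<Sum>j\<in>UNIV. norm ((axis i x :: 'b ^ 'n) $ j))"
  unfolding norm_vec_def by (rule L2_set_le_sum) simp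
 also have "... = (\<Sum>j\<in>UNIV. if j = i then norm x else 0)"
  by (intro sum.cong refl) (simp add: axis_def)
 finally show "norm (axis i x :: 'b ^ 'n)\<le>norm x * 1" by simp
qed (auto simp: vec_eq_iff axis_def)

lemma smooth_on_vec:
 fixes f :: "'a::real_normed_vector => 'b::real_normed_vector ^ 'n"
 assumes "open S"
 shows "smooth_on S f\<longleftrightarrow>(\<forall>i. smooth_on S (%x. f x $ i))"
proof
 assume "smooth_on S f"
 then show "\<forall>i. smooth_on S (%x. f x $ i)"
  using smooth_on_linear_compose[OF bounded_linear_vec_nth assms] by blast
next
 assume *: "\<forall>i. smooth_on S (%x. f x $ i)"
 have "smooth_on S (%x. \<Sum>i\<in>UNIV. axis i (f x $ i))"
  using * by (intro smooth_on_sum assms smooth_on_linear_compose[OF bounded_linear_axis assms]) simp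
 moreover have "(%x. \<Sum>i\<in>UNIV. axis i (f x $ i)) = f"
  by (simp add: fun_eq_iff vec_eq_iff axis_def)
 ultimately show "smooth_on S f" by simp
qed

lemma smooth_on_ln: "smooth_on {0<..} (ln :: real => real)"
 unfolding smooth_on_def
proof
 fix k show "Ck_on k (ln :: real => real) {0<..}"
 proof (rule Ck_on_Suc_lower,rule Ck_on_SucI)
  show "(ln has_derivative (%v. inverse x * v)) (at x)" if "x\<in>{0<..}" for x :: real
   using that DERIV_ln[of x] by (simp add: has_field_derivative_def)
  show "Ck_on k (%x. inverse x * v) {0<..}" for v :: real
   by (intro Ck_on_bilinear[OF bounded_bilinear_mult] Ck_on_const Ck_on_inverse
     Ck_on_bounded_linear bounded_linear_ident) auto
 qed simp
qed

text \<open>The derivative of a holomorphic function is multiplication by a holomorphic function, so its smoothness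
 reproduces itself.\<close>

lemma smooth_on_holomorphic:
 assumes "open S" "g holomorphic_on S"
 shows "smooth_on S g"
 unfolding smooth_on_def
proof
 fix k show "Ck_on k g S"
  using assms(2)
 proof (induction k arbitrary: g)
  case 0
  then show ?case by (simp add: holomorphic_on_imp_continuous_on)
 next
  case (Suc k)
  show ?case
  proof (rule Ck_on_SucI[OF assms(1)])
   show "(g has_derivative (%v. deriv g x * v)) (at x)" if "x\<in>S" for x
    using holomorphic_derivI[OF Suc.prems assms(1) that,of UNIV] by (simp add: has_field_derivative_def)
   show "Ck_on k (%x. deriv g x * v) S" for v
    using Suc.prems assms(1) by (intro Suc.IH holomorphic_intros)
  qed
 qed
qed

text \<open>The functions \<open>t\<^sup>-\<^sup>n exp (-1/t)\<close>, extended by \<open>0\<close>, are closed under differentiation up to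
 linear combinations; so all of them are smooth.\<close>

definition flat :: "nat => real => real" where
 "flat n t = (if t > 0 then inverse t ^ n * exp (- inverse t) else 0)"

lemma tendsto_flat: "(flat n \<longlongrightarrow> 0) (at 0)"
proof -
 have "((%t. inverse t ^ n * exp (- inverse t)) \<longlongrightarrow> 0) (at_right (0::real))"
 proof -
  have "((%x::real. x ^ n/exp x) \<longlongrightarrow> 0) at_top" by (rule tendsto_power_div_exp_0)
  then have "((%t::real. inverse t ^ n/exp (inverse t)) \<longlongrightarrow> 0) (at_right 0)"
   by (rule filterlim_compose[OF _ filterlim_inverse_at_top_right])
  then show ?thesis by (simp add: exp_minus divide_inverse)
 qed
 then have "(flat n \<longlongrightarrow> 0) (at_right 0)"
  by (rule Lim_transform_eventually) (auto simp: flat_def eventually_at_filter)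
 moreover have "(flat n \<longlongrightarrow> 0) (at_left 0)"
  by (rule Lim_transform_eventually[OF tendsto_const]) (auto simp: flat_def eventually_at_filter)
 ultimately show ?thesis by (simp add: filterlim_split_at)
qed

lemma flat_deriv: "(flat n has_real_derivative (flat (n+2) t - real n * flat (n+1) t)) (at t)"
proof -
 consider "t > 0" | "t < 0" | "t = 0" by linarith
 then show ?thesis
 proof cases
  case 1
  define i where "i = inverse t"
  have i: "((%t. inverse t) has_real_derivative - (i\<^sup>2)) (at t)"
   using 1 DERIV_inverse[of t UNIV] by (simp add: i_def power2_eq_square numeral_2_eq_2)
  have "((%t. inverse t ^ n * exp (- inverse t)) has_real_derivative
    (real n * (- (i\<^sup>2) * i ^ (n - Suc 0)) * exp (- i)+exp (- i) * - (- (i\<^sup>2)) * i ^ n)) (at t)"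
   using DERIV_mult[OF DERIV_power[OF i,of n] DERIV_fun_exp[OF DERIV_minus[OF i]]]
   unfolding i_def by (simp only: mult.assoc)
  also have "real n * (- (i\<^sup>2) * i ^ (n - Suc 0)) * exp (- i)+exp (- i) * - (- (i\<^sup>2)) * i ^ n
    = flat (n+2) t - real n * flat (n+1) t"
   using 1 by (cases n) (simp_all add: flat_def i_def[symmetric] power2_eq_square algebra_simps)
  finally have "((%t. inverse t ^ n * exp (- inverse t)) has_real_derivative
    (flat (n+2) t - real n * flat (n+1) t)) (at t)" .
  then show ?thesis
   by (rule DERIV_cong_ev[THEN iffD1,rotated -1])
    (use 1 in \<open>auto simp: flat_def intro!: eventually_nhds_in_open[of "{0<..}",THEN eventually_mono]\<close>)
 next
  case 2
  have "((%t. 0) has_real_derivative 0) (at t)" by simp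
  then show ?thesis
   by (rule DERIV_cong_ev[THEN iffD1,rotated -1])
    (use 2 in \<open>auto simp: flat_def intro!: eventually_nhds_in_open[of "{..<0}",THEN eventually_mono]\<close>)
 next
  case 3
  have "(%h. (flat n (0+h) - flat n 0)/h) = flat (n+1)"
   by (auto simp: fun_eq_iff flat_def field_simps)
  then have "(flat n has_real_derivative 0) (at 0)"
   unfolding DERIV_def using tendsto_flat[of "n+1"] by simp
  then show ?thesis using 3 by (simp add: flat_def)
 qed
qed

lemma smooth_on_flat: "smooth_on UNIV (flat n)"
 unfolding smooth_on_def
proof
 fix k show "Ck_on k (flat n) UNIV"
 proof (induction k arbitrary: n)
  case 0
  then show ?case using flat_deriv by (auto intro!: DERIV_isCont continuous_at_imp_continuous_on)
 next
  case (Suc k)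
  show ?case
  proof (rule Ck_on_SucI)
   show "(flat n has_derivative (%v. (flat (n+2) t+(- real n) * flat (n+1) t) * v)) (at t)" for t
    using flat_deriv[of n t] by (simp add: has_field_derivative_def)
   show "Ck_on k (%t. (flat (n+2) t+(- real n) * flat (n+1) t) * v) UNIV" for v
    by (intro Ck_on_bilinear[OF bounded_bilinear_mult] Ck_on_add Suc.IH Ck_on_const) auto
  qed simp
 qed
qed

section \<open>Wirtinger calculus\<close>

text \<open>Two mean value steps show that the second difference in the directions \<open>v\<close>, \<open>w\<close> is
 close to the iterated derivative; the difference is symmetric in \<open>v\<close> and \<open>w\<close>, hence
 so is the derivative.\<close>

lemma second_difference_mean_value:
 fixes f :: "'a::real_normed_vector => real"
 assumes f: "Ck_on (Suc (Suc 0)) f S" and t: "0 < t"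
  and S: "!!r s. 0\<le>r ==> r\<le>t ==> 0\<le>s ==> s\<le>t ==> x+s *\<^sub>R v+r *\<^sub>R w\<in>S"
 shows "\<exists>r s. 0\<le>r\<and>r\<le>t\<and>0\<le>s\<and>s\<le>t \<and>
  f (x+t *\<^sub>R v+t *\<^sub>R w) - f (x+t *\<^sub>R w) - (f (x+t *\<^sub>R v) - f x) =
   t * (t * frechet_derivative (%y. fderiv f y v) (at (x+s *\<^sub>R v+r *\<^sub>R w)) w)"
proof -
 define fv where "fv = (%y. fderiv f y v)"
 have f1: "(f has_derivative fderiv f y) (at y)" if "y\<in>S" for y
  using Ck_on_SucD(1)[OF f that] .
 have f2: "(fv has_derivative fderiv fv y) (at y)" if "y\<in>S" for y
  using Ck_on_SucD(1)[OF Ck_on_SucD(2)[OF f that] that] unfolding fv_def .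
 have line: "((%s. g (a+s *\<^sub>R u+b)) has_real_derivative g' u) (at s)"
  if "(g has_derivative g') (at (a+s *\<^sub>R u+b))" for g :: "'a => real" and g' a u b and s :: real
 proof -
  have "((%s. a+s *\<^sub>R u+b) has_derivative (%h. h *\<^sub>R u)) (at s)"
   by (auto intro!: derivative_eq_intros)
  from has_derivative_compose[OF this that]
  have "((%s. g (a+s *\<^sub>R u+b)) has_derivative (%h. g' (h *\<^sub>R u))) (at s)" .
  moreover have "g' (h *\<^sub>R u) = g' u * h" for h
   using has_derivative_bounded_linear[OF that] by (simp add: linear_simps)
  ultimately show ?thesis by (simp add: has_field_derivative_def)
 qed
 obtain s where s: "0 < s" "s < t"
  and s_eq: "(f (x+t *\<^sub>R v+t *\<^sub>R w) - f (x+t *\<^sub>R v+0)) - (f (x+0 *\<^sub>R v+t *\<^sub>R w) - f (x+0 *\<^sub>R v+0))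
   = (t - 0) * (fv (x+s *\<^sub>R v+t *\<^sub>R w) - fv (x+s *\<^sub>R v+0))"
 proof -
  have "\<exists>z>0. z < t\<and>(%s. f (x+s *\<^sub>R v+t *\<^sub>R w) - f (x+s *\<^sub>R v+0)) t
    - (%s. f (x+s *\<^sub>R v+t *\<^sub>R w) - f (x+s *\<^sub>R v+0)) 0
    = (t - 0) * (fv (x+z *\<^sub>R v+t *\<^sub>R w) - fv (x+z *\<^sub>R v+0))"
  proof (rule MVT2[OF t])
   fix s assume "0\<le>s" "s\<le>t"
   then have "x+s *\<^sub>R v+t *\<^sub>R w\<in>S" "x+s *\<^sub>R v+0\<in>S"
    using S[of t s] S[of 0 s] t by auto
   from DERIV_diff[OF line[OF f1[OF this(1)]] line[OF f1[OF this(2)]]]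
   show "((%s. f (x+s *\<^sub>R v+t *\<^sub>R w) - f (x+s *\<^sub>R v+0)) has_real_derivative
     fv (x+s *\<^sub>R v+t *\<^sub>R w) - fv (x+s *\<^sub>R v+0)) (at s)"
    unfolding fv_def .
  qed
  then show ?thesis using that by blast
 qed
 obtain r where r: "0 < r" "r < t"
  and r_eq: "fv (x+s *\<^sub>R v+t *\<^sub>R w+0) - fv (x+s *\<^sub>R v+0 *\<^sub>R w+0) =
   (t - 0) * fderiv fv (x+s *\<^sub>R v+r *\<^sub>R w+0) w"
 proof -
  have "\<exists>z>0. z < t\<and>(%r. fv (x+s *\<^sub>R v+r *\<^sub>R w+0)) t - (%r. fv (x+s *\<^sub>R v+r *\<^sub>R w+0)) 0 =
   (t - 0) * fderiv fv (x+s *\<^sub>R v+z *\<^sub>R w+0) w"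
  proof (rule MVT2[OF t])
   fix r assume "0\<le>r" "r\<le>t"
   then have "x+s *\<^sub>R v+r *\<^sub>R w+0\<in>S" using S[of r s] s by auto
   from line[OF f2[OF this]]
   show "((%r. fv (x+s *\<^sub>R v+r *\<^sub>R w+0)) has_real_derivative
     fderiv fv (x+s *\<^sub>R v+r *\<^sub>R w+0) w) (at r)" .
  qed
  then show ?thesis using that by blast
 qed
 show ?thesis
 proof (intro exI conjI)
  show "f (x+t *\<^sub>R v+t *\<^sub>R w) - f (x+t *\<^sub>R w) - (f (x+t *\<^sub>R v) - f x) =
   t * (t * frechet_derivative (%y. fderiv f y v) (at (x+s *\<^sub>R v+r *\<^sub>R w)) w)"
   using s_eq r_eq by (simp add: fv_def)
 qed (use r s in auto)
qed

lemma second_derivative_symmetric_real: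
 fixes f :: "'a::real_normed_vector => real"
 assumes "open S" "x\<in>S" and f: "Ck_on (Suc (Suc 0)) f S"
 shows "frechet_derivative (%y. fderiv f y v) (at x) w =
  frechet_derivative (%y. fderiv f y w) (at x) v"
proof -
 define F where "F = (%v w y. frechet_derivative (%y. fderiv f y v) (at y) w)"
 have cont: "continuous_on S (F v w)" for v w
  using f by (simp add: F_def)
 have "\<bar>F v w x - F w v x\<bar>\<le>e" if "e > 0" for e
 proof -
  have lim: "\<exists>d>0. \<forall>y. dist y x < d --> dist (F v w y) (F v w x) < e/2" for v w
  proof -
   have "isCont (F v w) x" using cont assms(1,2) continuous_on_eq_continuous_at by blast
   then show ?thesis
    using \<open>e > 0\<close> unfolding continuous_at_eps_delta by (metis dist_norm dist_commute half_gt_zero)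
  qed
  obtain d1 where d1: "d1 > 0" "!!y. dist y x < d1 ==> dist (F v w y) (F v w x) < e/2" using lim by blast
  obtain d2 where d2: "d2 > 0" "!!y. dist y x < d2 ==> dist (F w v y) (F w v x) < e/2" using lim by blast
  obtain d3 where d3: "d3 > 0" "!!y. dist y x < d3 ==> y\<in>S"
   using assms(1,2) unfolding open_dist by blast
  define d where "d = min d1 (min d2 d3)"
  have d: "d > 0" using d1 d2 d3 by (simp add: d_def)
  define t where "t = d/(norm v+norm w+1)"
  have t: "t > 0" unfolding t_def using d by (intro divide_pos_pos) (auto intro: add_nonneg_pos)
  have small: "dist (x+s *\<^sub>R v+r *\<^sub>R w) x < d" if "0\<le>r" "r\<le>t" "0\<le>s" "s\<le>t" for r s
  proof -
   have "dist (x+s *\<^sub>R v+r *\<^sub>R w) x\<le>s * norm v+r * norm w"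
    unfolding dist_norm using norm_triangle_ineq[of "s *\<^sub>R v" "r *\<^sub>R w"] that by simp
   also have "...\<le>t * norm v+t * norm w"
    by (intro add_mono mult_right_mono that) auto
   also have "... < t * (norm v+norm w+1)" using t by (simp add: algebra_simps)
   also have "... = d"
   proof -
    have "norm v+norm w+1 ~= 0" by (metis add_nonneg_nonneg add_nonneg_pos less_irrefl norm_ge_zero zero_less_one)
    then show ?thesis by (simp add: t_def)
   qed
   finally show ?thesis .
  qed
  obtain r s where rs: "0\<le>r" "r\<le>t" "0\<le>s" "s\<le>t"
   and 1: "f (x+t *\<^sub>R v+t *\<^sub>R w) - f (x+t *\<^sub>R w) - (f (x+t *\<^sub>R v) - f x)
    = t * (t * F v w (x+s *\<^sub>R v+r *\<^sub>R w))"
   using second_difference_mean_value[OF f t,of x v w] d3(2) small unfolding F_def d_def by force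
  obtain r' s' where rs': "0\<le>r'" "r'\<le>t" "0\<le>s'" "s'\<le>t"
   and 2: "f (x+t *\<^sub>R w+t *\<^sub>R v) - f (x+t *\<^sub>R v) - (f (x+t *\<^sub>R w) - f x)
    = t * (t * F w v (x+s' *\<^sub>R w+r' *\<^sub>R v))"
  proof -
   have "x+s *\<^sub>R w+r *\<^sub>R v\<in>S" if "0\<le>r" "r\<le>t" "0\<le>s" "s\<le>t" for r s
    using small[of s r] that d3(2)[of "x+s *\<^sub>R w+r *\<^sub>R v"] by (simp add: d_def add_ac)
   then show ?thesis
    using second_difference_mean_value[OF f t,of x w v] that unfolding F_def by blast
  qed
  have sw: "x+t *\<^sub>R w+t *\<^sub>R v = x+t *\<^sub>R v+t *\<^sub>R w" by simp
  have "t * (t * F v w (x+s *\<^sub>R v+r *\<^sub>R w)) = t * (t * F w v (x+s' *\<^sub>R w+r' *\<^sub>R v))"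
   using 1 2[unfolded sw] by linarith
  then have e0: "F v w (x+s *\<^sub>R v+r *\<^sub>R w) = F w v (x+s' *\<^sub>R w+r' *\<^sub>R v)" using t by simp
  have e1: "dist (F v w (x+s *\<^sub>R v+r *\<^sub>R w)) (F v w x) < e/2"
   using d1(2) small[OF rs] by (simp add: d_def)
  have e2: "dist (F w v (x+s' *\<^sub>R w+r' *\<^sub>R v)) (F w v x) < e/2"
  proof -
   have sw': "x+s' *\<^sub>R w+r' *\<^sub>R v = x+r' *\<^sub>R v+s' *\<^sub>R w" by simp
   show ?thesis unfolding sw' using d2(2) small[of s' r'] rs' by (simp add: d_def)
  qed
  show ?thesis using e0 e1 e2 unfolding dist_real_def by linarith
 qed
 then have "\<bar>F v w x - F w v x\<bar>\<le>0" by (rule field_le_epsilon) simp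
 then show ?thesis by (simp add: F_def)
qed

lemma second_derivative_symmetric:
 fixes f :: "'a::real_normed_vector => complex"
 assumes "open S" "x\<in>S" and f: "Ck_on (Suc (Suc 0)) f S"
 shows "frechet_derivative (%y. fderiv f y v) (at x) w =
  frechet_derivative (%y. fderiv f y w) (at x) v"
proof -
 have *: "L (frechet_derivative (%y. fderiv f y v) (at x) w) =
   L (frechet_derivative (%y. fderiv f y w) (at x) v)"
  if L: "bounded_linear L" for L :: "complex => real"
 proof -
  have D: "frechet_derivative (%y. L (g y)) (at y) = (%v. L (fderiv g y v))"
   if "g differentiable (at y)" for g :: "'a => complex" and y
   by (rule frechet_derivative_eqI,rule bounded_linear.has_derivative[OF L])
    (use that frechet_derivative_works in blast)
  have DD: "frechet_derivative (%y. frechet_derivative (%y. L (f y)) (at y) v) (at x) w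
    = L (frechet_derivative (%y. fderiv f y v) (at x) w)" for v w
  proof -
   have "frechet_derivative (%y. frechet_derivative (%y. L (f y)) (at y) v) (at x)
     = frechet_derivative (%y. L (fderiv f y v)) (at x)"
    by (rule frechet_derivative_cong_open(2)[OF assms(1,2)]) (use f D in simp)
   also have "... = (%w. L (frechet_derivative (%y. fderiv f y v) (at x) w))"
    by (rule D) (use f assms(2) in simp)
   finally show ?thesis by simp
  qed
  show ?thesis
   using second_derivative_symmetric_real[OF assms(1,2) Ck_on_linear_compose[OF L assms(1) f]]
   unfolding DD .
 qed
 show ?thesis by (rule complex_eqI) (rule *[OF bounded_linear_Re],rule *[OF bounded_linear_Im])
qed

text \<open>\<open>wirtinger_coeff k D\<close> is the coefficient of \<open>dz\<^sub>j\<close> or of its conjugate in a real linear form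
 \<open>D\<close>, and \<open>dual_coord k\<close> is this form itself.\<close>

fun wirtinger_coeff :: "'n+'n => (complex^'n => complex) => complex" where
 "wirtinger_coeff (Inl j) D = (D (axis j 1) - \<i> * D (axis j \<i>))/2"
| "wirtinger_coeff (Inr j) D = (D (axis j 1)+\<i> * D (axis j \<i>))/2"

fun dual_coord :: "'n+'n => complex^'n => complex" where
 "dual_coord (Inl j) v = v $ j"
| "dual_coord (Inr j) v = cnj (v $ j)"

definition bar :: "'n+'n => 'n+'n" where
 "bar = case_sum Inr Inl"

lemma bar_simps [simp]: "bar (Inl j) = Inr j" "bar (Inr j) = Inl j" "bar (bar k) = k"
 by (auto simp: bar_def split: sum.splits)

lemma sum_UNIV_Plus:
 fixes f :: "'n::finite+'n => 'a::comm_monoid_add"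
 shows "(\<Sum>k\<in>UNIV. f k) = (\<Sum>j\<in>UNIV. f (Inl j))+(\<Sum>j\<in>UNIV. f (Inr j))"
 unfolding UNIV_Plus_UNIV[symmetric] by (subst sum.Plus) (auto simp: o_def)

lemma wirtinger_eqI:
 assumes "(f has_derivative D) (at x)"
 shows "wirtinger k f x = wirtinger_coeff k D"
 using frechet_derivative_eqI[OF assms] differentiableI[OF assms] by (cases k) simp_all

lemma wirtinger_not_differentiable: "\<not> f differentiable (at x) ==> wirtinger k f x = 0"
 by (cases k) simp_all

declare wirtinger.simps [simp del]

lemma linear_form_wirtinger:
 assumes "bounded_linear D"
 shows "D v = (\<Sum>k\<in>UNIV. wirtinger_coeff k D * dual_coord k v)"
proof -
 interpret D: bounded_linear D by (rule assms)
 have ax: "axis j z = Re z *\<^sub>R axis j 1+Im z *\<^sub>R axis j \<i>" for j :: 'a and z :: complex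
  by (auto simp: vec_eq_iff axis_def complex_eq_iff)
 have "v = (\<Sum>j\<in>UNIV. axis j (v $ j))"
  by (simp add: vec_eq_iff axis_def)
 then have "D v = D (\<Sum>j\<in>UNIV. axis j (v $ j))" by simp
 also have "... = (\<Sum>j\<in>UNIV. D (axis j (v $ j)))" by (rule D.sum)
 also have "... = (\<Sum>j\<in>UNIV. Re (v $ j) * D (axis j 1)+Im (v $ j) * D (axis j \<i>))"
  by (rule sum.cong[OF refl],subst ax,simp only: D.add D.scaleR,simp only: scaleR_conv_of_real)
 also have "... = (\<Sum>j\<in>UNIV. wirtinger_coeff (Inl j) D * v $ j+wirtinger_coeff (Inr j) D * cnj (v $ j))"
  by (intro sum.cong refl) (simp add: complex_eq_iff,simp add: field_simps)
 also have "... = (\<Sum>k\<in>UNIV. wirtinger_coeff k D * dual_coord k v)"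
  by (simp add: sum_UNIV_Plus sum.distrib)
 finally show ?thesis .
qed

lemma wirtinger_coeff_linear_form:
 "wirtinger_coeff k (%v. \<Sum>l\<in>UNIV. a l * dual_coord l v) = a k"
proof -
 have ax: "(\<Sum>l\<in>UNIV. a l * dual_coord l (axis j z)) = a (Inl j) * z+a (Inr j) * cnj z" for j z
  by (simp add: sum_UNIV_Plus axis_def if_distrib[of cnj] if_distrib[of "(*) _"] cong: if_cong)
 show ?thesis by (cases k) (simp_all add: ax,simp_all add: field_simps)
qed

lemma wirtinger_cong_open:
 assumes "open S" "x\<in>S" "!!y. y\<in>S ==> f y = g y"
 shows "wirtinger k f x = wirtinger k g x"
 using frechet_derivative_cong_open[OF assms] by (cases k) (simp_all add: wirtinger.simps)

lemma wirtinger_has_derivative: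
 assumes "f differentiable (at x)"
 shows "(f has_derivative (%v. \<Sum>k\<in>UNIV. wirtinger k f x * dual_coord k v)) (at x)"
proof -
 have D: "(f has_derivative fderiv f x) (at x)"
  using assms frechet_derivative_works by blast
 have "fderiv f x = (%v. \<Sum>k\<in>UNIV. wirtinger k f x * dual_coord k v)"
  using linear_form_wirtinger[OF has_derivative_bounded_linear[OF D]] wirtinger_eqI[OF D] by auto
 with D show ?thesis by simp
qed

lemma wirtinger_eq_coeff:
 "(f has_derivative (%v. \<Sum>l\<in>UNIV. a l * dual_coord l v)) (at x) ==> wirtinger k f x = a k"
 by (simp add: wirtinger_eqI wirtinger_coeff_linear_form)

lemma wirtinger_const [simp]: "wirtinger k (%x. a) x = 0"
 by (cases k) (simp_all add: wirtinger.simps)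

lemma wirtinger_add:
 assumes "f differentiable (at x)" "g differentiable (at x)"
 shows "wirtinger k (%y. f y+g y) x = wirtinger k f x+wirtinger k g x"
 using has_derivative_add[OF wirtinger_has_derivative[OF assms(1)] wirtinger_has_derivative[OF assms(2)]]
 by (intro wirtinger_eq_coeff) (simp add: sum.distrib distrib_right)

lemma wirtinger_mult:
 assumes "f differentiable (at x)" "g differentiable (at x)"
 shows "wirtinger k (%y. f y * g y) x = wirtinger k f x * g x+f x * wirtinger k g x"
proof (rule wirtinger_eq_coeff)
 have "(%v. f x * (\<Sum>k\<in>UNIV. wirtinger k g x * dual_coord k v)+(\<Sum>k\<in>UNIV. wirtinger k f x * dual_coord k v) * g x)
   = (%v. \<Sum>l\<in>UNIV. (wirtinger l f x * g x+f x * wirtinger l g x) * dual_coord l v)"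
  by (simp add: fun_eq_iff sum.distrib distrib_right distrib_left sum_distrib_left sum_distrib_right mult_ac add.commute)
 then show "((%y. f y * g y) has_derivative
   (%v. \<Sum>l\<in>UNIV. (wirtinger l f x * g x+f x * wirtinger l g x) * dual_coord l v)) (at x)"
  using has_derivative_mult[OF wirtinger_has_derivative[OF assms(1)] wirtinger_has_derivative[OF assms(2)]]
  by simp
qed

lemma wirtinger_inverse:
 assumes "f differentiable (at x)" "f x ~= 0"
 shows "wirtinger k (%y. inverse (f y)) x = - wirtinger k f x/(f x)\<^sup>2"
 using Deriv.has_derivative_inverse[OF assms(2) wirtinger_has_derivative[OF assms(1)]]
 by (intro wirtinger_eq_coeff)
  (simp add: sum_distrib_left sum_distrib_right sum_negf[symmetric] power2_eq_square divide_inverse mult_ac)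

lemma wirtinger_cnj:
 "wirtinger k (%y. cnj (f y)) x = cnj (wirtinger (bar k) f x)"
proof (cases "f differentiable (at x)")
 case True
 have "(\<Sum>l\<in>UNIV. cnj (wirtinger l f x) * cnj (dual_coord l v)) =
   (\<Sum>l\<in>UNIV. cnj (wirtinger (bar l) f x) * dual_coord l v)" for v
  by (simp add: sum_UNIV_Plus)
 then show ?thesis
  using has_derivative_cnj[OF wirtinger_has_derivative[OF True]]
  by (intro wirtinger_eq_coeff) simp
next
 case False
 have "\<not> (%y. cnj (f y)) differentiable (at x)"
 proof
  assume "(%y. cnj (f y)) differentiable (at x)"
  then obtain D where "((%y. cnj (f y)) has_derivative D) (at x)" by (auto simp: differentiable_def)
  from has_derivative_cnj[OF this] have "f differentiable (at x)" by (auto simp: differentiable_def)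
  with False show False by simp
 qed
 with False show ?thesis by (simp add: wirtinger_not_differentiable)
qed

lemma wirtinger_chain:
 fixes psi :: "complex^'n::finite => complex^'m::finite"
 assumes "(psi has_derivative (%v. J *v v)) (at x)" "f differentiable (at (psi x))"
 shows "wirtinger (Inl j) (%y. f (psi y)) x = (\<Sum>i\<in>UNIV. J $ i $ j * wirtinger (Inl i) f (psi x))"
  "wirtinger (Inr j) (%y. f (psi y)) x = (\<Sum>i\<in>UNIV. cnj (J $ i $ j) * wirtinger (Inr i) f (psi x))"
proof -
 define a where "a = (%k. case k of Inl j => \<Sum>i\<in>UNIV. J $ i $ j * wirtinger (Inl i) f (psi x)
  | Inr j => \<Sum>i\<in>UNIV. cnj (J $ i $ j) * wirtinger (Inr i) f (psi x))"
 have "((%y. f (psi y)) has_derivative (%v. \<Sum>k\<in>UNIV. wirtinger k f (psi x) * dual_coord k (J *v v))) (at x)"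
  by (rule has_derivative_compose[OF assms(1) wirtinger_has_derivative[OF assms(2)]])
 also have "(%v. \<Sum>k\<in>UNIV. wirtinger k f (psi x) * dual_coord k (J *v v)) = (%v. \<Sum>k\<in>UNIV. a k * dual_coord k v)"
 proof
  fix v
  have 1: "(\<Sum>i\<in>UNIV. wirtinger (Inl i) f (psi x) * (\<Sum>j\<in>UNIV. J $ i $ j * v $ j)) =
    (\<Sum>j\<in>UNIV. (\<Sum>i\<in>UNIV. J $ i $ j * wirtinger (Inl i) f (psi x)) * v $ j)"
   unfolding sum_distrib_left sum_distrib_right by (subst sum.swap) (simp add: mult_ac)
  have 2: "(\<Sum>i\<in>UNIV. wirtinger (Inr i) f (psi x) * (\<Sum>j\<in>UNIV. cnj (J $ i $ j) * cnj (v $ j))) =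
    (\<Sum>j\<in>UNIV. (\<Sum>i\<in>UNIV. cnj (J $ i $ j) * wirtinger (Inr i) f (psi x)) * cnj (v $ j))"
   unfolding sum_distrib_left sum_distrib_right by (subst sum.swap) (simp add: mult_ac)
  show "(\<Sum>k\<in>UNIV. wirtinger k f (psi x) * dual_coord k (J *v v)) = (\<Sum>k\<in>UNIV. a k * dual_coord k v)"
   by (simp add: sum_UNIV_Plus matrix_vector_mult_def 1 2 a_def)
 qed
 finally have "wirtinger k (%y. f (psi y)) x = a k" for k by (rule wirtinger_eq_coeff)
 then show "wirtinger (Inl j) (%y. f (psi y)) x = (\<Sum>i\<in>UNIV. J $ i $ j * wirtinger (Inl i) f (psi x))"
  "wirtinger (Inr j) (%y. f (psi y)) x = (\<Sum>i\<in>UNIV. cnj (J $ i $ j) * wirtinger (Inr i) f (psi x))"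
  by (simp_all add: a_def)
qed

lemma wirtinger_hol:
 fixes psi :: "complex^'n::finite => complex^'m::finite"
 assumes "(psi has_derivative (%v. J *v v)) (at x)"
 shows "wirtinger (Inl j) (%y. psi y $ i) x = J $ i $ j" "wirtinger (Inr j) (%y. psi y $ i) x = 0"
  "(%y. psi y $ i) differentiable (at x)"
proof -
 have D: "((%y. psi y $ i) has_derivative (%v. (J *v v) $ i)) (at x)"
  using bounded_linear.has_derivative[OF bounded_linear_vec_nth assms] .
 then show "(%y. psi y $ i) differentiable (at x)" by (rule differentiableI)
 have "(%v. (J *v v) $ i) = (%v. \<Sum>l\<in>UNIV. case_sum (%j. J $ i $ j) (%j. 0) l * dual_coord l v)"
  by (simp add: sum_UNIV_Plus matrix_vector_mult_def)
 with D have "wirtinger k (%y. psi y $ i) x = case_sum (%j. J $ i $ j) (%j. 0) k" for k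
  by (intro wirtinger_eq_coeff) simp
 then show "wirtinger (Inl j) (%y. psi y $ i) x = J $ i $ j" "wirtinger (Inr j) (%y. psi y $ i) x = 0"
  by simp_all
qed

lemma hol_onI:
 fixes g :: "complex^'n::finite => complex^'m::finite"
 assumes "!!x i. x\<in>S ==> (%y. g y $ i) differentiable (at x)"
  and "!!x i j. x\<in>S ==> wirtinger (Inr j) (%y. g y $ i) x = 0"
 shows "hol_on S g"
 unfolding hol_on_def
proof (intro ballI exI)
 fix x assume x: "x\<in>S"
 define J :: "complex^'n^'m" where "J = (\<chi> i j. wirtinger (Inl j) (%y. g y $ i) x)"
 have "((%y. g y $ i) has_derivative (%v. (J *v v) $ i)) (at x)" for i
  using wirtinger_has_derivative[OF assms(1)[OF x]]
  by (simp add: sum_UNIV_Plus assms(2)[OF x] J_def matrix_vector_mult_def)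
 then have "((%y. \<Sum>i\<in>UNIV. axis i (g y $ i)) has_derivative (%v. \<Sum>i\<in>UNIV. axis i ((J *v v) $ i))) (at x)"
  by (intro has_derivative_sum bounded_linear.has_derivative[OF bounded_linear_axis])
 moreover have "(\<Sum>i\<in>UNIV. axis i (u $ i)) = u" for u :: "complex^'m"
  by (simp add: vec_eq_iff axis_def)
 ultimately show "(g has_derivative (%v. J *v v)) (at x)" by simp
qed

lemma wirtinger_coord [simp]:
 "wirtinger (Inl i) (%x. x $ j) x = (if i = j then 1 else 0)"
 "wirtinger (Inr i) (%x. x $ j) x = 0"
proof -
 have "((%x::complex^'a. x) has_derivative (%v. mat 1 *v v)) (at x)"
  by (simp add: matrix_vector_mul_lid has_derivative_ident)
 from wirtinger_hol[OF this] show "wirtinger (Inl i) (%x. x $ j) x = (if i = j then 1 else 0)"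
  "wirtinger (Inr i) (%x. x $ j) x = 0"
  by (auto simp: mat_def)
qed

lemma smooth_on_wirtinger:
 assumes "open S" "smooth_on S f"
 shows "smooth_on S (wirtinger k f)"
proof -
 have *: "smooth_on S (%x. (fderiv f x v+c * fderiv f x w)/2)" for v w c
  unfolding divide_inverse
  by (intro smooth_on_mult smooth_on_add smooth_on_frechet smooth_on_const assms)
 show ?thesis
 proof (cases k)
  case (Inl j)
  then show ?thesis
   using *[of "axis j 1" "-\<i>" "axis j \<i>"] smooth_on_differentiable[OF assms(2)]
   by (subst smooth_on_cong[OF assms(1),where g = "%x. (fderiv f x (axis j 1)+- \<i> * fderiv f x (axis j \<i>))/2"]) (auto simp: wirtinger.simps)
 next
  case (Inr j)
  then show ?thesis
   using *[of "axis j 1" "\<i>" "axis j \<i>"] smooth_on_differentiable[OF assms(2)]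
   by (subst smooth_on_cong[OF assms(1),where g = "%x. (fderiv f x (axis j 1)+\<i> * fderiv f x (axis j \<i>))/2"]) (auto simp: wirtinger.simps)
 qed
qed

text \<open>The Wirtinger derivatives are constant complex combinations of directional derivatives, and those commute.\<close>

lemma wirtinger_commute:
 assumes "open S" "x\<in>S" "smooth_on S f"
 shows "wirtinger k (wirtinger l f) x = wirtinger l (wirtinger k f) x"
proof -
 define c where "c = (%k :: 'a+'a. case k of Inl j => - \<i> | Inr j => \<i>)"
 define ix where "ix = (%k :: 'a+'a. case k of Inl j => j | Inr j => j)"
 have W: "wirtinger k g y = (fderiv g y (axis (ix k) 1)+c k * fderiv g y (axis (ix k) \<i>)) * (1/2)"
  if "g differentiable (at y)" for k g y
  using that by (cases k) (simp_all add: c_def ix_def wirtinger.simps)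
 define F where "F = (%v y. fderiv f y v)"
 have diff: "F v differentiable (at y)" if "y\<in>S" for v y
  unfolding F_def using smooth_on_frechet[OF assms(3)] that by (rule smooth_on_differentiable)
 have FF: "fderiv (F v) x w = fderiv (F w) x v" for v w
  unfolding F_def using assms(3) by (intro second_derivative_symmetric[OF assms(1,2)]) (simp add: smooth_on_def del: Ck_on.simps)
 have main: "wirtinger k (wirtinger l f) x =
   (frechet_derivative (F (axis (ix l) 1)) (at x) (axis (ix k) 1)
   +c l * frechet_derivative (F (axis (ix l) \<i>)) (at x) (axis (ix k) 1)
   +c k * frechet_derivative (F (axis (ix l) 1)) (at x) (axis (ix k) \<i>)
   +c k * c l * frechet_derivative (F (axis (ix l) \<i>)) (at x) (axis (ix k) \<i>))/4" for k l
 proof -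
  have "wirtinger k (wirtinger l f) x = wirtinger k (%y. (F (axis (ix l) 1) y+c l * F (axis (ix l) \<i>) y) * (1/2)) x"
   using W[of f _ l] smooth_on_differentiable[OF assms(3)]
   by (intro wirtinger_cong_open[OF assms(1,2)]) (simp add: F_def)
  also have "... = (wirtinger k (F (axis (ix l) 1)) x+c l * wirtinger k (F (axis (ix l) \<i>)) x) * (1/2)"
   using diff[OF assms(2)]
   by (simp only: wirtinger_mult wirtinger_add differentiable_add differentiable_mult differentiable_const wirtinger_const) simp
  finally show ?thesis unfolding W[OF diff[OF assms(2)]] by (simp add: algebra_simps add_divide_distrib)
 qed
 show ?thesis unfolding main[of k l] main[of l k]
  by (simp add: FF[of "axis (ix l) 1" "axis (ix k) 1"] FF[of "axis (ix l) 1" "axis (ix k) \<i>"]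
   FF[of "axis (ix l) \<i>" "axis (ix k) 1"] FF[of "axis (ix l) \<i>" "axis (ix k) \<i>"])
qed

lemma hol_on_smooth:
 fixes psi :: "complex^1 => complex^'k::finite"
 assumes "open S" "hol_on S psi"
 shows "smooth_on S psi"
 unfolding smooth_on_vec[OF assms(1)]
proof
 fix i
 define g where "g = (%z. psi (vec z) $ i)"
 define T where "T = (%z. vec z :: complex^1) -` S"
 have vec1: "vec (x $ 1) = x" for x :: "complex^1" by (simp add: vec_eq_iff)
 have lin: "bounded_linear (vec :: complex => complex^1)"
  by (rule bounded_linear_intro[where K = 1]) (auto simp: vec_eq_iff norm_vec_def)
 have "open T"
  unfolding T_def by (intro open_vimage assms linear_continuous_on lin)
 have der: "(g has_field_derivative (J $ i $ 1)) (at z)"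
  if "(psi has_derivative (%v. J *v v)) (at (vec z))" for z and J :: "complex^1^'k"
 proof -
  have "((%z. psi (vec z) $ i) has_derivative (%h. (J *v vec h) $ i)) (at z)"
   by (intro bounded_linear.has_derivative[OF bounded_linear_vec_nth]
     has_derivative_compose[OF bounded_linear_imp_has_derivative[OF lin] that])
  then show ?thesis
   by (simp add: g_def has_field_derivative_def matrix_vector_mult_def)
 qed
 have "g field_differentiable (at z)" if "z\<in>T" for z
 proof -
  obtain J where "(psi has_derivative (%v. J *v v)) (at (vec z))"
   using assms(2) \<open>z\<in>T\<close> unfolding hol_on_def T_def vimage_eq by metis
  then show ?thesis using der unfolding field_differentiable_def by blast
 qed
 then have "g holomorphic_on T"
  unfolding holomorphic_on_def by (metis field_differentiable_at_within)
 then have Tg: "smooth_on T g" by (rule smooth_on_holomorphic[OF \<open>open T\<close>])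
 have "smooth_on S (%x. g (x $ 1))"
 proof (rule smooth_on_compose[where f = g and g = "%x. x $ 1",OF assms(1) \<open>open T\<close>])
  show "(%x. x $ 1) ` S\<subseteq>T" using vec1 unfolding T_def by (metis image_subsetI vimageI)
  show "smooth_on S (%x. x $ 1)" by (rule smooth_on_bounded_linear[OF bounded_linear_vec_nth])
 qed (rule Tg)
 then show "smooth_on S (%x. psi x $ i)" by (simp add: g_def vec1)
qed

section \<open>Functions and tangent vectors on complex manifolds\<close>

abbreviation cinv :: "('m,'n::finite) chart => complex^'n => 'm" where
 "cinv C == the_inv_into (fst C) (snd C)"

text \<open>Differentiability in a chart. The derivations are defined on all functions but are linear and satisfy the
 Leibniz rule only on these.\<close>

definition cdiff :: "('m,'n::finite) chart => 'm => ('m => complex) => bool" where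
 "cdiff C p f\<longleftrightarrow>(%y. f (cinv C y)) differentiable (at (snd C p))"

lemma coord_vec_eq: "coord_vec C k p f = wirtinger k (%y. f (cinv C y)) (snd C p)"
 by (simp add: coord_vec_def o_def)

lemma smooth_fun_iff:
 "smooth_fun A W f\<longleftrightarrow>(\<forall>C\<in>A. smooth_on (snd C ` (fst C\<inter>W)) (%y. f (cinv C y)))"
 by (auto simp: smooth_fun_def o_def split_beta)

lemma holomorphic_fun_iff:
 "holomorphic_fun A W f\<longleftrightarrow>(\<forall>C\<in>A. hol_on (snd C ` (fst C\<inter>W)) (%y. f (cinv C y)))"
 by (auto simp: holomorphic_fun_def o_def split_beta)

lemma points_iff: "p\<in>points A\<longleftrightarrow>(\<exists>C\<in>A. p\<in>fst C)"
 by (simp add: points_def split_beta)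

lemma bar_conj_vec: "conj_vec (coord_vec C k p) = coord_vec C (bar k) p"
proof
 fix f :: "'a => complex"
 have "wirtinger k (%y. cnj (f (cinv C y))) (snd C p) = cnj (wirtinger (bar k) (%y. f (cinv C y)) (snd C p))"
  by (rule wirtinger_cnj)
 then show "conj_vec (coord_vec C k p) f = coord_vec C (bar k) p f"
  by (simp add: conj_vec_def coord_vec_eq)
qed

lemma coord_vec_cnj: "coord_vec C k p (%q. cnj (f q)) = cnj (coord_vec C (bar k) p f)"
 by (simp add: coord_vec_eq wirtinger_cnj)

lemma coord_vec_const [simp]: "coord_vec C k p (%q. a) = 0"
 by (simp add: coord_vec_eq)

lemma coord_vec_add:
 "cdiff C p f ==> cdiff C p g ==> coord_vec C k p (%q. f q+g q) = coord_vec C k p f+coord_vec C k p g"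
 by (simp add: coord_vec_eq cdiff_def wirtinger_add)

lemma coord_vec_mult:
 "cdiff C p f ==> cdiff C p g ==> coord_vec C k p (%q. f q * g q) = coord_vec C k p f * g (cinv C (snd C p))+f (cinv C (snd C p)) * coord_vec C k p g"
 by (simp add: coord_vec_eq cdiff_def wirtinger_mult)

lemma cdiff_const: "cdiff C p (%q. a)"
 by (simp add: cdiff_def)

lemma cdiff_add: "cdiff C p f ==> cdiff C p g ==> cdiff C p (%q. f q+g q)"
 by (simp add: cdiff_def)

lemma cdiff_mult: "cdiff C p f ==> cdiff C p g ==> cdiff C p (%q. f q * g q)"
 by (simp add: cdiff_def)

lemma cdiff_cnj: "cdiff C p f ==> cdiff C p (%q. cnj (f q))"
 unfolding cdiff_def differentiable_def using has_derivative_cnj by blast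

context
 fixes A :: "('m,'n::finite) atlas"
 assumes A: "complex_atlas A"
begin

lemma chart_inj: "C\<in>A ==> inj_on (snd C) (fst C)"
 using A by (auto simp: complex_atlas_def split_beta)

lemma cinv_chart [simp]: "C\<in>A ==> p\<in>fst C ==> cinv C (snd C p) = p"
 using chart_inj by (rule the_inv_into_f_f)

lemma chart_cinv:
 assumes "C\<in>A" "y\<in>snd C ` (fst C\<inter>W)"
 shows "cinv C y\<in>fst C" "cinv C y\<in>W" "snd C (cinv C y) = y"
 using assms by auto

lemma chart_mult_left:
 assumes "C\<in>A" "y\<in>snd C ` fst C"
 shows "cinv C y\<in>fst C" "snd C (cinv C y) = y"
 using assms by auto

lemma open_chart_image: "C\<in>A ==> open_in A W ==> open (snd C ` (fst C\<inter>W))"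
 using openin_atlas_topology[OF A,of W] by (auto simp: split_beta)

lemma open_chart: "C\<in>A ==> open (snd C ` fst C)"
 using A by (auto simp: complex_atlas_def split_beta)

lemma open_chart_overlap: "C\<in>A ==> D\<in>A ==> open (snd C ` (fst C\<inter>fst D))"
 using A by (auto simp: complex_atlas_def split_beta)

lemma transition_hol: "C\<in>A ==> D\<in>A ==> hol_on (snd C ` (fst C\<inter>fst D)) (%y. snd D (cinv C y))"
proof -
 assume CD: "C\<in>A" "D\<in>A"
 have "\<forall>C\<in>A. \<forall>D\<in>A. open (snd C ` (fst C\<inter>fst D))\<and>hol_on (snd C ` (fst C\<inter>fst D)) (snd D \<circ> cinv C)"
  by (rule A[unfolded complex_atlas_def case_prod_unfold,THEN conjunct2])
 then have "hol_on (snd C ` (fst C\<inter>fst D)) (snd D \<circ> cinv C)" using CD by (elim ballE) auto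
 then show ?thesis by (simp only: o_def)
qed

lemma openin_chart: "C\<in>A ==> open_in A (fst C)"
 unfolding openin_atlas_topology[OF A] case_prod_unfold subset_iff points_iff
 using open_chart_overlap by blast

lemma openin_subset_points: "open_in A W ==> W\<subseteq>points A"
 unfolding openin_atlas_topology[OF A] by blast

lemma openin_points: "open_in A (points A)"
proof -
 have "fst C\<inter>points A = fst C" if "C\<in>A" for C
  using that by (auto simp: points_def)
 then show ?thesis unfolding openin_atlas_topology[OF A] using open_chart by (auto simp: split_beta)
qed

lemma topspace_atlas: "topspace (atlas_topology A) = points A"
 using openin_points openin_subset_points by (metis openin_subset openin_topspace subset_antisym)

lemma hol_on_continuous: "hol_on S f ==> continuous_on S f" for f :: "complex^'k::finite => complex^'l::finite"
proof -
 assume f: "hol_on S f"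
 have "isCont f x" if "x\<in>S" for x
  using f that has_derivative_continuous unfolding hol_on_def by blast
 then show "continuous_on S f" by (simp add: continuous_at_imp_continuous_on)
qed

lemma openin_chart_preimage:
 assumes "C\<in>A" "open V" "V\<subseteq>snd C ` fst C"
 shows "open_in A (cinv C ` V)"
 unfolding openin_atlas_topology[OF A]
proof (intro conjI)
 have sub: "cinv C ` V\<subseteq>fst C" using assms chart_mult_left by blast
 then show "cinv C ` V\<subseteq>points A" using assms(1) unfolding points_iff subset_iff by blast
 have "open (snd D ` (fst D\<inter>cinv C ` V))" if D: "D\<in>A" for D
 proof -
  let ?S = "snd D ` (fst D\<inter>fst C)"
  have "snd D ` (fst D\<inter>cinv C ` V) = ?S\<inter>(%y. snd C (cinv D y)) -` V"
  proof (intro equalityI subsetI)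
   fix y assume "y\<in>snd D ` (fst D\<inter>cinv C ` V)"
   then obtain v where v: "v\<in>V" "cinv C v\<in>fst D" "y = snd D (cinv C v)" by auto
   then show "y\<in>?S\<inter>(%y. snd C (cinv D y)) -` V"
    using D chart_mult_left(1,2)[OF assms(1),of v] assms(3) by auto
  next
   fix y assume "y\<in>?S\<inter>(%y. snd C (cinv D y)) -` V"
   then obtain p where p: "p\<in>fst D" "p\<in>fst C" "y = snd D p" "snd C p\<in>V" using D by auto
   then have "cinv C (snd C p) = p" using assms(1) by simp
   with p show "y\<in>snd D ` (fst D\<inter>cinv C ` V)" by (metis IntI imageI)
  qed
  moreover have "open (?S\<inter>(%y. snd C (cinv D y)) -` V)"
   using hol_on_continuous[OF transition_hol[OF D assms(1)]] open_chart_overlap[OF D assms(1)] assms(2)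
   by (simp add: continuous_on_open_vimage Int_commute)
  ultimately show ?thesis by simp
 qed
 then show "\<forall>(U,c)\<in>A. open (c ` (U\<inter>cinv C ` V))" by auto
qed

lemma coord_vec_mult':
 "C\<in>A ==> p\<in>fst C ==> cdiff C p f ==> cdiff C p g ==>
  coord_vec C k p (%q. f q * g q) = coord_vec C k p f * g p+f p * coord_vec C k p g"
 by (simp add: coord_vec_mult)

lemma coord_vec_cmult:
 "C\<in>A ==> p\<in>fst C ==> cdiff C p f ==> coord_vec C k p (%q. a * f q) = a * coord_vec C k p f"
 using coord_vec_mult'[of C p "%q. a" f k] by (simp add: cdiff_const)

lemma coord_vec_inverse:
 "C\<in>A ==> p\<in>fst C ==> cdiff C p f ==> f p ~= 0 ==>
  coord_vec C k p (%q. inverse (f q)) = - coord_vec C k p f/(f p)\<^sup>2"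
 by (simp add: coord_vec_eq cdiff_def wirtinger_inverse)

lemma coord_vec_cong:
 assumes "C\<in>A" "p\<in>fst C" "open_in A W" "p\<in>W" "!!q. q\<in>W ==> f q = g q"
 shows "coord_vec C k p f = coord_vec C k p g" "cdiff C p f\<longleftrightarrow>cdiff C p g"
proof -
 have 1: "open (snd C ` (fst C\<inter>W))" "snd C p\<in>snd C ` (fst C\<inter>W)"
  using assms open_chart_image by auto
 have 2: "f (cinv C y) = g (cinv C y)" if "y\<in>snd C ` (fst C\<inter>W)" for y
  using chart_cinv(2)[OF assms(1) that] assms(5) by blast
 show "coord_vec C k p f = coord_vec C k p g"
  unfolding coord_vec_eq by (rule wirtinger_cong_open[OF 1 2])
 show "cdiff C p f\<longleftrightarrow>cdiff C p g"
  unfolding cdiff_def by (rule frechet_derivative_cong_open(1)[OF 1 2])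
qed

lemma smooth_fun_cdiff:
 assumes "smooth_fun A W f" "C\<in>A" "p\<in>fst C" "p\<in>W"
 shows "cdiff C p f"
 unfolding cdiff_def
 by (rule smooth_on_differentiable[where S = "snd C ` (fst C\<inter>W)"]) (use assms in \<open>auto simp: smooth_fun_iff\<close>)

lemma smooth_fun_subset: "smooth_fun A W f ==> V\<subseteq>W ==> smooth_fun A V f"
 unfolding smooth_fun_iff by (meson Int_mono image_mono smooth_on_subset subset_refl)

lemma smooth_fun_cong:
 assumes "open_in A W" "!!q. q\<in>W ==> f q = g q"
 shows "smooth_fun A W f\<longleftrightarrow>smooth_fun A W g"
 unfolding smooth_fun_iff
proof (rule ball_cong[OF refl],rule smooth_on_cong)
 fix C y assume "C\<in>A" "y\<in>snd C ` (fst C\<inter>W)"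
 then show "f (cinv C y) = g (cinv C y)" using chart_cinv(2) assms(2) by blast
qed (use assms open_chart_image in blast)

lemma smooth_fun_const: "smooth_fun A W (%q. a)"
 by (simp add: smooth_fun_iff smooth_on_const)

lemma smooth_fun_add:
 "open_in A W ==> smooth_fun A W f ==> smooth_fun A W g ==> smooth_fun A W (%q. f q+g q)"
 by (simp add: smooth_fun_iff smooth_on_add open_chart_image)

lemma smooth_fun_sum:
 "open_in A W ==> (!!i. i\<in>I ==> smooth_fun A W (f i)) ==> smooth_fun A W (%q. \<Sum>i\<in>I. f i q)"
 by (simp add: smooth_fun_iff smooth_on_sum open_chart_image)

lemma smooth_fun_bilinear:
 "bounded_bilinear B ==> open_in A W ==> smooth_fun A W f ==> smooth_fun A W g ==> smooth_fun A W (%q. B (f q) (g q))"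
 unfolding smooth_fun_iff by (intro ballI smooth_on_bilinear[where B = B] open_chart_image) auto

lemmas smooth_fun_mult = smooth_fun_bilinear[OF bounded_bilinear_mult]

lemma smooth_fun_linear:
 "bounded_linear L ==> open_in A W ==> smooth_fun A W f ==> smooth_fun A W (%q. L (f q))"
 unfolding smooth_fun_iff by (rule ballI,rule smooth_on_linear_compose[where L = L]) (auto intro: open_chart_image)

lemma smooth_fun_inverse:
 fixes f :: "'m => 'b::real_normed_field"
 assumes "open_in A W" "smooth_fun A W f" "!!q. q\<in>W ==> f q ~= 0"
 shows "smooth_fun A W (%q. inverse (f q))"
 unfolding smooth_fun_iff
proof
 fix C assume C: "C\<in>A"
 show "smooth_on (snd C ` (fst C\<inter>W)) (%y. inverse (f (cinv C y)))"
 proof (rule smooth_on_inverse)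
  show "f (cinv C y) ~= 0" if "y\<in>snd C ` (fst C\<inter>W)" for y
   using chart_cinv(2)[OF C that] assms(3) by blast
 qed (use assms C open_chart_image in \<open>auto simp: smooth_fun_iff\<close>)
qed

lemma smooth_fun_compose:
 fixes f :: "'m => 'b::euclidean_space" and g :: "'b => 'c::real_normed_vector"
 assumes "open_in A W" "smooth_fun A W f" "smooth_on T g" "open T" "!!q. q\<in>W ==> f q\<in>T"
 shows "smooth_fun A W (%q. g (f q))"
 unfolding smooth_fun_iff
proof
 fix C assume C: "C\<in>A"
 show "smooth_on (snd C ` (fst C\<inter>W)) (%y. g (f (cinv C y)))"
 proof (rule smooth_on_compose[where f = g and g = "%y. f (cinv C y)" and T = T])
  show "(%y. f (cinv C y)) ` (snd C ` (fst C\<inter>W))\<subseteq>T"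
   using C assms(5) by auto
 qed (use assms C open_chart_image in \<open>auto simp: smooth_fun_iff\<close>)
qed

lemma smooth_fun_vec:
 fixes f :: "'m => 'b::real_normed_vector ^ 'k"
 assumes "open_in A W"
 shows "smooth_fun A W f\<longleftrightarrow>(\<forall>i. smooth_fun A W (%q. f q $ i))"
 unfolding smooth_fun_iff using smooth_on_vec[OF open_chart_image[OF _ assms],of _ "%y. f (cinv _ y)"] by blast

lemma smooth_fun_local:
 assumes "!!p. p\<in>W ==> \<exists>N. open_in A N\<and>p\<in>N\<and>smooth_fun A (W\<inter>N) f"
 shows "smooth_fun A W f"
 unfolding smooth_fun_iff
proof (intro ballI smooth_on_local)
 fix C y assume C: "C\<in>A" and y: "y\<in>snd C ` (fst C\<inter>W)"
 then obtain p where p: "p\<in>fst C" "p\<in>W" "y = snd C p" by auto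
 obtain N where N: "open_in A N" "p\<in>N" "smooth_fun A (W\<inter>N) f" using assms[OF p(2)] by auto
 have "smooth_on (snd C ` (fst C\<inter>(W\<inter>N))) (%y. f (cinv C y))" using N(3) C by (simp add: smooth_fun_iff)
 moreover have "snd C ` (fst C\<inter>W)\<inter>snd C ` (fst C\<inter>N)\<subseteq>snd C ` (fst C\<inter>(W\<inter>N))"
  using chart_inj[OF C] by (auto simp: inj_on_def)
 ultimately have "smooth_on (snd C ` (fst C\<inter>W)\<inter>snd C ` (fst C\<inter>N)) (%y. f (cinv C y))"
  by (rule smooth_on_subset)
 then show "\<exists>N. open N\<and>y\<in>N\<and>smooth_on (snd C ` (fst C\<inter>W)\<inter>N) (%y. f (cinv C y))"
  using open_chart_image[OF C N(1)] p N(2) by blast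
qed

lemma holomorphic_fun_comp:
 assumes "holomorphic_fun A W f" "C\<in>A" "p\<in>fst C" "p\<in>W"
 shows "cdiff C p (%q. f q $ i)" "coord_vec C (Inr j) p (%q. f q $ i) = 0"
proof -
 have "snd C p\<in>snd C ` (fst C\<inter>W)" using assms by auto
 then obtain J :: "complex^'n^'a" where "((%y. f (cinv C y)) has_derivative (%v. J *v v)) (at (snd C p))"
  using assms(1,2) unfolding holomorphic_fun_iff hol_on_def by fast
 from wirtinger_hol(2,3)[OF this] show "cdiff C p (%q. f q $ i)" "coord_vec C (Inr j) p (%q. f q $ i) = 0"
  by (simp_all add: cdiff_def coord_vec_eq)
qed

lemma smooth_on_coord_vec:
 assumes "smooth_fun A W f" "C\<in>A" "open_in A W"
 shows "smooth_on (snd C ` (fst C\<inter>W)) (%y. coord_vec C k (cinv C y) f)"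
proof -
 have o: "open (snd C ` (fst C\<inter>W))" using assms open_chart_image by blast
 have "smooth_on (snd C ` (fst C\<inter>W)) (wirtinger k (%y. f (cinv C y)))"
  using assms by (intro smooth_on_wirtinger o) (simp add: smooth_fun_iff)
 then show ?thesis
  using chart_cinv(3)[OF assms(2)] by (subst smooth_on_cong[OF o]) (simp_all add: coord_vec_eq)
qed

lemma cdiff_coord_vec:
 assumes "smooth_fun A W f" "C\<in>A" "open_in A W" "p\<in>W" "p\<in>fst C"
 shows "cdiff C p (%q. coord_vec C k q f)"
 unfolding cdiff_def
 by (rule smooth_on_differentiable[OF smooth_on_coord_vec[OF assms(1-3)]]) (use assms in auto)

lemma coord_vec_commute:
 assumes "smooth_fun A W f" "C\<in>A" "open_in A W" "p\<in>W" "p\<in>fst C"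
 shows "coord_vec C k p (%q. coord_vec C l q f) = coord_vec C l p (%q. coord_vec C k q f)"
proof -
 let ?S = "snd C ` (fst C\<inter>W)"
 have o: "open ?S" "snd C p\<in>?S" using assms open_chart_image by auto
 have "coord_vec C k p (%q. coord_vec C l q f) = wirtinger k (wirtinger l (%y. f (cinv C y))) (snd C p)" for k l
  unfolding coord_vec_eq[of C k]
  by (rule wirtinger_cong_open[OF o]) (simp add: coord_vec_eq chart_cinv(3)[OF assms(2)])
 then show ?thesis
  using wirtinger_commute[OF o,of "%y. f (cinv C y)" k l] assms(1,2) by (simp add: smooth_fun_iff)
qed

lemma coord_in_tangent_space:
 assumes "C\<in>A" "p\<in>fst C"
 shows "coord_vec C k p\<in>tangent_space A p"
  "coord_vec C (Inl j) p\<in>tangent10 A p" "coord_vec C (Inr j) p\<in>tangent01 A p"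
proof -
 have "coord_vec C k p = (%f. \<Sum>l\<in>UNIV. (if l = k then 1 else 0) * coord_vec C l p f)"
  by (simp add: fun_eq_iff if_distrib[of "%x. x * _"] cong: if_cong)
 then show "coord_vec C k p\<in>tangent_space A p"
  using assms unfolding tangent_space_def mem_Collect_eq by (intro bexI[of _ C] conjI exI)
 have "coord_vec C (Inl j) p = (%f. \<Sum>l\<in>UNIV. (if l = j then 1 else 0) * coord_vec C (Inl l) p f)"
  by (simp add: fun_eq_iff if_distrib[of "%x. x * _"] cong: if_cong)
 then show "coord_vec C (Inl j) p\<in>tangent10 A p"
  using assms unfolding tangent10_def mem_Collect_eq by (intro bexI[of _ C] conjI exI)
 have "coord_vec C (Inr j) p = (%f. \<Sum>l\<in>UNIV. (if l = j then 1 else 0) * coord_vec C (Inr l) p f)"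
  by (simp add: fun_eq_iff if_distrib[of "%x. x * _"] cong: if_cong)
 then show "coord_vec C (Inr j) p\<in>tangent01 A p"
  using assms unfolding tangent01_def mem_Collect_eq by (intro bexI[of _ C] conjI exI)
qed

lemma tangent_cong:
 assumes "v\<in>tangent_space A p" "open_in A W" "p\<in>W" "!!q. q\<in>W ==> f q = g q"
 shows "v f = v g"
proof -
 obtain C a where "C\<in>A" "p\<in>fst C" "v = (%f. \<Sum>k\<in>UNIV. a k * coord_vec C k p f)"
  using assms(1) by (auto simp: tangent_space_def)
 then show ?thesis using coord_vec_cong(1)[OF _ _ assms(2-4)] by simp
qed

lemma tangent_const:
 assumes "v\<in>tangent_space A p" shows "v (%q. a) = 0"
 using assms by (auto simp: tangent_space_def)

lemma tangent01_subset: "v\<in>tangent01 A p ==> v\<in>tangent_space A p"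
proof -
 assume "v\<in>tangent01 A p"
 then obtain C a where C: "C\<in>A" "p\<in>fst C" "v = (%f. \<Sum>j\<in>UNIV. a j * coord_vec C (Inr j) p f)"
  by (auto simp: tangent01_def)
 then have "v = (%f. \<Sum>k\<in>UNIV. case_sum (%_. 0) a k * coord_vec C k p f)"
  by (simp add: sum_UNIV_Plus)
 then show ?thesis
  using C(1,2) unfolding tangent_space_def mem_Collect_eq by (intro bexI[of _ C] conjI exI)
qed

lemma tangent01_holomorphic:
 assumes "v\<in>tangent01 A p" "holomorphic_fun A W f" "p\<in>W"
 shows "v (%q. f q $ i) = 0"
 using assms holomorphic_fun_comp(2)[OF assms(2) _ _ assms(3)] by (auto simp: tangent01_def)

text \<open>Both sides vanish on functions that are not differentiable, so the rule for the change of
 coordinates holds for the coordinate vectors as functionals.\<close>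

lemma coord_vec_change:
 assumes C: "C\<in>A" "p\<in>fst C" and D: "D\<in>A" "p\<in>fst D"
 shows "coord_vec D (Inl j) p f = (\<Sum>i\<in>UNIV. coord_vec D (Inl j) p (%q. snd C q $ i) * coord_vec C (Inl i) p f)"
  "coord_vec D (Inr j) p f = (\<Sum>i\<in>UNIV. cnj (coord_vec D (Inl j) p (%q. snd C q $ i)) * coord_vec C (Inr i) p f)"
proof -
 have W: "open_in A (fst C\<inter>fst D)" using C D openin_chart by (intro openin_Int)
 have tr: "\<exists>J. ((%y. snd C (cinv D y)) has_derivative (%v. J *v v)) (at (snd D p))"
  if "C\<in>A" "p\<in>fst C" "D\<in>A" "p\<in>fst D" for C D
  using transition_hol[OF that(3,1)] that unfolding hol_on_def by blast
 obtain J where J: "((%y. snd C (cinv D y)) has_derivative (%v. J *v v)) (at (snd D p))"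
  using tr[OF C D] by blast
 have "coord_vec D (Inl j) p (%q. snd C q $ i) = J $ i $ j" for i
  unfolding coord_vec_eq by (rule wirtinger_hol(1)[OF J])
 have eq: "f (cinv D y) = f (cinv C (snd C (cinv D y)))" if "y\<in>snd D ` (fst D\<inter>fst C)" "C\<in>A" "D\<in>A" for C D y
  using that by auto
 have diff: "cdiff D p f" if hyps: "cdiff C p f" "C\<in>A" "p\<in>fst C" "D\<in>A" "p\<in>fst D" for C D
 proof -
  obtain J where J: "((%y. snd C (cinv D y)) has_derivative (%v. J *v v)) (at (snd D p))"
   using tr[OF hyps(2-5)] by blast
  have "(%y. f (cinv C y)) differentiable (at (snd C (cinv D (snd D p))))"
   using hyps by (simp add: cdiff_def)
  then have "(%y. f (cinv C (snd C (cinv D y)))) differentiable (at (snd D p))"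
   using has_derivative_compose[OF J] unfolding differentiable_def by blast
  then show ?thesis
   unfolding cdiff_def
   by (subst frechet_derivative_cong_open(1)[OF open_chart_overlap[OF hyps(4,2)] _ eq]) (use hyps in auto)
 qed
 have "coord_vec D (Inl j) p f = (\<Sum>i\<in>UNIV. J $ i $ j * coord_vec C (Inl i) p f) \<and>
  coord_vec D (Inr j) p f = (\<Sum>i\<in>UNIV. cnj (J $ i $ j) * coord_vec C (Inr i) p f)"
 proof (cases "cdiff C p f")
  case True
  have "wirtinger k (%y. f (cinv D y)) (snd D p) = wirtinger k (%y. f (cinv C (snd C (cinv D y)))) (snd D p)" for k
   by (rule wirtinger_cong_open[OF open_chart_overlap[OF D(1) C(1)] _ eq]) (use C D in auto)
  moreover have "(%y. f (cinv C y)) differentiable (at (snd C (cinv D (snd D p))))"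
   using True D by (simp add: cdiff_def)
  ultimately show ?thesis
   using wirtinger_chain[OF J,of "%y. f (cinv C y)" j] D by (simp add: coord_vec_eq)
 next
  case False
  then have "\<not> cdiff D p f" using diff C D by blast
  with False show ?thesis by (simp add: cdiff_def coord_vec_eq wirtinger_not_differentiable)
 qed
 then show "coord_vec D (Inl j) p f = (\<Sum>i\<in>UNIV. coord_vec D (Inl j) p (%q. snd C q $ i) * coord_vec C (Inl i) p f)"
  "coord_vec D (Inr j) p f = (\<Sum>i\<in>UNIV. cnj (coord_vec D (Inl j) p (%q. snd C q $ i)) * coord_vec C (Inr i) p f)"
  using \<open>!!i. coord_vec D (Inl j) p (%q. snd C q $ i) = J $ i $ j\<close> by simp_all
qed

lemma coord_vec_coordinate:
 assumes C: "C\<in>A" "p\<in>fst C"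
 shows "coord_vec C (Inl j) p (%q. snd C q $ i) = (if i = j then 1 else 0)"
  "coord_vec C (Inr j) p (%q. snd C q $ i) = 0"
proof -
 have "coord_vec C k p (%q. snd C q $ i) = wirtinger k (%y. y $ i) (snd C p)" for k
  unfolding coord_vec_eq
  by (rule wirtinger_cong_open[OF open_chart[OF C(1)]]) (use C chart_mult_left(2)[OF C(1)] in auto)
 then show "coord_vec C (Inl j) p (%q. snd C q $ i) = (if i = j then 1 else 0)"
  "coord_vec C (Inr j) p (%q. snd C q $ i) = 0" by auto
qed

lemma smooth_fun_coordinate:
 assumes "C\<in>A" "smooth_fun A (fst C) (snd C)" 
 shows "smooth_fun A (fst C) (%q. snd C q $ i)"
 using assms openin_chart smooth_fun_vec by blast

end


text \<open>On a Riemann surface the coordinate changes are smooth because they are holomorphic in one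
 variable; so smoothness can be tested in a single chart.\<close>

context
 fixes A :: "('m,1) atlas"
 assumes A: "complex_atlas A"
begin

lemma smooth_transition:
 assumes "C\<in>A" "D\<in>A"
 shows "smooth_on (snd C ` (fst C\<inter>fst D)) (%y. snd D (cinv C y))"
 using hol_on_smooth[OF open_chart_overlap[OF A assms] transition_hol[OF A assms]] .

lemma smooth_fun_chartI:
 assumes C: "C\<in>A" and W: "open_in A W" "W\<subseteq>fst C"
  and f: "smooth_on (snd C ` W) (%y. f (cinv C y))"
 shows "smooth_fun A W f"
 unfolding smooth_fun_iff
proof
 fix D assume D: "D\<in>A"
 have o: "open (snd D ` (fst D\<inter>W))" using open_chart_image[OF A D W(1)] .
 have "smooth_on (snd D ` (fst D\<inter>W)) (%y. f (cinv C (snd C (cinv D y))))"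
 proof (rule smooth_on_compose[where f = "%y. f (cinv C y)" and g = "%y. snd C (cinv D y)" and T = "snd C ` W",OF o])
  show "open (snd C ` W)" using open_chart_image[OF A C W(1)] W(2) by (simp add: Int_absorb1)
  show "(%y. snd C (cinv D y)) ` snd D ` (fst D\<inter>W)\<subseteq>snd C ` W"
   using D by (auto simp: cinv_chart[OF A])
  show "smooth_on (snd D ` (fst D\<inter>W)) (%y. snd C (cinv D y))"
   by (rule smooth_on_subset[OF smooth_transition[OF D C]]) (use W in auto)
 qed (rule f)
 then show "smooth_on (snd D ` (fst D\<inter>W)) (%y. f (cinv D y))"
 proof (subst smooth_on_cong[OF o])
  fix y assume "y\<in>snd D ` (fst D\<inter>W)"
  then have "cinv D y\<in>fst C" using D W(2) by (auto simp: cinv_chart[OF A])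
  then show "f (cinv D y) = f (cinv C (snd C (cinv D y)))" using cinv_chart[OF A C] by simp
 qed simp
qed

lemma smooth_fun_chart: "C\<in>A ==> smooth_fun A (fst C) (snd C)"
proof (rule smooth_fun_chartI)
 assume C: "C\<in>A"
 show "smooth_on (snd C ` fst C) (%y. snd C (cinv C y))"
  using smooth_on_cong[OF open_chart[OF A C],of "%y. snd C (cinv C y)" "%y. y"]
   smooth_on_bounded_linear[OF bounded_linear_ident] chart_mult_left(2)[OF A C] by simp
qed (use openin_chart[OF A] in auto)

lemma smooth_fun_coord_vec:
 assumes "smooth_fun A W f" "C\<in>A" "open_in A W"
 shows "smooth_fun A (W\<inter>fst C) (%p. coord_vec C k p f)"
proof (rule smooth_fun_chartI[OF assms(2)])
 show "open_in A (W\<inter>fst C)"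
  using assms openin_chart[OF A] by (intro openin_Int) auto
 show "smooth_on (snd C ` (W\<inter>fst C)) (%y. coord_vec C k (cinv C y) f)"
  using smooth_on_coord_vec[OF A assms] by (simp add: Int_commute)
qed simp

lemma holomorphic_fun_smooth:
 fixes f :: "'m => complex^'k::finite"
 assumes "open_in A W" "holomorphic_fun A W f"
 shows "smooth_fun A W f"
 using assms hol_on_smooth[OF open_chart_image[OF A _ assms(1)]]
 unfolding smooth_fun_iff holomorphic_fun_iff by blast

lemma coord_vec_change1:
 assumes C: "C\<in>A" "p\<in>fst C" and D: "D\<in>A" "p\<in>fst D"
 shows "dz D p f = dz D p (%q. snd C q $ 1) * dz C p f"
  "dbar D p f = cnj (dz D p (%q. snd C q $ 1)) * dbar C p f"
  "dz D p (%q. snd C q $ 1) ~= 0"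
proof -
 show eq: "dz D p f = dz D p (%q. snd C q $ 1) * dz C p f" for f
  using coord_vec_change(1)[OF A assms,of 1 f] by simp
 show "dbar D p f = cnj (dz D p (%q. snd C q $ 1)) * dbar C p f"
  using coord_vec_change(2)[OF A assms,of 1 f] by simp
 have "dz D p (%q. snd D q $ 1) = 1" using coord_vec_coordinate(1)[OF A D] by simp
 with eq[of "%q. snd D q $ 1"] show "dz D p (%q. snd C q $ 1) ~= 0" by auto
qed

end

section \<open>Fibres of vector bundles\<close>

text \<open>Differentiability at a point in every chart, so that every tangent vector at the point is a derivation on such
 functions.\<close>

definition tdiff :: "('m,'n::finite) atlas => 'm => ('m => complex) => bool" where
 "tdiff A p f\<longleftrightarrow>(\<forall>C\<in>A. p\<in>fst C --> cdiff C p f)"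

lemma tdiff_add: "tdiff A p f ==> tdiff A p g ==> tdiff A p (%q. f q+g q)"
 by (simp add: tdiff_def cdiff_add)

lemma tdiff_mult: "tdiff A p f ==> tdiff A p g ==> tdiff A p (%q. f q * g q)"
 by (simp add: tdiff_def cdiff_mult)

lemma tdiff_const: "tdiff A p (%q. a)"
 by (simp add: tdiff_def cdiff_const)

lemma smooth_fun_tdiff: "complex_atlas A ==> smooth_fun A W f ==> p\<in>W ==> tdiff A p f"
 unfolding tdiff_def by (intro ballI impI,rule smooth_fun_cdiff)

lemma holomorphic_fun_tdiff:
 "complex_atlas A ==> holomorphic_fun A W f ==> p\<in>W ==> tdiff A p (%q. f q $ i)"
 unfolding tdiff_def by (intro ballI impI,rule holomorphic_fun_comp(1))

lemma tangent_space_chart: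
 assumes "v\<in>tangent_space A p"
 obtains C a where "C\<in>A" "p\<in>fst C" "v = (%f. \<Sum>k\<in>UNIV. a k * coord_vec C k p f)"
 using assms unfolding tangent_space_def by blast

lemma tangent_plus:
 assumes "v\<in>tangent_space A p" "tdiff A p f" "tdiff A p g"
 shows "v (%q. f q+g q) = v f+v g"
proof -
 obtain C a where "C\<in>A" "p\<in>fst C" "v = (%f. \<Sum>k\<in>UNIV. a k * coord_vec C k p f)"
  using assms(1) by (rule tangent_space_chart)
 with assms(2,3) show ?thesis
  by (simp add: tdiff_def coord_vec_add sum.distrib distrib_left)
qed

lemma tangent_times:
 assumes "complex_atlas A" "v\<in>tangent_space A p" "tdiff A p f" "tdiff A p g"
 shows "v (%q. f q * g q) = v f * g p+f p * v g"
proof -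
 obtain C a where "C\<in>A" "p\<in>fst C" "v = (%f. \<Sum>k\<in>UNIV. a k * coord_vec C k p f)"
  using assms(2) by (rule tangent_space_chart)
 with assms(3,4) show ?thesis
  by (simp add: tdiff_def coord_vec_mult'[OF assms(1)] sum.distrib distrib_left sum_distrib_left sum_distrib_right mult_ac)
qed

lemma tangent_sum:
 assumes "v\<in>tangent_space A p" "!!i. i\<in>I ==> tdiff A p (f i)"
 shows "v (%q. \<Sum>i\<in>I. f i q) = (\<Sum>i\<in>I. v (f i))\<and>tdiff A p (%q. \<Sum>i\<in>I. f i q)"
 using assms(2)
proof (induction I rule: infinite_finite_induct)
 case (insert i I)
 then show ?case using tangent_plus[OF assms(1),of "f i" "%q. \<Sum>i\<in>I. f i q"] tdiff_add[of A p "f i"] by simp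
qed (use assms(1) in \<open>auto simp: tdiff_const tangent_space_def\<close>)

lemma vec_mult_sum: "(g *v x) $ i = (\<Sum>j\<in>UNIV. g $ i $ j * x $ j)"
 by (simp add: matrix_vector_mult_def)

lemma bundle_bij:
 "bundle_with P A E ==> (W,T)\<in>triv E ==> x\<in>W ==> bij_betw T {e. proj E e = x} UNIV"
 unfolding bundle_with_def by blast

lemma bundle_openin: "bundle_with P A E ==> (W,T)\<in>triv E ==> open_in A W"
 unfolding bundle_with_def by blast

lemma bundle_cover:
 assumes "bundle_with P A E" "x\<in>points A"
 obtains W T where "(W,T)\<in>triv E" "x\<in>W"
proof -
 have "x\<in>(\<Union>(W,T)\<in>triv E. W)" using assms unfolding bundle_with_def by simp
 then show ?thesis using that by auto
qed

lemma bundle_transition: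
 assumes "bundle_with P A E" "(W,T)\<in>triv E" "(W',T')\<in>triv E"
 obtains g where "P (W\<inter>W') g" "!!e. proj E e\<in>W\<inter>W' ==> T' e = g (proj E e) *v T e"
proof -
 have "\<forall>t\<in>triv E. \<forall>t'\<in>triv E. \<exists>g. P (fst t\<inter>fst t') g \<and>
    (\<forall>e. proj E e\<in>fst t\<inter>fst t' --> snd t' e = g (proj E e) *v snd t e)"
  using assms(1) unfolding bundle_with_def case_prod_unfold by (elim conjE)
 from bspec[OF bspec[OF this assms(2)] assms(3)] show ?thesis using that by auto
qed

text \<open>The vector in the fibre over \<open>x\<close> with coordinates \<open>y\<close> in the trivialisation \<open>T\<close>.\<close>

definition frame :: "('m,'e,'r::finite) vbundle => ('e => complex^'r) => 'm => complex^'r => 'e" where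
 "frame E T x y = the_inv_into {e. proj E e = x} T y"

lemma frame:
 assumes "bundle_with P A E" "(W,T)\<in>triv E" "x\<in>W"
 shows "proj E (frame E T x y) = x" "T (frame E T x y) = y"
  and "!!e. proj E e = x ==> frame E T x (T e) = e"
  and "!!e e'. proj E e = x ==> proj E e' = x ==> T e = T e' ==> e = e'"
proof -
 have b: "bij_betw T {e. proj E e = x} UNIV" by (rule bundle_bij[OF assms])
 then have inj: "inj_on T {e. proj E e = x}" and im: "y\<in>T ` {e. proj E e = x}" for y
  by (auto simp: bij_betw_def)
 show "proj E (frame E T x y) = x"
  using the_inv_into_into[OF inj im[of y] subset_refl] by (simp add: frame_def)
 show "T (frame E T x y) = y"
  unfolding frame_def by (rule f_the_inv_into_f[OF inj im])
 show "frame E T x (T e) = e" if "proj E e = x" for e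
  unfolding frame_def by (rule the_inv_into_f_f[OF inj]) (simp add: that)
 show "e = e'" if "proj E e = x" "proj E e' = x" "T e = T e'" for e e'
  using inj that by (simp add: inj_on_def)
qed

lemma fibre_vec_eqI:
 assumes "bundle_with P A E" "(W,T)\<in>triv E" "x\<in>W" "proj E e = x"
  "!!W T. (W,T)\<in>triv E ==> x\<in>W ==> T e = F T"
 shows "fibre_vec E x F = e"
 unfolding fibre_vec_def
proof (rule the_equality)
 show "proj E e = x\<and>(\<forall>(W,T)\<in>triv E. x\<in>W --> T e = F T)" using assms(4,5) by auto
next
 fix e' assume e': "proj E e' = x\<and>(\<forall>(W,T)\<in>triv E. x\<in>W --> T e' = F T)"
 then have "T e' = F T" using assms(2,3) by auto
 then have "T e' = T e" using assms(5)[OF assms(2,3)] by simp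
 then show "e' = e" using frame(4)[OF assms(1-3)] e' assms(4) by blast
qed

text \<open>Coordinates prescribed in all trivialisations come from a vector as soon as they transform by the transition
 matrices.\<close>

lemma fibre_vec_consistent:
 assumes "bundle_with P A E" "(W,T)\<in>triv E" "x\<in>W"
  and F: "!!W' T' g. (W',T')\<in>triv E ==> x\<in>W' ==> P (W\<inter>W') g ==>
   (!!e. proj E e\<in>W\<inter>W' ==> T' e = g (proj E e) *v T e) ==> F T' = g x *v F T"
 shows "proj E (fibre_vec E x F) = x" "fibre_vec E x F = frame E T x (F T)"
  "!!W' T'. (W',T')\<in>triv E ==> x\<in>W' ==> T' (fibre_vec E x F) = F T'"
proof -
 let ?e = "frame E T x (F T)"
 have e: "proj E ?e = x" "T ?e = F T" using frame(1,2)[OF assms(1-3)] by auto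
 have *: "T' ?e = F T'" if T': "(W',T')\<in>triv E" "x\<in>W'" for W' T'
 proof -
  obtain g where g: "P (W\<inter>W') g" "!!e. proj E e\<in>W\<inter>W' ==> T' e = g (proj E e) *v T e"
   using bundle_transition[OF assms(1,2) T'(1)] by blast
  have "T' ?e = g x *v T ?e" using g(2)[of ?e] e assms(3) T'(2) by simp
  also have "... = F T'" using F[OF T' g] e by simp
  finally show ?thesis .
 qed
 have eq: "fibre_vec E x F = ?e" by (rule fibre_vec_eqI[OF assms(1-3) e(1)]) (rule *)
 then show "fibre_vec E x F = frame E T x (F T)" .
 show "proj E (fibre_vec E x F) = x" using eq e by simp
 show "!!W' T'. (W',T')\<in>triv E ==> x\<in>W' ==> T' (fibre_vec E x F) = F T'" using eq * by simp
qed

lemma fibre_vec_combination: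
 assumes "bundle_with P A E" "(W,T)\<in>triv E" "x\<in>W" "proj E u = x" "proj E v = x"
  and F: "!!T. F T = a *s T u+b *s T v"
 shows "proj E (fibre_vec E x F) = x" "fibre_vec E x F = frame E T x (F T)"
  "!!W' T'. (W',T')\<in>triv E ==> x\<in>W' ==> T' (fibre_vec E x F) = F T'"
proof -
 have *: "F T' = g x *v F T" if "x\<in>W'" "!!e. proj E e\<in>W\<inter>W' ==> T' e = g (proj E e) *v T e" for T' W' g
  using that(2)[of u] that(2)[of v] that(1) assms(3,4,5)
  by (simp add: F matrix_vector_right_distrib vector_scalar_commute)
 show "proj E (fibre_vec E x F) = x" "fibre_vec E x F = frame E T x (F T)"
  "!!W' T'. (W',T')\<in>triv E ==> x\<in>W' ==> T' (fibre_vec E x F) = F T'"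
  using fibre_vec_consistent[OF assms(1-3),of F] * by blast+
qed

text \<open>The transition matrices of a holomorphic bundle are annihilated by vectors of type (0,1), so differentiating
 the coordinates of a section is consistent.\<close>

lemma dolbeault_trivialisation:
 fixes A :: "('m,'n::finite) atlas"
 assumes A: "complex_atlas A" and H: "holomorphic_bundle A H" and V: "open_in A V" "p\<in>V"
  and s: "!!q. q\<in>V ==> proj H (s q) = q"
   "!!W T i. (W,T)\<in>triv H ==> p\<in>W ==> tdiff A p (%q. T (s q) $ i)"
  and v: "v\<in>tangent01 A p"
 shows "proj H (dolbeault H s p v) = p"
  "!!W T. (W,T)\<in>triv H ==> p\<in>W ==> T (dolbeault H s p v) = (\<chi> i. v (%q. T (s q) $ i))"
proof -
 have H': "bundle_with (%W g. \<forall>i. holomorphic_fun A W (%x. g x $ i)) A H"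
  using H by (simp add: holomorphic_bundle_def)
 obtain W T where W: "(W,T)\<in>triv H" "p\<in>W"
  using bundle_cover[OF H'] V openin_subset_points[OF A V(1)] by blast
 have v': "v\<in>tangent_space A p" by (rule tangent01_subset[OF A v])
 have cons: "(\<chi> i. v (%q. T' (s q) $ i)) = g p *v (\<chi> i. v (%q. T (s q) $ i))"
  if W': "(W',T')\<in>triv H" "p\<in>W'" and g: "\<forall>i. holomorphic_fun A (W\<inter>W') (%x. g x $ i)"
   "!!e. proj H e\<in>W\<inter>W' ==> T' e = g (proj H e) *v T e" for W' T' g
 proof -
  have o: "open_in A (V\<inter>(W\<inter>W'))"
   using V(1) bundle_openin[OF H' W(1)] bundle_openin[OF H' W'(1)] by blast
  have "v (%q. T' (s q) $ i) = (\<Sum>j\<in>UNIV. g p $ i $ j * v (%q. T (s q) $ j))" for i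
  proof -
   have gd: "tdiff A p (%q. g q $ i $ j)" "v (%q. g q $ i $ j) = 0" for j
    using holomorphic_fun_tdiff[OF A g(1)[rule_format]] tangent01_holomorphic[OF A v g(1)[rule_format]] W(2) W'(2)
    by auto
   have td: "tdiff A p (%q. g q $ i $ j * T (s q) $ j)" for j
    by (intro tdiff_mult gd s(2)[OF W])
   have "v (%q. T' (s q) $ i) = v (%q. \<Sum>j\<in>UNIV. g q $ i $ j * T (s q) $ j)"
    by (rule tangent_cong[OF A v' o]) (use V W W' g(2) s(1) in \<open>auto simp: vec_mult_sum\<close>)
   also have "... = (\<Sum>j\<in>UNIV. v (%q. g q $ i $ j * T (s q) $ j))"
    using tangent_sum[OF v',of UNIV "%j q. g q $ i $ j * T (s q) $ j"] td by blast
   also have "... = (\<Sum>j\<in>UNIV. g p $ i $ j * v (%q. T (s q) $ j))"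
    using tangent_times[OF A v' gd(1) s(2)[OF W]] gd(2) by simp
   finally show ?thesis .
  qed
  then show ?thesis by (simp add: vec_eq_iff vec_mult_sum)
 qed
 show "proj H (dolbeault H s p v) = p" unfolding dolbeault_def
  by (rule fibre_vec_consistent(1)[OF H' W]) (rule cons)
 show "T (dolbeault H s p v) = (\<chi> i. v (%q. T (s q) $ i))" if that: "(W',T)\<in>triv H" "p\<in>W'" for W' T
  unfolding dolbeault_def by (rule fibre_vec_consistent(3)[OF H' W _ that]) (rule cons)
qed

lemma smooth_section_subset:
 assumes "complex_atlas A" "smooth_section A E V s" "V'\<subseteq>V"
 shows "smooth_section A E V' s"
 unfolding smooth_section_def
proof (intro conjI ballI,goal_cases)
 case (1 x)
 have "\<forall>x\<in>V. proj E (s x) = x" using assms(2) unfolding smooth_section_def by (rule conjunct1)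
 then show ?case using 1 assms(3) by blast
next
 case (2 t)
 have "\<forall>t\<in>triv E. smooth_fun A (V\<inter>fst t) (%x. snd t (s x))"
  using assms(2) unfolding smooth_section_def case_prod_unfold by (rule conjunct2)
 then have "smooth_fun A (V\<inter>fst t) (%x. snd t (s x))" using 2 by (rule bspec)
 then have "smooth_fun A (V'\<inter>fst t) (%x. snd t (s x))"
  by (rule smooth_fun_subset[OF assms(1)]) (use assms(3) in blast)
 then show ?case by (simp add: case_prod_unfold)
qed


section \<open>Hermitian line bundles on a Riemann surface\<close>

lemma vec1_eq_iff: "x = y\<longleftrightarrow>x $ 1 = y $ 1" for x y :: "'a^1"
 by (simp add: vec_eq_iff forall_1)

lemma sum_UNIV_Plus1: "(\<Sum>k\<in>(UNIV :: (1+1) set). f k) = f (Inl 1)+f (Inr 1)"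
 by (simp add: sum_UNIV_Plus)

lemma cdiff_exp: "cdiff C p f ==> cdiff C p (%q. exp (f q))"
 and coord_vec_exp: "cdiff C p f ==> coord_vec C k p (%q. exp (f q)) = exp (f (cinv C (snd C p))) * coord_vec C k p f"
proof -
 let ?f = "%y. f (cinv C y)"
 assume "cdiff C p f"
 then have "(?f has_derivative (%v. \<Sum>k\<in>UNIV. wirtinger k ?f (snd C p) * dual_coord k v)) (at (snd C p))"
  unfolding cdiff_def by (rule wirtinger_has_derivative)
 from has_derivative_compose[OF this DERIV_exp[unfolded has_field_derivative_def]]
 have *: "((%y. exp (?f y)) has_derivative (%v. \<Sum>k\<in>UNIV. (exp (?f (snd C p)) * wirtinger k ?f (snd C p)) * dual_coord k v)) (at (snd C p))"
  by (simp add: sum_distrib_left mult.assoc)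
 then show "cdiff C p (%q. exp (f q))" unfolding cdiff_def by (rule differentiableI)
 show "coord_vec C k p (%q. exp (f q)) = exp (f (cinv C (snd C p))) * coord_vec C k p f"
  unfolding coord_vec_eq by (rule wirtinger_eq_coeff[OF *])
qed

text \<open>The coefficient of the form obtained by applying \<open>\<partial>\<close> and then its conjugate to
 \<open>u\<close>.\<close>

definition lap :: "('m,1) chart => ('m => complex) => 'm => complex" where
 "lap C u p = dbar C p (%q. dz C q u)"

definition base_chart :: "('m,'n::finite) atlas => 'm => ('m,'n) chart" where
 "base_chart A p = (SOME C. C\<in>A\<and>p\<in>fst C)"

lemma base_chart: "p\<in>points A ==> base_chart A p\<in>A\<and>p\<in>fst (base_chart A p)"
 unfolding base_chart_def points_iff by (rule someI_ex) blast

text \<open>The (1,0)-part of the differential of a function.\<close>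

definition del :: "('m,1) atlas => ('m => complex) => 'm => 'm tangent => complex" where
 "del A u p v = v (%q. snd (base_chart A p) q $ 1) * dz (base_chart A p) p u"

context
 fixes A :: "('m,1) atlas"
 assumes A: "complex_atlas A"
begin

lemma coord_vec_transition_holomorphic:
 assumes C: "C\<in>A" "p\<in>fst C" and D: "D\<in>A" "p\<in>fst D"
 shows "dbar D p (%q. snd C q $ 1) = 0"
  "dbar D p (%q. dz D q (%q. snd C q $ 1)) = 0"
  "cdiff D p (%q. dz D q (%q. snd C q $ 1))"
proof -
 have o: "open_in A (fst C)" by (rule openin_chart[OF A C(1)])
 have sm: "smooth_fun A (fst C) (%q. snd C q $ 1)"
  by (rule smooth_fun_coordinate[OF A C(1) smooth_fun_chart[OF A C(1)]])
 have 0: "dbar D q (%q. snd C q $ 1) = 0" if "q\<in>fst C" "q\<in>fst D" for q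
  using coord_vec_change1(2)[OF A C(1) that(1) D(1) that(2),of "%q. snd C q $ 1"]
   coord_vec_coordinate(2)[OF A C(1) that(1)] by simp
 show "dbar D p (%q. snd C q $ 1) = 0" using 0 C D by blast
 have "dbar D p (%q. dz D q (%q. snd C q $ 1)) =
   dz D p (%q. dbar D q (%q. snd C q $ 1))"
  by (rule coord_vec_commute[OF A sm D(1) o C(2) D(2)])
 also have "... = dz D p (%q. 0)"
  by (rule coord_vec_cong(1)[OF A D openin_Int[OF o openin_chart[OF A D(1)]]]) (use C D 0 in auto)
 finally show "dbar D p (%q. dz D q (%q. snd C q $ 1)) = 0" by simp
 show "cdiff D p (%q. dz D q (%q. snd C q $ 1))"
  by (rule cdiff_coord_vec[OF A sm D(1) o C(2) D(2)])
qed

text \<open>The factor is the square modulus of the derivative of the coordinate change; no first order term appears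
 because that derivative is holomorphic.\<close>

lemma lap_change:
 assumes C: "C\<in>A" "p\<in>fst C" and D: "D\<in>A" "p\<in>fst D"
  and u: "smooth_fun A W u" "open_in A W" "p\<in>W"
 shows "lap D u p = (let w = dz D p (%q. snd C q $ 1) in w * cnj w * lap C u p)"
proof -
 define w where "w = (%q. dz D q (%q. snd C q $ 1))"
 have o: "open_in A (fst C\<inter>fst D)" using C D openin_chart[OF A] by blast
 have cd: "cdiff C p (%q. dz C q u)" by (rule cdiff_coord_vec[OF A u(1) C(1) u(2,3) C(2)])
 have "tdiff A p (%q. dz C q u)"
  by (rule smooth_fun_tdiff[OF A smooth_fun_coord_vec[OF A u(1) C(1) u(2)]]) (use u C in simp)
 then have cd': "cdiff D p (%q. dz C q u)" using D by (simp add: tdiff_def)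
 have "lap D u p = dbar D p (%q. w q * dz C q u)"
  unfolding lap_def
 proof (rule coord_vec_cong(1)[OF A D o])
  show "dz D q u = w q * dz C q u" if "q\<in>fst C\<inter>fst D" for q
   unfolding w_def by (rule coord_vec_change1(1)[OF A C(1) _ D(1)]) (use that in auto)
 qed (use C D in auto)
 also have "... = w p * dbar D p (%q. dz C q u)"
  using coord_vec_mult'[OF A D coord_vec_transition_holomorphic(3)[OF C D] cd',of "Inr 1"]
   coord_vec_transition_holomorphic(2)[OF C D] by (simp add: w_def)
 also have "dbar D p (%q. dz C q u) = cnj (w p) * lap C u p"
  unfolding lap_def w_def by (rule coord_vec_change1(2)[OF A C D])
 finally show ?thesis by (simp add: w_def Let_def)
qed

lemma tangent_space1:
 assumes "v\<in>tangent_space A p"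
 obtains C a b where "C\<in>A" "p\<in>fst C" "v = (%f. a * dz C p f+b * dbar C p f)"
  "conj_vec v = (%f. cnj b * dz C p f+cnj a * dbar C p f)"
  "\<forall>u. del A u p v = a * dz C p u"
  "\<forall>u. del A u p (conj_vec v) = cnj b * dz C p u"
proof -
 obtain C a where C: "C\<in>A" "p\<in>fst C" "v = (%f. \<Sum>k\<in>UNIV. a k * coord_vec C k p f)"
  using assms by (rule tangent_space_chart)
 have B: "base_chart A p\<in>A" "p\<in>fst (base_chart A p)"
  using base_chart[of p A] C(1,2) unfolding points_iff by auto
 have v: "v = (%f. a (Inl 1) * dz C p f+a (Inr 1) * dbar C p f)"
  by (simp add: C(3) sum_UNIV_Plus1)
 have cv: "conj_vec v = (%f. cnj (a (Inr 1)) * dz C p f+cnj (a (Inl 1)) * dbar C p f)"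
  by (simp add: v conj_vec_def coord_vec_cnj fun_eq_iff add.commute)
 have *: "(x * dz C p (%q. snd (base_chart A p) q $ 1)+y * dbar C p (%q. snd (base_chart A p) q $ 1))
   * dz (base_chart A p) p u = x * dz C p u" for x y u
  using coord_vec_transition_holomorphic(1)[OF B C(1,2)] coord_vec_change1(1)[OF A B C(1,2),of u] by simp
 show ?thesis
  by (rule that[OF C(1,2) v cv]) (simp_all add: del_def cv,simp_all add: v *)
qed

lemma del_coord:
 assumes "C\<in>A" "p\<in>fst C"
 shows "del A u p (dz C p) = dz C p u" "del A u p (dbar C p) = 0"
proof -
 have B: "base_chart A p\<in>A" "p\<in>fst (base_chart A p)"
  using base_chart[of p A] assms unfolding points_iff by auto
 show "del A u p (dz C p) = dz C p u" "del A u p (dbar C p) = 0"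
  using coord_vec_transition_holomorphic(1)[OF B assms] coord_vec_change1(1)[OF A B assms,of u]
  by (simp_all add: del_def)
qed

end

lemma connectionD:
 assumes "connection A E D" "open_in A W" "smooth_section A E W s"
 shows "!!p v. p\<in>W ==> v\<in>tangent_space A p ==> proj E (D s p v) = p"
  "!!C k. C\<in>A ==> smooth_section A E (W\<inter>fst C) (%p. D s p (coord_vec C k p))"
  "!!V t p v. open_in A V ==> V\<subseteq>W ==> (!!q. q\<in>V ==> t q = s q) ==>
   p\<in>V ==> v\<in>tangent_space A p ==> D t p v = D s p v"
proof -
 note * = assms(1)[unfolded connection_def,THEN spec,THEN spec,THEN mp,OF conjI[OF assms(2,3)]]
 note 1 = *[THEN conjunct1] and 2 = *[THEN conjunct2,THEN conjunct2,THEN conjunct1]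
  and 3 = *[THEN conjunct2,THEN conjunct2,THEN conjunct2,THEN conjunct1]
 show "proj E (D s p v) = p" if "p\<in>W" "v\<in>tangent_space A p" for p v
  by (rule bspec[OF bspec[OF 1 that(1)] that(2)])
 show "smooth_section A E (W\<inter>fst C) (%p. D s p (coord_vec C k p))" if "C\<in>A" for C k
  by (rule spec[OF bspec[OF 2 that]])
 show "D t p v = D s p v" if "open_in A V" "V\<subseteq>W" "!!q. q\<in>V ==> t q = s q"
   "p\<in>V" "v\<in>tangent_space A p" for V t p v
  by (rule bspec[OF bspec[OF mp[OF spec[OF spec[OF 3,of V],of t]] that(4)] that(5)]) (use that in auto)
qed

lemma compatibleD:
 assumes "compatible A E h D" "open_in A W" "smooth_section A E W s" "smooth_section A E W t"
  "p\<in>W" "v\<in>tangent_space A p"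
 shows "v (%q. h (s q) (t q)) = h (D s p v) (t p)+h (s p) (D t p (conj_vec v))"
 by (rule assms(1)[unfolded compatible_def,THEN spec,THEN spec,THEN spec,THEN mp,THEN bspec,THEN bspec])
  (use assms in auto)

lemma chern_connectionD:
 assumes "chern_connection A E H h D"
 shows "connection A E D" "compatible A E h D"
  "!!W s p v. open_in A W ==> smooth_section A E W s ==> p\<in>W ==> v\<in>tangent01 A p ==>
   D s p v = dolbeault H s p v"
proof -
 note * = assms[unfolded chern_connection_def]
 show "connection A E D" by (rule *[THEN conjunct1])
 show "compatible A E h D" by (rule *[THEN conjunct2,THEN conjunct1])
 show "D s p v = dolbeault H s p v" if "open_in A W" "smooth_section A E W s" "p\<in>W"
  "v\<in>tangent01 A p" for W s p v
  by (rule *[THEN conjunct2,THEN conjunct2,THEN spec,THEN spec,THEN mp,THEN bspec,THEN bspec,of W])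
   (use that in auto)
qed

text \<open>The logarithm of the square length of the frame vector of the trivialisation \<open>T\<close>, the local
 weight of the metric.\<close>

definition log_metric :: "('m,'e,1) vbundle => ('e => 'e => complex) => ('e => complex^1) => 'm => complex" where
 "log_metric L h T x = of_real (ln (Re (h (frame L T x 1) (frame L T x 1))))"

definition base_triv :: "('m,'e,'r::finite) vbundle => 'm => ('e => complex^'r)" where
 "base_triv E x = snd (SOME t. t\<in>triv E\<and>x\<in>fst t)"

text \<open>The Chern connection: \<open>d + \<partial> log h\<close> in every holomorphic trivialisation.\<close>

definition line_connection :: "('m,1) atlas => ('m,'e,1) vbundle => ('e => 'e => complex) => ('m,'e) derivation_op" where
 "line_connection A L h s p v = fibre_vec L p (%T. \<chi> i.
   v (%q. T (s q) $ 1)+del A (log_metric L h T) p v * T (s p) $ 1)"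

text \<open>Minus the form with coefficient \<open>lap\<close> of the local weight, written in chosen charts and
 trivialisations; by \<open>lap_change\<close> and \<open>log_metric_transition\<close> the choice is
 immaterial.\<close>

definition line_curvature :: "('m,1) atlas => ('m,'e,1) vbundle => ('e => 'e => complex) => 'm form2" where
 "line_curvature A L h p v w = (let B = base_chart A p; z = (%q. snd B q $ 1); z' = (%q. cnj (snd B q $ 1)) in
   - (v z * w z' - w z * v z') * lap B (log_metric L h (base_triv L p)) p)"

lemma cnj_log_metric: "cnj (log_metric L h T x) = log_metric L h T x"
 by (simp add: log_metric_def)

context
 fixes A :: "('m,1) atlas" and L :: "('m,'e,1) vbundle"
 assumes A: "complex_atlas A" and L: "holomorphic_bundle A L"
begin

lemma line_bundle_with: "bundle_with (%W g. \<forall>i. holomorphic_fun A W (%x. g x $ i)) A L"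
 using L by (simp add: holomorphic_bundle_def)

lemmas line_frame = frame[OF line_bundle_with]
lemmas line_openin = bundle_openin[OF line_bundle_with]

lemma base_triv:
 assumes "p\<in>points A"
 obtains W where "(W,base_triv L p)\<in>triv L" "p\<in>W"
proof -
 obtain W T where "(W,T)\<in>triv L" "p\<in>W" using bundle_cover[OF line_bundle_with assms] .
 then have "\<exists>t. t\<in>triv L\<and>p\<in>fst t" by (intro exI[of _ "(W,T)"]) simp
 from someI_ex[OF this] show ?thesis
  by (intro that[of "fst (SOME t. t\<in>triv L\<and>p\<in>fst t)"]) (simp_all add: base_triv_def)
qed

lemma line_transition:
 assumes W: "(W,T)\<in>triv L" "(W',T')\<in>triv L"
 obtains g where "smooth_fun A (W\<inter>W') g" "!!x. x\<in>W ==> x\<in>W' ==> g x ~= 0"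
  "!!C p. C\<in>A ==> p\<in>fst C ==> p\<in>W ==> p\<in>W' ==> dbar C p g = 0"
  "!!l. proj L l\<in>W ==> proj L l\<in>W' ==> T' l $ 1 = g (proj L l) * T l $ 1"
proof -
 obtain G where G: "\<forall>i. holomorphic_fun A (W\<inter>W') (%x. G x $ i)"
  "!!e. proj L e\<in>W\<inter>W' ==> T' e = G (proj L e) *v T e"
  using bundle_transition[OF line_bundle_with W] by blast
 define g where "g = (%x. G x $ 1 $ 1)"
 have o: "open_in A (W\<inter>W')" using line_openin[OF W(1)] line_openin[OF W(2)] by (rule openin_Int)
 have 1: "smooth_fun A (W\<inter>W') (%x. G x $ 1)"
  by (rule holomorphic_fun_smooth[OF A o G(1)[rule_format]])
 have eq: "T' l $ 1 = g (proj L l) * T l $ 1" if "proj L l\<in>W" "proj L l\<in>W'" for l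
  using G(2)[of l] that by (simp add: vec_mult_sum g_def)
 show ?thesis
 proof (rule that[OF _ _ _ eq])
  show "smooth_fun A (W\<inter>W') g" unfolding g_def using 1 by (simp add: smooth_fun_vec[OF A o])
  show "g x ~= 0" if "x\<in>W" "x\<in>W'" for x
   using eq[of "frame L T' x 1"] that line_frame(1,2)[OF W(2),of x 1] by auto
  show "dbar C p g = 0" if "C\<in>A" "p\<in>fst C" "p\<in>W" "p\<in>W'" for C p
   unfolding g_def by (rule holomorphic_fun_comp(2)[OF A G(1)[rule_format] that(1,2)]) (use that in simp)
 qed
qed

lemma smooth_section_lineI:
 assumes "open_in A V" "!!x. x\<in>V ==> proj L (s x) = x"
  "!!W T. (W,T)\<in>triv L ==> smooth_fun A (V\<inter>W) (%x. T (s x) $ 1)"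
 shows "smooth_section A L V s"
 unfolding smooth_section_def
proof (intro conjI ballI)
 show "proj L (s x) = x" if "x\<in>V" for x by (rule assms(2)[OF that])
 fix t assume t: "t\<in>triv L"
 then have t': "(fst t,snd t)\<in>triv L" by simp
 have "open_in A (V\<inter>fst t)" using assms(1) line_openin[OF t'] by (rule openin_Int)
 then have "smooth_fun A (V\<inter>fst t) (%x. snd t (s x))"
  using assms(3)[OF t'] by (simp add: smooth_fun_vec[OF A] forall_1)
 then show "case t of (W',T) => smooth_fun A (V\<inter>W') (%x. T (s x))" by (simp add: case_prod_unfold)
qed

lemma smooth_section_line:
 assumes "smooth_section A L V s" "open_in A V" "(W,T)\<in>triv L"
 shows "smooth_fun A (V\<inter>W) (%q. T (s q) $ 1)" "!!x. x\<in>V ==> proj L (s x) = x"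
  "!!p. p\<in>V ==> p\<in>W ==> tdiff A p (%q. T (s q) $ 1)"
proof -
 have "\<forall>x\<in>V. proj L (s x) = x" using assms(1) unfolding smooth_section_def by (rule conjunct1)
 then show *: "!!x. x\<in>V ==> proj L (s x) = x" by blast
 have "\<forall>t\<in>triv L. smooth_fun A (V\<inter>fst t) (%x. snd t (s x))"
  using assms(1) unfolding smooth_section_def case_prod_unfold by (rule conjunct2)
 from bspec[OF this assms(3)] have "smooth_fun A (V\<inter>W) (%q. T (s q))" by simp
 moreover have "open_in A (V\<inter>W)" using assms(2) line_openin[OF assms(3)] by (rule openin_Int)
 ultimately show 1: "smooth_fun A (V\<inter>W) (%q. T (s q) $ 1)" by (simp add: smooth_fun_vec[OF A])
 show "tdiff A p (%q. T (s q) $ 1)" if "p\<in>V" "p\<in>W" for p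
  by (rule smooth_fun_tdiff[OF A 1]) (use that in simp)
qed

lemma smooth_section_frame:
 assumes W: "(W,T)\<in>triv L"
 shows "smooth_section A L W (%x. frame L T x 1)"
proof (rule smooth_section_lineI[OF line_openin[OF W] line_frame(1)[OF W]])
 fix W' T' assume W': "(W',T')\<in>triv L"
 obtain g where g: "smooth_fun A (W\<inter>W') g"
  "!!l. proj L l\<in>W ==> proj L l\<in>W' ==> T' l $ 1 = g (proj L l) * T l $ 1"
  using line_transition[OF W W'] by metis
 have o: "open_in A (W\<inter>W')" using line_openin[OF W] line_openin[OF W'] by (rule openin_Int)
 have "T' (frame L T x 1) $ 1 = g x" if "x\<in>W\<inter>W'" for x
  using g(2)[of "frame L T x 1"] line_frame(1,2)[OF W,of x 1] that by simp
 then show "smooth_fun A (W\<inter>W') (%x. T' (frame L T x 1) $ 1)"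
  using smooth_fun_cong[OF A o,of "%x. T' (frame L T x 1) $ 1" g] g(1) by simp
qed

lemma fibre_eq_line:
 assumes "(W,T)\<in>triv L" "x\<in>W" "proj L l = x" "proj L l' = x" "T l $ 1 = T l' $ 1"
 shows "l = l'"
 using line_frame(4)[OF assms(1-4)] assms(5) by (simp add: vec1_eq_iff)

lemma dolbeault_line:
 assumes W: "(W,T)\<in>triv L" and V: "open_in A V" "p\<in>V" "p\<in>W" and s: "smooth_section A L V s"
  and v: "v\<in>tangent01 A p"
 shows "proj L (dolbeault L s p v) = p" "T (dolbeault L s p v) $ 1 = v (%q. T (s q) $ 1)"
proof -
 have p: "proj L (s q) = q" if "q\<in>V" for q
  by (rule smooth_section_line(2)[OF s V(1) W that])
 have "\<forall>i. tdiff A p (%q. T' (s q) $ i)" if "(W',T')\<in>triv L" "p\<in>W'" for W' T'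
  unfolding forall_1 by (rule smooth_section_line(3)[OF s V(1) that(1) V(2) that(2)])
 then have td: "tdiff A p (%q. T' (s q) $ i)" if "(W',T')\<in>triv L" "p\<in>W'" for W' T' i
  using that by blast
 note * = dolbeault_trivialisation[OF A L V(1,2) p td v]
 show "proj L (dolbeault L s p v) = p" by (rule *(1))
 show "T (dolbeault L s p v) $ 1 = v (%q. T (s q) $ 1)" using *(2)[OF _ _ _ W V(3)] by simp
qed

context
 fixes h :: "'e => 'e => complex"
 assumes h: "hermitian_metric A L h"
begin

lemma metric_linear:
 assumes "x\<in>points A" "proj L u = x" "proj L v = x" "proj L w = x"
 shows "h w u = cnj (h u w)" "h (fibre_vec L x (%T. a *s T u+b *s T v)) w = a * h u w+b * h v w"
proof -
 have 1: "\<forall>x\<in>points A. \<forall>u v w. proj L u = x\<and>proj L v = x\<and>proj L w = x -->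
    h w u = cnj (h u w) \<and>
    (\<forall>a b. h (fibre_vec L x (%T. a *s T u+b *s T v)) w = a * h u w+b * h v w)"
  using h unfolding hermitian_metric_def hermitian_form_def by (elim conjE)
 have "h w u = cnj (h u w) \<and>
    (\<forall>a b. h (fibre_vec L x (%T. a *s T u+b *s T v)) w = a * h u w+b * h v w)"
  by (rule mp[OF spec[OF spec[OF spec[OF bspec[OF 1 assms(1)],of u],of v],of w]]) (simp add: assms)
 then show "h w u = cnj (h u w)" "h (fibre_vec L x (%T. a *s T u+b *s T v)) w = a * h u w+b * h v w"
  by simp_all
qed

lemma metric_local:
 assumes W: "(W,T)\<in>triv L" "x\<in>W" and l: "proj L l = x" "proj L l' = x"
 shows "h l l' = T l $ 1 * cnj (T l' $ 1) * exp (log_metric L h T x)"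
proof -
 let ?e = "frame L T x 1"
 have e: "proj L ?e = x" "T ?e $ 1 = 1" using line_frame(1,2)[OF W] by simp_all
 have x: "x\<in>points A" using openin_subset_points[OF A line_openin[OF W(1)]] W(2) by blast
 have lin: "h l w = T l $ 1 * h ?e w" if l: "proj L l = x" "proj L w = x" for l w
 proof -
  note fc = fibre_vec_combination[OF line_bundle_with W e(1) e(1),of "%U. (T l $ 1) *s U ?e+0 *s U ?e" "T l $ 1" 0]
  have "fibre_vec L x (%U. (T l $ 1) *s U ?e+0 *s U ?e) = l"
   by (rule fibre_eq_line[OF W fc(1)]) (use fc(3)[OF _ W] e l in simp_all)
  then show ?thesis using metric_linear(2)[OF x e(1) e(1) l(2),of "T l $ 1" 0] by simp
 qed
 have "h l l' = T l $ 1 * h ?e l'" by (rule lin[OF l])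
 also have "h ?e l' = cnj (h l' ?e)" by (rule metric_linear(1)[OF x l(2) l(2) e(1)])
 also have "h l' ?e = T l' $ 1 * h ?e ?e" by (rule lin[OF l(2) e(1)])
 finally have 1: "h l l' = T l $ 1 * cnj (T l' $ 1) * cnj (h ?e ?e)" by simp
 have cn: "cnj (h ?e ?e) = h ?e ?e" using metric_linear(1)[OF x e(1) e(1) e(1)] by simp
 have "\<forall>t\<in>triv L. \<forall>u. proj L u\<in>fst t\<and>snd t u ~= 0 --> 0 < Re (h u u)"
  using h unfolding hermitian_metric_def case_prod_unfold by (rule conjunct2)
 from bspec[OF this W(1)] have "proj L ?e\<in>W\<and>T ?e ~= 0 --> 0 < Re (h ?e ?e)" by simp
 then have pos: "0 < Re (h ?e ?e)" using e W(2) by (metis zero_index zero_neq_one)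
 have "h ?e ?e = of_real (Re (h ?e ?e))" using cn by (simp add: complex_eq_iff)
 also have "... = exp (log_metric L h T x)"
  using pos by (simp add: log_metric_def exp_of_real)
 finally show ?thesis using 1 cn by simp
qed

lemma metric_smooth_sections:
 assumes "open_in A V" "smooth_section A L V s" "smooth_section A L V t"
 shows "smooth_fun A V (%x. h (s x) (t x))"
proof -
 have "\<forall>V s t. open_in A V\<and>smooth_section A L V s\<and>smooth_section A L V t -->
    smooth_fun A V (%x. h (s x) (t x))"
  using h unfolding hermitian_metric_def hermitian_form_def by (elim conjE)
 then show ?thesis using assms by blast
qed

lemma log_metric_smooth:
 assumes W: "(W,T)\<in>triv L"
 shows "smooth_fun A W (log_metric L h T)"
proof -
 let ?e = "%x. frame L T x 1"
 have o: "open_in A W" by (rule line_openin[OF W])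
 have e: "h (?e x) (?e x) = exp (log_metric L h T x)" if "x\<in>W" for x
  using metric_local[OF W that line_frame(1)[OF W that] line_frame(1)[OF W that],of 1 1]
   line_frame(2)[OF W that,of 1] by simp
 have "smooth_fun A W (%x. h (?e x) (?e x))"
  by (rule metric_smooth_sections[OF o smooth_section_frame[OF W] smooth_section_frame[OF W]])
 then have "smooth_fun A W (%x. Re (h (?e x) (?e x)))" by (rule smooth_fun_linear[OF A bounded_linear_Re o])
 then have "smooth_fun A W (%x. ln (Re (h (?e x) (?e x))))"
 proof (rule smooth_fun_compose[OF A o _ smooth_on_ln])
  show "Re (h (?e q) (?e q))\<in>{0<..}" if "q\<in>W" for q
  proof -
   have "Re (h (?e q) (?e q)) = Re (exp (log_metric L h T q))" by (simp only: e[OF that])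
   also have "... = exp (ln (Re (h (?e q) (?e q))))"
    unfolding log_metric_def exp_of_real by (rule Re_complex_of_real)
   finally show ?thesis by (metis exp_gt_zero greaterThan_iff)
  qed
 qed simp
 then have "smooth_fun A W (%x. complex_of_real (ln (Re (h (?e x) (?e x)))))"
  by (rule smooth_fun_linear[OF A bounded_linear_of_real o])
 then show ?thesis unfolding log_metric_def .
qed

text \<open>The weights differ by \<open>log |g|\<^sup>2\<close> with \<open>g\<close> holomorphic: its (1,0)-derivative
 is \<open>\<partial>g / g\<close>, which the (0,1)-vector annihilates.\<close>

lemma log_metric_transition:
 assumes W: "(W,T)\<in>triv L" "(W',T')\<in>triv L" and p: "p\<in>W" "p\<in>W'"
  and g: "smooth_fun A (W\<inter>W') g" "!!x. x\<in>W ==> x\<in>W' ==> g x ~= 0"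
   "!!C p. C\<in>A ==> p\<in>fst C ==> p\<in>W ==> p\<in>W' ==> dbar C p g = 0"
   "!!l. proj L l\<in>W ==> proj L l\<in>W' ==> T' l $ 1 = g (proj L l) * T l $ 1"
  and C: "C\<in>A" "p\<in>fst C"
 shows "dz C p (log_metric L h T) =
   dz C p g/g p+dz C p (log_metric L h T')"
  "lap C (log_metric L h T) p = lap C (log_metric L h T') p"
proof -
 let ?N = "W\<inter>W'" and ?u = "log_metric L h T" and ?u' = "log_metric L h T'"
 have o: "open_in A ?N" using line_openin[OF W(1)] line_openin[OF W(2)] by (rule openin_Int)
 have smu: "smooth_fun A ?N ?u" "smooth_fun A ?N ?u'"
  by (rule smooth_fun_subset[OF A log_metric_smooth[OF W(1)]],simp)
   (rule smooth_fun_subset[OF A log_metric_smooth[OF W(2)]],simp)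
 have ex: "exp (?u x) = g x * (cnj (g x) * exp (?u' x))" if "x\<in>?N" for x
 proof -
  let ?e = "frame L T x 1"
  have e: "proj L ?e = x" "T ?e $ 1 = 1" using line_frame(1,2)[OF W(1)] that by simp_all
  have "T' ?e $ 1 = g x" using g(4)[of ?e] e that by simp
  then show ?thesis
   using metric_local[OF W(1) _ e(1) e(1)] metric_local[OF W(2) _ e(1) e(1)] e(2) that by (simp add: mult.assoc)
 qed
 have 1: "dz C x ?u = dz C x g/g x+dz C x ?u'"
  if x: "x\<in>?N" "x\<in>fst C" for x
 proof -
  have cd: "cdiff C x f" if "smooth_fun A ?N f" for f
   by (rule smooth_fun_cdiff[OF A that C(1) x(2,1)])
  have c: "cinv C (snd C x) = x" by (rule cinv_chart[OF A C(1) x(2)])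
  note cds = cd[OF smu(1)] cd[OF smu(2)] cd[OF g(1)]
  have gb: "dz C x (%q. cnj (g q)) = 0"
   using g(3)[OF C(1) x(2)] x(1) by (simp add: coord_vec_cnj)
  have "exp (?u x) * dz C x ?u = dz C x (%q. exp (?u q))"
   using coord_vec_exp[OF cds(1)] c by simp
  also have "... = dz C x (%q. g q * (cnj (g q) * exp (?u' q)))"
   by (rule coord_vec_cong(1)[OF A C(1) x(2) o x(1) ex])
  also have "... = dz C x g * (cnj (g x) * exp (?u' x))+g x * (cnj (g x) * (exp (?u' x) * dz C x ?u'))"
   by (simp add: coord_vec_mult'[OF A C(1) x(2)] cds cdiff_mult cdiff_cnj cdiff_exp gb coord_vec_exp c)
  also have "... = exp (?u x) * (dz C x g/g x+dz C x ?u')"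
   using g(2)[of x] x(1) by (simp add: ex[OF x(1)] field_simps)
  finally show ?thesis by simp
 qed
 show "dz C p ?u = dz C p g/g p+dz C p ?u'"
  using 1 p C by simp
 have pN: "p\<in>?N" using p by simp
 let ?dg = "%q. dz C q g"
 have cdg: "cdiff C p g" by (rule smooth_fun_cdiff[OF A g(1) C pN])
 have cddg: "cdiff C p ?dg" by (rule cdiff_coord_vec[OF A g(1) C(1) o pN C(2)])
 have cdd: "cdiff C p (%q. dz C q ?u')" by (rule cdiff_coord_vec[OF A smu(2) C(1) o pN C(2)])
 have gp: "g p ~= 0" "dbar C p g = 0" using g(2,3) p C by auto
 have cdi: "cdiff C p (%q. inverse (g q))"
  by (rule smooth_fun_cdiff[OF A smooth_fun_inverse[OF A o g(1)] C pN]) (use g(2) in auto)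
 have z: "dbar C p ?dg = 0"
 proof -
  have "dbar C p ?dg = dz C p (%q. dbar C q g)"
   by (rule coord_vec_commute[OF A g(1) C(1) o pN C(2)])
  also have "... = dz C p (%q. 0)"
   by (rule coord_vec_cong(1)[OF A C openin_Int[OF o openin_chart[OF A C(1)]]]) (use p C g(3) in auto)
  finally show ?thesis by simp
 qed
 have "lap C ?u p = dbar C p (%q. ?dg q * inverse (g q)+dz C q ?u')"
  unfolding lap_def
  by (rule coord_vec_cong(1)[OF A C openin_Int[OF o openin_chart[OF A C(1)]]])
   (use p C 1 in \<open>auto simp: divide_inverse\<close>)
 also have "... = lap C ?u' p"
  by (simp add: lap_def coord_vec_add coord_vec_mult'[OF A C] coord_vec_inverse[OF A C] cdiff_mult cddg cdi cdd cdg z gp)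
 finally show "lap C ?u p = lap C ?u' p" .
qed

text \<open>The (1,0)-part follows by differentiating the product of the section with the holomorphic frame, whose
 (0,1)-derivative vanishes.\<close>

lemma chern_local:
 assumes D: "chern_connection A L L h D" and V: "open_in A V" "smooth_section A L V s"
  and W: "(W,T)\<in>triv L" and C: "C\<in>A" and p: "p\<in>V" "p\<in>W" "p\<in>fst C"
 shows "proj L (D s p (coord_vec C k p)) = p"
  "T (D s p (dbar C p)) $ 1 = dbar C p (%q. T (s q) $ 1)"
  "T (D s p (dz C p)) $ 1 = dz C p (%q. T (s q) $ 1)
   +T (s p) $ 1 * dz C p (log_metric L h T)"
proof -
 note tv = coord_in_tangent_space[OF A C p(3)]
 note DD = chern_connectionD[OF D]
 note prj = connectionD(1)[OF DD(1)]
 show "proj L (D s p (coord_vec C k p)) = p" by (rule prj[OF V p(1) tv(1)])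
 have dol': "D s p (dbar C p) = dolbeault L s p (dbar C p)"
  if "open_in A V" "smooth_section A L V s" "p\<in>V" for V s
  by (rule DD(3)[OF that tv(3)])
 show "T (D s p (dbar C p)) $ 1 = dbar C p (%q. T (s q) $ 1)"
  unfolding dol'[OF V p(1)] by (rule dolbeault_line(2)[OF W V(1) p(1,2) V(2) tv(3)])
 let ?N = "V\<inter>W" and ?e = "%x. frame L T x 1" and ?f = "%q. T (s q) $ 1" and ?u = "log_metric L h T"
 have oN: "open_in A ?N" using V(1) line_openin[OF W] by (rule openin_Int)
 have sN: "smooth_section A L ?N s" "smooth_section A L ?N ?e"
  by (rule smooth_section_subset[OF A V(2)],simp) (rule smooth_section_subset[OF A smooth_section_frame[OF W]],simp)
 have pN: "p\<in>?N" using p by simp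
 have De: "T (D ?e p (dbar C p)) $ 1 = 0"
 proof -
  have "T (D ?e p (dbar C p)) $ 1 = dbar C p (%q. T (?e q) $ 1)"
   unfolding dol'[OF oN sN(2) pN] by (rule dolbeault_line(2)[OF W oN pN p(2) sN(2) tv(3)])
  also have "... = dbar C p (%q. 1)"
   by (rule coord_vec_cong(1)[OF A C p(3) oN pN]) (use line_frame(2)[OF W] in auto)
  finally show ?thesis by simp
 qed
 have hs: "h (s q) (?e q) = ?f q * exp (?u q)" if "q\<in>?N" for q
  using metric_local[OF W,of q "s q" "?e q"] that smooth_section_line(2)[OF V(2,1) W] line_frame(1,2)[OF W,of q 1]
  by simp
 have prs: "proj L (s p) = p" "proj L (?e p) = p" "T (?e p) $ 1 = 1"
  using smooth_section_line(2)[OF V(2,1) W p(1)] line_frame(1,2)[OF W p(2),of 1] by auto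
 have cds: "cdiff C p ?f" "cdiff C p ?u"
  using smooth_fun_cdiff[OF A smooth_section_line(1)[OF V(2,1) W] C p(3) pN]
   smooth_fun_cdiff[OF A log_metric_smooth[OF W] C p(3,2)] by auto
 have "dz C p (%q. h (s q) (?e q)) =
   h (D s p (dz C p)) (?e p)+h (s p) (D ?e p (conj_vec (dz C p)))"
  by (rule compatibleD[OF DD(2) oN sN pN tv(1)])
 also have "h (s p) (D ?e p (conj_vec (dz C p))) = 0"
  using metric_local[OF W p(2) prs(1) prj[OF oN sN(2) pN tv(1)],of "Inr 1"] De by (simp add: bar_conj_vec)
 also have "h (D s p (dz C p)) (?e p) = T (D s p (dz C p)) $ 1 * exp (?u p)"
  using metric_local[OF W p(2) prj[OF oN sN(1) pN tv(1)] prs(2),of "Inl 1"] prs(3) by simp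
 also have "dz C p (%q. h (s q) (?e q)) = dz C p (%q. ?f q * exp (?u q))"
  by (rule coord_vec_cong(1)[OF A C p(3) oN pN hs])
 also have "... = (dz C p ?f+?f p * dz C p ?u) * exp (?u p)"
  by (simp add: coord_vec_mult'[OF A C p(3)] cds cdiff_exp coord_vec_exp cinv_chart[OF A C p(3)] algebra_simps)
 finally show "T (D s p (dz C p)) $ 1 = dz C p ?f+?f p * dz C p ?u"
  by simp
qed

lemma chern_curvature:
 assumes D: "chern_connection A L L h D" and V: "open_in A V" "smooth_section A L V s"
  and W: "(W,T)\<in>triv L" and C: "C\<in>A" and p: "p\<in>V" "p\<in>W" "p\<in>fst C"
 shows "proj L (curvature L D C k l s p) = p"
  "T (curvature L D C (Inl 1) (Inr 1) s p) $ 1 = - lap C (log_metric L h T) p * T (s p) $ 1"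
  "T (curvature L D C (Inr 1) (Inl 1) s p) $ 1 = lap C (log_metric L h T) p * T (s p) $ 1"
  "T (curvature L D C k k s p) $ 1 = 0"
proof -
 let ?N = "V\<inter>fst C" and ?f = "%q. T (s q) $ 1" and ?u = "log_metric L h T"
 let ?s = "%l q. D s q (coord_vec C l q)"
 have oN: "open_in A ?N" using V(1) openin_chart[OF A C] by (rule openin_Int)
 have pN: "p\<in>?N" using p by simp
 have sm: "smooth_section A L ?N (?s l)" for l
  by (rule connectionD(2)[OF chern_connectionD(1)[OF D] V C])
 have pr: "proj L (D (?s l) p (coord_vec C k p)) = p" for k l
  by (rule chern_local(1)[OF D oN sm W C pN p(2,3)])
 have curv: "curvature L D C k l s p = fibre_vec L p (%T. 1 *s T (D (?s l) p (coord_vec C k p))+(-1) *s T (D (?s k) p (coord_vec C l p)))" for k l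
  by (simp add: curvature_def vector_sneg_minus1[symmetric])
 note fc = fibre_vec_combination[OF line_bundle_with W p(2) pr pr,of "%T. 1 *s T (D (?s l) p (coord_vec C k p))+(-1) *s T (D (?s k) p (coord_vec C l p))" 1 l k "-1" k l for k l]
 show "proj L (curvature L D C k l s p) = p" unfolding curv by (rule fc(1)) simp
 have T: "T (curvature L D C k l s p) $ 1 = T (D (?s l) p (coord_vec C k p)) $ 1 - T (D (?s k) p (coord_vec C l p)) $ 1" for k l
  unfolding curv by (subst fc(3)[OF _ W p(2)]) simp_all
 show "T (curvature L D C k k s p) $ 1 = 0" by (simp add: T)
 let ?M = "?N\<inter>W"
 have oM: "open_in A ?M" "p\<in>?M" using oN line_openin[OF W] p by auto
 have sr: "T (?s (Inr 1) q) $ 1 = dbar C q ?f"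
  "T (?s (Inl 1) q) $ 1 = dz C q ?f+?f q * dz C q ?u" if "q\<in>?M" for q
  using chern_local(2,3)[OF D V W C,of q] that by auto
 have smf: "smooth_fun A (V\<inter>W) ?f" by (rule smooth_section_line(1)[OF V(2,1) W])
 have smu: "smooth_fun A W ?u" by (rule log_metric_smooth[OF W])
 have oVW: "open_in A (V\<inter>W)" "p\<in>V\<inter>W" using V(1) line_openin[OF W] p by auto
 note cds = smooth_fun_cdiff[OF A smf C p(3) oVW(2)] cdiff_coord_vec[OF A smf C oVW p(3)]
  cdiff_coord_vec[OF A smu C line_openin[OF W] p(2,3)]
 have c1: "coord_vec C k p (%q. T (?s (Inr 1) q) $ 1) = coord_vec C k p (%q. dbar C q ?f)" for k
  by (rule coord_vec_cong(1)[OF A C p(3) oM sr(1)])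
 have c2: "coord_vec C k p (%q. T (?s (Inl 1) q) $ 1) =
   coord_vec C k p (%q. dz C q ?f+?f q * dz C q ?u)" for k
  by (rule coord_vec_cong(1)[OF A C p(3) oM sr(2)])
 have comm: "dz C p (%q. dbar C q ?f) = dbar C p (%q. dz C q ?f)"
  by (rule coord_vec_commute[OF A smf C oVW p(3)])
 have "T (D (?s (Inr 1)) p (dz C p)) $ 1 = dbar C p (%q. dz C q ?f)
  +dbar C p ?f * dz C p ?u"
  using chern_local(3)[OF D oN sm W C pN p(2,3)] c1 comm sr(1)[OF oM(2)] by simp
 moreover have "T (D (?s (Inl 1)) p (dbar C p)) $ 1 =
   dbar C p (%q. dz C q ?f)+dbar C p ?f * dz C p ?u+?f p * lap C ?u p"
  using chern_local(2)[OF D oN sm W C pN p(2,3)] c2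
  by (simp add: coord_vec_add coord_vec_mult'[OF A C p(3)] cds cdiff_mult lap_def)
 ultimately show "T (curvature L D C (Inl 1) (Inr 1) s p) $ 1 = - lap C ?u p * T (s p) $ 1"
  "T (curvature L D C (Inr 1) (Inl 1) s p) $ 1 = lap C ?u p * T (s p) $ 1"
  by (simp_all add: T)
qed

lemma curvature_form_unique:
 assumes D: "chern_connection A L L h D" "curvature_form A L D F"
  and W: "(W,T)\<in>triv L" "p\<in>W" and C: "C\<in>A" "p\<in>fst C"
 shows "F p (dz C p) (dbar C p) = - lap C (log_metric L h T) p"
proof -
 let ?e = "%x. frame L T x 1"
 have o: "open_in A W" by (rule line_openin[OF W(1)])
 have se: "smooth_section A L W ?e" by (rule smooth_section_frame[OF W(1)])
 have e: "proj L (?e p) = p" "T (?e p) $ 1 = 1" using line_frame(1,2)[OF W,of 1] by auto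
 let ?F = "F p (dz C p) (dbar C p)"
 have "curvature L D C (Inl 1) (Inr 1) ?e p = fibre_vec L p (%T. ?F *s T (?e p))"
  using D(2)[unfolded curvature_form_def,THEN conjunct2,THEN bspec[OF _ C(1)],THEN spec,THEN spec,THEN spec,THEN spec,
    THEN mp,OF conjI[OF o se]] W(2) C(2) by auto
 moreover have "T (fibre_vec L p (%T. ?F *s T (?e p))) $ 1 = ?F"
  using fibre_vec_combination(3)[OF line_bundle_with W e(1) e(1),of "%T. ?F *s T (?e p)" ?F 0 W T] W e(2) by simp
 ultimately show ?thesis
  using chern_curvature(2)[OF D(1) o se W(1) C(1) W(2,2) C(2)] e(2) by simp
qed

end

end

section \<open>Existence of the Chern connection of a line bundle\<close>

lemma index_cases:
 fixes k l :: "1+1"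
 obtains "k = l" | "k = Inl 1" "l = Inr 1" | "k = Inr 1" "l = Inl 1"
proof -
 have "k = Inl 1 \<or> k = Inr 1" for k :: "1+1"
  by (cases k) simp_all
 from this[of k] this[of l] show ?thesis using that by auto
qed

context
 fixes A :: "('m,1) atlas" and L :: "('m,'e,1) vbundle" and h :: "'e => 'e => complex"
 assumes A: "complex_atlas A" and L: "holomorphic_bundle A L" and h: "hermitian_metric A L h"
begin

lemma line_connection_local:
 assumes V: "open_in A V" "smooth_section A L V s" and W: "(W,T)\<in>triv L"
  and p: "p\<in>V" "p\<in>W" and v: "v\<in>tangent_space A p"
 shows "proj L (line_connection A L h s p v) = p"
  "T (line_connection A L h s p v) $ 1 = v (%q. T (s q) $ 1)+del A (log_metric L h T) p v * T (s p) $ 1"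
proof -
 define F where "F = (%T :: 'e => complex^1. (\<chi> i. v (%q. T (s q) $ 1)+del A (log_metric L h T) p v * T (s p) $ 1) :: complex^1)"
 let ?e = "frame L T p (F T)"
 have e: "proj L ?e = p" "T ?e = F T" using line_frame(1,2)[OF A L W p(2)] by auto
 have tr: "T' ?e = F T'" if T': "(W',T')\<in>triv L" "p\<in>W'" for W' T'
 proof -
  obtain g where g: "smooth_fun A (W\<inter>W') g" "!!x. x\<in>W ==> x\<in>W' ==> g x ~= 0"
   "!!C p. C\<in>A ==> p\<in>fst C ==> p\<in>W ==> p\<in>W' ==> dbar C p g = 0"
   "!!l. proj L l\<in>W ==> proj L l\<in>W' ==> T' l $ 1 = g (proj L l) * T l $ 1"
   using line_transition[OF A L W T'(1)] by metis
  have B: "base_chart A p\<in>A" "p\<in>fst (base_chart A p)"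
   using base_chart[of p A] openin_subset_points[OF A V(1)] p(1) by auto
  note tr = log_metric_transition(1)[OF A L h W T'(1) p(2) T'(2) g B]
  have o: "open_in A (V\<inter>(W\<inter>W'))"
   using V(1) line_openin[OF A L W] line_openin[OF A L T'(1)] by (intro openin_Int)
  have pN: "p\<in>V\<inter>(W\<inter>W')" using p T' by simp
  have ps: "proj L (s q) = q" if "q\<in>V" for q
   by (rule smooth_section_line(2)[OF A L V(2,1) W that])
  have tdg: "tdiff A p g" by (rule smooth_fun_tdiff[OF A g(1)]) (use pN in simp)
  have vg: "v g = v (%q. snd (base_chart A p) q $ 1) * dz (base_chart A p) p g"
  proof -
   obtain C a b where C: "C\<in>A" "p\<in>fst C" "v = (%f. a * dz C p f+b * dbar C p f)"
    "conj_vec v = (%f. cnj b * dz C p f+cnj a * dbar C p f)"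
    "\<forall>u. del A u p v = a * dz C p u" "\<forall>u. del A u p (conj_vec v) = cnj b * dz C p u"
    by (rule tangent_space1[OF A v])
   show ?thesis using C(3,5) g(3)[OF C(1,2) p(2) T'(2)] unfolding del_def by simp
  qed
  have "v (%q. T' (s q) $ 1) = v (%q. g q * T (s q) $ 1)"
   by (rule tangent_cong[OF A v o pN]) (use g(4) ps in auto)
  also have "... = v g * T (s p) $ 1+g p * v (%q. T (s q) $ 1)"
   by (rule tangent_times[OF A v tdg smooth_section_line(3)[OF A L V(2,1) W p]])
  finally have vT: "v (%q. T' (s q) $ 1) = v g * T (s p) $ 1+g p * v (%q. T (s q) $ 1)" .
  have "T' (s p) $ 1 = g p * T (s p) $ 1" using g(4)[of "s p"] ps[OF p(1)] p T' by simp
  then have "F T' $ 1 = g p * F T $ 1"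
   using g(2)[OF p(2) T'(2)] by (simp add: F_def vT vg del_def tr field_simps)
  moreover have "T' ?e $ 1 = g p * T ?e $ 1" using g(4)[of ?e] e(1) p T' by simp
  ultimately show ?thesis by (simp add: vec1_eq_iff e(2))
 qed
 have eq: "line_connection A L h s p v = ?e"
  unfolding line_connection_def F_def[symmetric]
  by (rule fibre_vec_eqI[OF line_bundle_with[OF A L] W p(2) e(1)]) (rule tr)
 then show "proj L (line_connection A L h s p v) = p"
  "T (line_connection A L h s p v) $ 1 = v (%q. T (s q) $ 1)+del A (log_metric L h T) p v * T (s p) $ 1"
  using e by (simp_all add: F_def)
qed

lemma line_cover:
 assumes "open_in A V" "p\<in>V"
 obtains W T where "(W,T)\<in>triv L" "p\<in>W"
 using bundle_cover[OF line_bundle_with[OF A L]] openin_subset_points[OF A assms(1)] assms(2) by blast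

lemma smooth_section_combination:
 assumes V: "open_in A V" and s: "smooth_section A L V s" and t: "smooth_section A L V t"
  and f: "smooth_fun A V f" and g: "smooth_fun A V g"
 defines "r == (%q. fibre_vec L q (%T. f q *s T (s q)+g q *s T (t q)))"
 shows "smooth_section A L V r" "!!q. q\<in>V ==> proj L (r q) = q"
  "!!W T q. (W,T)\<in>triv L ==> q\<in>V ==> q\<in>W ==> T (r q) $ 1 = f q * T (s q) $ 1+g q * T (t q) $ 1"
proof -
 have *: "proj L (r q) = q\<and>(q\<in>W --> T (r q) $ 1 = f q * T (s q) $ 1+g q * T (t q) $ 1)"
  if q: "q\<in>V" and W: "(W,T)\<in>triv L" for q W T
 proof -
  obtain W' T' where W': "(W',T')\<in>triv L" "q\<in>W'" using line_cover[OF V q] .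
  note c = fibre_vec_combination[OF line_bundle_with[OF A L] W' smooth_section_line(2)[OF A L s V W'(1) q]
    smooth_section_line(2)[OF A L t V W'(1) q],of "%T. f q *s T (s q)+g q *s T (t q)" "f q" "g q",OF refl]
  show ?thesis using c(1) c(3)[OF W] unfolding r_def by simp
 qed
 show pr: "proj L (r q) = q" if "q\<in>V" for q
  using line_cover[OF V that] *[OF that] by metis
 show T: "T (r q) $ 1 = f q * T (s q) $ 1+g q * T (t q) $ 1" if "(W,T)\<in>triv L" "q\<in>V" "q\<in>W" for W T q
  using *[OF that(2,1)] that(3) by simp
 show "smooth_section A L V r"
 proof (rule smooth_section_lineI[OF A L V pr])
  fix W T assume W: "(W,T)\<in>triv L"
  have o: "open_in A (V\<inter>W)" using V line_openin[OF A L W] by (rule openin_Int)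
  have "smooth_fun A (V\<inter>W) (%q. f q * T (s q) $ 1+g q * T (t q) $ 1)"
   by (intro smooth_fun_add[OF A o] smooth_fun_mult[OF A o] smooth_section_line(1)[OF A L s V W]
     smooth_section_line(1)[OF A L t V W] smooth_fun_subset[OF A f] smooth_fun_subset[OF A g]) auto
  then show "smooth_fun A (V\<inter>W) (%x. T (r x) $ 1)"
   by (subst smooth_fun_cong[OF A o]) (use T[OF W] in auto)
 qed
qed

text \<open>All clauses are checked on the coordinate of a section in one trivialisation, where the connection is a
 derivation plus a multiplication operator.\<close>

lemma line_connection_connection: "connection A L (line_connection A L h)"
 unfolding connection_def
proof (intro allI impI,elim conjE)
 fix V s assume V: "open_in A V" and s: "smooth_section A L V s"
 let ?D = "line_connection A L h"
 note loc = line_connection_local[OF V s]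
 note sl = smooth_section_line[OF A L s V]
 have cov: "\<exists>W T. (W,T)\<in>triv L\<and>p\<in>W" if "p\<in>V" for p using line_cover[OF V that] by metis
 have 1: "\<forall>p\<in>V. \<forall>v\<in>tangent_space A p. proj L (?D s p v) = p"
  using loc(1) cov by metis
 have 2: "\<forall>p\<in>V. \<forall>v\<in>tangent_space A p. \<forall>w\<in>tangent_space A p. \<forall>a b.
    ?D s p (%f. a * v f+b * w f) = fibre_vec L p (%T. a *s T (?D s p v)+b *s T (?D s p w))"
 proof (intro ballI allI)
  fix p v w a b assume p: "p\<in>V" and v: "v\<in>tangent_space A p" and w: "w\<in>tangent_space A p"
  obtain W T where W: "(W,T)\<in>triv L" "p\<in>W" using cov[OF p] by blast
  have B: "base_chart A p\<in>A" "p\<in>fst (base_chart A p)"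
   using base_chart[of p A] openin_subset_points[OF A V] p by auto
  have vw: "(%f. a * v f+b * w f)\<in>tangent_space A p"
  proof -
   obtain C c d where C: "C\<in>A" "p\<in>fst C" "v = (%f. c * dz C p f+d * dbar C p f)"
    "conj_vec v = (%f. cnj d * dz C p f+cnj c * dbar C p f)"
    "\<forall>u. del A u p v = c * dz C p u" "\<forall>u. del A u p (conj_vec v) = cnj d * dz C p u"
    by (rule tangent_space1[OF A v])
   obtain C' c' d' where C': "C'\<in>A" "p\<in>fst C'" "w = (%f. c' * dz C' p f+d' * dbar C' p f)"
    "conj_vec w = (%f. cnj d' * dz C' p f+cnj c' * dbar C' p f)"
    "\<forall>u. del A u p w = c' * dz C' p u" "\<forall>u. del A u p (conj_vec w) = cnj d' * dz C' p u"
    by (rule tangent_space1[OF A w])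
   define z where "z = dz C' p (%q. snd C q $ 1)"
   have "(%f. a * v f+b * w f) = (%f. \<Sum>k\<in>UNIV. case_sum (%_. a * c+b * c' * z) (%_. a * d+b * d' * cnj z) k * coord_vec C k p f)"
   proof
    fix f
    have *: "dz C' p f = z * dz C p f" "dbar C' p f = cnj z * dbar C p f"
     unfolding z_def by (rule coord_vec_change1(1)[OF A C(1,2) C'(1,2)],rule coord_vec_change1(2)[OF A C(1,2) C'(1,2)])
    show "a * v f+b * w f = (\<Sum>k\<in>UNIV. case_sum (%_. a * c+b * c' * z) (%_. a * d+b * d' * cnj z) k * coord_vec C k p f)"
     unfolding sum_UNIV_Plus1 C(3) C'(3) * by (simp add: algebra_simps)
   qed
   then show ?thesis using C(1,2) unfolding tangent_space_def mem_Collect_eq by (intro bexI[of _ C] conjI exI)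
  qed
  note c = fibre_vec_combination[OF line_bundle_with[OF A L] W loc(1)[OF W(1) p W(2) v] loc(1)[OF W(1) p W(2) w],
    of "%T. a *s T (?D s p v)+b *s T (?D s p w)" a b,OF refl]
  show "?D s p (%f. a * v f+b * w f) = fibre_vec L p (%T. a *s T (?D s p v)+b *s T (?D s p w))"
  proof (rule fibre_eq_line[OF A L W loc(1)[OF W(1) p W(2) vw] c(1)])
   show "T (?D s p (%f. a * v f+b * w f)) $ 1 = T (fibre_vec L p (%T. a *s T (?D s p v)+b *s T (?D s p w))) $ 1"
    unfolding c(3)[OF W] loc(2)[OF W(1) p W(2) vw]
    by (simp add: loc(2)[OF W(1) p W(2) v] loc(2)[OF W(1) p W(2) w] del_def algebra_simps)
  qed
 qed
 have 3: "\<forall>C\<in>A. \<forall>k. smooth_section A L (V\<inter>fst C) (%p. ?D s p (coord_vec C k p))"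
 proof (intro ballI allI)
  fix C and k :: "1+1" assume C: "C\<in>A"
  have o: "open_in A (V\<inter>fst C)" using V openin_chart[OF A C] by (rule openin_Int)
  show "smooth_section A L (V\<inter>fst C) (%p. ?D s p (coord_vec C k p))"
  proof (rule smooth_section_lineI[OF A L o])
   fix p assume p: "p\<in>V\<inter>fst C"
   then obtain W T where W: "(W,T)\<in>triv L" "p\<in>W" using cov by blast
   show "proj L (?D s p (coord_vec C k p)) = p"
    by (rule loc(1)[OF W(1) _ W(2)]) (use p coord_in_tangent_space[OF A C] in auto)
  next
   fix W T assume W: "(W,T)\<in>triv L"
   let ?N = "V\<inter>fst C\<inter>W"
   have oN: "open_in A ?N" "open_in A (V\<inter>W)"
    using o V line_openin[OF A L W] by auto
   define d :: complex where "d = (if k = Inl 1 then 1 else 0)"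
   have eq: "T (?D s p (coord_vec C k p)) $ 1 =
     coord_vec C k p (%q. T (s q) $ 1)+d * dz C p (log_metric L h T) * T (s p) $ 1"
    if p: "p\<in>?N" for p
   proof -
    have "del A u p (coord_vec C k p) = d * dz C p u" for u
     using del_coord[OF A C,of p u] p by (cases k "Inl 1 :: 1+1" rule: index_cases) (simp_all add: d_def)
    then show ?thesis
     using loc(2)[OF W,of p "coord_vec C k p"] p coord_in_tangent_space(1)[OF A C,of p k] by simp
   qed
   have sub: "?N\<subseteq>V\<inter>W\<inter>fst C" "?N\<subseteq>W\<inter>fst C" "?N\<subseteq>V\<inter>W" by auto
   have "smooth_fun A ?N (%p. coord_vec C k p (%q. T (s q) $ 1)+d * dz C p (log_metric L h T) * T (s p) $ 1)"
    by (intro smooth_fun_add[OF A oN(1)] smooth_fun_mult[OF A oN(1)] smooth_fun_const[OF A]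
      smooth_fun_subset[OF A smooth_fun_coord_vec[OF A sl(1)[OF W] C oN(2)] sub(1)]
      smooth_fun_subset[OF A smooth_fun_coord_vec[OF A log_metric_smooth[OF A L h W] C line_openin[OF A L W]] sub(2)]
      smooth_fun_subset[OF A sl(1)[OF W] sub(3)])
   then show "smooth_fun A ?N (%x. T (?D s x (coord_vec C k x)) $ 1)"
    by (subst smooth_fun_cong[OF A oN(1)]) (use eq in auto)
  qed
 qed
 have 4: "\<forall>U t. open_in A U\<and>U\<subseteq>V\<and>(\<forall>q\<in>U. t q = s q) -->
    (\<forall>p\<in>U. \<forall>v\<in>tangent_space A p. ?D t p v = ?D s p v)"
 proof (intro allI impI ballI,elim conjE)
  fix U t p v assume U: "open_in A U" "U\<subseteq>V" "\<forall>q\<in>U. t q = s q" "p\<in>U" "v\<in>tangent_space A p"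
  have "v (%q. T (t q) $ 1) = v (%q. T (s q) $ 1)" for T :: "'e => complex^1"
   by (rule tangent_cong[OF A U(5,1,4)]) (use U in auto)
  then show "?D t p v = ?D s p v" using U(3,4) by (simp add: line_connection_def)
 qed
 have 56: "?D (%q. fibre_vec L q (%T. f q *s T (s q)+g q *s T (t q))) p v =
   fibre_vec L p (%T. (v f *s T (s p)+f p *s T (?D s p v))+(v g *s T (t p)+g p *s T (?D t p v)))"
  if t: "smooth_section A L V t" and f: "smooth_fun A V f" and g: "smooth_fun A V g"
   and p: "p\<in>V" and v: "v\<in>tangent_space A p" for t f g p v
 proof -
  note comb = smooth_section_combination[OF V s t f g]
  obtain W T where W: "(W,T)\<in>triv L" "p\<in>W" using cov[OF p] by blast
  let ?r = "%q. fibre_vec L q (%T. f q *s T (s q)+g q *s T (t q))"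
  let ?F = "%T. (v f *s T (s p)+f p *s T (?D s p v))+(v g *s T (t p)+g p *s T (?D t p v))"
  note Dr = line_connection_local[OF V comb(1) W(1) p W(2) v]
  note Dt = line_connection_local[OF V t W(1) p W(2) v]
  note Ds = line_connection_local[OF V s W(1) p W(2) v]
  have ps: "proj L (s p) = p" "proj L (t p) = p"
   using sl(2)[OF W(1) p] smooth_section_line(2)[OF A L t V W(1) p] by auto
  have F: "?F T' = G p *v ?F T" if "p\<in>W'" "!!e. proj L e\<in>W\<inter>W' ==> T' e = G (proj L e) *v T e" for T' W' G
   using that(2)[of "s p"] that(2)[of "t p"] that(2)[of "?D s p v"] that(2)[of "?D t p v"] that(1) ps Ds(1) Dt(1) W(2)
   by (simp add: matrix_vector_right_distrib vector_scalar_commute)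
  have c: "proj L (fibre_vec L p ?F) = p" "T (fibre_vec L p ?F) = ?F T"
   by (rule fibre_vec_consistent(1)[OF line_bundle_with[OF A L] W]; rule F; assumption)
    (rule fibre_vec_consistent(3)[OF line_bundle_with[OF A L] W _ W]; rule F; assumption)
  show ?thesis
  proof (rule fibre_eq_line[OF A L W Dr(1) c(1)])
   note tds = sl(3)[OF W(1) p W(2)] smooth_section_line(3)[OF A L t V W(1) p W(2)]
    smooth_fun_tdiff[OF A f p] smooth_fun_tdiff[OF A g p]
   have oN: "open_in A (V\<inter>W)" "p\<in>V\<inter>W" using V line_openin[OF A L W(1)] p W by auto
   have "v (%q. T (?r q) $ 1) = v (%q. f q * T (s q) $ 1+g q * T (t q) $ 1)"
    by (rule tangent_cong[OF A v oN]) (use comb(3)[OF W(1)] in auto)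
   also have "... = (v f * T (s p) $ 1+f p * v (%q. T (s q) $ 1))+(v g * T (t p) $ 1+g p * v (%q. T (t q) $ 1))"
    using tds by (simp add: tangent_plus[OF v] tangent_times[OF A v] tdiff_mult)
   finally show "T (?D ?r p v) $ 1 = T (fibre_vec L p ?F) $ 1"
    unfolding c(2) Dr(2) comb(3)[OF W(1) p W(2)] by (simp add: Ds(2) Dt(2) algebra_simps)
  qed
 qed
 have 5: "\<forall>t. smooth_section A L V t --> (\<forall>p\<in>V. \<forall>v\<in>tangent_space A p.
    ?D (%q. fibre_vec L q (%T. T (s q)+T (t q))) p v = fibre_vec L p (%T. T (?D s p v)+T (?D t p v)))"
  using 56[of _ "%q. 1" "%q. 1"] by (simp add: smooth_fun_const[OF A] tangent_const[OF A])
 have 6: "\<forall>f. smooth_fun A V f --> (\<forall>p\<in>V. \<forall>v\<in>tangent_space A p.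
    ?D (%q. fibre_vec L q (%T. f q *s T (s q))) p v = fibre_vec L p (%T. v f *s T (s p)+f p *s T (?D s p v)))"
  using 56[of s _ "%q. 0"] s by (simp add: smooth_fun_const[OF A] tangent_const[OF A])
 show "(\<forall>p\<in>V. \<forall>v\<in>tangent_space A p. proj L (?D s p v) = p) \<and>
   (\<forall>p\<in>V. \<forall>v\<in>tangent_space A p. \<forall>w\<in>tangent_space A p. \<forall>a b.
    ?D s p (%f. a * v f+b * w f) = fibre_vec L p (%T. a *s T (?D s p v)+b *s T (?D s p w))) \<and>
   (\<forall>C\<in>A. \<forall>k. smooth_section A L (V\<inter>fst C) (%p. ?D s p (coord_vec C k p))) \<and>
   (\<forall>U t. open_in A U\<and>U\<subseteq>V\<and>(\<forall>q\<in>U. t q = s q) -->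
    (\<forall>p\<in>U. \<forall>v\<in>tangent_space A p. ?D t p v = ?D s p v)) \<and>
   (\<forall>t. smooth_section A L V t --> (\<forall>p\<in>V. \<forall>v\<in>tangent_space A p.
    ?D (%q. fibre_vec L q (%T. T (s q)+T (t q))) p v = fibre_vec L p (%T. T (?D s p v)+T (?D t p v)))) \<and>
   (\<forall>f. smooth_fun A V f --> (\<forall>p\<in>V. \<forall>v\<in>tangent_space A p.
    ?D (%q. fibre_vec L q (%T. f q *s T (s q))) p v = fibre_vec L p (%T. v f *s T (s p)+f p *s T (?D s p v))))"
  using 1 2 3 4 5 6 by (intro conjI)
qed

lemma line_connection_chern: "chern_connection A L L h (line_connection A L h)"
 unfolding chern_connection_def
proof (intro conjI allI impI ballI line_connection_connection; (elim conjE)?)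
 let ?D = "line_connection A L h"
 fix V s p v assume V: "open_in A V" and s: "smooth_section A L V s" and p: "p\<in>V" and v: "v\<in>tangent01 A p"
 obtain W T where W: "(W,T)\<in>triv L" "p\<in>W" using line_cover[OF V p] .
 have v': "v\<in>tangent_space A p" by (rule tangent01_subset[OF A v])
 note loc = line_connection_local[OF V s W(1) p W(2) v'] and dol = dolbeault_line[OF A L W(1) V p W(2) s v]
 have B: "base_chart A p\<in>A" "p\<in>fst (base_chart A p)"
  using base_chart[of p A] openin_subset_points[OF A V] p by auto
 have "del A u p v = 0" for u
 proof -
  obtain C a where C: "C\<in>A" "p\<in>fst C" "v = (%f. \<Sum>j\<in>UNIV. a j * coord_vec C (Inr j) p f)"
   using v unfolding tangent01_def by blast
  then show ?thesis using coord_vec_transition_holomorphic(1)[OF A B C(1,2)] by (simp add: del_def)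
 qed
 then show "?D s p v = dolbeault L s p v"
  by (intro fibre_eq_line[OF A L W loc(1) dol(1)]) (simp add: loc(2) dol(2))
next
 let ?D = "line_connection A L h"
 show "compatible A L h ?D"
  unfolding compatible_def
 proof (intro allI impI ballI,elim conjE)
  fix V s t p v assume V: "open_in A V" and s: "smooth_section A L V s" and t: "smooth_section A L V t"
   and p: "p\<in>V" and v: "v\<in>tangent_space A p"
  obtain W T where W: "(W,T)\<in>triv L" "p\<in>W" using line_cover[OF V p] .
  obtain C a b where C: "C\<in>A" "p\<in>fst C" "v = (%f. a * dz C p f+b * dbar C p f)"
   "conj_vec v = (%f. cnj b * dz C p f+cnj a * dbar C p f)"
   "\<forall>u. del A u p v = a * dz C p u" "\<forall>u. del A u p (conj_vec v) = cnj b * dz C p u"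
   by (rule tangent_space1[OF A v])
  have cv: "conj_vec v\<in>tangent_space A p"
  proof -
   have "conj_vec v = (%f. \<Sum>k\<in>UNIV. case_sum (%_. cnj b) (%_. cnj a) k * coord_vec C k p f)"
    by (simp add: sum_UNIV_Plus1 C(4))
   then show ?thesis using C(1,2) unfolding tangent_space_def mem_Collect_eq by (intro bexI[of _ C] conjI exI)
  qed
  let ?u = "log_metric L h T" and ?f = "%q. T (s q) $ 1" and ?g = "%q. T (t q) $ 1"
  note Ds = line_connection_local[OF V s W(1) p W(2) v] and Dt = line_connection_local[OF V t W(1) p W(2) cv]
  have oN: "open_in A (V\<inter>W)" "p\<in>V\<inter>W" using V line_openin[OF A L W(1)] p W by auto
  have cds: "cdiff C p ?f" "cdiff C p ?g" "cdiff C p ?u"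
   using smooth_fun_cdiff[OF A smooth_section_line(1)[OF A L s V W(1)] C(1,2) oN(2)]
    smooth_fun_cdiff[OF A smooth_section_line(1)[OF A L t V W(1)] C(1,2) oN(2)]
    smooth_fun_cdiff[OF A log_metric_smooth[OF A L h W(1)] C(1,2) W(2)] by auto
  have ps: "proj L (s q) = q" "proj L (t q) = q" if "q\<in>V" for q
   using smooth_section_line(2)[OF A L s V W(1) that] smooth_section_line(2)[OF A L t V W(1) that] by auto
  have ub: "dbar C p ?u = cnj (dz C p ?u)"
   using coord_vec_cnj[of C "Inr 1" p ?u] by (simp add: cnj_log_metric)
  have cvg: "conj_vec v ?g = cnj b * dz C p ?g+cnj a * dbar C p ?g"
   by (simp only: C(4))
  have "v (%q. h (s q) (t q)) = v (%q. (?f q * cnj (?g q)) * exp (?u q))"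
   by (rule tangent_cong[OF A v oN]) (use metric_local[OF A L h W(1)] ps in auto)
  also have "... = (v ?f * cnj (?g p)+?f p * cnj (cnj b * dz C p ?g+cnj a * dbar C p ?g)) * exp (?u p)+?f p * cnj (?g p) * (exp (?u p) * v ?u)"
   by (simp add: C(3) coord_vec_mult'[OF A C(1,2)] cds cdiff_mult cdiff_cnj cdiff_exp coord_vec_exp coord_vec_cnj
     cinv_chart[OF A C(1,2)] algebra_simps)
  also have "... = h (?D s p v) (t p)+h (s p) (?D t p (conj_vec v))"
   unfolding metric_local[OF A L h W Ds(1) ps(2)[OF p]] metric_local[OF A L h W ps(1)[OF p] Dt(1)] Ds(2) Dt(2) cvg C(5)[rule_format] C(6)[rule_format]
   by (simp add: C(3) ub algebra_simps)
  finally show "v (%q. h (s q) (t q)) = h (?D s p v) (t p)+h (s p) (?D t p (conj_vec v))" .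
 qed
qed

lemma line_curvature_coord:
 assumes C: "C\<in>A" "p\<in>fst C" and W: "(W,T)\<in>triv L" "p\<in>W"
 shows "line_curvature A L h p (dz C p) (dbar C p) = - lap C (log_metric L h T) p"
  "line_curvature A L h p (dbar C p) (dz C p) = lap C (log_metric L h T) p"
  "line_curvature A L h p (coord_vec C k p) (coord_vec C k p) = 0"
proof -
 have pA: "p\<in>points A" using C by (auto simp: points_iff)
 have B: "base_chart A p\<in>A" "p\<in>fst (base_chart A p)" using base_chart[OF pA] by auto
 obtain W' where W': "(W',base_triv L p)\<in>triv L" "p\<in>W'" using base_triv[OF A L pA] .
 obtain g where g: "smooth_fun A (W\<inter>W') g" "!!x. x\<in>W ==> x\<in>W' ==> g x ~= 0"
   "!!C p. C\<in>A ==> p\<in>fst C ==> p\<in>W ==> p\<in>W' ==> dbar C p g = 0"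
   "!!l. proj L l\<in>W ==> proj L l\<in>W' ==> base_triv L p l $ 1 = g (proj L l) * T l $ 1"
  using line_transition[OF A L W(1) W'(1)] by metis
 have 1: "lap C (log_metric L h T) p = lap C (log_metric L h (base_triv L p)) p"
  by (rule log_metric_transition(2)[OF A L h W(1) W'(1) W(2) W'(2) g C])
 note 2 = lap_change[OF A B C log_metric_smooth[OF A L h W'(1)] line_openin[OF A L W'(1)] W'(2)]
 note 3 = coord_vec_transition_holomorphic(1)[OF A B C]
 show "line_curvature A L h p (dz C p) (dbar C p) = - lap C (log_metric L h T) p"
  "line_curvature A L h p (dbar C p) (dz C p) = lap C (log_metric L h T) p"
  "line_curvature A L h p (coord_vec C k p) (coord_vec C k p) = 0"
  by (simp_all add: line_curvature_def Let_def 1 2 3 coord_vec_cnj)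
qed

lemma line_curvature_form: "curvature_form A L (line_connection A L h) (line_curvature A L h)"
 unfolding curvature_form_def
proof (intro conjI)
 have algebra: "line_curvature A L h p v w = - line_curvature A L h p w v"
  "line_curvature A L h p (%f. a * u f+b * v f) w = a * line_curvature A L h p u w+b * line_curvature A L h p v w" for p u v w a b
  by (simp_all add: line_curvature_def Let_def algebra_simps)
 have sm: "smooth_fun A (fst C) (%p. line_curvature A L h p (coord_vec C k p) (coord_vec C l p))" if C: "C\<in>A" for C k l
 proof (rule smooth_fun_local[OF A])
  fix p assume p: "p\<in>fst C"
  obtain W T where W: "(W,T)\<in>triv L" "p\<in>W" using line_cover[OF openin_chart[OF A C] p] .
  have o: "open_in A W" by (rule line_openin[OF A L W(1)])
  have oC: "open_in A (fst C\<inter>W)" using openin_chart[OF A C] o by (rule openin_Int)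
  have sl: "smooth_fun A (fst C\<inter>W) (lap C (log_metric L h T))"
  proof -
   have 1: "smooth_fun A (W\<inter>fst C) (%p. dz C p (log_metric L h T))"
    by (rule smooth_fun_coord_vec[OF A log_metric_smooth[OF A L h W(1)] C o])
   have "smooth_fun A (W\<inter>fst C\<inter>fst C) (%p. dbar C p (%p. dz C p (log_metric L h T)))"
    by (rule smooth_fun_coord_vec[OF A 1 C]) (use oC in \<open>simp add: Int_commute\<close>)
   then show ?thesis unfolding lap_def by (rule smooth_fun_subset[OF A]) auto
  qed
  define c :: complex where "c = (if k = l then 0 else if k = Inl 1 then - 1 else 1)"
  have "line_curvature A L h q (coord_vec C k q) (coord_vec C l q) = c * lap C (log_metric L h T) q"
   if "q\<in>fst C\<inter>W" for q
   using line_curvature_coord[OF C _ W(1),of q] that by (cases k l rule: index_cases) (auto simp: c_def)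
  then have "smooth_fun A (fst C\<inter>W) (%p. line_curvature A L h p (coord_vec C k p) (coord_vec C l p))"
   by (subst smooth_fun_cong[OF A oC]) (use smooth_fun_mult[OF A oC smooth_fun_const[OF A] sl] in auto)
  then show "\<exists>N. open_in A N\<and>p\<in>N \<and>
    smooth_fun A (fst C\<inter>N) (%p. line_curvature A L h p (coord_vec C k p) (coord_vec C l p))"
   using o W(2) by blast
 qed
 show "two_form A (line_curvature A L h)"
  unfolding two_form_def
 proof (intro conjI ballI allI)
  show "line_curvature A L h p v w = - line_curvature A L h p w v" for p v w by (rule algebra(1))
  show "line_curvature A L h p (%f. a * u f+b * v f) w = a * line_curvature A L h p u w+b * line_curvature A L h p v w"
   for p u v w a b by (rule algebra(2))
  show "smooth_fun A (fst C) (%p. line_curvature A L h p (coord_vec C k p) (coord_vec C l p))" if "C\<in>A" for C k l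
   by (rule sm[OF that])
 qed
 show "\<forall>C\<in>A. \<forall>k l V s. open_in A V\<and>smooth_section A L V s -->
    (\<forall>p\<in>V\<inter>fst C. curvature L (line_connection A L h) C k l s p =
      fibre_vec L p (%T. line_curvature A L h p (coord_vec C k p) (coord_vec C l p) *s T (s p)))"
 proof (intro ballI allI impI,elim conjE)
  fix C and k l :: "1+1" and V s p
  assume C: "C\<in>A" and V: "open_in A V" "smooth_section A L V s" and p: "p\<in>V\<inter>fst C"
  then have p': "p\<in>V" "p\<in>fst C" by auto
  obtain W T where W: "(W,T)\<in>triv L" "p\<in>W" using line_cover[OF V(1) p'(1)] .
  have ps: "proj L (s p) = p" by (rule smooth_section_line(2)[OF A L V(2,1) W(1) p'(1)])
  let ?K = "line_curvature A L h p (coord_vec C k p) (coord_vec C l p)"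
  note c = fibre_vec_combination[OF line_bundle_with[OF A L] W ps ps,of "%T. ?K *s T (s p)" ?K 0]
  note cc = chern_curvature[OF A L h line_connection_chern V W(1) C p'(1) W(2) p'(2)]
  show "curvature L (line_connection A L h) C k l s p = fibre_vec L p (%T. ?K *s T (s p))"
  proof (rule fibre_eq_line[OF A L W cc(1)])
   show "proj L (fibre_vec L p (%T. ?K *s T (s p))) = p" by (rule c(1)) simp
   have "T (fibre_vec L p (%T. ?K *s T (s p))) $ 1 = ?K * T (s p) $ 1" by (subst c(3)[OF _ W]) simp_all
   then show "T (curvature L (line_connection A L h) C k l s p) $ 1 = T (fibre_vec L p (%T. ?K *s T (s p))) $ 1"
    using cc(2,3,4) line_curvature_coord[OF C p'(2) W] by (cases k l rule: index_cases) simp_all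
  qed
 qed
qed

end

section \<open>Integration in one complex variable\<close>

definition to_C1 :: "real^2 => complex^1" where
 "to_C1 x = vec (Complex (x $ 1) (x $ 2))"

definition of_C1 :: "complex^1 => real^2" where
 "of_C1 y = vector [Re (y $ 1),Im (y $ 1)]"

lemma to_C1_of_C1 [simp]: "to_C1 (of_C1 y) = y" "of_C1 (to_C1 x) = x"
 by (simp_all add: to_C1_def of_C1_def vec_eq_iff forall_1 forall_2)

lemma bounded_linear_to_C1: "bounded_linear to_C1"
proof (rule linear_conv_bounded_linear[THEN iffD1],rule linearI)
 show "to_C1 (x+y) = to_C1 x+to_C1 y" for x y
  by (simp add: to_C1_def vec_eq_iff complex_eq_iff)
 show "to_C1 (r *\<^sub>R x) = r *\<^sub>R to_C1 x" for r x
  by (simp add: to_C1_def vec_eq_iff complex_eq_iff)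
qed

lemma bounded_linear_of_C1: "bounded_linear of_C1"
proof (rule linear_conv_bounded_linear[THEN iffD1],rule linearI)
 show "of_C1 (x+y) = of_C1 x + of_C1 y" for x y
  by (simp add: of_C1_def vec_eq_iff forall_2)
 show "of_C1 (r *\<^sub>R x) = r *\<^sub>R of_C1 x" for r x
  by (simp add: of_C1_def vec_eq_iff forall_2)
qed

lemma Basis_C1: "(Basis :: (complex^1) set) = {axis 1 1,axis 1 \<i>}"
 by (auto simp: Basis_vec_def Basis_complex_def)

lemma Basis_R2: "(Basis :: (real^2) set) = {axis 1 1,axis 2 1}"
 by (auto simp: Basis_vec_def UNIV_2)

lemma borel_measurable_to_C1 [measurable]: "to_C1\<in>borel_measurable borel"
 by (intro borel_measurable_continuous_onI linear_continuous_on bounded_linear_to_C1)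

text \<open>Lebesgue measure on \<open>complex^1\<close> is transported from the real plane, on which the change of
 variables formula has its determinant form.\<close>

lemma lborel_C1: "(lborel :: (complex^1) measure) = distr lborel borel to_C1"
proof (rule lborel_eqI)
 fix l u :: "complex^1" assume le: "!!b. b\<in>Basis ==> l \<bullet> b\<le>u \<bullet> b"
 have pre: "to_C1 -` box l u = box (of_C1 l) (of_C1 u)"
  by (auto simp: box_def Basis_C1 Basis_R2 to_C1_def of_C1_def inner_axis inner_complex_def)
 have "emeasure (distr lborel borel to_C1) (box l u) = emeasure lborel (to_C1 -` box l u)"
  by (subst emeasure_distr) auto
 also have "... = ennreal (\<Prod>b\<in>Basis. (of_C1 u - of_C1 l) \<bullet> b)"
  unfolding pre by (rule emeasure_lborel_box)
   (use le[of "axis 1 1"] le[of "axis 1 \<i>"] in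
    \<open>auto simp: Basis_C1 Basis_R2 of_C1_def inner_axis inner_complex_def\<close>)
 also have "(\<Prod>b\<in>Basis. (of_C1 u - of_C1 l) \<bullet> b) = (\<Prod>b\<in>Basis. (u - l) \<bullet> b)"
  by (simp add: Basis_C1 Basis_R2 of_C1_def inner_axis inner_complex_def axis_eq_axis)
 finally show "emeasure (distr lborel borel to_C1) (box l u) = (\<Prod>b\<in>Basis. (u - l) \<bullet> b)" .
qed simp

lemma to_C1_integral:
 fixes f :: "complex^1 => complex"
 assumes T: "open T" and f: "continuous_on T f"
 shows "set_integrable lborel T f\<longleftrightarrow>set_integrable lborel (to_C1 -` T) (%x. f (to_C1 x))"
  "(LINT y:T|lborel. f y) = (LINT x:to_C1 -` T|lborel. f (to_C1 x))"
proof -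
 have m [measurable]: "(%y. indicator T y *\<^sub>R f y)\<in>borel_measurable borel"
  by (rule borel_measurable_continuous_on_indicator) (use T f in auto)
 have i: "indicator (to_C1 -` T) x = (indicator T (to_C1 x) :: real)" for x
  by (simp add: indicator_def)
 show "set_integrable lborel T f\<longleftrightarrow>set_integrable lborel (to_C1 -` T) (%x. f (to_C1 x))"
  unfolding set_integrable_def i by (subst lborel_C1,subst integrable_distr_eq) auto
 show "(LINT y:T|lborel. f y) = (LINT x:to_C1 -` T|lborel. f (to_C1 x))"
  unfolding set_lebesgue_integral_def i by (subst lborel_C1,subst integral_distr) auto
qed

definition C_R2 :: "complex => real^2" where
 "C_R2 z = vector [Re z,Im z]"

lemma bounded_linear_C_R2: "bounded_linear C_R2"
proof (rule linear_conv_bounded_linear[THEN iffD1],rule linearI)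
 show "C_R2 (x+y) = C_R2 x+C_R2 y" for x y
  by (simp add: C_R2_def vec_eq_iff forall_2)
 show "C_R2 (r *\<^sub>R x) = r *\<^sub>R C_R2 x" for r x
  by (simp add: C_R2_def vec_eq_iff forall_2)
qed

lemma C_R2_eq_iff: "C_R2 z = C_R2 w\<longleftrightarrow>z = w"
 by (simp add: C_R2_def vec_eq_iff forall_2 complex_eq_iff)

lemma C_R2_integral:
 fixes f :: "real^2 => complex"
 assumes "set_integrable lborel S f"
 shows "set_integrable lborel S (%x. C_R2 (f x))" "C_R2 (LINT x:S|lborel. f x) = integral S (%x. C_R2 (f x))"
proof -
 interpret K: bounded_linear C_R2 by (rule bounded_linear_C_R2)
 have "integrable lborel (%x. C_R2 (indicator S x *\<^sub>R f x))"
  using assms unfolding set_integrable_def by (rule integrable_bounded_linear[OF bounded_linear_C_R2])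
 then show 1: "set_integrable lborel S (%x. C_R2 (f x))" by (simp add: set_integrable_def K.scaleR)
 have "C_R2 (LINT x:S|lborel. f x) = (LINT x|lborel. C_R2 (indicator S x *\<^sub>R f x))"
  using assms unfolding set_integrable_def set_lebesgue_integral_def
  by (rule integral_bounded_linear[OF bounded_linear_C_R2,symmetric])
 also have "... = (LINT x:S|lborel. C_R2 (f x))" by (simp add: set_lebesgue_integral_def K.scaleR)
 also have "... = integral S (%x. C_R2 (f x))" by (rule set_borel_integral_eq_integral(2)[OF 1])
 finally show "C_R2 (LINT x:S|lborel. f x) = integral S (%x. C_R2 (f x))" .
qed

text \<open>The real Jacobian determinant of a holomorphic map is the square modulus of its complex derivative.\<close>

lemma change_of_variables_C1:
 fixes psi :: "complex^1 => complex^1" and f :: "complex^1 => complex"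
 assumes S: "open S" "open (psi ` S)" "inj_on psi S"
  and psi: "!!y. y\<in>S ==> (psi has_derivative (%v. w y *s v)) (at y)" and w: "continuous_on S w"
  and f: "continuous_on (psi ` S) f" "set_integrable lborel (psi ` S) f"
 shows "(LINT y:psi ` S|lborel. f y) = (LINT y:S|lborel. of_real ((cmod (w y))\<^sup>2) * f (psi y))"
proof -
 interpret K: bounded_linear C_R2 by (rule bounded_linear_C_R2)
 interpret J: bounded_linear to_C1 by (rule bounded_linear_to_C1)
 interpret R: bounded_linear of_C1 by (rule bounded_linear_of_C1)
 define S' where "S' = to_C1 -` S"
 define g where "g = (%x. of_C1 (psi (to_C1 x)))"
 define g' where "g' = (%x v. of_C1 (w (to_C1 x) *s to_C1 v))"
 define F where "F = (%x. C_R2 (f (to_C1 x)))"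
 have gS: "g ` S' = to_C1 -` (psi ` S)"
 proof (intro equalityI subsetI)
  fix x assume "x\<in>to_C1 -` (psi ` S)"
  then obtain y where y: "y\<in>S" "to_C1 x = psi y" by auto
  then have "x = g (of_C1 y)" unfolding g_def by (metis to_C1_of_C1)
  then show "x\<in>g ` S'" using y(1) by (simp add: S'_def)
 qed (auto simp: g_def S'_def)
 have openS': "open S'" unfolding S'_def by (intro open_vimage S J.continuous_on continuous_on_id)
 have S'm: "S'\<in>sets lebesgue" using openS' by (simp add: borel_open)
 have der: "(g has_derivative g' x) (at x within S')" if "x\<in>S'" for x
 proof -
  have 1: "(psi has_derivative (%v. w (to_C1 x) *s v)) (at (to_C1 x))" using psi that by (simp add: S'_def)
  have 2: "(to_C1 has_derivative to_C1) (at x)" by (rule bounded_linear_imp_has_derivative[OF bounded_linear_to_C1])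
  from bounded_linear.has_derivative[OF bounded_linear_of_C1 has_derivative_compose[OF 2 1]]
  show ?thesis unfolding g_def g'_def by (rule has_derivative_at_withinI)
 qed
 have inj: "inj_on g S'"
 proof (rule inj_onI)
  fix x y assume "x\<in>S'" "y\<in>S'" "g x = g y"
  then have "to_C1 x = to_C1 y" using S(3) unfolding g_def S'_def by (metis inj_onD to_C1_of_C1(1) vimageE)
  then show "x = y" by (metis to_C1_of_C1(2))
 qed
 have det: "\<bar>det (matrix (g' x))\<bar> = (cmod (w (to_C1 x)))\<^sup>2" for x
 proof -
  have 1: "to_C1 (axis 1 1) $ 1 = 1" "to_C1 (axis 2 1) $ 1 = \<i>"
   by (simp_all add: to_C1_def axis_def complex_eq_iff)
  have "det (matrix (g' x)) = (Re (w (to_C1 x)))\<^sup>2+(Im (w (to_C1 x)))\<^sup>2"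
   by (simp add: det_2 matrix_def g'_def of_C1_def 1 power2_eq_square)
  then show ?thesis by (simp add: cmod_power2)
 qed
 have iT: "set_integrable lborel (g ` S') (%x. f (to_C1 x))"
  unfolding gS using f(2) to_C1_integral(1)[OF S(2) f(1)] by blast
 have F1: "set_integrable lborel (g ` S') F" and F2: "C_R2 (LINT y:psi ` S|lborel. f y) = integral (g ` S') F"
  using C_R2_integral[OF iT] to_C1_integral(2)[OF S(2) f(1)] unfolding F_def gS by simp_all
 have "F absolutely_integrable_on (g ` S')"
  using F1 unfolding set_integrable_def
  by (subst integrable_completion) (use borel_measurable_integrable in auto)
 then have abs: "(%x. \<bar>det (matrix (g' x))\<bar> *\<^sub>R F (g x)) absolutely_integrable_on S'"
  and int: "integral S' (%x. \<bar>det (matrix (g' x))\<bar> *\<^sub>R F (g x)) = integral (g ` S') F"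
  using has_absolute_integral_change_of_variables[OF S'm der inj,of F "integral (g ` S') F"] by simp_all
 define G where "G = (%y. of_real ((cmod (w y))\<^sup>2) * f (psi y))"
 have contpsi: "continuous_on S psi"
  using psi by (meson continuous_at_imp_continuous_on has_derivative_continuous)
 have contG: "continuous_on S G"
  unfolding G_def by (intro continuous_intros w continuous_on_compose2[OF f(1) contpsi]) auto
 have FG: "(%x. \<bar>det (matrix (g' x))\<bar> *\<^sub>R F (g x)) = (%x. C_R2 (G (to_C1 x)))"
  by (rule ext) (simp only: det F_def g_def G_def to_C1_of_C1 K.scaleR[symmetric] scaleR_conv_of_real[where 'a = complex])
 have contGJ: "continuous_on S' (%x. G (to_C1 x))"
  by (rule continuous_on_compose2[OF contG]) (auto simp: S'_def intro!: J.continuous_on continuous_on_id)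
 have "set_integrable lborel S' (%x. C_R2 (G (to_C1 x)))"
 proof -
  have "(%x. indicator S' x *\<^sub>R C_R2 (G (to_C1 x)))\<in>borel_measurable borel"
   by (rule borel_measurable_continuous_on_indicator)
    (use openS' contGJ in \<open>auto intro!: K.continuous_on\<close>)
  then show ?thesis using abs unfolding FG set_integrable_def by (subst (asm) integrable_completion) auto
 qed
 then have "set_integrable lborel S' (%x. G (to_C1 x))"
 proof -
  assume *: "set_integrable lborel S' (%x. C_R2 (G (to_C1 x)))"
  define M where "M = (%v :: real^2. Complex (v $ 1) (v $ 2))"
  have "linear M" by (rule linearI) (simp_all add: M_def complex_eq_iff)
  then have M: "bounded_linear M" by (simp add: linear_conv_bounded_linear)
  then interpret M: bounded_linear M .
  have "integrable lborel (%x. M (indicator S' x *\<^sub>R C_R2 (G (to_C1 x))))"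
   using * unfolding set_integrable_def by (rule integrable_bounded_linear[OF M])
  moreover have "M (C_R2 z) = z" for z by (simp add: M_def C_R2_def)
  ultimately show ?thesis by (simp add: set_integrable_def M.scaleR)
 qed
 from C_R2_integral(2)[OF this]
 have "C_R2 (LINT x:S'|lborel. G (to_C1 x)) = integral (g ` S') F" using int unfolding FG by simp
 then have "C_R2 (LINT y:S|lborel. G y) = C_R2 (LINT y:psi ` S|lborel. f y)"
  using to_C1_integral(2)[OF S(1) contG] F2 unfolding S'_def by simp
 then show ?thesis unfolding C_R2_eq_iff G_def by simp
qed

lemma integrable_compact_support:
 fixes f :: "'a::euclidean_space => 'b::{banach,second_countable_topology}"
 assumes "compact K" "K\<subseteq>T" "continuous_on T f" "!!x. x\<in>T ==> x \<notin> K ==> f x = 0"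
 shows "set_integrable lborel T f"
proof -
 have "integrable lborel (%x. indicator K x *\<^sub>R f x)"
  by (rule borel_integrable_compact) (use assms continuous_on_subset in auto)
 moreover have "(%x. indicator K x *\<^sub>R f x) = (%x. indicator T x *\<^sub>R f x)"
  using assms(2,4) by (auto simp: fun_eq_iff indicator_def)
 ultimately show ?thesis by (simp add: set_integrable_def)
qed

text \<open>The integral of \<open>g\<close> does not change under translation, so that of its derivative along the
 translation vanishes; dominated convergence exchanges limit and integral.\<close>

lemma integral_derivative_zero:
 fixes g :: "'a::euclidean_space => complex"
 assumes g: "Ck_on (Suc 0) g UNIV" and K: "compact K" "!!x. x \<notin> K ==> g x = 0"
 shows "integrable lborel (%x. fderiv g x v)"
  "(LINT x|lborel. fderiv g x v) = 0"
proof -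
 define d where "d = (%x. fderiv g x v)"
 have D: "(g has_derivative fderiv g x) (at x)" for x
  using Ck_on_SucD(1)[OF g] by simp
 have contd: "continuous_on UNIV d" using g by (simp add: d_def)
 have contg: "continuous_on UNIV g" using Ck_on_Suc_lower[OF g] by simp
 have d0: "d x = 0" if "x \<notin> K" for x
  using frechet_derivative_cong_open(2)[of "- K" x g "%_. 0"] K that compact_imp_closed[OF K(1)]
  by (simp add: d_def open_Compl)
 show "integrable lborel (%x. fderiv g x v)"
  using integrable_compact_support[OF K(1),of UNIV d] contd d0 by (simp add: set_integrable_def d_def)
 have gi: "integrable lborel g"
  using integrable_compact_support[OF K(1),of UNIV g] contg K(2) by (simp add: set_integrable_def)
 obtain B where B: "!!x. x\<in>K ==> norm (d x)\<le>B" "0\<le>B"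
 proof -
  have "bounded (d ` K)" by (intro compact_imp_bounded compact_continuous_image K continuous_on_subset[OF contd]) auto
  then obtain B where "\<forall>y\<in>d ` K. norm y\<le>B" unfolding bounded_iff by blast
  then show ?thesis using that[of "max B 0"] by force
 qed
 have B': "norm (d x)\<le>B" for x using B d0[of x] by (cases "x\<in>K") auto
 (* K' contains the supports of all translates by at most v, so one bound dominates the difference quotients. *)
 define K' where "K' = (%(x,t). x - t *\<^sub>R v) ` (K\<times>{0..1::real})"
 have K': "compact K'"
  unfolding K'_def case_prod_unfold
  by (intro compact_continuous_image compact_Times K compact_Icc continuous_intros)
 have out: "x\<in>K'" if "x+t *\<^sub>R v\<in>K" "0\<le>t" "t\<le>1" for x t
  unfolding K'_def using that by (intro image_eqI[of _ _ "(x+t *\<^sub>R v,t)"]) auto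
 define r where "r = (%n. inverse (real (Suc n)))"
 define s where "s = (%n x. (g (x+r n *\<^sub>R v) - g x) /\<^sub>R r n)"
 have r: "0 < r n" "r n\<le>1" for n by (simp_all add: r_def field_simps)
 have r0: "r \<longlonglongrightarrow> 0" unfolding r_def by (rule LIMSEQ_inverse_real_of_nat)
 have line: "((%t. g (x+t *\<^sub>R v)) has_vector_derivative d (x+t *\<^sub>R v)) (at t)" for x t
 proof -
  have "((%t. x+t *\<^sub>R v) has_derivative (%h. h *\<^sub>R v)) (at t)"
   by (auto intro!: derivative_eq_intros)
  from has_derivative_compose[OF this D] show ?thesis
   unfolding has_vector_derivative_def d_def
   using has_derivative_bounded_linear[OF D] by (simp add: linear_simps)
 qed
 have lim: "(%n. s n x) \<longlonglongrightarrow> d x" for x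
 proof -
  have "((%t. g (x+t *\<^sub>R v)) has_vector_derivative d x) (at 0)" using line[of x 0] by simp
  then have l0: "((%h. norm (g (x+h *\<^sub>R v) - g x - h *\<^sub>R d x)/norm h) \<longlongrightarrow> 0) (at 0)"
   unfolding has_vector_derivative_def has_derivative_iff_norm by simp
  have l1: "norm (g (x+h *\<^sub>R v) - g x - h *\<^sub>R d x)/norm h = norm ((g (x+h *\<^sub>R v) - g x) /\<^sub>R h - d x)"
   if "h ~= 0" for h
  proof -
   have "(g (x+h *\<^sub>R v) - g x) /\<^sub>R h - d x = (g (x+h *\<^sub>R v) - g x - h *\<^sub>R d x) /\<^sub>R h"
    using that by (simp add: scaleR_diff_right)
   then show ?thesis by (simp add: divide_inverse mult.commute)
  qed
  have "((%h. norm ((g (x+h *\<^sub>R v) - g x) /\<^sub>R h - d x)) \<longlongrightarrow> 0) (at 0)"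
   by (rule Lim_transform_eventually[OF l0]) (unfold eventually_at_filter,intro always_eventually allI impI l1)
  then have "((%h. (g (x+h *\<^sub>R v) - g x) /\<^sub>R h - d x) \<longlongrightarrow> 0) (at 0)"
   by (rule tendsto_norm_zero_cancel)
  then have "((%h. (g (x+h *\<^sub>R v) - g x) /\<^sub>R h) \<longlongrightarrow> d x) (at 0)"
   by (rule LIM_zero_cancel)
  moreover have "filterlim r (at 0) sequentially"
   unfolding filterlim_at using r0 r(1) by (simp add: less_imp_neq[symmetric])
  ultimately show ?thesis unfolding s_def by (rule filterlim_compose)
 qed
 have bound: "norm (s n x)\<le>B * indicator K' x" for n x
 proof (cases "x\<in>K'")
  case True
  have "norm (g (x+r n *\<^sub>R v) - g (x+0 *\<^sub>R v))\<le>B * norm (r n - 0)"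
  proof (rule differentiable_bound[where S = UNIV and f = "%t. g (x+t *\<^sub>R v)" and f' = "%t h. h *\<^sub>R d (x+t *\<^sub>R v)"])
   show "((%t. g (x+t *\<^sub>R v)) has_derivative (%h. h *\<^sub>R d (x+t *\<^sub>R v))) (at t within UNIV)" for t
    using line[of x t] by (simp add: has_vector_derivative_def)
   show "onorm (%h. h *\<^sub>R d (x+t *\<^sub>R v))\<le>B" for t
   proof (rule onorm_le)
    fix h :: real
    have "\<bar>h\<bar> * norm (d (x+t *\<^sub>R v))\<le>\<bar>h\<bar> * B" by (rule mult_left_mono[OF B']) simp
    then show "norm (h *\<^sub>R d (x+t *\<^sub>R v))\<le>B * norm h" by (simp add: mult.commute)
   qed
  qed auto
  moreover have "norm (s n x) = norm (g (x+r n *\<^sub>R v) - g x)/r n"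
   using r(1)[of n] unfolding s_def norm_scaleR by (simp add: divide_inverse mult.commute)
  ultimately show ?thesis using True r(1)[of n] by (simp add: pos_divide_le_eq)
 next
  case False
  then have "g x = 0" "g (x+r n *\<^sub>R v) = 0"
   using out[of x 0] out[of x "r n"] r[of n] K(2) by auto
  then show ?thesis using False by (simp add: s_def)
 qed
 have shift: "integrable lborel (%x. g (x+c))" "(LINT x|lborel. g (x+c)) = (LINT x|lborel. g x)" for c
 proof -
  have m: "g\<in>borel_measurable borel" using contg by (rule borel_measurable_continuous_onI)
  show "integrable lborel (%x. g (x+c))"
   using gi integrable_distr_eq[of "(+) c" lborel borel g] m by (simp add: lborel_distr_plus add.commute)
  show "(LINT x|lborel. g (x+c)) = (LINT x|lborel. g x)"
   using integral_distr[of "(+) c" lborel borel g] m by (simp add: lborel_distr_plus add.commute)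
 qed
 have s_int: "integrable lborel (s n)" "(LINT x|lborel. s n x) = 0" for n
  unfolding s_def using shift[of "r n *\<^sub>R v"] gi by simp_all
 have "(%n. LINT x|lborel. s n x) \<longlonglongrightarrow> (LINT x|lborel. d x)"
 proof (rule integral_dominated_convergence[where w = "%x. B * indicator K' x"])
  show "integrable lborel (%x. B * indicator K' x)"
   using emeasure_compact_finite[OF K'] K' by (intro integrable_mult_right integrable_real_indicator) (auto simp: compact_imp_closed borel_closed)
  show "d\<in>borel_measurable lborel" using borel_measurable_continuous_onI[OF contd] by simp
  show "s n\<in>borel_measurable lborel" for n using s_int(1) by (rule borel_measurable_integrable)
 qed (use lim bound in auto)
 then have "(LINT x|lborel. d x) = 0" using s_int(2) LIMSEQ_unique tendsto_const by (simp add: LIMSEQ_const_iff)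
 then show "(LINT x|lborel. fderiv g x v) = 0" by (simp add: d_def)
qed

lemma integral_wirtinger_zero:
 fixes g :: "complex^'n::finite => complex"
 assumes g: "smooth_on UNIV g" and K: "compact K" "!!x. x \<notin> K ==> g x = 0"
 shows "(LINT x|lborel. wirtinger (Inr j) g x) = 0"
proof -
 have 1: "Ck_on (Suc 0) g UNIV" using g unfolding smooth_on_def by (rule spec)
 have "wirtinger (Inr j) g = (%x. (fderiv g x (axis j 1)+\<i> * fderiv g x (axis j \<i>))/2)"
  using smooth_on_differentiable[OF g] by (simp add: fun_eq_iff wirtinger.simps)
 then show ?thesis
  using integral_derivative_zero[OF 1 K] by simp
qed

section \<open>Integration on a compact Riemann surface\<close>

text \<open>The coefficient of a continuous (1,1)-form: it has one representative in every chart and is multiplied by the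
 square modulus of the derivative of the coordinate change.\<close>

definition density :: "('m,1) atlas => (('m,1) chart => 'm => complex) => bool" where
 "density A d\<longleftrightarrow>(\<forall>C\<in>A. continuous_on (snd C ` fst C) (%y. d C (cinv C y))) \<and>
   (\<forall>C\<in>A. \<forall>D\<in>A. \<forall>p\<in>fst C\<inter>fst D.
    d D p = of_real ((cmod (dz D p (%q. snd C q $ 1)))\<^sup>2) * d C p)"

definition chart_integral :: "('m,1) chart => ('m => complex) => complex" where
 "chart_integral C f = (LINT y : snd C ` fst C | lborel. f (cinv C y))"

definition chart_integrable :: "('m,1) chart => ('m => complex) => bool" where
 "chart_integrable C f\<longleftrightarrow>set_integrable lborel (snd C ` fst C) (%y. f (cinv C y))"

definition partition_integral ::
 "('m,1) chart set => (('m,1) chart => 'm => real) => (('m,1) chart => 'm => complex) => complex" where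
 "partition_integral K rho d = (\<Sum>C\<in>K. chart_integral C (%p. of_real (rho C p) * d C p))"

lemma chart_integral_sum:
 assumes "!!i. i\<in>I ==> chart_integrable C (f i)"
 shows "chart_integral C (%p. \<Sum>i\<in>I. f i p) = (\<Sum>i\<in>I. chart_integral C (f i))"
 using assms unfolding chart_integral_def chart_integrable_def set_lebesgue_integral_def set_integrable_def
 by (simp add: scaleR_sum_right Bochner_Integration.integral_sum)

lemma chart_integral_linear:
 assumes "chart_integrable C f" "chart_integrable C g"
 shows "chart_integral C (%p. a * f p+b * g p) = a * chart_integral C f+b * chart_integral C g"
proof -
 define F where "F = (%y. indicator (snd C ` fst C) y *\<^sub>R f (cinv C y))"
 define G where "G = (%y. indicator (snd C ` fst C) y *\<^sub>R g (cinv C y))"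
 have 1: "integrable lborel F" "integrable lborel G"
  using assms unfolding chart_integrable_def set_integrable_def F_def G_def by auto
 have "(%y. indicator (snd C ` fst C) y *\<^sub>R (a * f (cinv C y)+b * g (cinv C y))) = (%y. a * F y+b * G y)"
  by (simp add: fun_eq_iff scaleR_add_right F_def G_def)
 then show ?thesis
  using 1 unfolding chart_integral_def set_lebesgue_integral_def F_def[symmetric] G_def[symmetric] by simp
qed

lemma chart_integral_cong: "(!!p. p\<in>fst C ==> f p = g p) ==> inj_on (snd C) (fst C) ==> chart_integral C f = chart_integral C g"
 unfolding chart_integral_def set_lebesgue_integral_def
 by (rule Bochner_Integration.integral_cong) (auto simp: indicator_def the_inv_into_f_f)

context
 fixes A :: "('m,1) atlas"
 assumes A: "complex_atlas A"
begin

lemma densityD: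
 assumes "density A d"
 shows "C\<in>A ==> continuous_on (snd C ` fst C) (%y. d C (cinv C y))"
  "C\<in>A ==> D\<in>A ==> p\<in>fst C ==> p\<in>fst D ==>
   d D p = of_real ((cmod (dz D p (%q. snd C q $ 1)))\<^sup>2) * d C p"
proof -
 show "continuous_on (snd C ` fst C) (%y. d C (cinv C y))" if "C\<in>A"
  by (rule bspec[OF assms[unfolded density_def,THEN conjunct1] that])
 show "d D p = of_real ((cmod (dz D p (%q. snd C q $ 1)))\<^sup>2) * d C p"
  if "C\<in>A" "D\<in>A" "p\<in>fst C" "p\<in>fst D"
  by (rule assms[unfolded density_def,THEN conjunct2,THEN bspec,THEN bspec,THEN bspec]) (use that in auto)
qed

lemma continuous_map_chart:
 assumes "C\<in>A"
 shows "continuous_map (subtopology (atlas_topology A) (fst C)) euclidean (snd C)"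
  "continuous_map (subtopology euclidean (snd C ` fst C)) (atlas_topology A) (cinv C)"
proof -
 have top: "topspace (subtopology (atlas_topology A) (fst C)) = fst C"
  using assms openin_subset_points[OF A openin_chart[OF A assms]] by (simp add: topspace_atlas[OF A] Int_absorb1)
 show "continuous_map (subtopology (atlas_topology A) (fst C)) euclidean (snd C)"
  unfolding continuous_map_def top
 proof (intro conjI allI impI)
  fix V :: "(complex^1) set" assume "openin euclidean V"
  then have o: "open (V\<inter>snd C ` fst C)" using open_chart[OF A assms] by auto
  have "{x\<in>fst C. snd C x\<in>V} = cinv C ` (V\<inter>snd C ` fst C)"
  proof (intro equalityI subsetI)
   fix x assume "x\<in>{x\<in>fst C. snd C x\<in>V}"
   then show "x\<in>cinv C ` (V\<inter>snd C ` fst C)"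
    using assms by (intro image_eqI[of _ _ "snd C x"]) (auto simp: cinv_chart[OF A])
  qed (use assms in \<open>auto simp: cinv_chart[OF A]\<close>)
  then have "open_in A {x\<in>fst C. snd C x\<in>V}"
   using openin_chart_preimage[OF A assms o] by simp
  then show "openin (subtopology (atlas_topology A) (fst C)) {x\<in>fst C. snd C x\<in>V}"
   unfolding openin_subtopology by (intro exI[of _ "{x\<in>fst C. snd C x\<in>V}"]) auto
 qed auto
 show "continuous_map (subtopology euclidean (snd C ` fst C)) (atlas_topology A) (cinv C)"
  unfolding continuous_map_def
 proof (intro conjI allI impI)
  show "cinv C\<in>topspace (subtopology euclidean (snd C ` fst C)) \<rightarrow> topspace (atlas_topology A)"
   using assms by (auto simp: topspace_atlas[OF A] cinv_chart[OF A] points_iff)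
  fix V assume V: "open_in A V"
  have "{x\<in>topspace (subtopology euclidean (snd C ` fst C)). cinv C x\<in>V} = snd C ` (fst C\<inter>V)"
   using assms by (auto simp: cinv_chart[OF A])
  moreover have "openin (subtopology euclidean (snd C ` fst C)) (snd C ` (fst C\<inter>V))"
   using open_chart_image[OF A assms V] by (intro openin_open_subtopology[THEN iffD2]) (auto simp: open_chart[OF A assms] openin_open_eq)
  ultimately show "openin (subtopology euclidean (snd C ` fst C)) {x\<in>topspace (subtopology euclidean (snd C ` fst C)). cinv C x\<in>V}"
   by simp
 qed
qed

lemma compactin_chart_image:
 assumes "C\<in>A" "compactin (atlas_topology A) Q" "Q\<subseteq>fst C"
 shows "compact (snd C ` Q)"
proof -
 have "compactin (subtopology (atlas_topology A) (fst C)) Q" using assms by (simp add: compactin_subtopology)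
 then have "compactin euclidean (snd C ` Q)" using continuous_map_chart(1)[OF assms(1)] by (rule image_compactin)
 then show ?thesis by simp
qed

lemma compactin_chart_preimage:
 assumes "C\<in>A" "compact Q" "Q\<subseteq>snd C ` fst C"
 shows "compactin (atlas_topology A) (cinv C ` Q)"
proof -
 have "compactin (subtopology euclidean (snd C ` fst C)) Q" using assms by (simp add: compactin_subtopology)
 then show ?thesis using continuous_map_chart(2)[OF assms(1)] by (rule image_compactin)
qed

text \<open>The transformation factor of a density is the Jacobian determinant.\<close>

lemma chart_integral_change:
 assumes C: "C\<in>A" and D: "D\<in>A" and d: "density A d" and \<phi>: "smooth_fun A (points A) \<phi>"
  and sup: "!!p. p\<in>fst C ==> \<phi> p * d C p ~= 0 ==> p\<in>fst D" "!!p. p\<in>fst D ==> \<phi> p * d D p ~= 0 ==> p\<in>fst C"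
  and int: "chart_integrable D (%p. \<phi> p * d D p)"
 shows "chart_integral C (%p. \<phi> p * d C p) = chart_integral D (%p. \<phi> p * d D p)"
proof -
 define S where "S = snd C ` (fst C\<inter>fst D)"
 define psi where "psi = (%y. snd D (cinv C y))"
 define w where "w = (%y. dz C (cinv C y) (%q. snd D q $ 1))"
 define f where "f = (%y. \<phi> (cinv D y) * d D (cinv D y))"
 have Sp: "\<exists>p. p\<in>fst C\<and>p\<in>fst D\<and>y = snd C p\<and>cinv C y = p\<and>cinv D (psi y) = p" if "y\<in>S" for y
  using that C D by (auto simp: S_def psi_def cinv_chart[OF A])
 have im: "psi ` S = snd D ` (fst C\<inter>fst D)"
 proof -
  have "psi (snd C p) = snd D p" if "p\<in>fst C\<inter>fst D" for p
   using that C by (simp add: psi_def cinv_chart[OF A])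
  then show ?thesis unfolding S_def image_image by (intro image_cong) auto
 qed
 have oS: "open S" "open (psi ` S)"
  unfolding im unfolding S_def using open_chart_overlap[OF A C D] open_chart_overlap[OF A D C] by (simp_all add: Int_commute)
 have inj: "inj_on psi S"
 proof (rule inj_onI)
  fix y y' assume yy: "y\<in>S" "y'\<in>S" "psi y = psi y'"
  then show "y = y'" using Sp[OF yy(1)] Sp[OF yy(2)] by auto
 qed
 have der: "(psi has_derivative (%v. w y *s v)) (at y)" if y: "y\<in>S" for y
 proof -
  obtain J where J: "(psi has_derivative (%v. J *v v)) (at y)"
   using transition_hol[OF A C D] y unfolding hol_on_def psi_def S_def by auto
  obtain p where p: "p\<in>fst C" "y = snd C p" "cinv C y = p" using Sp[OF y] by auto
  have "w y = J $ 1 $ 1"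
   unfolding w_def p(3) coord_vec_eq using wirtinger_hol(1)[OF J,of 1 1] p(2) by (simp add: psi_def)
  then have "(%v. J *v v) = (%v. w y *s v)" by (simp add: fun_eq_iff vec1_eq_iff vec_mult_sum)
  with J show ?thesis by simp
 qed
 have contw: "continuous_on S w"
 proof -
  have "smooth_fun A (fst D) (%q. snd D q $ 1)" by (rule smooth_fun_coordinate[OF A D smooth_fun_chart[OF A D]])
  from smooth_on_coord_vec[OF A this C openin_chart[OF A D]] show ?thesis
   unfolding w_def S_def by (rule smooth_on_continuous)
 qed
 have contf: "continuous_on (snd D ` fst D) f"
 proof -
  have "smooth_fun A (fst D) \<phi>" by (rule smooth_fun_subset[OF A \<phi> openin_subset_points[OF A openin_chart[OF A D]]])
  then have "continuous_on (snd D ` fst D) (%y. \<phi> (cinv D y))"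
   using D smooth_on_continuous unfolding smooth_fun_iff by force
  then show ?thesis unfolding f_def using densityD(1)[OF d D] by (intro continuous_on_mult)
 qed
 have sub: "psi ` S\<subseteq>snd D ` fst D" unfolding im by auto
 have fint: "set_integrable lborel (psi ` S) f"
 proof (rule set_integrable_subset[OF _ _ sub])
  show "set_integrable lborel (snd D ` fst D) f" using int by (simp add: chart_integrable_def f_def)
 qed (use oS in simp)
 have "chart_integral D (%p. \<phi> p * d D p) = (LINT y:psi ` S|lborel. f y)"
  unfolding chart_integral_def set_lebesgue_integral_def f_def[symmetric]
 proof (rule Bochner_Integration.integral_cong[OF refl])
  fix y
  have "f y = 0" if "y\<in>snd D ` fst D" "y \<notin> psi ` S"
  proof -
   obtain p where p: "p\<in>fst D" "y = snd D p" using \<open>y\<in>snd D ` fst D\<close> by auto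
   then have "p \<notin> fst C" using that(2) unfolding im by auto
   then have "\<phi> p * d D p = 0" using sup(2)[OF p(1)] by blast
   then show ?thesis using p D by (simp add: f_def cinv_chart[OF A])
  qed
  then show "indicator (snd D ` fst D) y *\<^sub>R f y = indicator (psi ` S) y *\<^sub>R f y"
   using sub by (auto simp: indicator_def)
 qed
 also have "... = (LINT y:S|lborel. of_real ((cmod (w y))\<^sup>2) * f (psi y))"
  by (rule change_of_variables_C1[OF oS inj der contw continuous_on_subset[OF contf sub] fint])
 also have "... = chart_integral C (%p. \<phi> p * d C p)"
  unfolding chart_integral_def set_lebesgue_integral_def
 proof (rule Bochner_Integration.integral_cong[OF refl])
  fix y
  have 1: "of_real ((cmod (w y))\<^sup>2) * f (psi y) = \<phi> (cinv C y) * d C (cinv C y)" if yS: "y\<in>S"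
  proof -
   obtain p where p: "p\<in>fst C" "p\<in>fst D" "cinv C y = p" "cinv D (psi y) = p" using Sp[OF yS] by auto
   show ?thesis using densityD(2)[OF d D C p(2,1)] by (simp add: f_def w_def p)
  qed
  have 2: "\<phi> (cinv C y) * d C (cinv C y) = 0" if y: "y\<in>snd C ` fst C" "y \<notin> S"
  proof -
   obtain p where p: "p\<in>fst C" "y = snd C p" using y(1) by auto
   then have "p \<notin> fst D" using y(2) unfolding S_def by auto
   then have "\<phi> p * d C p = 0" using sup(1)[OF p(1)] by blast
   then show ?thesis using p C by (simp add: cinv_chart[OF A])
  qed
  have "S\<subseteq>snd C ` fst C" unfolding S_def by auto
  then show "indicator S y *\<^sub>R (of_real ((cmod (w y))\<^sup>2) * f (psi y)) =
    indicator (snd C ` fst C) y *\<^sub>R (\<phi> (cinv C y) * d C (cinv C y))"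
   using 1 2 by (auto simp: indicator_def)
 qed
 finally show ?thesis by simp
qed

context
 assumes compact: "compact_space (atlas_topology A)"
begin

lemma support_in_chart:
 assumes C: "C\<in>A" and cl: "atlas_topology A closure_of {p\<in>points A. rho p ~= (0::real)}\<subseteq>fst C"
 obtains Q where "compact Q" "Q\<subseteq>snd C ` fst C" "!!p. p\<in>points A ==> rho p ~= 0 ==> p\<in>fst C\<and>snd C p\<in>Q"
  "open_in A (points A - cinv C ` Q)"
proof
 let ?F = "atlas_topology A closure_of {p\<in>points A. rho p ~= 0}"
 have F: "closedin (atlas_topology A) ?F" by (rule closedin_closure_of)
 have "compactin (atlas_topology A) ?F"
  by (rule closedin_compact_space[OF compact F])
 then show "compact (snd C ` ?F)" using C cl by (intro compactin_chart_image)
 show "snd C ` ?F\<subseteq>snd C ` fst C" using cl by auto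
 have sub: "{p\<in>points A. rho p ~= 0}\<subseteq>?F"
  by (rule closure_of_subset) (auto simp: topspace_atlas[OF A])
 show "p\<in>fst C\<and>snd C p\<in>snd C ` ?F" if "p\<in>points A" "rho p ~= 0" for p
  using sub cl that by blast
 have "cinv C ` snd C ` ?F = ?F"
 proof -
  have "cinv C ` snd C ` ?F = (%p. p) ` ?F"
   unfolding image_image by (rule image_cong[OF refl]) (use cl C cinv_chart[OF A] in blast)
  then show ?thesis by simp
 qed
 then show "open_in A (points A - cinv C ` snd C ` ?F)"
  using F by (simp add: closedin_def topspace_atlas[OF A])
qed

lemma partition_of_unityD:
 assumes "partition_of_unity A K rho"
 shows "finite K" "K\<subseteq>A" "!!C. C\<in>K ==> smooth_fun A (points A) (rho C)"
  "!!C. C\<in>K ==> atlas_topology A closure_of {p\<in>points A. rho C p ~= 0}\<subseteq>fst C"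
  "!!p. p\<in>points A ==> (\<Sum>C\<in>K. rho C p) = 1"
 using assms unfolding partition_of_unity_def by blast+

lemma smooth_fun_complex_of_real: "smooth_fun A (points A) r ==> smooth_fun A (points A) (%p. complex_of_real (r p))"
 by (rule smooth_fun_linear[OF A bounded_linear_of_real openin_points[OF A]])

lemma chart_integrable_density:
 assumes d: "density A d" and C: "C\<in>A" and \<phi>: "smooth_fun A (points A) \<phi>"
  and Q: "compact Q" "Q\<subseteq>snd C ` fst C" "!!p. p\<in>fst C ==> \<phi> p * d C p ~= 0 ==> snd C p\<in>Q"
 shows "chart_integrable C (%p. \<phi> p * d C p)"
 unfolding chart_integrable_def
proof (rule integrable_compact_support[OF Q(1,2)])
 have "smooth_fun A (fst C) \<phi>" by (rule smooth_fun_subset[OF A \<phi> openin_subset_points[OF A openin_chart[OF A C]]])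
 then have "continuous_on (snd C ` fst C) (%y. \<phi> (cinv C y))"
  using C smooth_on_continuous unfolding smooth_fun_iff by force
 then show "continuous_on (snd C ` fst C) (%y. \<phi> (cinv C y) * d C (cinv C y))"
  using densityD(1)[OF d C] by (intro continuous_on_mult)
 show "\<phi> (cinv C y) * d C (cinv C y) = 0" if "y\<in>snd C ` fst C" "y \<notin> Q" for y
 proof -
  have *: "cinv C y\<in>fst C" "snd C (cinv C y) = y" using that C chart_mult_left[OF A] by auto
  then show ?thesis using Q(3)[OF *(1)] that(2) by auto
 qed
qed

lemma partition_integrable:
 assumes d: "density A d" and P: "partition_of_unity A K rho" and C: "C\<in>K" and \<phi>: "smooth_fun A (points A) \<phi>"
 shows "chart_integrable C (%p. (of_real (rho C p) * \<phi> p) * d C p)"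
proof -
 note PD = partition_of_unityD[OF P]
 have CA: "C\<in>A" using PD(2) C by blast
 obtain Q where Q: "compact Q" "Q\<subseteq>snd C ` fst C" "!!p. p\<in>points A ==> rho C p ~= 0 ==> p\<in>fst C\<and>snd C p\<in>Q"
  using support_in_chart[OF CA PD(4)[OF C]] by metis
 have sub: "fst C\<subseteq>points A" by (rule openin_subset_points[OF A openin_chart[OF A CA]])
 show ?thesis
 proof (rule chart_integrable_density[OF d CA _ Q(1,2)])
  show "smooth_fun A (points A) (%p. complex_of_real (rho C p) * \<phi> p)"
   by (intro smooth_fun_mult[OF A openin_points[OF A]] smooth_fun_complex_of_real PD(3)[OF C] \<phi>)
  show "snd C p\<in>Q" if "p\<in>fst C" "complex_of_real (rho C p) * \<phi> p * d C p ~= 0" for p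
   using Q(3)[of p] that sub by auto
 qed
qed

text \<open>Inserting the second partition and exchanging the sums leaves integrals over overlaps of charts, which agree
 in both charts.\<close>

lemma partition_integral_unique:
 assumes d: "density A d" and P: "partition_of_unity A K rho" and P': "partition_of_unity A K' rho'"
 shows "partition_integral K rho d = partition_integral K' rho' d"
proof -
 note PD = partition_of_unityD[OF P] and PD' = partition_of_unityD[OF P']
 let ?f = "%C D p. (of_real (rho C p) * of_real (rho' D p)) * d C p"
 let ?g = "%C D p. (of_real (rho' D p) * of_real (rho C p)) * d D p"
 have pts: "p\<in>points A" if "C\<in>A" "p\<in>fst C" for C p
  using that openin_subset_points[OF A openin_chart[OF A that(1)]] by blast
 have i1: "chart_integrable C (?f C D)" if "C\<in>K" "D\<in>K'" for C D
  by (rule partition_integrable[OF d P that(1) smooth_fun_complex_of_real[OF PD'(3)[OF that(2)]]])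
 have i2: "chart_integrable D (?g C D)" if "C\<in>K" "D\<in>K'" for C D
  by (rule partition_integrable[OF d P' that(2) smooth_fun_complex_of_real[OF PD(3)[OF that(1)]]])
 have sw: "chart_integral C (?f C D) = chart_integral D (?g C D)" if CD: "C\<in>K" "D\<in>K'" for C D
 proof -
  have CA: "C\<in>A" "D\<in>A" using CD PD(2) PD'(2) by auto
  have s: "p\<in>fst C" if "p\<in>points A" "rho C p ~= 0" for p
   using support_in_chart[OF CA(1) PD(4)[OF CD(1)]] that by metis
  have s': "p\<in>fst D" if "p\<in>points A" "rho' D p ~= 0" for p
   using support_in_chart[OF CA(2) PD'(4)[OF CD(2)]] that by metis
  have "chart_integral C (?f C D) = chart_integral D (%p. (of_real (rho C p) * of_real (rho' D p)) * d D p)"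
  proof (rule chart_integral_change[OF CA d])
   show "smooth_fun A (points A) (%p. complex_of_real (rho C p) * complex_of_real (rho' D p))"
    by (intro smooth_fun_mult[OF A openin_points[OF A]] smooth_fun_complex_of_real PD(3)[OF CD(1)] PD'(3)[OF CD(2)])
   show "p\<in>fst D" if "p\<in>fst C" "complex_of_real (rho C p) * complex_of_real (rho' D p) * d C p ~= 0" for p
    using s'[OF pts[OF CA(1) that(1)]] that(2) by auto
   show "p\<in>fst C" if "p\<in>fst D" "complex_of_real (rho C p) * complex_of_real (rho' D p) * d D p ~= 0" for p
    using s[OF pts[OF CA(2) that(1)]] that(2) by auto
   show "chart_integrable D (%p. complex_of_real (rho C p) * complex_of_real (rho' D p) * d D p)"
    using i2[OF CD] by (simp add: mult_ac)
  qed
  then show ?thesis by (simp add: mult_ac)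
 qed
 have "partition_integral K rho d = (\<Sum>C\<in>K. chart_integral C (%p. \<Sum>D\<in>K'. ?f C D p))"
  unfolding partition_integral_def
 proof (rule sum.cong[OF refl],rule chart_integral_cong)
  fix C p assume C: "C\<in>K" "p\<in>fst C"
  have "p\<in>points A" using C PD(2) pts by blast
  from arg_cong[OF PD'(5)[OF this],of complex_of_real]
  have "(\<Sum>D\<in>K'. complex_of_real (rho' D p)) = 1" by simp
  then show "of_real (rho C p) * d C p = (\<Sum>D\<in>K'. ?f C D p)"
   by (simp add: sum_distrib_left[symmetric] sum_distrib_right[symmetric])
 qed (use PD(2) chart_inj[OF A] in blast)
 also have "... = (\<Sum>C\<in>K. \<Sum>D\<in>K'. chart_integral C (?f C D))"
  using i1 by (intro sum.cong[OF refl] chart_integral_sum) auto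
 also have "... = (\<Sum>C\<in>K. \<Sum>D\<in>K'. chart_integral D (?g C D))"
  using sw by (intro sum.cong refl) auto
 also have "... = (\<Sum>D\<in>K'. \<Sum>C\<in>K. chart_integral D (?g C D))" by (rule sum.swap)
 also have "... = (\<Sum>D\<in>K'. chart_integral D (%p. \<Sum>C\<in>K. ?g C D p))"
  using i2 by (intro sum.cong[OF refl] chart_integral_sum[symmetric]) auto
 also have "... = partition_integral K' rho' d"
  unfolding partition_integral_def
 proof (rule sum.cong[OF refl],rule chart_integral_cong)
  fix D p assume D: "D\<in>K'" "p\<in>fst D"
  have "p\<in>points A" using D PD'(2) pts by blast
  from arg_cong[OF PD(5)[OF this],of complex_of_real]
  have "(\<Sum>C\<in>K. complex_of_real (rho C p)) = 1" by simp
  then show "(\<Sum>C\<in>K. ?g C D p) = of_real (rho' D p) * d D p"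
   by (simp add: sum_distrib_left[symmetric] sum_distrib_right[symmetric])
 qed (use PD'(2) chart_inj[OF A] in blast)
 finally show ?thesis .
qed

lemma density_lap:
 assumes "smooth_fun A (points A) u"
 shows "density A (%C. lap C u)"
 unfolding density_def
proof (intro conjI ballI)
 fix C assume C: "C\<in>A"
 have o: "open_in A (points A)" "open_in A (points A\<inter>fst C)"
  using openin_points[OF A] openin_chart[OF A C] by auto
 have sub: "fst C\<subseteq>points A" by (rule openin_subset_points[OF A openin_chart[OF A C]])
 have "smooth_fun A (points A\<inter>fst C\<inter>fst C) (%p. dbar C p (%p. dz C p u))"
  by (rule smooth_fun_coord_vec[OF A smooth_fun_coord_vec[OF A assms C o(1)] C o(2)])
 then have "smooth_fun A (fst C) (lap C u)" unfolding lap_def by (rule smooth_fun_subset[OF A]) (use sub in auto)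
 then show "continuous_on (snd C ` fst C) (%y. lap C u (cinv C y))"
  using C smooth_on_continuous unfolding smooth_fun_iff by force
next
 fix C D p assume CD: "C\<in>A" "D\<in>A" "p\<in>fst C\<inter>fst D"
 then have p: "p\<in>fst C" "p\<in>fst D" "p\<in>points A" by (auto simp: points_iff)
 show "lap D u p = complex_of_real ((cmod (dz D p (%q. snd C q $ 1)))\<^sup>2) * lap C u p"
  unfolding lap_change[OF A CD(1) p(1) CD(2) p(2) assms openin_points[OF A] p(3)] Let_def
  by (simp only: complex_norm_square)
qed

lemma lap_sum:
 assumes "!!i. i\<in>I ==> smooth_fun A (points A) (u i)" "C\<in>A" "p\<in>fst C"
 shows "lap C (%q. \<Sum>i\<in>I. u i q) p = (\<Sum>i\<in>I. lap C (u i) p)"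
 using assms(1)
proof (induction I rule: infinite_finite_induct)
 case (insert i I)
 have o: "open_in A (points A)" by (rule openin_points[OF A])
 have sub: "fst C\<subseteq>points A" by (rule openin_subset_points[OF A openin_chart[OF A assms(2)]])
 have s: "smooth_fun A (points A) (u i)" "smooth_fun A (points A) (%q. \<Sum>i\<in>I. u i q)"
  using insert by (auto intro!: smooth_fun_sum[OF A o])
 have 1: "dz C q (%q. u i q+(\<Sum>i\<in>I. u i q)) = dz C q (u i)+dz C q (%q. \<Sum>i\<in>I. u i q)"
  if "q\<in>fst C" for q
  by (intro coord_vec_add smooth_fun_cdiff[OF A s(1) assms(2) that] smooth_fun_cdiff[OF A s(2) assms(2) that]) (use that sub in auto)
 have pp: "p\<in>points A" using assms(3) sub by blast
 have "lap C (%q. \<Sum>i\<in>insert i I. u i q) p = dbar C p (%q. dz C q (u i)+dz C q (%q. \<Sum>i\<in>I. u i q))"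
  unfolding lap_def using insert(1,2)
  by (intro coord_vec_cong(1)[OF A assms(2,3) openin_chart[OF A assms(2)] assms(3)]) (simp add: 1)
 also have "... = lap C (u i) p+lap C (%q. \<Sum>i\<in>I. u i q) p"
  unfolding lap_def
  by (intro coord_vec_add cdiff_coord_vec[OF A s(1) assms(2) o pp assms(3)] cdiff_coord_vec[OF A s(2) assms(2) o pp assms(3)])
 finally show ?case using insert by simp
qed (simp_all add: lap_def)

text \<open>A function with compact support in the chart extends by zero to the plane, where the integral of a derivative
 vanishes.\<close>

lemma chart_integral_lap_zero:
 assumes C: "C\<in>A" and u: "smooth_fun A (points A) u"
  and Q: "compact Q" "Q\<subseteq>snd C ` fst C" "!!p. p\<in>fst C ==> u p ~= 0 ==> snd C p\<in>Q"
 shows "chart_integral C (lap C u) = 0"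
proof -
 let ?S = "snd C ` fst C"
 have o: "open ?S" by (rule open_chart[OF A C])
 have sub: "fst C\<subseteq>points A" by (rule openin_subset_points[OF A openin_chart[OF A C]])
 define f where "f = (%y. if y\<in>?S then u (cinv C y) else 0)"
 have f0: "f y = 0" if "y \<notin> Q" for y
 proof (cases "y\<in>?S")
  case True
  have "cinv C y\<in>fst C" "snd C (cinv C y) = y" using chart_mult_left[OF A C True] by auto
  then show ?thesis using Q(3)[of "cinv C y"] that by (auto simp: f_def)
 qed (simp add: f_def)
 have smf: "smooth_on UNIV f"
 proof (rule smooth_on_local)
  fix y
  show "\<exists>N. open N\<and>y\<in>N\<and>smooth_on (UNIV\<inter>N) f"
  proof (cases "y\<in>?S")
   case True
   have "snd C ` (fst C\<inter>points A) = ?S" using sub by (simp add: Int_absorb2)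
   then have "smooth_on ?S (%y. u (cinv C y))" using u C unfolding smooth_fun_iff by force
   then have "smooth_on ?S f" by (subst smooth_on_cong[OF o]) (auto simp: f_def)
   then show ?thesis using True o by auto
  next
   case False
   have "open (- Q)" using Q(1) by (simp add: compact_imp_closed open_Compl)
   moreover have "smooth_on (- Q) f"
    using smooth_on_cong[OF \<open>open (- Q)\<close>,of f "%_. 0"] f0 smooth_on_const by auto
   ultimately show ?thesis using False Q(2) by (intro exI[of _ "- Q"]) auto
  qed
 qed
 have W: "smooth_on UNIV (wirtinger (Inl 1) f)" by (rule smooth_on_wirtinger[OF open_UNIV smf])
 have W0: "wirtinger k f y = 0" if "y \<notin> Q" for y and k :: "1+1"
  using wirtinger_cong_open[of "- Q" y f "%_. 0" k] that f0 Q(1) by (simp add: compact_imp_closed open_Compl)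
 have WW0: "wirtinger (Inr 1) (wirtinger (Inl 1) f) y = 0" if "y \<notin> Q" for y
  using wirtinger_cong_open[of "- Q" y "wirtinger (Inl 1) f" "%_. 0" "Inr 1"] that W0 Q(1)
  by (simp add: compact_imp_closed open_Compl)
 have eq: "lap C u (cinv C y) = wirtinger (Inr 1) (wirtinger (Inl 1) f) y" if y: "y\<in>?S" for y
 proof -
  have cy: "cinv C y\<in>fst C" "snd C (cinv C y) = y" using y C chart_mult_left[OF A] by auto
  have "lap C u (cinv C y) = wirtinger (Inr 1) (%y. dz C (cinv C y) u) y"
   by (simp add: lap_def coord_vec_eq[of C "Inr 1"] cy(2))
  also have "... = wirtinger (Inr 1) (wirtinger (Inl 1) f) y"
  proof (rule wirtinger_cong_open[OF o y])
   fix z assume z: "z\<in>?S"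
   then have "snd C (cinv C z) = z" using C chart_mult_left[OF A] by auto
   then show "dz C (cinv C z) u = wirtinger (Inl 1) f z"
    unfolding coord_vec_eq by (simp,intro wirtinger_cong_open[OF o z]) (simp add: f_def)
  qed
  finally show ?thesis .
 qed
 have "chart_integral C (lap C u) = (LINT y|lborel. wirtinger (Inr 1) (wirtinger (Inl 1) f) y)"
  unfolding chart_integral_def set_lebesgue_integral_def
  by (rule Bochner_Integration.integral_cong[OF refl]) (use eq WW0 Q(2) in \<open>auto simp: indicator_def\<close>)
 also have "... = 0" by (rule integral_wirtinger_zero[OF W Q(1) W0])
 finally show ?thesis .
qed

text \<open>Write \<open>u\<close> as the sum of its products with the functions of the partition. Each is supported in
 one chart, so that its integral can be computed in that chart alone.\<close>

lemma partition_integral_lap: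
 assumes u: "smooth_fun A (points A) u" and P: "partition_of_unity A K rho"
 shows "partition_integral K rho (%C. lap C u) = 0"
proof -
 note PD = partition_of_unityD[OF P]
 define v where "v = (%D p. complex_of_real (rho D p) * u p)"
 have pts: "p\<in>points A" if "C\<in>A" "p\<in>fst C" for C p
  using that openin_subset_points[OF A openin_chart[OF A that(1)]] by blast
 have sv: "smooth_fun A (points A) (v D)" if "D\<in>K" for D
  unfolding v_def by (intro smooth_fun_mult[OF A openin_points[OF A]] smooth_fun_complex_of_real PD(3)[OF that] u)
 have sr: "smooth_fun A (points A) (%p. complex_of_real (rho C p))" if "C\<in>K" for C
  by (rule smooth_fun_complex_of_real[OF PD(3)[OF that]])
 have supp: "\<exists>Q. compact Q\<and>Q\<subseteq>snd D ` fst D\<and>(\<forall>p\<in>points A. v D p ~= 0 --> p\<in>fst D\<and>snd D p\<in>Q) \<and>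
   (\<forall>C\<in>A. \<forall>p\<in>fst C. lap C (v D) p ~= 0 --> p\<in>fst D\<and>snd D p\<in>Q)" if D: "D\<in>K" for D
 proof -
  have DA: "D\<in>A" using D PD(2) by blast
  obtain Q where Q: "compact Q" "Q\<subseteq>snd D ` fst D" "!!p. p\<in>points A ==> rho D p ~= 0 ==> p\<in>fst D\<and>snd D p\<in>Q"
   "open_in A (points A - cinv D ` Q)"
   using support_in_chart[OF DA PD(4)[OF D]] by metis
  let ?N = "points A - cinv D ` Q"
  have z: "v D q = 0" if "q\<in>?N" for q
   using Q(3)[of q] that cinv_chart[OF A DA,of q] unfolding v_def by force
  have "lap C (v D) p = 0" if C: "C\<in>A" "p\<in>fst C" "p\<in>?N" for C p
  proof -
   have z': "dz C q (v D) = 0" if "q\<in>?N\<inter>fst C" for q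
    using coord_vec_cong(1)[OF A C(1) _ Q(4),of q "v D" "%_. 0" "Inl 1"] that z by simp
   show ?thesis
    unfolding lap_def
    using coord_vec_cong(1)[OF A C(1,2) openin_Int[OF Q(4) openin_chart[OF A C(1)]],of "%q. dz C q (v D)" "%_. 0" "Inr 1"] C z'
    by simp
  qed
  moreover have "p\<in>fst D\<and>snd D p\<in>Q" if "p\<in>cinv D ` Q" for p
   using that Q(2) DA chart_mult_left[OF A DA] by auto
  ultimately have "p\<in>fst D\<and>snd D p\<in>Q" if "C\<in>A" "p\<in>fst C" "lap C (v D) p ~= 0" for C p
   using that pts[OF that(1,2)] by blast
  moreover have "p\<in>fst D\<and>snd D p\<in>Q" if "p\<in>points A" "v D p ~= 0" for p
   using Q(3)[OF that(1)] that(2) by (auto simp: v_def)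
  ultimately show ?thesis using Q(1,2) by blast
 qed
 have dens: "density A (%C. lap C (v D))" if "D\<in>K" for D by (rule density_lap[OF sv[OF that]])
 have i1: "chart_integrable C (%p. of_real (rho C p) * lap C (v D) p)" if "C\<in>K" "D\<in>K" for C D
  using partition_integrable[OF dens[OF that(2)] P that(1) smooth_fun_const[OF A,of _ 1]] by simp
 have i2: "chart_integrable D (%p. of_real (rho C p) * lap D (v D) p)" if CD: "C\<in>K" "D\<in>K" for C D
 proof -
  have DA: "D\<in>A" using CD PD(2) by blast
  obtain Q where Q: "compact Q" "Q\<subseteq>snd D ` fst D" "\<forall>C\<in>A. \<forall>p\<in>fst C. lap C (v D) p ~= 0 --> p\<in>fst D\<and>snd D p\<in>Q"
   using supp[OF CD(2)] by blast
  show ?thesis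
   by (rule chart_integrable_density[OF dens[OF CD(2)] DA sr[OF CD(1)] Q(1,2)]) (use Q(3) DA in auto)
 qed
 have sw: "chart_integral C (%p. of_real (rho C p) * lap C (v D) p) = chart_integral D (%p. of_real (rho C p) * lap D (v D) p)"
  if CD: "C\<in>K" "D\<in>K" for C D
 proof -
  have CA: "C\<in>A" "D\<in>A" using CD PD(2) by auto
  show ?thesis
  proof (rule chart_integral_change[OF CA dens[OF CD(2)] sr[OF CD(1)] _ _ i2[OF CD]])
   show "p\<in>fst D" if "p\<in>fst C" "of_real (rho C p) * lap C (v D) p ~= 0" for p
   proof -
    have "lap C (v D) p ~= 0" using that(2) by auto
    then show ?thesis using supp[OF CD(2)] CA(1) that(1) by blast
   qed
   show "p\<in>fst C" if "p\<in>fst D" "of_real (rho C p) * lap D (v D) p ~= 0" for p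
   proof -
    have "rho C p ~= 0" using that(2) by auto
    then show ?thesis using support_in_chart[OF CA(1) PD(4)[OF CD(1)]] pts[OF CA(2) that(1)] by metis
   qed
  qed
 qed
 have one: "(\<Sum>C\<in>K. complex_of_real (rho C p)) = 1" if "p\<in>points A" for p
  using arg_cong[OF PD(5)[OF that],of complex_of_real] by simp
 have lapu: "lap C u p = (\<Sum>D\<in>K. lap C (v D) p)" if C: "C\<in>A" "p\<in>fst C" for C p
 proof -
  have uq: "u q = (\<Sum>D\<in>K. v D q)" if "q\<in>points A" for q
   using one[OF that] by (simp add: v_def sum_distrib_right[symmetric])
  have 1: "dz C q u = dz C q (%q. \<Sum>D\<in>K. v D q)" if "q\<in>fst C" for q
   by (rule coord_vec_cong(1)[OF A C(1) that openin_points[OF A] pts[OF C(1) that] uq])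
  have "lap C u p = lap C (%q. \<Sum>D\<in>K. v D q) p"
   unfolding lap_def by (rule coord_vec_cong(1)[OF A C openin_chart[OF A C(1)] C(2) 1])
  also have "... = (\<Sum>D\<in>K. lap C (v D) p)" by (rule lap_sum[OF sv C])
  finally show ?thesis .
 qed
 have "partition_integral K rho (%C. lap C u) = (\<Sum>C\<in>K. chart_integral C (%p. \<Sum>D\<in>K. of_real (rho C p) * lap C (v D) p))"
  unfolding partition_integral_def
  by (rule sum.cong[OF refl],rule chart_integral_cong)
   (use lapu PD(2) chart_inj[OF A] in \<open>auto simp: sum_distrib_left\<close>)
 also have "... = (\<Sum>C\<in>K. \<Sum>D\<in>K. chart_integral C (%p. of_real (rho C p) * lap C (v D) p))"
  using i1 by (intro sum.cong[OF refl] chart_integral_sum) auto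
 also have "... = (\<Sum>C\<in>K. \<Sum>D\<in>K. chart_integral D (%p. of_real (rho C p) * lap D (v D) p))"
  using sw by (intro sum.cong refl) auto
 also have "... = (\<Sum>D\<in>K. \<Sum>C\<in>K. chart_integral D (%p. of_real (rho C p) * lap D (v D) p))" by (rule sum.swap)
 also have "... = (\<Sum>D\<in>K. chart_integral D (%p. \<Sum>C\<in>K. of_real (rho C p) * lap D (v D) p))"
  using i2 by (intro sum.cong[OF refl] chart_integral_sum[symmetric]) auto
 also have "... = (\<Sum>D\<in>K. chart_integral D (lap D (v D)))"
 proof (rule sum.cong[OF refl],rule chart_integral_cong)
  fix D p assume D: "D\<in>K" "p\<in>fst D"
  then have "p\<in>points A" using PD(2) pts by blast
  then show "(\<Sum>C\<in>K. of_real (rho C p) * lap D (v D) p) = lap D (v D) p"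
   using one by (simp add: sum_distrib_right[symmetric])
 qed (use PD(2) chart_inj[OF A] in blast)
 also have "... = 0"
 proof (rule sum.neutral,rule ballI)
  fix D assume D: "D\<in>K"
  then have DA: "D\<in>A" using PD(2) by blast
  obtain Q where Q: "compact Q" "Q\<subseteq>snd D ` fst D" "\<forall>p\<in>points A. v D p ~= 0 --> p\<in>fst D\<and>snd D p\<in>Q"
   using supp[OF D] by blast
  show "chart_integral D (lap D (v D)) = 0"
   by (rule chart_integral_lap_zero[OF DA sv[OF D] Q(1,2)]) (use Q(3) pts[OF DA] in auto)
 qed
 finally show ?thesis .
qed

end

end

text \<open>A smooth function with exactly the coordinate ball as its set of positivity; the function \<open>flat\<close>
 vanishes to infinite order at the boundary.\<close>

definition bump :: "('m,1) chart => complex^1 => real => 'm => real" where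
 "bump C y e q = (if q\<in>fst C then flat 0 (e\<^sup>2 - (snd C q - y) \<bullet> (snd C q - y)) else 0)"

lemma flat_pos_iff: "flat n t > 0\<longleftrightarrow>t > 0" and flat_nonneg: "flat n t \<ge> 0"
 by (auto simp: flat_def)

definition form_coeff :: "'m form2 => ('m,1) chart => 'm => complex" where
 "form_coeff F C p = F p (dz C p) (dbar C p)"

context
 fixes A :: "('m,1) atlas"
 assumes A: "complex_atlas A" and compact: "compact_space (atlas_topology A)"
  and haus: "Hausdorff_space (atlas_topology A)"
begin

lemma bump:
 assumes C: "C\<in>A" and e: "e > 0" "cball y e\<subseteq>snd C ` fst C"
 shows "smooth_fun A (points A) (bump C y e)" "bump C y e q \<ge> 0"
  "{q\<in>points A. bump C y e q > 0} = cinv C ` ball y e"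
  "closedin (atlas_topology A) (cinv C ` cball y e)" "cinv C ` cball y e\<subseteq>fst C"
proof -
 show cl: "closedin (atlas_topology A) (cinv C ` cball y e)"
  by (rule compactin_imp_closedin[OF haus compactin_chart_preimage[OF A C compact_cball e(2)]])
 show sub: "cinv C ` cball y e\<subseteq>fst C" using e(2) chart_mult_left[OF A C] by blast
 show "bump C y e q \<ge> 0" by (simp add: bump_def flat_nonneg)
 have pos: "bump C y e q > 0\<longleftrightarrow>q\<in>fst C\<and>snd C q\<in>ball y e" for q
 proof -
  have "e\<^sup>2 - (snd C q - y) \<bullet> (snd C q - y) > 0\<longleftrightarrow>norm (snd C q - y) < e"
   using abs_less_iff power2_less_imp_less[of "norm (snd C q - y)" e] e(1)
    power_strict_mono[of "norm (snd C q - y)" e 2] by (auto simp: power2_norm_eq_inner[symmetric])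
  then show ?thesis by (auto simp: bump_def flat_pos_iff dist_norm norm_minus_commute)
 qed
 show "{q\<in>points A. bump C y e q > 0} = cinv C ` ball y e"
 proof (intro equalityI subsetI)
  fix q assume "q\<in>{q\<in>points A. bump C y e q > 0}"
  then have "q\<in>fst C" "snd C q\<in>ball y e" using pos by auto
  then show "q\<in>cinv C ` ball y e" using cinv_chart[OF A C,of q] by (intro image_eqI[of _ _ "snd C q"]) auto
 next
  fix q assume "q\<in>cinv C ` ball y e"
  then obtain z where z: "z\<in>ball y e" "q = cinv C z" by auto
  then have "z\<in>snd C ` fst C" using e(2) ball_subset_cball by blast
  then have "q\<in>fst C" "snd C q = z" using chart_mult_left[OF A C] z(2) by auto
  then show "q\<in>{q\<in>points A. bump C y e q > 0}" using pos z(1) C by (auto simp: points_iff)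
 qed
 show "smooth_fun A (points A) (bump C y e)"
 proof (rule smooth_fun_local[OF A])
  fix p assume p: "p\<in>points A"
  have oC: "open_in A (fst C)" by (rule openin_chart[OF A C])
  show "\<exists>N. open_in A N\<and>p\<in>N\<and>smooth_fun A (points A\<inter>N) (bump C y e)"
  proof (cases "p\<in>fst C")
   case True
   let ?S = "snd C ` fst C"
   have o: "open ?S" by (rule open_chart[OF A C])
   have lin: "smooth_on ?S (%z. z+(- y))"
    by (intro smooth_on_add[OF o] smooth_on_const smooth_on_bounded_linear bounded_linear_ident)
   have "smooth_on ?S (%z. e\<^sup>2+- 1 * ((z+- y) \<bullet> (z+- y)))"
    by (intro smooth_on_add[OF o] smooth_on_const smooth_on_mult[OF o] smooth_on_bilinear[OF bounded_bilinear_inner o] lin)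
   then have "smooth_on ?S (%z. flat 0 (e\<^sup>2+- 1 * ((z+- y) \<bullet> (z+- y))))"
    by (rule smooth_on_compose[where f = "flat 0" and T = UNIV,OF o open_UNIV subset_UNIV smooth_on_flat])
   then have "smooth_on ?S (%z. bump C y e (cinv C z))"
    by (subst smooth_on_cong[OF o]) (use chart_mult_left[OF A C] in \<open>auto simp: bump_def\<close>)
   then have "smooth_fun A (fst C) (bump C y e)" by (rule smooth_fun_chartI[OF A C oC subset_refl])
   then have "smooth_fun A (points A\<inter>fst C) (bump C y e)" by (rule smooth_fun_subset[OF A]) simp
   then show ?thesis using True oC by blast
  next
   case False
   let ?N = "points A - cinv C ` cball y e"
   have oN: "open_in A ?N" using cl by (simp add: closedin_def topspace_atlas[OF A])
   have z: "bump C y e q = 0" if "q\<in>?N" for q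
   proof -
    have "\<not> bump C y e q > 0"
    proof
     assume "bump C y e q > 0"
     then have "q\<in>fst C" "snd C q\<in>cball y e" using pos ball_subset_cball by blast+
     then have "q\<in>cinv C ` cball y e" using cinv_chart[OF A C,of q] by (intro image_eqI[of _ _ "snd C q"]) auto
     then show False using that by blast
    qed
    moreover have "bump C y e q \<ge> 0" by (simp add: bump_def flat_nonneg)
    ultimately show ?thesis by linarith
   qed
   have "smooth_fun A ?N (bump C y e)"
    by (subst smooth_fun_cong[OF A oN z]) (auto intro: smooth_fun_const[OF A])
   then have "smooth_fun A (points A\<inter>?N) (bump C y e)" by (rule smooth_fun_subset[OF A]) simp
   moreover have "p\<in>?N" using p False sub by blast
   ultimately show ?thesis using oN by blast
  qed
 qed
qed

text \<open>Finitely many coordinate balls cover the compact surface; divide their bump functions by the sum and collect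
 those that live in the same chart.\<close>

lemma partition_of_unity_exists: "\<exists>K rho. partition_of_unity A K rho"
proof -
 have "\<exists>e>0. cball (snd (base_chart A p) p) e\<subseteq>snd (base_chart A p) ` fst (base_chart A p)" if "p\<in>points A" for p
 proof -
  have B: "base_chart A p\<in>A" "p\<in>fst (base_chart A p)" using base_chart[OF that] by auto
  then show ?thesis using open_chart[OF A B(1)] open_contains_cball by blast
 qed
 then obtain e where e: "!!p. p\<in>points A ==> e p > 0"
  "!!p. p\<in>points A ==> cball (snd (base_chart A p) p) (e p)\<subseteq>snd (base_chart A p) ` fst (base_chart A p)"
  by metis
 define b where "b = (%p. bump (base_chart A p) (snd (base_chart A p) p) (e p))"
 define N where "N = (%p. {q\<in>points A. b p q > 0})"
 define Z where "Z = (%p. cinv (base_chart A p) ` cball (snd (base_chart A p) p) (e p))"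
 have B: "base_chart A p\<in>A" "p\<in>fst (base_chart A p)" if "p\<in>points A" for p using base_chart[OF that] by auto
 have b: "smooth_fun A (points A) (b p)" "!!q. b p q \<ge> 0"
  "N p = cinv (base_chart A p) ` ball (snd (base_chart A p) p) (e p)"
  "closedin (atlas_topology A) (Z p)" "Z p\<subseteq>fst (base_chart A p)" if p: "p\<in>points A" for p
  using bump[OF B(1)[OF p] e[OF p]] unfolding b_def N_def Z_def by blast+
 have oN: "open_in A (N p)" if p: "p\<in>points A" for p
  unfolding b(3)[OF p]
  by (rule openin_chart_preimage[OF A B(1)[OF p]]) (use e(2)[OF p] ball_subset_cball in auto)
 have pN: "p\<in>N p" if p: "p\<in>points A" for p
  unfolding b(3)[OF p] using e(1)[OF p] cinv_chart[OF A B[OF p]]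
  by (intro image_eqI[of _ _ "snd (base_chart A p) p"]) auto
 have NZ: "N p\<subseteq>Z p" if "p\<in>points A" for p
  unfolding b(3)[OF that] Z_def by (intro image_mono ball_subset_cball)
 obtain P where P: "finite P" "P\<subseteq>points A" "points A\<subseteq>(\<Union>p\<in>P. N p)"
 proof -
  have "\<forall>\<U>. Ball \<U> (open_in A)\<and>topspace (atlas_topology A)\<subseteq>\<Union>\<U> -->
    (\<exists>\<F>. finite \<F>\<and>\<F>\<subseteq>\<U>\<and>topspace (atlas_topology A)\<subseteq>\<Union>\<F>)"
   using compact unfolding compact_space_alt by simp
  moreover have "points A\<subseteq>\<Union> (N ` points A)" using pN by blast
  moreover have "Ball (N ` points A) (open_in A)" using oN by blast
  ultimately have "\<exists>\<F>. finite \<F>\<and>\<F>\<subseteq>N ` points A\<and>points A\<subseteq>\<Union>\<F>"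
   unfolding topspace_atlas[OF A] by blast
  then
  obtain \<F> where "finite \<F>" "\<F>\<subseteq>N ` points A" "points A\<subseteq>\<Union>\<F>"
   by blast
  then show ?thesis using that finite_subset_image[of \<F> N "points A"] by metis
 qed
 define S where "S = (%q. \<Sum>p\<in>P. b p q)"
 define rho where "rho = (%C q. (\<Sum>p\<in>{p\<in>P. base_chart A p = C}. b p q) * inverse (S q))"
 have o: "open_in A (points A)" by (rule openin_points[OF A])
 have Spos: "S q > 0" if q: "q\<in>points A" for q
 proof -
  obtain p where p: "p\<in>P" "q\<in>N p" using P(3) q by blast
  show ?thesis unfolding S_def
   by (rule sum_pos2[OF P(1) p(1)]) (use p P(2) b(2) in \<open>auto simp: N_def\<close>)
 qed
 have "partition_of_unity A (base_chart A ` P) rho"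
  unfolding partition_of_unity_def
 proof (intro conjI ballI)
  show "finite (base_chart A ` P)" using P(1) by simp
  show "base_chart A ` P\<subseteq>A" using P(2) B(1) by auto
 next
  fix C assume C: "C\<in>base_chart A ` P"
  have "smooth_fun A (points A) S" unfolding S_def
   by (rule smooth_fun_sum[OF A o]) (use b(1) P(2) in auto)
  then have "smooth_fun A (points A) (%q. inverse (S q))"
   by (rule smooth_fun_inverse[OF A o]) (use Spos in force)
  then show "smooth_fun A (points A) (rho C)"
   unfolding rho_def
   by (intro smooth_fun_mult[OF A o] smooth_fun_sum[OF A o]) (use b(1) P(2) in auto)
  show "0\<le>rho C q" if "q\<in>points A" for q
   unfolding rho_def using Spos[OF that] b(2) P(2) by (intro mult_nonneg_nonneg sum_nonneg) auto
  have "closedin (atlas_topology A) (\<Union>p\<in>{p\<in>P. base_chart A p = C}. Z p)"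
   by (rule closedin_Union) (use P(1,2) b(4) in auto)
  moreover have "{q\<in>points A. rho C q ~= 0}\<subseteq>(\<Union>p\<in>{p\<in>P. base_chart A p = C}. Z p)"
  proof
   fix q assume q: "q\<in>{q\<in>points A. rho C q ~= 0}"
   then have "(\<Sum>p\<in>{p\<in>P. base_chart A p = C}. b p q) ~= 0" unfolding rho_def by auto
   then obtain p where p: "p\<in>P" "base_chart A p = C" "b p q ~= 0" by (metis (mono_tags,lifting) mem_Collect_eq sum.neutral)
   have "b p q > 0" using b(2)[of p q] p P(2) by force
   then have "q\<in>N p" using q by (simp add: N_def)
   then show "q\<in>(\<Union>p\<in>{p\<in>P. base_chart A p = C}. Z p)" using NZ p P(2) by blast
  qed
  ultimately have "atlas_topology A closure_of {q\<in>points A. rho C q ~= 0}\<subseteq>(\<Union>p\<in>{p\<in>P. base_chart A p = C}. Z p)"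
   by (intro closure_of_minimal)
  also have "...\<subseteq>fst C" using b(5) P(2) by blast
  finally show "atlas_topology A closure_of {q\<in>points A. rho C q ~= 0}\<subseteq>fst C" .
 next
  fix q assume q: "q\<in>points A"
  have "(\<Sum>C\<in>base_chart A ` P. rho C q) = (\<Sum>C\<in>base_chart A ` P. \<Sum>p\<in>{p\<in>P. base_chart A p = C}. b p q) * inverse (S q)"
   by (simp add: rho_def sum_distrib_right)
  also have "(\<Sum>C\<in>base_chart A ` P. \<Sum>p\<in>{p\<in>P. base_chart A p = C}. b p q) = S q"
   unfolding S_def by (rule sum.image_gen[OF P(1),symmetric])
  finally show "(\<Sum>C\<in>base_chart A ` P. rho C q) = 1" using Spos[OF q] by simp
 qed
 then show ?thesis by blast
qed

lemma density_coeff: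
 assumes F: "two_form A F"
 shows "density A (form_coeff F)"
 unfolding density_def
proof (intro conjI ballI)
 fix C assume C: "C\<in>A"
 have "smooth_fun A (fst C) (form_coeff F C)"
  using F C unfolding two_form_def form_coeff_def by blast
 then show "continuous_on (snd C ` fst C) (%y. form_coeff F C (cinv C y))"
  using C smooth_on_continuous unfolding smooth_fun_iff by force
next
 fix C D p assume CD: "C\<in>A" "D\<in>A" "p\<in>fst C\<inter>fst D"
 then have p: "p\<in>fst C" "p\<in>fst D" "p\<in>points A" by (auto simp: points_iff)
 have F1: "\<forall>p\<in>points A. \<forall>u\<in>tangent_space A p. \<forall>v\<in>tangent_space A p. \<forall>w\<in>tangent_space A p. \<forall>a b.
    F p v w = - F p w v\<and>F p (%f. a * u f+b * v f) w = a * F p u w+b * F p v w"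
  using F unfolding two_form_def by (rule conjunct1)
 have anti: "F p v w = - F p w v" and lin: "F p (%f. a * u f) w = a * F p u w"
  if "u\<in>tangent_space A p" "v\<in>tangent_space A p" "w\<in>tangent_space A p" for u v w a
 proof -
  note * = F1[rule_format,OF p(3) that]
  show "F p v w = - F p w v" using * by blast
  show "F p (%f. a * u f) w = a * F p u w" using conjunct2[OF *[of a 0]] by simp
 qed
 define w where "w = dz D p (%q. snd C q $ 1)"
 have ch: "dz D p = (%f. w * dz C p f)" "dbar D p = (%f. cnj w * dbar C p f)"
  unfolding w_def
  by (rule ext,rule coord_vec_change1(1)[OF A CD(1) p(1) CD(2) p(2)])
   (rule ext,rule coord_vec_change1(2)[OF A CD(1) p(1) CD(2) p(2)])
 note tC = coord_in_tangent_space(1)[OF A CD(1) p(1)] and tD = coord_in_tangent_space(1)[OF A CD(2) p(2)]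
 have "form_coeff F D p = w * F p (dz C p) (dbar D p)"
  unfolding form_coeff_def ch(1) by (rule lin[OF tC tC tD])
 also have "F p (dz C p) (dbar D p) = - F p (dbar D p) (dz C p)"
  by (rule anti[OF tC tC tD])
 also have "F p (dbar D p) (dz C p) = cnj w * F p (dbar C p) (dz C p)"
  unfolding ch(2) by (rule lin[OF tC tC tC])
 also have "F p (dbar C p) (dz C p) = - form_coeff F C p"
  unfolding form_coeff_def by (rule anti[OF tC tC tC])
 finally have "form_coeff F D p = (w * cnj w) * form_coeff F C p" by (simp only: mult_ac minus_mult_minus mult_minus_left mult_minus_right minus_minus)
 also have "w * cnj w = of_real ((cmod w)\<^sup>2)" by (simp only: complex_norm_square)
 finally show "form_coeff F D p = of_real ((cmod (dz D p (%q. snd C q $ 1)))\<^sup>2) * form_coeff F C p"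
  unfolding w_def .
qed

lemma surface_integral_eq:
 assumes F: "two_form A F" and P: "partition_of_unity A K rho"
 shows "surface_integral A F = - 2 * \<i> * partition_integral K rho (form_coeff F)"
proof -
 have *: "(\<Sum>C\<in>K. LINT y : snd C ` fst C | lborel.
      (let p = the_inv_into (fst C) (snd C) y in
       of_real (rho C p) * F p (dz C p) (dbar C p) * (- 2 * \<i>)))
   = - 2 * \<i> * partition_integral K rho (form_coeff F)" for K rho
  unfolding partition_integral_def chart_integral_def Let_def form_coeff_def[symmetric] sum_distrib_left
 proof (rule sum.cong[OF refl])
  fix C
  have "(LINT y:snd C ` fst C|lborel. of_real (rho C (cinv C y)) * form_coeff F C (cinv C y) * (- 2 * \<i>)) =
    (LINT y:snd C ` fst C|lborel. of_real (rho C (cinv C y)) * form_coeff F C (cinv C y)) * (- 2 * \<i>)"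
   by (rule set_integral_mult_left)
  then show "(LINT y:snd C ` fst C|lborel. of_real (rho C (cinv C y)) * form_coeff F C (cinv C y) * (- 2 * \<i>)) =
    - 2 * \<i> * (LINT y:snd C ` fst C|lborel. of_real (rho C (cinv C y)) * form_coeff F C (cinv C y))"
   by (simp only: mult.commute)
 qed
 show ?thesis
  unfolding surface_integral_def *
 proof (rule the_equality)
  show "\<exists>K' rho'. partition_of_unity A K' rho'\<and>- 2 * \<i> * partition_integral K rho (form_coeff F) = - 2 * \<i> * partition_integral K' rho' (form_coeff F)"
   using P by blast
  show "I = - 2 * \<i> * partition_integral K rho (form_coeff F)"
   if "\<exists>K rho. partition_of_unity A K rho\<and>I = - 2 * \<i> * partition_integral K rho (form_coeff F)" for I
   using that partition_integral_unique[OF A compact density_coeff[OF F] P] by metis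
 qed
qed

lemma partition_integral_linear:
 assumes d: "density A d" "density A d'" and P: "partition_of_unity A K rho"
  and eq: "!!C p. C\<in>A ==> p\<in>fst C ==> d'' C p = a * d C p+b * d' C p"
 shows "partition_integral K rho d'' = a * partition_integral K rho d+b * partition_integral K rho d'"
proof -
 note PD = partition_of_unityD[OF A compact P]
 have "chart_integral C (%p. of_real (rho C p) * d'' C p) =
   a * chart_integral C (%p. of_real (rho C p) * d C p)+b * chart_integral C (%p. of_real (rho C p) * d' C p)" if C: "C\<in>K" for C
 proof -
  have CA: "C\<in>A" using PD(2) C by blast
  have i: "chart_integrable C (%p. of_real (rho C p) * d C p)" if "density A d" for d
   using partition_integrable[OF A compact that P C smooth_fun_const[OF A,of _ 1]] by simp
  have "chart_integral C (%p. of_real (rho C p) * d'' C p) =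
    chart_integral C (%p. a * (of_real (rho C p) * d C p)+b * (of_real (rho C p) * d' C p))"
   by (rule chart_integral_cong) (use eq[OF CA] chart_inj[OF A CA] in \<open>simp_all add: algebra_simps\<close>)
  then show ?thesis using chart_integral_linear[OF i[OF d(1)] i[OF d(2)]] by simp
 qed
 then show ?thesis by (simp add: partition_integral_def sum.distrib sum_distrib_left)
qed

context
 fixes L :: "('m,'e,1) vbundle"
 assumes L: "holomorphic_bundle A L"
begin

text \<open>Two metrics differ by a positive function \<open>exp u\<close> on the surface; the curvatures then differ by
 \<open>lap C u\<close>, which integrates to zero.\<close>

lemma curvature_integral_unique:
 assumes h: "hermitian_metric A L h" "hermitian_metric A L h'"
  and D: "chern_connection A L L h D" "curvature_form A L D F" "chern_connection A L L h' D'" "curvature_form A L D' F'"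
 shows "surface_integral A F = surface_integral A F'"
proof -
 obtain K rho where P: "partition_of_unity A K rho" using partition_of_unity_exists by blast
 define v where "v = (%T p. log_metric L h T p+- log_metric L h' T p)"
 define u where "u = (%p. v (base_triv L p) p)"
 have uv: "u p = v T p" if W: "(W,T)\<in>triv L" "p\<in>W" for W T p
 proof -
  have "p\<in>points A" using openin_subset_points[OF A line_openin[OF A L W(1)]] W(2) by blast
  then obtain W' where W': "(W',base_triv L p)\<in>triv L" "p\<in>W'" using base_triv[OF A L] by blast
  (* Both weights change by the same factor z, which cancels in u. *)
  have e: "exp (log_metric L h (base_triv L p) p) = z * exp (log_metric L h T p)"
   if "z = base_triv L p (frame L T p 1) $ 1 * 0+inverse (base_triv L p (frame L T p 1) $ 1 * cnj (base_triv L p (frame L T p 1) $ 1))"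
    "hermitian_metric A L h" for z h
  proof -
   let ?e = "frame L T p 1"
   have e: "proj L ?e = p" "T ?e $ 1 = 1" using line_frame(1,2)[OF A L W,of 1] by auto
   have "exp (log_metric L h T p) = base_triv L p ?e $ 1 * cnj (base_triv L p ?e $ 1) * exp (log_metric L h (base_triv L p) p)"
    using metric_local[OF A L that(2) W e(1) e(1)] metric_local[OF A L that(2) W' e(1) e(1)] e(2) by simp
   moreover from this have "base_triv L p ?e $ 1 ~= 0" by auto
   ultimately show ?thesis using that(1) by (simp add: field_simps)
  qed
  have "exp (u p) = exp (v T p)"
  proof -
   define z where "z = base_triv L p (frame L T p 1) $ 1 * cnj (base_triv L p (frame L T p 1) $ 1)"
   have 1: "exp (log_metric L h (base_triv L p) p) = inverse z * exp (log_metric L h T p)"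
    "exp (log_metric L h' (base_triv L p) p) = inverse z * exp (log_metric L h' T p)"
    using e[OF refl h(1)] e[OF refl h(2)] by (simp_all add: z_def)
   then have "z ~= 0" by auto
   then show ?thesis by (simp add: u_def v_def exp_diff 1)
  qed
  moreover have "u p = of_real (Re (u p))" "v T p = of_real (Re (v T p))"
   by (simp_all add: u_def v_def log_metric_def)
  ultimately show ?thesis by (metis exp_of_real of_real_eq_iff exp_inj_iff)
 qed
 have o: "open_in A W" if "(W,T)\<in>triv L" for W T by (rule line_openin[OF A L that])
 have sv: "smooth_fun A W (v T)" if W: "(W,T)\<in>triv L" for W T
 proof -
  have "smooth_fun A W (%p. log_metric L h T p+(- 1) * log_metric L h' T p)"
   by (intro smooth_fun_add[OF A o[OF W]] smooth_fun_mult[OF A o[OF W]] smooth_fun_const[OF A]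
     log_metric_smooth[OF A L h(1) W] log_metric_smooth[OF A L h(2) W])
  then show ?thesis by (simp add: v_def)
 qed
 have su: "smooth_fun A (points A) u"
 proof (rule smooth_fun_local[OF A])
  fix p assume "p\<in>points A"
  then obtain W where W: "(W,base_triv L p)\<in>triv L" "p\<in>W" using base_triv[OF A L] by blast
  have "smooth_fun A W u" by (subst smooth_fun_cong[OF A o[OF W(1)] uv[OF W(1)]]) (auto intro: sv[OF W(1)])
  then have "smooth_fun A (points A\<inter>W) u" by (rule smooth_fun_subset[OF A]) simp
  then show "\<exists>N. open_in A N\<and>p\<in>N\<and>smooth_fun A (points A\<inter>N) u" using o[OF W(1)] W(2) by blast
 qed
 have lapu: "form_coeff F' C p = 1 * form_coeff F C p+1 * lap C u p" if C: "C\<in>A" "p\<in>fst C" for C p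
 proof -
  have "p\<in>points A" using C by (auto simp: points_iff)
  then obtain W where W: "(W,base_triv L p)\<in>triv L" "p\<in>W" using base_triv[OF A L] by blast
  let ?T = "base_triv L p"
  let ?a = "log_metric L h ?T" and ?b = "%q. - 1 * log_metric L h' ?T q"
  have sa: "smooth_fun A W ?a" "smooth_fun A W (log_metric L h' ?T)"
   using log_metric_smooth[OF A L h(1) W(1)] log_metric_smooth[OF A L h(2) W(1)] by auto
  have sb: "smooth_fun A W ?b" by (intro smooth_fun_mult[OF A o[OF W(1)]] smooth_fun_const[OF A] sa)
  have oW: "open_in A (W\<inter>fst C)" using o[OF W(1)] openin_chart[OF A C(1)] by (rule openin_Int)
  have 1: "dz C q u = dz C q ?a+- 1 * dz C q (log_metric L h' ?T)"
   if q: "q\<in>W\<inter>fst C" for q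
  proof -
   have qW: "q\<in>W" "q\<in>fst C" using q by auto
   have "dz C q u = dz C q (%q. ?a q+?b q)"
    by (rule coord_vec_cong(1)[OF A C(1) qW(2) o[OF W(1)] qW(1)]) (simp add: uv[OF W(1)] v_def)
   also have "... = dz C q ?a+dz C q ?b"
    by (intro coord_vec_add smooth_fun_cdiff[OF A sa(1) C(1) qW(2,1)] smooth_fun_cdiff[OF A sb C(1) qW(2,1)])
   also have "dz C q ?b = - 1 * dz C q (log_metric L h' ?T)"
    by (rule coord_vec_cmult[OF A C(1) qW(2) smooth_fun_cdiff[OF A sa(2) C(1) qW(2,1)]])
   finally show ?thesis .
  qed
  have cd: "cdiff C p (%q. dz C q f)" if "smooth_fun A W f" for f
   by (rule cdiff_coord_vec[OF A that C(1) o[OF W(1)] W(2) C(2)])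
  have pW: "p\<in>W\<inter>fst C" using W(2) C(2) by simp
  have "lap C u p = dbar C p (%q. dz C q ?a+- 1 * dz C q (log_metric L h' ?T))"
   unfolding lap_def by (rule coord_vec_cong(1)[OF A C oW pW 1])
  also have "... = lap C ?a p+- 1 * lap C (log_metric L h' ?T) p"
   unfolding lap_def
   by (simp only: coord_vec_add[OF cd[OF sa(1)] cdiff_mult[OF cdiff_const cd[OF sa(2)]]] coord_vec_cmult[OF A C cd[OF sa(2)]])
  finally show ?thesis
   using curvature_form_unique[OF A L h(1) D(1,2) W C] curvature_form_unique[OF A L h(2) D(3,4) W C]
   by (simp add: form_coeff_def)
 qed
 have F: "two_form A F" "two_form A F'" using D(2,4) unfolding curvature_form_def by auto
 have "partition_integral K rho (form_coeff F') = 1 * partition_integral K rho (form_coeff F)+1 * partition_integral K rho (%C. lap C u)"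
  by (rule partition_integral_linear[OF density_coeff[OF F(1)] density_lap[OF A compact su] P lapu])
 then show ?thesis
  using partition_integral_lap[OF A compact su P] surface_integral_eq[OF F(1) P] surface_integral_eq[OF F(2) P] by simp
qed

lemma bundle_degree_eq:
 assumes h: "hermitian_metric A L h" and D: "chern_connection A L L h D" "curvature_form A L D F"
  and d: "complex_of_real d = \<i>/(2 * of_real pi) * surface_integral A F"
 shows "bundle_degree A L = d"
 unfolding bundle_degree_def
proof (rule the_equality)
 show "\<exists>h D F. hermitian_metric A L h\<and>chern_connection A L L h D \<and>
   curvature_form A L D F\<and>complex_of_real d = \<i>/(2 * of_real pi) * surface_integral A F"
  using assms by blast
next
 fix d' assume "\<exists>h D F. hermitian_metric A L h\<and>chern_connection A L L h D \<and>
   curvature_form A L D F\<and>complex_of_real d' = \<i>/(2 * of_real pi) * surface_integral A F"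
 then obtain h' D' F' where *: "hermitian_metric A L h'" "chern_connection A L L h' D'" "curvature_form A L D' F'"
  "complex_of_real d' = \<i>/(2 * of_real pi) * surface_integral A F'" by blast
 have "complex_of_real d' = complex_of_real d"
  unfolding *(4) d curvature_integral_unique[OF h *(1) D *(2,3)] ..
 then show "d' = d" by simp
qed

end

end

section \<open>The product with the disc\<close>

definition pchart :: "('x,1) chart => ('x\<times>complex,2) chart" where
 "pchart C = (fst C\<times>\<Delta>,%(x,z). vector [snd C x $ 1,z])"

definition first_coord :: "complex^2 => complex^1" where
 "first_coord y = vec (y $ 1)"

definition slice :: "complex => complex^1 => complex^2" where
 "slice z y = vector [y $ 1,z]"

lemma times_disc_eq: "times_disc A = pchart ` A"
proof (intro equalityI subsetI)
 fix t assume "t\<in>times_disc A"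
 then obtain U c where "(U,c)\<in>A" "t = (U\<times>\<Delta>,%(x,z). vector [c x $ 1,z])" unfolding times_disc_def by blast
 then show "t\<in>pchart ` A" by (intro image_eqI[of _ _ "(U,c)"]) (simp_all add: pchart_def)
next
 fix t assume "t\<in>pchart ` A"
 then obtain C where C: "C\<in>A" "t = pchart C" by auto
 then have "(fst C,snd C)\<in>A" by simp
 then show "t\<in>times_disc A" unfolding times_disc_def C(2) pchart_def by blast
qed

lemma pchart_mem [simp]: "p\<in>fst (pchart C)\<longleftrightarrow>fst p\<in>fst C\<and>cmod (snd p) < 1"
 by (cases p) (simp add: pchart_def)

lemma pchart_coord [simp]:
 "snd (pchart C) p $ 1 = snd C (fst p) $ 1" "snd (pchart C) p $ 2 = snd p"
 by (cases p; simp add: pchart_def)+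

lemma first_coord_prod [simp]: "first_coord (snd (pchart C) p) = snd C (fst p)"
 by (simp add: first_coord_def vec1_eq_iff)

lemma first_coord_slice [simp]: "first_coord (slice z y) = y" "slice z y $ 2 = z" "slice z y $ 1 = y $ 1"
 by (simp_all add: first_coord_def slice_def vec1_eq_iff)

lemma slice_prod: "slice z (snd C x) = snd (pchart C) (x,z)"
 by (simp add: vec_eq_iff forall_2)

lemma vec2_eq_iff: "x = y\<longleftrightarrow>x $ 1 = y $ 1\<and>x $ 2 = y $ 2" for x y :: "'a^2"
 by (simp add: vec_eq_iff forall_2)

lemma points_times_disc: "points (times_disc A) = points A\<times>\<Delta>"
 by (auto simp: times_disc_eq points_iff)

lemma first_coord_derivative:
 "(first_coord has_derivative (%v. (\<chi> i j. if j = 1 then 1 else 0) *v v)) (at y)"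
proof -
 have "first_coord = (%v. (\<chi> i j. if j = 1 then 1 else 0) *v v)"
  by (auto simp: fun_eq_iff first_coord_def vec1_eq_iff vec_mult_sum sum_2)
 then show ?thesis by (metis bounded_linear_imp_has_derivative matrix_vector_mul_bounded_linear)
qed

lemma slice_derivative:
 "(slice z has_derivative (%v. (\<chi> i j. if i = 1 then 1 else 0) *v v)) (at y)"
proof -
 let ?Q = "(\<chi> i j. if i = 1 then 1 else 0) :: complex^1^2"
 have "slice z = (%v. ?Q *v v+axis 2 z)"
  by (auto simp: fun_eq_iff vec2_eq_iff vec_mult_sum axis_def)
 moreover have "((%v. ?Q *v v+axis 2 z) has_derivative (%v. ?Q *v v+0)) (at y)"
  by (intro has_derivative_add has_derivative_const bounded_linear_imp_has_derivative matrix_vector_mul_bounded_linear)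
 ultimately show ?thesis by simp
qed

lemma smooth_on_first_coord: "smooth_on S first_coord"
 using first_coord_derivative has_derivative_bounded_linear
proof -
 have "bounded_linear (%v :: complex^2. (\<chi> i j. if j = 1 then 1 else 0) *v v :: complex^1)"
  by (rule matrix_vector_mul_bounded_linear)
 moreover have "first_coord = (%v. (\<chi> i j. if j = 1 then 1 else 0) *v v)"
  by (auto simp: fun_eq_iff first_coord_def vec1_eq_iff vec_mult_sum sum_2)
 ultimately show ?thesis using smooth_on_bounded_linear by metis
qed

lemma smooth_on_slice: "open S ==> smooth_on S (slice z)"
proof -
 assume S: "open S"
 have b: "bounded_linear (%v :: complex^1. (\<chi> i j. if i = 1 then 1 else 0) *v v :: complex^2)"
  by (rule matrix_vector_mul_bounded_linear)
 have "slice z = (%v. (\<chi> i j. if i = 1 then 1 else 0) *v v+axis 2 z)"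
  by (auto simp: fun_eq_iff vec2_eq_iff vec_mult_sum axis_def)
 then show ?thesis using smooth_on_add[OF S smooth_on_bounded_linear[OF b] smooth_on_const] by simp
qed

context
 fixes A :: "('x,1) atlas"
 assumes A: "complex_atlas A"
begin

lemma pchart_image:
 assumes "C\<in>A" "W\<subseteq>fst C" "Z\<subseteq>\<Delta>"
 shows "snd (pchart C) ` (W\<times>Z) = {y. first_coord y\<in>snd C ` W\<and>y $ 2\<in>Z}"
proof (intro equalityI subsetI)
 fix y assume "y\<in>{y. first_coord y\<in>snd C ` W\<and>y $ 2\<in>Z}"
 then obtain x where x: "x\<in>W" "first_coord y = snd C x" "y $ 2\<in>Z" by auto
 have "y = snd (pchart C) (x,y $ 2)"
  using arg_cong[OF x(2),of "%u. u $ 1"] by (simp add: vec2_eq_iff first_coord_def)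
 then show "y\<in>snd (pchart C) ` (W\<times>Z)" using x by blast
qed auto

lemma open_prod_image:
 assumes "open S" "open Z"
 shows "open {y. first_coord y\<in>S\<and>y $ 2\<in>Z}"
proof -
 have "{y. first_coord y\<in>S\<and>y $ 2\<in>Z} = first_coord -` S\<inter>(%y. y $ 2) -` Z" by auto
 moreover have "open (first_coord -` S)"
  by (rule open_vimage[OF assms(1)]) (rule smooth_on_continuous[OF smooth_on_first_coord])
 moreover have "open ((%y::complex^2. y $ 2) -` Z)"
  by (rule open_vimage[OF assms(2)]) (intro continuous_intros)
 ultimately show ?thesis by auto
qed

lemma open_disc: "open \<Delta>"
proof -
 have "\<Delta> = ball 0 1" by auto
 then show ?thesis by simp
qed

lemma cinv_pchart:
 assumes "C\<in>A" "first_coord y\<in>snd C ` fst C" "cmod (y $ 2) < 1"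
 shows "cinv (pchart C) y = (cinv C (first_coord y),y $ 2)"
proof -
 have inj: "inj_on (snd (pchart C)) (fst (pchart C))"
 proof (rule inj_onI)
  fix p q assume pq: "p\<in>fst (pchart C)" "q\<in>fst (pchart C)" "snd (pchart C) p = snd (pchart C) q"
  have "snd C (fst p) = snd C (fst q)" using arg_cong[OF pq(3),of first_coord] by simp
  then have "fst p = fst q" using chart_inj[OF A assms(1)] pq(1,2) by (simp add: inj_on_def)
  moreover have "snd p = snd q" using arg_cong[OF pq(3),of "%y. y $ 2"] by simp
  ultimately show "p = q" by (simp add: prod_eq_iff)
 qed
 have c: "cinv C (first_coord y)\<in>fst C" "snd C (cinv C (first_coord y)) = first_coord y"
  using chart_mult_left[OF A assms(1,2)] by auto
 show ?thesis
  by (rule the_inv_into_f_eq[OF inj]) (use c assms(3) in \<open>auto simp: vec2_eq_iff first_coord_def\<close>)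
qed

lemma atlas_times_disc: "complex_atlas (times_disc A)"
 unfolding complex_atlas_def case_prod_unfold
proof (intro conjI ballI)
 fix t assume "t\<in>times_disc A"
 then obtain C where C: "C\<in>A" "t = pchart C" by (auto simp: times_disc_eq)
 show "inj_on (snd t) (fst t)"
  unfolding C(2)
 proof (rule inj_onI)
  fix p q assume pq: "p\<in>fst (pchart C)" "q\<in>fst (pchart C)" "snd (pchart C) p = snd (pchart C) q"
  have "snd C (fst p) = snd C (fst q)" using arg_cong[OF pq(3),of first_coord] by simp
  then have "fst p = fst q" using chart_inj[OF A C(1)] pq(1,2) by (simp add: inj_on_def)
  moreover have "snd p = snd q" using arg_cong[OF pq(3),of "%y. y $ 2"] by simp
  ultimately show "p = q" by (simp add: prod_eq_iff)
 qed
 have "fst t = fst C\<times>\<Delta>" unfolding C(2) pchart_def by simp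
 then show "open (snd t ` fst t)"
  using open_prod_image[OF open_chart[OF A C(1)] open_disc] pchart_image[OF C(1) subset_refl subset_refl]
  unfolding C(2) by simp
next
 fix t t' assume "t\<in>times_disc A" "t'\<in>times_disc A"
 then obtain C D where C: "C\<in>A" "t = pchart C" and D: "D\<in>A" "t' = pchart D" by (auto simp: times_disc_eq)
 let ?S = "snd C ` (fst C\<inter>fst D)"
 have "fst t\<inter>fst t' = (fst C\<inter>fst D)\<times>\<Delta>" unfolding C(2) D(2) pchart_def by auto
 then have im: "snd t ` (fst t\<inter>fst t') = {y. first_coord y\<in>?S\<and>y $ 2\<in>\<Delta>}"
  using pchart_image[OF C(1) Int_lower1 subset_refl,of "fst D"] unfolding C(2) by simp
 show o: "open (snd t ` (fst t\<inter>fst t'))"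
  unfolding im by (rule open_prod_image[OF open_chart_overlap[OF A C(1) D(1)] open_disc])
 show "hol_on (snd t ` (fst t\<inter>fst t')) (snd t' \<circ> cinv t)"
  unfolding hol_on_def
 proof
  fix y assume y: "y\<in>snd t ` (fst t\<inter>fst t')"
  then have y': "first_coord y\<in>?S" "y $ 2\<in>\<Delta>" unfolding im by auto
  obtain J where J: "((%y. snd D (cinv C y)) has_derivative (%v. J *v v)) (at (first_coord y))"
   using transition_hol[OF A C(1) D(1)] y'(1) unfolding hol_on_def by blast
  let ?P = "(\<chi> i j. if j = 1 then 1 else 0) :: complex^2^1"
  let ?K = "(\<chi> i j. if i = 1 then (if j = 1 then J $ 1 $ 1 else 0) else (if j = 1 then 0 else 1)) :: complex^2^2"
  let ?f = "%y :: complex^2. vector [snd D (cinv C (first_coord y)) $ 1,y $ 2] :: complex^2"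
  have 1: "((%y. snd D (cinv C (first_coord y))) has_derivative (%v. J *v (?P *v v))) (at y)"
   by (rule has_derivative_compose[OF first_coord_derivative J])
  have "((%y. \<Sum>i\<in>UNIV. axis i (?f y $ i)) has_derivative (%v. \<Sum>i\<in>UNIV. axis i ((?K *v v) $ i))) (at y)"
  proof (rule has_derivative_sum,rule bounded_linear.has_derivative[OF bounded_linear_axis])
   fix i :: 2
   have a: "((%y. snd D (cinv C (first_coord y)) $ 1) has_derivative (%v. (J *v (?P *v v)) $ 1)) (at y)"
    by (rule bounded_linear.has_derivative[OF bounded_linear_vec_nth 1])
   have b: "((%y :: complex^2. y $ 2) has_derivative (%v. v $ 2)) (at y)"
    by (rule bounded_linear_imp_has_derivative[OF bounded_linear_vec_nth])
   show "((%y. ?f y $ i) has_derivative (%v. (?K *v v) $ i)) (at y)"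
    using exhaust_2[of i] a b by (auto simp: vec_mult_sum sum_2)
  qed
  moreover have "(\<Sum>i\<in>UNIV. axis i (u $ i)) = u" for u :: "complex^2" by (simp add: vec_eq_iff axis_def)
  ultimately have 2: "(?f has_derivative (%v. ?K *v v)) (at y)" by simp
  have "((snd t' \<circ> cinv t) has_derivative (%v. ?K *v v)) (at y)"
  proof (rule has_derivative_transform_within_open[OF 2 o y])
   fix z assume "z\<in>snd t ` (fst t\<inter>fst t')"
   then have z: "first_coord z\<in>snd C ` fst C" "cmod (z $ 2) < 1" unfolding im by auto
   show "?f z = (snd t' \<circ> cinv t) z"
    unfolding C(2) D(2) o_def cinv_pchart[OF C(1) z] by (simp add: vec2_eq_iff)
  qed
  then show "\<exists>J. ((snd t' \<circ> cinv t) has_derivative (%v. J *v v)) (at y)" by blast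
 qed
qed

lemma openin_times_disc:
 assumes "open_in A W" "open Z" "Z\<subseteq>\<Delta>"
 shows "open_in (times_disc A) (W\<times>Z)"
 unfolding openin_atlas_topology[OF atlas_times_disc] case_prod_unfold
proof (intro conjI ballI)
 show "W\<times>Z\<subseteq>points (times_disc A)"
  using openin_subset_points[OF A assms(1)] assms(3) unfolding points_times_disc by auto
 fix t assume "t\<in>times_disc A"
 then obtain C where C: "C\<in>A" "t = pchart C" by (auto simp: times_disc_eq)
 have "fst t\<inter>W\<times>Z = (fst C\<inter>W)\<times>Z" unfolding C(2) pchart_def using assms(3) by auto
 then show "open (snd t ` (fst t\<inter>W\<times>Z))"
  using open_prod_image[OF open_chart_image[OF A C(1) assms(1)] assms(2)]
   pchart_image[OF C(1) Int_lower1 assms(3),of W] unfolding C(2) by simp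
qed

lemma smooth_fun_fst:
 assumes W: "open_in A W" and f: "smooth_fun A W f"
 shows "smooth_fun (times_disc A) (W\<times>\<Delta>) (%q. f (fst q))"
 unfolding smooth_fun_iff
proof
 fix t assume "t\<in>times_disc A"
 then obtain C where C: "C\<in>A" "t = pchart C" by (auto simp: times_disc_eq)
 let ?S = "snd C ` (fst C\<inter>W)" and ?R = "snd t ` (fst t\<inter>W\<times>\<Delta>)"
 have "fst t\<inter>W\<times>\<Delta> = (fst C\<inter>W)\<times>\<Delta>" unfolding C(2) pchart_def by auto
 then have im: "?R = {y. first_coord y\<in>?S\<and>y $ 2\<in>\<Delta>}"
  using pchart_image[OF C(1) Int_lower1 subset_refl,of W] unfolding C(2) by simp
 have oS: "open ?S" by (rule open_chart_image[OF A C(1) W])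
 have o: "open ?R" unfolding im by (rule open_prod_image[OF oS open_disc])
 have "smooth_on ?R (%y. f (cinv C (first_coord y)))"
  by (rule smooth_on_compose[where f = "%y. f (cinv C y)" and g = first_coord and T = ?S,OF o oS])
   (use f C(1) smooth_on_first_coord im in \<open>auto simp: smooth_fun_iff\<close>)
 then show "smooth_on ?R (%y. f (fst (cinv t y)))"
 proof (subst smooth_on_cong[OF o])
  fix y assume "y\<in>?R"
  then have "first_coord y\<in>snd C ` fst C" "cmod (y $ 2) < 1" unfolding im by auto
  then show "f (fst (cinv t y)) = f (cinv C (first_coord y))" unfolding C(2) by (simp add: cinv_pchart[OF C(1)])
 qed simp
qed

lemma smooth_fun_slice:
 assumes W: "open_in A W" and f: "smooth_fun (times_disc A) (W\<times>\<Delta>) F" and z: "cmod z < 1"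
 shows "smooth_fun A W (%x. F (x,z))"
 unfolding smooth_fun_iff
proof
 fix C assume C: "C\<in>A"
 let ?t = "pchart C"
 let ?S = "snd C ` (fst C\<inter>W)" and ?R = "snd ?t ` (fst ?t\<inter>W\<times>\<Delta>)"
 have t: "?t\<in>times_disc A" using C by (simp add: times_disc_eq)
 have "fst ?t\<inter>W\<times>\<Delta> = (fst C\<inter>W)\<times>\<Delta>" unfolding pchart_def by auto
 then have im: "?R = {y. first_coord y\<in>?S\<and>y $ 2\<in>\<Delta>}"
  using pchart_image[OF C Int_lower1 subset_refl,of W] by simp
 have oS: "open ?S" by (rule open_chart_image[OF A C W])
 have o: "open ?R" unfolding im by (rule open_prod_image[OF oS open_disc])
 have "smooth_on ?S (%y. F (cinv ?t (slice z y)))"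
  by (rule smooth_on_compose[where f = "%y. F (cinv ?t y)" and g = "slice z" and T = ?R,OF oS o])
   (use f t smooth_on_slice[OF oS] im z in \<open>auto simp: smooth_fun_iff\<close>)
 then show "smooth_on ?S (%y. F (cinv C y,z))"
 proof (subst smooth_on_cong[OF oS])
  fix y assume "y\<in>?S"
  then have "first_coord (slice z y)\<in>snd C ` fst C" "cmod (slice z y $ 2) < 1" using z by auto
  from cinv_pchart[OF C this] show "F (cinv C y,z) = F (cinv ?t (slice z y))" by simp
 qed simp
qed

lemma pchart_in: "C\<in>A ==> pchart C\<in>times_disc A"
 by (simp add: times_disc_eq)

lemma cdiff_slice:
 assumes C: "C\<in>A" "x\<in>fst C" and z: "cmod z < 1" and F: "cdiff (pchart C) (x,z) F"
 shows "cdiff C x (%x. F (x,z))"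
  "dz C x (%x. F (x,z)) = dz (pchart C) (x,z) F"
  "dbar C x (%x. F (x,z)) = dbar (pchart C) (x,z) F"
proof -
 let ?t = "pchart C" and ?S = "snd C ` fst C"
 have eq: "F (cinv C y,z) = F (cinv ?t (slice z y))" if "y\<in>?S" for y
  using cinv_pchart[OF C(1),of "slice z y"] that z by simp
 have o: "open ?S" "snd C x\<in>?S" using open_chart[OF A C(1)] C(2) by auto
 have d: "(%y. F (cinv ?t y)) differentiable (at (slice z (snd C x)))"
  using F unfolding cdiff_def slice_prod .
 then obtain D where "((%y. F (cinv ?t y)) has_derivative D) (at (slice z (snd C x)))" by (auto simp: differentiable_def)
 from has_derivative_compose[OF slice_derivative this]
 have d': "(%y. F (cinv ?t (slice z y))) differentiable (at (snd C x))" by (rule differentiableI)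
 show "cdiff C x (%x. F (x,z))" unfolding cdiff_def
  using d' frechet_derivative_cong_open(1)[OF o eq] by simp
 have w: "coord_vec C k x (%x. F (x,z)) = wirtinger k (%y. F (cinv ?t (slice z y))) (snd C x)" for k
  unfolding coord_vec_eq by (rule wirtinger_cong_open[OF o eq])
 show "dz C x (%x. F (x,z)) = dz ?t (x,z) F"
  "dbar C x (%x. F (x,z)) = dbar ?t (x,z) F"
  unfolding w wirtinger_chain[OF slice_derivative d] coord_vec_eq[of ?t] by (simp_all add: sum_2 slice_prod)
qed

lemma coord_vec_fst:
 assumes C: "C\<in>A" "fst p\<in>fst C" and z: "cmod (snd p) < 1"
 shows "dz (pchart C) p (%q. f (fst q)) = dz C (fst p) f"
  "dbar (pchart C) p (%q. f (fst q)) = dbar C (fst p) f"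
  "coord_vec (pchart C) (Inl 2) p (%q. f (fst q)) = 0"
  "coord_vec (pchart C) (Inr 2) p (%q. f (fst q)) = 0"
  "cdiff C (fst p) f ==> cdiff (pchart C) p (%q. f (fst q))"
proof -
 let ?t = "pchart C" and ?R = "{y. first_coord y\<in>snd C ` fst C\<and>y $ 2\<in>\<Delta>}"
 have o: "open ?R" "snd ?t p\<in>?R" using open_prod_image[OF open_chart[OF A C(1)] open_disc] C z by auto
 have eq: "f (fst (cinv ?t y)) = f (cinv C (first_coord y))" if "y\<in>?R" for y
  using cinv_pchart[OF C(1),of y] that by simp
 have w: "coord_vec ?t k p (%q. f (fst q)) = wirtinger k (%y. f (cinv C (first_coord y))) (snd ?t p)" for k
  unfolding coord_vec_eq by (rule wirtinger_cong_open[OF o eq])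
 have cd: "cdiff ?t p (%q. f (fst q))" if "cdiff C (fst p) f"
 proof -
  have "(%y. f (cinv C y)) differentiable (at (first_coord (snd ?t p)))" using that by (simp add: cdiff_def)
  then obtain D where "((%y. f (cinv C y)) has_derivative D) (at (first_coord (snd ?t p)))" by (auto simp: differentiable_def)
  from has_derivative_compose[OF first_coord_derivative this]
  have "(%y. f (cinv C (first_coord y))) differentiable (at (snd ?t p))" by (rule differentiableI)
  then show ?thesis unfolding cdiff_def using frechet_derivative_cong_open(1)[OF o eq] by simp
 qed
 then show "cdiff C (fst p) f ==> cdiff ?t p (%q. f (fst q))" .
 have "dz ?t p (%q. f (fst q)) = dz C (fst p) f \<and>
  dbar ?t p (%q. f (fst q)) = dbar C (fst p) f \<and>
  coord_vec ?t (Inl 2) p (%q. f (fst q)) = 0\<and>coord_vec ?t (Inr 2) p (%q. f (fst q)) = 0"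
 proof (cases "cdiff C (fst p) f")
  case True
  then have "(%y. f (cinv C y)) differentiable (at (first_coord (snd ?t p)))" by (simp add: cdiff_def)
  from wirtinger_chain[OF first_coord_derivative this] show ?thesis unfolding w coord_vec_eq[of C] by simp
 next
  case False
  have "\<not> cdiff ?t p (%q. f (fst q))"
  proof
   assume "cdiff ?t p (%q. f (fst q))"
   then have "cdiff ?t (fst p,snd p) (%q. f (fst q))" by simp
   from cdiff_slice(1)[OF C z this] False show False by simp
  qed
  then show ?thesis using False unfolding cdiff_def by (simp add: coord_vec_eq wirtinger_not_differentiable)
 qed
 then show "dz ?t p (%q. f (fst q)) = dz C (fst p) f"
  "dbar ?t p (%q. f (fst q)) = dbar C (fst p) f"
  "coord_vec ?t (Inl 2) p (%q. f (fst q)) = 0" "coord_vec ?t (Inr 2) p (%q. f (fst q)) = 0" by blast+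
qed

lemma coord_vec_snd:
 assumes C: "C\<in>A" "fst p\<in>fst C" and z: "cmod (snd p) < 1"
 shows "dz (pchart C) p snd = 0" "coord_vec (pchart C) (Inl 2) p snd = 1"
  "coord_vec (pchart C) (Inr j) p snd = 0"
  "dbar (pchart C) p (%q. cnj (snd q)) = 0" "coord_vec (pchart C) (Inr 2) p (%q. cnj (snd q)) = 1"
  "coord_vec (pchart C) (Inl j) p (%q. cnj (snd q)) = 0"
  "cdiff (pchart C) p snd"
proof -
 let ?t = "pchart C"
 have t: "?t\<in>times_disc A" "p\<in>fst ?t" using C z by (auto simp: times_disc_eq)
 have e: "(%q. snd ?t q $ 2) = snd" by (simp add: fun_eq_iff)
 have 1: "coord_vec ?t (Inl j) p snd = (if 2 = j then 1 else 0)" "coord_vec ?t (Inr j) p snd = 0" for j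
  using coord_vec_coordinate[OF atlas_times_disc t,of j 2] unfolding e by auto
 show "dz ?t p snd = 0" "coord_vec ?t (Inl 2) p snd = 1" "coord_vec ?t (Inr j) p snd = 0"
  by (simp_all add: 1)
 show "dbar ?t p (%q. cnj (snd q)) = 0" "coord_vec ?t (Inr 2) p (%q. cnj (snd q)) = 1"
  "coord_vec ?t (Inl j) p (%q. cnj (snd q)) = 0"
  by (simp_all add: coord_vec_cnj 1)
 show "cdiff ?t p snd"
 proof -
  let ?R = "{y. first_coord y\<in>snd C ` fst C\<and>y $ 2\<in>\<Delta>}"
  have o: "open ?R" "snd ?t p\<in>?R" using open_prod_image[OF open_chart[OF A C(1)] open_disc] C z by auto
  have "(%y :: complex^2. y $ 2) differentiable (at (snd ?t p))"
   by (rule differentiableI[OF bounded_linear_imp_has_derivative[OF bounded_linear_vec_nth]])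
  then show ?thesis
   unfolding cdiff_def
   by (subst frechet_derivative_cong_open(1)[OF o,where g = "%y. y $ 2"]) (auto simp: cinv_pchart[OF C(1)])
 qed
qed

text \<open>The coordinate change of the product does not involve \<open>z\<close>, so the vector along the disc is
 globally defined.\<close>

lemma coord_vec_2_independent:
 assumes C: "C\<in>A" "fst p\<in>fst C" and D: "D\<in>A" "fst p\<in>fst D" and z: "cmod (snd p) < 1"
 shows "coord_vec (pchart D) (Inr 2) p f = coord_vec (pchart C) (Inr 2) p f"
proof -
 have t: "pchart C\<in>times_disc A" "p\<in>fst (pchart C)" "pchart D\<in>times_disc A" "p\<in>fst (pchart D)"
  using C D z by (auto simp: times_disc_eq)
 have e: "(%q. snd (pchart C) q $ 2) = snd" by (simp add: fun_eq_iff)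
 show ?thesis
  using coord_vec_change(2)[OF atlas_times_disc t,of 2 f]
   coord_vec_fst(3)[OF D z,of "%x. snd C x $ 1"] coord_vec_snd(2)[OF D z]
  by (simp add: sum_2 e)
qed

end

section \<open>Invariant holomorphic extensions\<close>

text \<open>Holomorphic maps of total spaces carry holomorphic sections to holomorphic sections. It is applied to sections
 with constant coordinates.\<close>

lemma holomorphic_map_section:
 fixes B :: "('m,'n::finite) atlas" and B' :: "('p,'k::finite) atlas"
  and E :: "('m,'e,'r::finite) vbundle" and E' :: "('p,'f,'s::finite) vbundle"
 assumes hm: "holomorphic_map (total_space B E) (total_space B' E') f" and B: "complex_atlas B"
  and C: "C\<in>B" and W: "(W,T)\<in>triv E" and C': "C'\<in>B'" and W': "(W',T')\<in>triv E'"
  and N: "open_in B N" "p\<in>N" "N\<subseteq>fst C\<inter>W"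
  and inj: "!!e e'. proj E e\<in>W ==> proj E e = proj E e' ==> T e = T e' ==> e = e'"
  and s: "!!q. q\<in>N ==> proj E (s q) = q" "!!q. q\<in>N ==> T (s q) = a"
  and fs: "!!q. q\<in>N ==> proj E' (f (s q))\<in>fst C'\<inter>W'"
 shows "cdiff C p (%q. T' (f (s q)) $ i)" "coord_vec C (Inr j) p (%q. T' (f (s q)) $ i) = 0"
proof -
 define U1 where "U1 = proj E -` (fst C\<inter>W)"
 define c1 where "c1 = (%e. \<chi> i. case i of Inl j => snd C (proj E e) $ j | Inr k => T e $ k)"
 define U2 where "U2 = proj E' -` (fst C'\<inter>W')"
 define c2 where "c2 = (%e. \<chi> i. case i of Inl j => snd C' (proj E' e) $ j | Inr k => T' e $ k)"
 define \<Theta> where "\<Theta> = c2 \<circ> f \<circ> the_inv_into U1 c1"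
 have m1: "(U1,c1)\<in>total_space B E"
  unfolding total_space_def U1_def c1_def mem_Collect_eq
  by (rule exI[of _ "fst C"],rule exI[of _ "snd C"],rule exI[of _ W],rule exI[of _ T]) (use C W in simp)
 have m2: "(U2,c2)\<in>total_space B' E'"
  unfolding total_space_def U2_def c2_def mem_Collect_eq
  by (rule exI[of _ "fst C'"],rule exI[of _ "snd C'"],rule exI[of _ W'],rule exI[of _ T']) (use C' W' in simp)
 have "\<forall>t\<in>total_space B E. \<forall>t'\<in>total_space B' E'. open (snd t ` (fst t\<inter>f -` fst t')) \<and>
    hol_on (snd t ` (fst t\<inter>f -` fst t')) (snd t' \<circ> f \<circ> cinv t)"
  using hm unfolding holomorphic_map_def case_prod_unfold by (rule conjunct2)
 from bspec[OF bspec[OF this m1] m2] have hol: "hol_on (c1 ` (U1\<inter>f -` U2)) \<Theta>" unfolding \<Theta>_def by simp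
 have inj1: "inj_on c1 U1"
 proof (rule inj_onI)
  fix e e' assume e: "e\<in>U1" "e'\<in>U1" "c1 e = c1 e'"
  have "c1 e $ Inl j = c1 e' $ Inl j" "c1 e $ Inr k = c1 e' $ Inr k" for j k using e(3) by simp_all
  then have "snd C (proj E e) = snd C (proj E e')" "T e = T e'" by (simp_all add: c1_def vec_eq_iff)
  then show "e = e'" using inj[of e e'] chart_inj[OF B C] e(1,2) unfolding U1_def inj_on_def by auto
 qed
 define \<kappa> :: "complex^'n => complex^('n+'r)" where "\<kappa> = (%\<eta>. \<chi> i. case i of Inl j => \<eta> $ j | Inr k => a $ k)"
 define K :: "complex^'n^('n+'r)" where "K = (\<chi> i j. case i of Inl i' => if j = i' then 1 else 0 | Inr k => 0)"
 have \<kappa>d: "(\<kappa> has_derivative (%v. K *v v)) (at \<eta>)" for \<eta>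
 proof -
  have "\<kappa> = (%v. K *v v+\<kappa> 0)"
  proof
   fix v show "\<kappa> v = K *v v+\<kappa> 0"
    by (simp add: vec_eq_iff \<kappa>_def K_def vec_mult_sum if_distrib[of "%x. x * _"] split: sum.splits cong: if_cong)
  qed
  moreover have "((%v. K *v v+\<kappa> 0) has_derivative (%v. K *v v+0)) (at \<eta>)"
   by (intro has_derivative_add has_derivative_const bounded_linear_imp_has_derivative matrix_vector_mul_bounded_linear)
  ultimately show ?thesis by simp
 qed
 have sU: "s q\<in>U1\<inter>f -` U2" "\<kappa> (snd C q) = c1 (s q)" if "q\<in>N" for q
 proof -
  show "s q\<in>U1\<inter>f -` U2" using s(1)[OF that] fs[OF that] N(3) that unfolding U1_def U2_def by auto
  show "\<kappa> (snd C q) = c1 (s q)"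
   by (simp add: vec_eq_iff \<kappa>_def c1_def s(1)[OF that] s(2)[OF that] split: sum.splits)
 qed
 have \<Theta>\<kappa>: "\<Theta> (\<kappa> (snd C q)) = c2 (f (s q))" if "q\<in>N" for q
  using sU[OF that] the_inv_into_f_f[OF inj1,of "s q"] by (simp add: \<Theta>_def)
 have "\<kappa> (snd C p)\<in>c1 ` (U1\<inter>f -` U2)" using sU[OF N(2)] by simp
 then obtain J where J: "(\<Theta> has_derivative (%v. J *v v)) (at (\<kappa> (snd C p)))" using hol unfolding hol_on_def by blast
 have "((%\<eta>. \<Theta> (\<kappa> \<eta>)) has_derivative (%v. (J ** K) *v v)) (at (snd C p))"
  using has_derivative_compose[OF \<kappa>d J] by (simp add: matrix_vector_mul_assoc)
 note w = wirtinger_hol(2)[OF this,of j "Inr i"] wirtinger_hol(3)[OF this,of "Inr i"]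
 have o: "open (snd C ` (fst C\<inter>N))" "snd C p\<in>snd C ` (fst C\<inter>N)"
  using open_chart_image[OF B C N(1)] N by auto
 have eq: "T' (f (s (cinv C \<eta>))) $ i = \<Theta> (\<kappa> \<eta>) $ Inr i" if \<eta>: "\<eta>\<in>snd C ` (fst C\<inter>N)" for \<eta>
 proof -
  obtain q where q: "q\<in>fst C" "q\<in>N" "\<eta> = snd C q" using \<eta> by auto
  then show ?thesis using \<Theta>\<kappa>[OF q(2)] cinv_chart[OF B C q(1)] by (simp add: c2_def)
 qed
 show "cdiff C p (%q. T' (f (s q)) $ i)" unfolding cdiff_def
  using w(2) frechet_derivative_cong_open(1)[OF o eq] by simp
 show "coord_vec C (Inr j) p (%q. T' (f (s q)) $ i) = 0" unfolding coord_vec_eq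
  using w(1) wirtinger_cong_open[OF o eq] by simp
qed

lemma tangent01_zero:
 assumes "v\<in>tangent01 B p" "!!C j. C\<in>B ==> p\<in>fst C ==> coord_vec C (Inr j) p f = 0"
 shows "v f = 0"
proof -
 obtain C a where C: "C\<in>B" "p\<in>fst C" "v = (%f. \<Sum>j\<in>UNIV. a j * coord_vec C (Inr j) p f)"
  using assms(1) unfolding tangent01_def by blast
 then show ?thesis using assms(2) by simp
qed

definition lift_triv :: "('l => complex^1) => 'l\<times>complex\<times>complex => complex^2" where
 "lift_triv T = (%(l,z,w). vector [T l $ 1,w])"

text \<open>The frame of the sub over the trivialisation \<open>T\<close> of \<open>L\<close>, and below the global
 section of the splitting.\<close>

definition sub_frame :: "('x,'l,1) vbundle => ('l => complex^1) => 'x\<times>complex => 'l\<times>complex\<times>complex" where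
 "sub_frame L T q = (frame L T (fst q) 1,snd q,0)"

definition quot_frame :: "('x,'l,1) vbundle => 'x\<times>complex => 'l\<times>complex\<times>complex" where
 "quot_frame L q = (fibre_vec L (fst q) (%_. 0),snd q,1)"

definition act :: "complex^2^2 => 'x\<times>complex => 'x\<times>complex" where
 "act g q = (fst q,moebius g (snd q))"

lemma lift_triv_nth [simp]: "lift_triv T e $ 1 = T (fst e) $ 1" "lift_triv T e $ 2 = snd (snd e)"
 by (cases e; simp add: lift_triv_def)+

lemma proj_sum_bundle [simp]: "sproj L e = (proj L (fst e),fst (snd e))"
 by (cases e) (simp add: sum_bundle_def)

lemma triv_sum_bundle: "triv (sum_bundle L) = {(W\<times>\<Delta>,lift_triv T) | W T. (W,T)\<in>triv L}"
 by (simp add: sum_bundle_def lift_triv_def)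

lemma SU11_cases:
 assumes "g\<in>SU11"
 obtains a b where "g $ 1 $ 1 = a" "g $ 1 $ 2 = b" "g $ 2 $ 1 = cnj b" "g $ 2 $ 2 = cnj a" "(cmod a)\<^sup>2 - (cmod b)\<^sup>2 = 1"
 using assms unfolding SU11_def by auto

lemma moebius:
 assumes g: "g\<in>SU11" and z: "cmod z < 1"
 shows "g $ 2 $ 1 * z+g $ 2 $ 2 ~= 0" "cmod (moebius g z) < 1"
  "(moebius g has_field_derivative 1/(g $ 2 $ 1 * z+g $ 2 $ 2)\<^sup>2) (at z)"
proof -
 obtain a b where ab: "g $ 1 $ 1 = a" "g $ 1 $ 2 = b" "g $ 2 $ 1 = cnj b" "g $ 2 $ 2 = cnj a" "(cmod a)\<^sup>2 - (cmod b)\<^sup>2 = 1"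
  by (rule SU11_cases[OF g])
 let ?d = "cnj b * z+cnj a" and ?n = "a * z+b"
 have ab': "a * cnj a - b * cnj b = 1"
  using arg_cong[OF ab(5),of complex_of_real] by (simp only: of_real_diff complex_norm_square of_real_1)
 have "?d * cnj ?d - ?n * cnj ?n = (1 - z * cnj z) * (a * cnj a - b * cnj b)"
  by (simp add: algebra_simps)
 then have "complex_of_real ((cmod ?d)\<^sup>2 - (cmod ?n)\<^sup>2) = complex_of_real (1 - (cmod z)\<^sup>2)"
  unfolding ab' by (simp only: of_real_diff complex_norm_square of_real_1 mult_1_right)
 then have eq: "(cmod ?d)\<^sup>2 - (cmod ?n)\<^sup>2 = 1 - (cmod z)\<^sup>2" by (simp only: of_real_eq_iff)
 have "(cmod z)\<^sup>2 < 1" using z by (simp add: power_less_one_iff abs_square_less_1)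
 then have lt: "(cmod ?n)\<^sup>2 < (cmod ?d)\<^sup>2" using eq by linarith
 then have d0: "?d ~= 0" by (metis norm_zero not_less power_zero_numeral zero_le_power2)
 then show "g $ 2 $ 1 * z+g $ 2 $ 2 ~= 0" by (simp add: ab)
 have "cmod ?n < cmod ?d" using lt by (metis norm_ge_zero power2_less_imp_less)
 then show "cmod (moebius g z) < 1" using d0 by (simp add: moebius_def ab norm_divide)
 have "((%z. (a * z+b)/(cnj b * z+cnj a)) has_field_derivative (a * ?d - ?n * cnj b)/(?d * ?d)) (at z)"
  using d0 by (auto intro!: derivative_eq_intros)
 also have "a * ?d - ?n * cnj b = 1" using ab' by (simp add: algebra_simps)
 finally show "(moebius g has_field_derivative 1/(g $ 2 $ 1 * z+g $ 2 $ 2)\<^sup>2) (at z)"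
  by (simp add: moebius_def[abs_def] ab power2_eq_square)
qed

context
 fixes A :: "('x,1) atlas" and L :: "('x,'l,1) vbundle"
 assumes A: "complex_atlas A" and L: "holomorphic_bundle A L"
begin

lemma zero_vector:
 assumes "x\<in>points A"
 shows "proj L (fibre_vec L x (%_. 0)) = x" "!!W T. (W,T)\<in>triv L ==> x\<in>W ==> T (fibre_vec L x (%_. 0)) = 0"
proof -
 obtain W T where W: "(W,T)\<in>triv L" "x\<in>W" using bundle_cover[OF line_bundle_with[OF A L] assms] .
 show "proj L (fibre_vec L x (%_. 0)) = x"
  by (rule fibre_vec_consistent(1)[OF line_bundle_with[OF A L] W]) simp
 show "T (fibre_vec L x (%_. 0)) = 0" if "(W',T)\<in>triv L" "x\<in>W'" for W' T
  by (rule fibre_vec_consistent(3)[OF line_bundle_with[OF A L] W _ that]) simp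
qed

lemma sum_fibre_eq:
 assumes W: "(W,T)\<in>triv L" "proj L (fst e)\<in>W"
  and e: "sproj L e = sproj L e'" "lift_triv T e = lift_triv T e'"
 shows "e = e'"
proof -
 have "T (fst e) $ 1 = T (fst e') $ 1" "snd (snd e) = snd (snd e')"
  using arg_cong[OF e(2),of "%u. u $ 1"] arg_cong[OF e(2),of "%u. u $ 2"] by simp_all
 moreover have "proj L (fst e) = proj L (fst e')" "fst (snd e) = fst (snd e')" using e(1) by simp_all
 moreover have "fst e = fst e'" by (rule fibre_eq_line[OF A L W refl]) (use calculation in simp_all)
 ultimately show ?thesis by (simp add: prod_eq_iff)
qed

lemma frames_sum:
 assumes W: "(W,T)\<in>triv L" "fst q\<in>W"
 shows "sproj L (sub_frame L T q) = q" "sproj L (quot_frame L q) = q"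
  "T (fst (sub_frame L T q)) $ 1 = 1" "T (fst (quot_frame L q)) $ 1 = 0"
  "snd (snd (sub_frame L T q)) = 0" "snd (snd (quot_frame L q)) = 1"
proof -
 have x: "fst q\<in>points A" using openin_subset_points[OF A line_openin[OF A L W(1)]] W(2) by blast
 show "sproj L (sub_frame L T q) = q" "T (fst (sub_frame L T q)) $ 1 = 1" "snd (snd (sub_frame L T q)) = 0"
  using line_frame(1,2)[OF A L W,of 1] by (simp_all add: sub_frame_def)
 show "sproj L (quot_frame L q) = q" "T (fst (quot_frame L q)) $ 1 = 0" "snd (snd (quot_frame L q)) = 1"
  using zero_vector(1)[OF x] zero_vector(2)[OF x W] by (simp_all add: quot_frame_def)
qed

lemma action_simps:
 assumes "proj L (fst e)\<in>points A"
 shows "sproj L (action L g e) = act g (sproj L e)"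
  "!!W T. (W,T)\<in>triv L ==> proj L (fst e)\<in>W ==> T (fst (action L g e)) $ 1 = factor (- 2) g (fst (snd e)) * T (fst e) $ 1"
  "snd (snd (action L g e)) = snd (snd e)"
proof -
 let ?x = "proj L (fst e)" and ?F = "%T. factor (- 2) g (fst (snd e)) *s T (fst e)"
 obtain W T where W: "(W,T)\<in>triv L" "?x\<in>W" using bundle_cover[OF line_bundle_with[OF A L] assms] .
 have a: "action L g e = (fibre_vec L ?x ?F,moebius g (fst (snd e)),snd (snd e))"
  by (cases e) (simp add: action_def)
 note c = fibre_vec_combination[OF line_bundle_with[OF A L] W refl refl,of ?F "factor (- 2) g (fst (snd e))" 0]
 show "sproj L (action L g e) = act g (sproj L e)" "snd (snd (action L g e)) = snd (snd e)"
  unfolding a using c(1) by (simp_all add: act_def)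
 show "T (fst (action L g e)) $ 1 = factor (- 2) g (fst (snd e)) * T (fst e) $ 1"
  if "(W,T)\<in>triv L" "?x\<in>W" for W T
  unfolding a using c(3)[OF _ that] by simp
qed

lemma twisted_holomorphic: "holomorphic_bundle (times_disc A) (twisted L)"
 unfolding holomorphic_bundle_def bundle_with_def case_prod_unfold
proof (intro conjI ballI)
 note Lb = line_bundle_with[OF A L]
 have tr: "triv (twisted L) = {(W\<times>\<Delta>,%(l,z). T l) | W T. (W,T)\<in>triv L}" by (simp add: twisted_def)
 have pr: "proj (twisted L) e = (proj L (fst e),snd e)" for e by (cases e) (simp add: twisted_def)
 show "(\<Union>t\<in>triv (twisted L). fst t) = points (times_disc A)"
  unfolding points_times_disc
 proof (intro equalityI subsetI)
  fix q assume "q\<in>(\<Union>t\<in>triv (twisted L). fst t)"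
  then obtain W T where W: "(W,T)\<in>triv L" "q\<in>W\<times>\<Delta>" unfolding tr by auto
  then show "q\<in>points A\<times>\<Delta>" using openin_subset_points[OF A line_openin[OF A L W(1)]] by auto
 next
  fix q assume q: "q\<in>points A\<times>\<Delta>"
  then have "fst q\<in>points A" by auto
  then obtain W T where W: "(W,T)\<in>triv L" "fst q\<in>W" by (rule bundle_cover[OF Lb])
  then have "(W\<times>\<Delta>,%(l,z :: complex). T l)\<in>triv (twisted L)" unfolding tr by blast
  moreover have "q\<in>W\<times>\<Delta>" using q W(2) by (cases q) auto
  ultimately show "q\<in>(\<Union>t\<in>triv (twisted L). fst t)" by force
 qed
 fix t assume t: "t\<in>triv (twisted L)"
 then obtain W T where W: "(W,T)\<in>triv L" "t = (W\<times>\<Delta>,%(l,z). T l)" unfolding tr by auto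
 show "open_in (times_disc A) (fst t)"
  unfolding W(2) using openin_times_disc[OF A line_openin[OF A L W(1)] open_disc[OF A] subset_refl] by simp
 show "bij_betw (snd t) {e. proj (twisted L) e = q} UNIV" if q: "q\<in>fst t" for q
 proof -
  have b: "bij_betw T {l. proj L l = fst q} UNIV" using bundle_bij[OF Lb W(1)] q W(2) by auto
  show ?thesis
  proof (rule bij_betwI')
   fix e e' assume "e\<in>{e. proj (twisted L) e = q}" "e'\<in>{e. proj (twisted L) e = q}"
   then show "snd t e = snd t e'\<longleftrightarrow>e = e'"
    using b unfolding W(2) pr bij_betw_def inj_on_def by (auto simp: prod_eq_iff case_prod_unfold)
  next
   fix y assume "y\<in>(UNIV :: (complex^1) set)"
   then obtain l where "proj L l = fst q" "T l = y" using b unfolding bij_betw_def by (metis (mono_tags,lifting) image_iff mem_Collect_eq)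
   then show "\<exists>e\<in>{e. proj (twisted L) e = q}. y = snd t e"
    unfolding W(2) by (intro bexI[of _ "(l,snd q)"]) (auto simp: pr)
  qed simp
 qed
 fix t' assume t': "t'\<in>triv (twisted L)"
 then obtain W' T' where W': "(W',T')\<in>triv L" "t' = (W'\<times>\<Delta>,%(l,z). T' l)" unfolding tr by auto
 obtain g where g: "\<forall>i. holomorphic_fun A (W\<inter>W') (%x. g x $ i)"
  "!!e. proj L e\<in>W\<inter>W' ==> T' e = g (proj L e) *v T e"
  using bundle_transition[OF Lb W(1) W'(1)] by blast
 have hol: "holomorphic_fun (times_disc A) (fst t\<inter>fst t') (%q. g (fst q) $ i)" for i
  unfolding holomorphic_fun_iff
 proof (rule ballI)
  fix c assume "c\<in>times_disc A"
  then obtain C where C: "C\<in>A" "c = pchart C" by (auto simp: times_disc_eq)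
  note Bt = atlas_times_disc[OF A]
  show "hol_on (snd c ` (fst c\<inter>(fst t\<inter>fst t'))) (%y. g (fst (cinv c y)) $ i)"
  proof (rule hol_onI)
   fix y k assume "y\<in>snd c ` (fst c\<inter>(fst t\<inter>fst t'))"
   then obtain q where q: "q\<in>fst c" "fst q\<in>W\<inter>W'" "y = snd c q" unfolding W(2) W'(2) by auto
   have q': "fst q\<in>fst C" "cmod (snd q) < 1" using q(1) unfolding C(2) by auto
   note hc = holomorphic_fun_comp[OF A g(1)[rule_format] C(1) q'(1) q(2)]
   show "(%y. g (fst (cinv c y)) $ i $ k) differentiable at y"
    using coord_vec_fst(5)[OF A C(1) q' hc(1)] unfolding cdiff_def C(2) q(3) by simp
   fix j :: 2
   show "wirtinger (Inr j) (%y. g (fst (cinv c y)) $ i $ k) y = 0"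
    using coord_vec_fst(2,4)[OF A C(1) q',of "%x. g x $ i $ k"] hc(2)[of 1] exhaust_2[of j]
    unfolding coord_vec_eq C(2) q(3) by auto
  qed
 qed
 show "\<exists>G. (\<forall>i. holomorphic_fun (times_disc A) (fst t\<inter>fst t') (%x. G x $ i)) \<and>
   (\<forall>e. proj (twisted L) e\<in>fst t\<inter>fst t' --> snd t' e = G (proj (twisted L) e) *v snd t e)"
  by (rule exI[of _ "%q. g (fst q)"]) (use hol g(2) in \<open>auto simp: pr W(2) W'(2)\<close>)
qed

context
 fixes H :: "('x\<times>complex,'l\<times>complex\<times>complex,2) vbundle"
 assumes ext: "holomorphic_extension A L H"
begin

lemma ext_facts:
 shows "proj H = sproj L" "holomorphic_bundle (times_disc A) H"
  "bundle_with (smooth_fun (times_disc A)) (times_disc A) (sum_bundle L\<lparr>triv := triv (sum_bundle L) \<union> triv H\<rparr>)"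
  "holomorphic_map (total_space (times_disc A) (twisted L)) (total_space (times_disc A) H) (%(l,z). (l,z,0))"
  "holomorphic_map (total_space (times_disc A) H)
    (total_space (times_disc A) (trivial_line (points (times_disc A)))) (%(l,z,w). ((proj L l,z),w))"
  "bundle_with (%W g. \<forall>i. holomorphic_fun (times_disc A) W (%x. g x $ i)) (times_disc A) H"
 using ext unfolding holomorphic_extension_def holomorphic_structure_def smooth_bundle_def holomorphic_bundle_def
 by (auto simp del: proj_sum_bundle)

lemma sum_transition:
 assumes "(V,S)\<in>triv H" "(W,T)\<in>triv L"
 obtains G G' where "smooth_fun (times_disc A) ((W\<times>\<Delta>)\<inter>V) G"
  "!!e. sproj L e\<in>(W\<times>\<Delta>)\<inter>V ==> S e = G (sproj L e) *v lift_triv T e"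
  "!!e. sproj L e\<in>(W\<times>\<Delta>)\<inter>V ==> lift_triv T e = G' (sproj L e) *v S e"
  "smooth_fun (times_disc A) ((W\<times>\<Delta>)\<inter>V) G'"
proof -
 let ?E = "sum_bundle L\<lparr>triv := triv (sum_bundle L) \<union> triv H\<rparr>"
 have p: "proj ?E = sproj L" by simp
 have m: "(W\<times>\<Delta>,lift_triv T)\<in>triv ?E" "(V,S)\<in>triv ?E" using assms by (auto simp: triv_sum_bundle)
 obtain G where G: "smooth_fun (times_disc A) ((W\<times>\<Delta>)\<inter>V) G"
  "!!e. proj ?E e\<in>(W\<times>\<Delta>)\<inter>V ==> S e = G (proj ?E e) *v lift_triv T e"
  using bundle_transition[OF ext_facts(3) m] by blast
 obtain G' where G': "smooth_fun (times_disc A) (V\<inter>(W\<times>\<Delta>)) G'"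
  "!!e. proj ?E e\<in>V\<inter>(W\<times>\<Delta>) ==> lift_triv T e = G' (proj ?E e) *v S e"
  using bundle_transition[OF ext_facts(3) m(2,1)] by blast
 show ?thesis by (rule that[OF G(1)]) (use G(2) G' in \<open>auto simp: p Int_commute simp del: proj_sum_bundle\<close>)
qed

lemma sum_expansion:
 assumes S: "(V,S)\<in>triv H" and W: "(W,T)\<in>triv L" and q: "q\<in>V" "fst q\<in>W" "cmod (snd q) < 1"
  and e: "sproj L e = q"
 shows "S e $ i = T (fst e) $ 1 * S (sub_frame L T q) $ i+snd (snd e) * S (quot_frame L q) $ i"
proof -
 obtain G G' where G: "!!e. sproj L e\<in>(W\<times>\<Delta>)\<inter>V ==> S e = G (sproj L e) *v lift_triv T e"
  using sum_transition[OF S W] by metis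
 have qin: "q\<in>(W\<times>\<Delta>)\<inter>V" using q by (cases q) auto
 note f = frames_sum[OF W q(2)]
 show ?thesis
  using G[of e] G[of "sub_frame L T q"] G[of "quot_frame L q"] qin e f by (simp add: vec_mult_sum sum_2 algebra_simps del: proj_sum_bundle)
qed

lemma frames_smooth:
 assumes S: "(V,S)\<in>triv H" and W: "(W,T)\<in>triv L"
 shows "open_in (times_disc A) ((W\<times>\<Delta>)\<inter>V)"
  "smooth_fun (times_disc A) ((W\<times>\<Delta>)\<inter>V) (%q. S (sub_frame L T q) $ i)"
  "smooth_fun (times_disc A) ((W\<times>\<Delta>)\<inter>V) (%q. S (quot_frame L q) $ i)"
proof -
 note Bt = atlas_times_disc[OF A]
 obtain G G' where G: "smooth_fun (times_disc A) ((W\<times>\<Delta>)\<inter>V) G"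
  "!!e. sproj L e\<in>(W\<times>\<Delta>)\<inter>V ==> S e = G (sproj L e) *v lift_triv T e"
  using sum_transition[OF S W] by metis
 show o: "open_in (times_disc A) ((W\<times>\<Delta>)\<inter>V)"
  using openin_times_disc[OF A line_openin[OF A L W] open_disc[OF A] subset_refl] bundle_openin[OF ext_facts(6) S] by (rule openin_Int)
 have c: "S (sub_frame L T q) $ i = G q $ i $ 1\<and>S (quot_frame L q) $ i = G q $ i $ 2" if "q\<in>(W\<times>\<Delta>)\<inter>V" for q
 proof -
  have "fst q\<in>W" using that by auto
  note f = frames_sum[OF W this]
  show ?thesis using G(2)[of "sub_frame L T q"] G(2)[of "quot_frame L q"] that f by (simp add: vec_mult_sum sum_2 del: proj_sum_bundle)
 qed
 have "smooth_fun (times_disc A) ((W\<times>\<Delta>)\<inter>V) (%q. G q $ i)" using G(1) by (simp add: smooth_fun_vec[OF Bt o])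
 then have g: "smooth_fun (times_disc A) ((W\<times>\<Delta>)\<inter>V) (%q. G q $ i $ k)" for k by (simp add: smooth_fun_vec[OF Bt o])
 show "smooth_fun (times_disc A) ((W\<times>\<Delta>)\<inter>V) (%q. S (sub_frame L T q) $ i)"
  by (subst smooth_fun_cong[OF Bt o,where g = "%q. G q $ i $ 1"]) (use c g in auto)
 show "smooth_fun (times_disc A) ((W\<times>\<Delta>)\<inter>V) (%q. S (quot_frame L q) $ i)"
  by (subst smooth_fun_cong[OF Bt o,where g = "%q. G q $ i $ 2"]) (use c g in auto)
qed

lemma sub_frame_holomorphic:
 assumes S: "(V,S)\<in>triv H" and W: "(W,T)\<in>triv L" and P: "P\<in>times_disc A" "p\<in>fst P"
  and p: "p\<in>V" "fst p\<in>W" "cmod (snd p) < 1"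
 shows "coord_vec P (Inr j) p (%q. S (sub_frame L T q) $ i) = 0"
proof -
 note Bt = atlas_times_disc[OF A]
 let ?N = "fst P\<inter>((W\<times>\<Delta>)\<inter>V)" and ?s = "%q. (frame L T (fst q) 1,snd q)"
 have o: "open_in (times_disc A) ?N"
  using openin_chart[OF Bt P(1)] frames_smooth(1)[OF S W] by (rule openin_Int)
 have tw: "(W\<times>\<Delta>,%(l,z). T l)\<in>triv (twisted L)" using W by (auto simp: twisted_def)
 have "coord_vec P (Inr j) p (%q. S ((%(l,z). (l,z,0)) (?s q)) $ i) = 0"
 proof (rule holomorphic_map_section(2)[OF ext_facts(4) Bt P(1) tw P(1) S o])
  show "p\<in>?N" using P p by (cases p) auto
  fix e e' :: "'l\<times>complex"
  assume e: "proj (twisted L) e\<in>W\<times>\<Delta>" "proj (twisted L) e = proj (twisted L) e'" "(%(l,z). T l) e = (%(l,z). T l) e'"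
  then show "e = e'"
   using fibre_eq_line[OF A L W,of "proj L (fst e)" "fst e" "fst e'"] by (cases e; cases e') (auto simp: twisted_def)
 next
  fix q assume q: "q\<in>?N"
  then have "fst q\<in>W" by auto
  note f = line_frame(1,2)[OF A L W this,of 1]
  show "proj (twisted L) (?s q) = q" using f by (simp add: twisted_def)
  show "(%(l,z). T l) (?s q) = 1" using f by simp
  show "proj H ((%(l,z). (l,z,0)) (?s q))\<in>fst P\<inter>V" using f q unfolding ext_facts(1) by simp
 qed auto
 then show ?thesis by (simp add: sub_frame_def)
qed

text \<open>The quotient map is holomorphic and sends the frame to the constant \<open>1\<close>; so the derivative of the
 frame lies in the sub.\<close>

lemma dolbeault_quot_frame:
 assumes v: "v\<in>tangent01 (times_disc A) p" and p: "p\<in>points (times_disc A)"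
 shows "sproj L (dolbeault H (quot_frame L) p v) = p"
  "!!V S. (V,S)\<in>triv H ==> p\<in>V ==> S (dolbeault H (quot_frame L) p v) = (\<chi> i. v (%q. S (quot_frame L q) $ i))"
  "snd (snd (dolbeault H (quot_frame L) p v)) = 0"
proof -
 note Bt = atlas_times_disc[OF A]
 have px: "fst p\<in>points A" "cmod (snd p) < 1" using p by (auto simp: points_times_disc)
 obtain W T where W: "(W,T)\<in>triv L" "fst p\<in>W" using bundle_cover[OF line_bundle_with[OF A L] px(1)] .
 have prj: "proj H (quot_frame L q) = q" if "q\<in>points (times_disc A)" for q
 proof -
  have "fst q\<in>points A" using that by (auto simp: points_times_disc)
  from bundle_cover[OF line_bundle_with[OF A L] this] obtain W T where "(W,T)\<in>triv L" "fst q\<in>W" by blast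
  from frames_sum(2)[OF this] show ?thesis unfolding ext_facts(1) .
 qed
 have pin: "p\<in>(W\<times>\<Delta>)\<inter>V" if "p\<in>V" for V using that px W(2) by (cases p) auto
 have td: "tdiff (times_disc A) p (%q. S (quot_frame L q) $ i)" if "(V,S)\<in>triv H" "p\<in>V" for V S i
  by (rule smooth_fun_tdiff[OF Bt frames_smooth(3)[OF that(1) W(1)] pin[OF that(2)]])
 note d = dolbeault_trivialisation[OF Bt ext_facts(2) openin_points[OF Bt] p prj td v]
 show pr: "sproj L (dolbeault H (quot_frame L) p v) = p" using d(1) unfolding ext_facts(1) .
 show Sd: "S (dolbeault H (quot_frame L) p v) = (\<chi> i. v (%q. S (quot_frame L q) $ i))" if "(V,S)\<in>triv H" "p\<in>V" for V S
  by (rule d(2)[OF _ _ _ that])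
 obtain V S where S: "(V,S)\<in>triv H" "p\<in>V" using bundle_cover[OF ext_facts(6) p] .
 obtain G G' where G': "!!e. sproj L e\<in>(W\<times>\<Delta>)\<inter>V ==> lift_triv T e = G' (sproj L e) *v S e"
  using sum_transition[OF S(1) W(1)] by metis
 have w: "snd (snd e) = (\<Sum>k\<in>UNIV. G' q $ 2 $ k * S e $ k)" if "q\<in>(W\<times>\<Delta>)\<inter>V" "sproj L e = q" for q e
  using arg_cong[OF G'[of e],of "%u. u $ 2"] that by (simp add: vec_mult_sum del: proj_sum_bundle)
 note oN = frames_smooth(1)[OF S(1) W(1)]
 define r where "r = (%k q. snd (snd (frame H S q (axis k 1))))"
 have fr: "sproj L (frame H S q y) = q" "S (frame H S q y) = y" if "q\<in>V" for q y
  using frame(1,2)[OF ext_facts(6) S(1) that,of y] unfolding ext_facts(1) by auto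
 have rG: "r k q = G' q $ 2 $ k" if "q\<in>(W\<times>\<Delta>)\<inter>V" for k q
  using w[OF that,of "frame H S q (axis k 1)"] fr[of q "axis k 1"] that
  by (simp add: r_def axis_def if_distrib[of "(*) _"] cong: if_cong del: proj_sum_bundle)
 have rhol: "cdiff P p (r k)" "coord_vec P (Inr j) p (r k) = 0" if P: "P\<in>times_disc A" "p\<in>fst P" for P k j
 proof -
  let ?N = "fst P\<inter>V"
  let ?f = "%(l,z :: complex,w :: complex). ((proj L l,z),w)"
  have o: "open_in (times_disc A) ?N"
   using openin_chart[OF Bt P(1)] bundle_openin[OF ext_facts(6) S(1)] by (rule openin_Int)
  have tl: "(points (times_disc A),%(p,w). vector [w])\<in>triv (trivial_line (points (times_disc A)))"
   by (simp add: trivial_line_def)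
  have pN: "p\<in>?N" using P S(2) by simp
  have inj: "e = e'" if "proj H e\<in>V" "proj H e = proj H e'" "S e = S e'" for e e'
   using frame(4)[OF ext_facts(6) S(1) that(1) refl that(2)[symmetric] that(3)] .
  have f: "proj (trivial_line (points (times_disc A))) (?f e) = sproj L e" for e :: "'l\<times>complex\<times>complex"
   by (cases e) (simp add: trivial_line_def)
  have c: "proj H (frame H S q (axis k 1)) = q" "S (frame H S q (axis k 1)) = axis k 1"
   "proj (trivial_line (points (times_disc A))) (?f (frame H S q (axis k 1)))\<in>fst P\<inter>points (times_disc A)" if "q\<in>?N" for q
   using fr[of q "axis k 1"] that openin_subset_points[OF Bt openin_chart[OF Bt P(1)]] unfolding f ext_facts(1) by auto
  have e: "(%q. (%(p,w). vector [w] :: complex^1) (?f (frame H S q (axis k 1))) $ 1) = r k"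
   by (simp add: fun_eq_iff r_def case_prod_unfold)
  show "cdiff P p (r k)"
   unfolding e[symmetric]
   by (rule holomorphic_map_section(1)[OF ext_facts(5) Bt P(1) S(1) P(1) tl o pN subset_refl,of "%q. frame H S q (axis k 1)" "axis k 1"])
    ((rule inj; assumption),(rule c; assumption)+)
  show "coord_vec P (Inr j) p (r k) = 0"
   unfolding e[symmetric]
   by (rule holomorphic_map_section(2)[OF ext_facts(5) Bt P(1) S(1) P(1) tl o pN subset_refl,of "%q. frame H S q (axis k 1)" "axis k 1"])
    ((rule inj; assumption),(rule c; assumption)+)
 qed
 have v': "v\<in>tangent_space (times_disc A) p" by (rule tangent01_subset[OF Bt v])
 have rt: "tdiff (times_disc A) p (r k)" for k using rhol(1) by (simp add: tdiff_def)
 have vr: "v (r k) = 0" for k by (rule tangent01_zero[OF v rhol(2)])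
 have td2: "tdiff (times_disc A) p (%q. r k q * S (quot_frame L q) $ k)" for k by (rule tdiff_mult[OF rt td[OF S]])
 have "v (%q. \<Sum>k\<in>UNIV. r k q * S (quot_frame L q) $ k) = v (%q. 1)"
 proof (rule tangent_cong[OF Bt v' oN pin[OF S(2)]])
  fix q assume q: "q\<in>(W\<times>\<Delta>)\<inter>V"
  then have "fst q\<in>W" by auto
  from frames_sum(2,6)[OF W(1) this] show "(\<Sum>k\<in>UNIV. r k q * S (quot_frame L q) $ k) = 1"
   using w[OF q,of "quot_frame L q"] rG[OF q] by simp
 qed
 then have "(\<Sum>k\<in>UNIV. v (%q. r k q * S (quot_frame L q) $ k)) = 0"
  using tangent_sum[OF v',of UNIV "%k q. r k q * S (quot_frame L q) $ k"] td2 tangent_const[OF Bt v'] by simp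
 moreover have "v (%q. r k q * S (quot_frame L q) $ k) = r k p * v (%q. S (quot_frame L q) $ k)" for k
  using tangent_times[OF Bt v' rt td[OF S],of k k] vr by simp
 ultimately show "snd (snd (dolbeault H (quot_frame L) p v)) = 0"
  using w[OF pin[OF S(2)] pr] Sd[OF S] rG[OF pin[OF S(2)]] by simp
qed

end

end

section \<open>The action of SU(1,1)\<close>

context
 fixes A :: "('x,1) atlas"
 assumes A: "complex_atlas A"
begin

lemma act_points: "g\<in>SU11 ==> p\<in>points (times_disc A) ==> act g p\<in>points (times_disc A)"
 using moebius(2) by (auto simp: points_times_disc act_def)

lemma act_chart:
 assumes g: "g\<in>SU11" and C: "C\<in>A"
 defines "psi == %y. vector [y $ 1,moebius g (y $ 2)] :: complex^2"
  and "J == %z. (\<chi> i j. if i = 1 then (if j = 1 then 1 else 0) else (if j = 1 then 0 else 1/(g $ 2 $ 1 * z+g $ 2 $ 2)\<^sup>2)) :: complex^2^2"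
 shows "!!q. fst q\<in>fst C ==> cmod (snd q) < 1 ==> psi (snd (pchart C) q) = snd (pchart C) (act g q)"
  "!!y. cmod (y $ 2) < 1 ==> (psi has_derivative (%v. J (y $ 2) *v v)) (at y)"
proof -
 show "psi (snd (pchart C) q) = snd (pchart C) (act g q)" for q
  by (simp add: vec2_eq_iff psi_def act_def)
 fix y :: "complex^2" assume y: "cmod (y $ 2) < 1"
 have 1: "((%y :: complex^2. y $ k) has_derivative (%v. v $ k)) (at y)" for k
  by (rule bounded_linear_imp_has_derivative[OF bounded_linear_vec_nth])
 have 2: "((%y. moebius g (y $ 2)) has_derivative (%v. 1/(g $ 2 $ 1 * (y $ 2)+g $ 2 $ 2)\<^sup>2 * v $ 2)) (at y)"
  by (rule has_derivative_compose[OF 1 moebius(3)[OF g y,unfolded has_field_derivative_def]])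
 have "((%y. \<Sum>i\<in>UNIV. axis i (psi y $ i)) has_derivative (%v. \<Sum>i\<in>UNIV. axis i ((J (y $ 2) *v v) $ i))) (at y)"
 proof (rule has_derivative_sum,rule bounded_linear.has_derivative[OF bounded_linear_axis])
  fix i :: 2
  show "((%y. psi y $ i) has_derivative (%v. (J (y $ 2) *v v) $ i)) (at y)"
   using exhaust_2[of i] 1[of 1] 2 by (auto simp: vec_mult_sum sum_2 psi_def J_def)
 qed
 moreover have "(\<Sum>i\<in>UNIV. axis i (u $ i)) = u" for u :: "complex^2" by (simp add: vec_eq_iff axis_def)
 ultimately show "(psi has_derivative (%v. J (y $ 2) *v v)) (at y)" by simp
qed

text \<open>The derivative of the action along the disc is \<open>(cnj b z + cnj a)\<^sup>-\<^sup>2\<close>, and it is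
 conjugated on vectors of type (0,1).\<close>

lemma act_chain:
 assumes g: "g\<in>SU11" and C: "C\<in>A" "fst p\<in>fst C" and z: "cmod (snd p) < 1"
  and F: "cdiff (pchart C) (act g p) F"
 shows "dbar (pchart C) p (%q. F (act g q)) = dbar (pchart C) (act g p) F"
  "coord_vec (pchart C) (Inr 2) p (%q. F (act g q)) =
   cnj (1/(g $ 2 $ 1 * snd p+g $ 2 $ 2)\<^sup>2) * coord_vec (pchart C) (Inr 2) (act g p) F"
proof -
 let ?t = "pchart C" and ?psi = "%y. vector [y $ 1,moebius g (y $ 2)] :: complex^2"
 note Bt = atlas_times_disc[OF A] and t = pchart_in[OF A C(1)]
 have o: "open (snd ?t ` fst ?t)" "snd ?t p\<in>snd ?t ` fst ?t" using open_chart[OF Bt t] C z by auto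
 have eq: "F (act g (cinv ?t y)) = F (cinv ?t (?psi y))" if "y\<in>snd ?t ` fst ?t" for y
 proof -
  have q: "cinv ?t y\<in>fst ?t" "snd ?t (cinv ?t y) = y" using chart_mult_left[OF Bt t that] by auto
  have "?psi y = snd ?t (act g (cinv ?t y))"
   using act_chart(1)[OF g C(1),of "cinv ?t y"] q by simp
  moreover have "act g (cinv ?t y)\<in>fst ?t" using q(1) moebius(2)[OF g] by (simp add: act_def)
  ultimately show ?thesis using cinv_chart[OF Bt t] by simp
 qed
 have psi: "?psi (snd ?t p) = snd ?t (act g p)" by (rule act_chart(1)[OF g C z])
 have z2: "cmod (snd ?t p $ 2) < 1" using z by simp
 have d: "(%y. F (cinv ?t y)) differentiable (at (?psi (snd ?t p)))" using F unfolding psi cdiff_def .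
 have w: "coord_vec ?t k p (%q. F (act g q)) = wirtinger k (%y. F (cinv ?t (?psi y))) (snd ?t p)" for k
  unfolding coord_vec_eq by (rule wirtinger_cong_open[OF o eq])
 note ch = wirtinger_chain(2)[OF act_chart(2)[OF g C(1) z2] d]
 show "dbar ?t p (%q. F (act g q)) = dbar ?t (act g p) F"
  unfolding w ch unfolding psi coord_vec_eq by (simp add: sum_2)
 show "coord_vec ?t (Inr 2) p (%q. F (act g q)) =
   cnj (1/(g $ 2 $ 1 * snd p+g $ 2 $ 2)\<^sup>2) * coord_vec ?t (Inr 2) (act g p) F"
  unfolding w ch unfolding psi coord_vec_eq by (simp add: sum_2)
qed

lemma openin_act_preimage:
 assumes g: "g\<in>SU11" and C: "C\<in>A" and V: "open_in (times_disc A) V"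
 shows "open_in (times_disc A) {q\<in>fst (pchart C). act g q\<in>V}"
proof -
 let ?t = "pchart C" and ?psi = "%y. vector [y $ 1,moebius g (y $ 2)] :: complex^2"
 note Bt = atlas_times_disc[OF A] and t = pchart_in[OF A C]
 let ?R = "snd ?t ` fst ?t" and ?Q = "snd ?t ` (fst ?t\<inter>V)"
 have o: "open ?R" "open ?Q" using open_chart[OF Bt t] open_chart_image[OF Bt t V] by auto
 have "continuous_on ?R ?psi"
 proof (rule continuous_at_imp_continuous_on,rule ballI)
  fix y assume "y\<in>?R"
  then have "cmod (y $ 2) < 1" by auto
  from act_chart(2)[OF g C this] show "isCont ?psi y" by (rule has_derivative_continuous)
 qed
 then have oR: "open (?R\<inter>?psi -` ?Q)"
  using o by (simp add: continuous_on_open_vimage Int_commute)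
 have "{q\<in>fst ?t. act g q\<in>V} = cinv ?t ` (?R\<inter>?psi -` ?Q)"
 proof (intro equalityI subsetI)
  fix q assume "q\<in>{q\<in>fst ?t. act g q\<in>V}"
  then have q: "q\<in>fst ?t" "act g q\<in>V" by auto
  have "act g q\<in>fst ?t" using q(1) moebius(2)[OF g] by (simp add: act_def)
  then have "?psi (snd ?t q)\<in>?Q" using act_chart(1)[OF g C,of q] q by auto
  then show "q\<in>cinv ?t ` (?R\<inter>?psi -` ?Q)"
   using q(1) cinv_chart[OF Bt t q(1)] by (intro image_eqI[of _ _ "snd ?t q"]) auto
 next
  fix q assume "q\<in>cinv ?t ` (?R\<inter>?psi -` ?Q)"
  then obtain y where y: "y\<in>?R" "?psi y\<in>?Q" "q = cinv ?t y" by auto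
  have q: "q\<in>fst ?t" "snd ?t q = y" using chart_mult_left[OF Bt t y(1)] y(3) by auto
  obtain r where r: "r\<in>fst ?t" "r\<in>V" "?psi y = snd ?t r" using y(2) by auto
  have "snd ?t (act g q) = snd ?t r" using act_chart(1)[OF g C,of q] q r(3) by simp
  moreover have "act g q\<in>fst ?t" using q(1) moebius(2)[OF g] by (simp add: act_def)
  ultimately have "act g q = r" using chart_inj[OF Bt t] r(1) by (simp add: inj_on_def)
  then show "q\<in>{q\<in>fst ?t. act g q\<in>V}" using q(1) r(2) by simp
 qed
 then show ?thesis using openin_chart_preimage[OF Bt t oR] by simp
qed

end

text \<open>The second fundamental form of the extension: the derivative of the section of the splitting, in the
 coordinate of the sub.\<close>

definition second_form :: "('x,'l,1) vbundle => ('x\<times>complex,'l\<times>complex\<times>complex,2) vbundle =>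
  ('l => complex^1) => 'x\<times>complex => ('x\<times>complex) tangent => complex" where
 "second_form L H T q v = T (fst (dolbeault H (quot_frame L) q v)) $ 1"

context
 fixes A :: "('x,1) atlas" and L :: "('x,'l,1) vbundle" and H :: "('x\<times>complex,'l\<times>complex\<times>complex,2) vbundle"
 assumes A: "complex_atlas A" and L: "holomorphic_bundle A L" and ext: "holomorphic_extension A L H"
begin

lemma second_form_quot:
 assumes v: "v\<in>tangent01 (times_disc A) p" and p: "p\<in>points (times_disc A)"
  and S: "(V,S)\<in>triv H" "p\<in>V" and W: "(W,T)\<in>triv L" "fst p\<in>W"
 shows "v (%q. S (quot_frame L q) $ i) = second_form L H T p v * S (sub_frame L T p) $ i"
proof -
 let ?b = "dolbeault H (quot_frame L) p v"
 note d = dolbeault_quot_frame[OF A L ext v p]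
 have "cmod (snd p) < 1" using p by (auto simp: points_times_disc)
 from sum_expansion[OF A L ext S(1) W(1) S(2) W(2) this d(1),of i] show ?thesis
  using d(2)[OF S] d(3) by (simp add: second_form_def)
qed

text \<open>Leibniz rule in the frame of the splitting, with the sub frame holomorphic and the other one differentiating
 to the second fundamental form.\<close>

lemma dolbeault_section:
 assumes N: "open_in (times_disc A) N" "p\<in>N"
  and s: "sum_section A L N s"
  and v: "v\<in>tangent01 (times_disc A) p" and W: "(W,T)\<in>triv L" "fst p\<in>W"
 shows "sproj L (dolbeault H s p v) = p"
  "T (fst (dolbeault H s p v)) $ 1 = v (%q. T (fst (s q)) $ 1)+snd (snd (s p)) * second_form L H T p v"
  "snd (snd (dolbeault H s p v)) = v (%q. snd (snd (s q)))"
  "smooth_fun (times_disc A) (N\<inter>(W\<times>\<Delta>)) (%q. T (fst (s q)) $ 1)"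
  "smooth_fun (times_disc A) (N\<inter>(W\<times>\<Delta>)) (%q. snd (snd (s q)))"
proof -
 note Bt = atlas_times_disc[OF A]
 note E = ext_facts[OF A L ext]
 have p: "p\<in>points (times_disc A)" using openin_subset_points[OF Bt N(1)] N(2) by blast
 have z: "cmod (snd p) < 1" using p by (auto simp: points_times_disc)
 have "\<forall>x\<in>N. sproj L (s x) = x" using s unfolding smooth_section_def by (rule conjunct1)
 then have ps: "sproj L (s q) = q" if "q\<in>N" for q using that by blast
 have sm: "smooth_fun (times_disc A) (N\<inter>(W'\<times>\<Delta>)) (%q. lift_triv T' (s q) $ i)" if "(W',T')\<in>triv L" for W' T' i
 proof -
  have "\<forall>t\<in>triv (sum_bundle L). smooth_fun (times_disc A) (N\<inter>fst t) (%x. snd t (s x))"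
   using s unfolding smooth_section_def case_prod_unfold by (rule conjunct2)
  moreover have "(W'\<times>\<Delta>,lift_triv T')\<in>triv (sum_bundle L)" using that unfolding triv_sum_bundle by blast
  ultimately have 1: "smooth_fun (times_disc A) (N\<inter>(W'\<times>\<Delta>)) (%x. lift_triv T' (s x))" by fastforce
  have "open_in (times_disc A) (N\<inter>(W'\<times>\<Delta>))"
   using N(1) openin_times_disc[OF A line_openin[OF A L that] open_disc[OF A] subset_refl] by (rule openin_Int)
  with 1 show ?thesis by (simp only: smooth_fun_vec[OF Bt])
 qed
 show s1: "smooth_fun (times_disc A) (N\<inter>(W\<times>\<Delta>)) (%q. T (fst (s q)) $ 1)"
  and s2: "smooth_fun (times_disc A) (N\<inter>(W\<times>\<Delta>)) (%q. snd (snd (s q)))"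
  using sm[OF W(1),of 1] sm[OF W(1),of 2] by simp_all
 have pin: "p\<in>N\<inter>(W\<times>\<Delta>)" using N(2) W(2) z by (cases p) auto
 have pV: "p\<in>(W\<times>\<Delta>)\<inter>V" if "p\<in>V" for V using pin that by blast
 have v': "v\<in>tangent_space (times_disc A) p" by (rule tangent01_subset[OF Bt v])
 note td = smooth_fun_tdiff[OF Bt s1 pin] smooth_fun_tdiff[OF Bt s2 pin]
 have ex: "S (s q) $ i = T (fst (s q)) $ 1 * S (sub_frame L T q) $ i+snd (snd (s q)) * S (quot_frame L q) $ i"
  if "(V,S)\<in>triv H" "q\<in>V" "q\<in>N" "q\<in>W\<times>\<Delta>" for V S q i
  by (rule sum_expansion[OF A L ext that(1) W(1) that(2) _ _ ps[OF that(3)]]) (use that(4) in auto)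
 have oN: "open_in (times_disc A) (N\<inter>((W\<times>\<Delta>)\<inter>V))" if "(V,S)\<in>triv H" for V S
  using N(1) frames_smooth(1)[OF A L ext that W(1)] by (rule openin_Int)
 have td12: "tdiff (times_disc A) p (%q. S (sub_frame L T q) $ i)" "tdiff (times_disc A) p (%q. S (quot_frame L q) $ i)"
  if "(V,S)\<in>triv H" "p\<in>V" for V S i
  using smooth_fun_tdiff[OF Bt frames_smooth(2)[OF A L ext that(1) W(1)] pV[OF that(2)]]
   smooth_fun_tdiff[OF Bt frames_smooth(3)[OF A L ext that(1) W(1)] pV[OF that(2)]] by auto
 have tdS: "tdiff (times_disc A) p (%q. S (s q) $ i)" if S: "(V,S)\<in>triv H" "p\<in>V" for V S i
  unfolding tdiff_def
 proof (intro ballI impI)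
  fix P assume P: "P\<in>times_disc A" "p\<in>fst P"
  have "cdiff P p (%q. T (fst (s q)) $ 1 * S (sub_frame L T q) $ i+snd (snd (s q)) * S (quot_frame L q) $ i)"
   using td td12[OF S] P unfolding tdiff_def by (intro cdiff_add cdiff_mult) auto
  then show "cdiff P p (%q. S (s q) $ i)"
   by (subst coord_vec_cong(2)[OF Bt P oN[OF S(1)]]) (use pin S ex in auto)
 qed
 have prH: "proj H (s q) = q" if "q\<in>N" for q using ps[OF that] unfolding E(1) .
 note d = dolbeault_trivialisation[OF Bt E(2) N prH tdS v]
 show pd: "sproj L (dolbeault H s p v) = p" using d(1) unfolding E(1) .
 obtain V S where S: "(V,S)\<in>triv H" "p\<in>V" using bundle_cover[OF E(6) p] .
 have v0: "v (%q. S (sub_frame L T q) $ i) = 0" for i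
  by (rule tangent01_zero[OF v]) (rule sub_frame_holomorphic[OF A L ext S(1) W(1) _ _ S(2) W(2) z])
 define e where "e = (frame L T (fst p) (vec (v (%q. T (fst (s q)) $ 1)+snd (snd (s p)) * second_form L H T p v)),
   snd p,v (%q. snd (snd (s q))))"
 have e: "sproj L e = p" "T (fst e) $ 1 = v (%q. T (fst (s q)) $ 1)+snd (snd (s p)) * second_form L H T p v"
  "snd (snd e) = v (%q. snd (snd (s q)))"
  using line_frame(1,2)[OF A L W] by (simp_all add: e_def)
 have "S (dolbeault H s p v) $ i = S e $ i" for i
 proof -
  have "S (dolbeault H s p v) $ i = v (%q. S (s q) $ i)" using d(2)[OF _ _ _ S] by simp
  also have "... = v (%q. T (fst (s q)) $ 1 * S (sub_frame L T q) $ i+snd (snd (s q)) * S (quot_frame L q) $ i)"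
   by (rule tangent_cong[OF Bt v' oN[OF S(1)]]) (use pin S ex in auto)
  also have "... = v (%q. T (fst (s q)) $ 1) * S (sub_frame L T p) $ i +
    (v (%q. snd (snd (s q))) * S (quot_frame L p) $ i+snd (snd (s p)) * (second_form L H T p v * S (sub_frame L T p) $ i))"
   using td td12[OF S] by (simp add: tangent_plus[OF v'] tangent_times[OF Bt v'] tdiff_mult v0 second_form_quot[OF v p S W])
  also have "... = S e $ i"
   using sum_expansion[OF A L ext S(1) W(1) S(2) W(2) z e(1),of i] e by (simp add: algebra_simps)
  finally show ?thesis .
 qed
 then have "S (dolbeault H s p v) = S e" by (simp add: vec_eq_iff)
 then have "dolbeault H s p v = e"
  by (rule frame(4)[OF E(6) S,unfolded E(1),OF pd e(1)])
 then show "T (fst (dolbeault H s p v)) $ 1 = v (%q. T (fst (s q)) $ 1)+snd (snd (s p)) * second_form L H T p v"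
  "snd (snd (dolbeault H s p v)) = v (%q. snd (snd (s q)))" using e by auto
qed

text \<open>The action is holomorphic and fixes the section of the splitting; so it carries the derivative of this section
 at \<open>p\<close> to the one at \<open>g p\<close>. The number \<open>\<mu>\<close> is the derivative of the
 action on the vector.\<close>

lemma second_form_equivariant:
 assumes g: "g\<in>SU11" "holomorphic_map (total_space (times_disc A) H) (total_space (times_disc A) H) (action L g)"
  and p: "p\<in>points (times_disc A)" and W: "(W,T)\<in>triv L" "fst p\<in>W" and C: "C\<in>A" "fst p\<in>fst C"
  and \<mu>: "!!F. cdiff (pchart C) (act g p) F ==>
   coord_vec (pchart C) (Inr j) p (%q. F (act g q)) = \<mu> * coord_vec (pchart C) (Inr j) (act g p) F"
 shows "\<mu> * second_form L H T (act g p) (coord_vec (pchart C) (Inr j) (act g p)) =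
  factor (- 2) g (snd p) * second_form L H T p (coord_vec (pchart C) (Inr j) p)"
proof -
 note Bt = atlas_times_disc[OF A]
 note E = ext_facts[OF A L ext]
 let ?t = "pchart C"
 have z: "cmod (snd p) < 1" using p by (auto simp: points_times_disc)
 have t: "?t\<in>times_disc A" "p\<in>fst ?t" using pchart_in[OF A C(1)] C z by auto
 have gp: "act g p\<in>points (times_disc A)" by (rule act_points[OF A g(1) p])
 have gt: "act g p\<in>fst ?t" using C(2) moebius(2)[OF g(1) z] by (simp add: act_def)
 have gW: "fst (act g q) = fst q" for q by (simp add: act_def)
 have gz: "cmod (snd (act g q)) < 1" if "cmod (snd q) < 1" for q using moebius(2)[OF g(1) that] by (simp add: act_def)
 obtain V S where S: "(V,S)\<in>triv H" "p\<in>V" using bundle_cover[OF E(6) p] .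
 obtain V' S' where S': "(V',S')\<in>triv H" "act g p\<in>V'" using bundle_cover[OF E(6) gp] .
 let ?v = "coord_vec ?t (Inr j) p" and ?v' = "coord_vec ?t (Inr j) (act g p)"
 have v: "?v\<in>tangent01 (times_disc A) p" by (rule coord_in_tangent_space(3)[OF Bt t])
 have v': "?v'\<in>tangent01 (times_disc A) (act g p)" by (rule coord_in_tangent_space(3)[OF Bt t(1) gt])
 have vs: "?v\<in>tangent_space (times_disc A) p" by (rule coord_in_tangent_space(1)[OF Bt t])
 let ?b = "dolbeault H (quot_frame L) p ?v" and ?b' = "dolbeault H (quot_frame L) (act g p) ?v'"
 note d = dolbeault_quot_frame[OF A L ext v p] and d' = dolbeault_quot_frame[OF A L ext v' gp]
 obtain G G' where G': "!!e. sproj L e\<in>(W\<times>\<Delta>)\<inter>V ==> lift_triv T e = G' (sproj L e) *v S e"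
  using sum_transition[OF A L ext S(1) W(1)] by metis
 obtain K K' where K': "!!e. sproj L e\<in>(W\<times>\<Delta>)\<inter>V' ==> lift_triv T e = K' (sproj L e) *v S' e"
  using sum_transition[OF A L ext S'(1) W(1)] by metis
 define N where "N = {q\<in>fst ?t. act g q\<in>V'}\<inter>((W\<times>\<Delta>)\<inter>V)"
 have oN: "open_in (times_disc A) N"
  unfolding N_def by (rule openin_Int[OF openin_act_preimage[OF A g(1) C(1) bundle_openin[OF E(6) S'(1)]] frames_smooth(1)[OF A L ext S(1) W(1)]])
 have pN: "p\<in>N" using t S S' W z unfolding N_def by (cases p) auto
 have Nq: "fst q\<in>W" "cmod (snd q) < 1" "q\<in>V" "act g q\<in>V'" "q\<in>fst ?t" "fst q\<in>points A" if "q\<in>N" for q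
  using that openin_subset_points[OF A line_openin[OF A L W(1)]] unfolding N_def by auto
 have fr: "sproj L (frame H S q y) = q" "S (frame H S q y) = y" if "q\<in>V" for q y
  using frame(1,2)[OF E(6) S(1) that,of y] unfolding E(1) by auto
 define M where "M = (%k i q. S' (action L g (frame H S q (axis k 1))) $ i)"
 have act_e: "sproj L (action L g e) = act g q"
  "T (fst (action L g e)) $ 1 = factor (- 2) g (snd q) * T (fst e) $ 1" "snd (snd (action L g e)) = snd (snd e)"
  if "q\<in>N" "sproj L e = q" for q e
 proof -
  have "proj L (fst e) = fst q" "fst (snd e) = snd q" using that(2) by auto
  then have "proj L (fst e)\<in>points A" "proj L (fst e)\<in>W" "fst (snd e) = snd q" using Nq[OF that(1)] by auto
  then show "sproj L (action L g e) = act g q"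
   "T (fst (action L g e)) $ 1 = factor (- 2) g (snd q) * T (fst e) $ 1" "snd (snd (action L g e)) = snd (snd e)"
   using action_simps[OF A L,of e] W(1) that(2) by (auto simp del: proj_sum_bundle)
 qed
 have lin: "S' (action L g e) $ i = (\<Sum>k\<in>UNIV. S e $ k * M k i q)" if q: "q\<in>N" and e: "sproj L e = q" for q e i
 proof -
  have qin: "q\<in>(W\<times>\<Delta>)\<inter>V" using q unfolding N_def by blast
  note n = Nq[OF q]
  have l: "lift_triv T e $ r = (\<Sum>k\<in>UNIV. S e $ k * lift_triv T (frame H S q (axis k 1)) $ r)" for r
  proof -
   have "lift_triv T (frame H S q (axis k 1)) $ r = G' q $ r $ k" for k
    using G'[of "frame H S q (axis k 1)"] fr[OF n(3),of "axis k 1"] qin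
    by (simp add: vec_mult_sum axis_def if_distrib[of "(*) _"] cong: if_cong del: proj_sum_bundle lift_triv_nth)
   then show ?thesis using G'[of e] e qin by (simp add: vec_mult_sum mult.commute del: proj_sum_bundle lift_triv_nth)
  qed
  have x: "S' (action L g e) $ i = factor (- 2) g (snd q) * lift_triv T e $ 1 * S' (sub_frame L T (act g q)) $ i
   +lift_triv T e $ 2 * S' (quot_frame L (act g q)) $ i" if e: "sproj L e = q" for e
  proof -
   note a = act_e[OF q e]
   have "fst (act g q)\<in>W" using n(1) by (simp add: gW)
   from sum_expansion[OF A L ext S'(1) W(1) n(4) this gz[OF n(2)] a(1),of i] show ?thesis using a(2,3) by simp
  qed
  show ?thesis
   unfolding M_def x[OF e] x[OF fr(1)[OF n(3)]] l[of 1] l[of 2]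
   by (simp add: sum_2 algebra_simps)
 qed
 have Mhol: "cdiff P p (M k i)" "coord_vec P (Inr j') p (M k i) = 0" if P: "P\<in>times_disc A" "p\<in>fst P" for P k i j'
 proof -
  let ?s = "%q. frame H S q (axis k 1)"
  have oP: "open_in (times_disc A) (N\<inter>fst P)" "p\<in>N\<inter>fst P" "N\<inter>fst P\<subseteq>fst P\<inter>V"
   using oN openin_chart[OF Bt P(1)] pN P(2) Nq(3) by auto
  have inj: "e = e'" if "proj H e\<in>V" "proj H e = proj H e'" "S e = S e'" for e e'
   using frame(4)[OF E(6) S(1) that(1) refl that(2)[symmetric] that(3)] .
  have c1: "proj H (?s q) = q" "S (?s q) = axis k 1" if "q\<in>N\<inter>fst P" for q
   using fr[of q "axis k 1"] Nq(3)[of q] that unfolding E(1) by auto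
  have c3: "proj H (action L g (?s q))\<in>fst ?t\<inter>V'" if "q\<in>N\<inter>fst P" for q
  proof -
   have qN: "q\<in>N" using that by blast
   have "proj H (action L g (?s q)) = act g q" unfolding E(1) by (rule act_e(1)[OF qN fr(1)[OF Nq(3)[OF qN]]])
   then show ?thesis using Nq[OF qN] gz[of q] gW[of q] by simp
  qed
  show "cdiff P p (M k i)" unfolding M_def
   by (rule holomorphic_map_section(1)[OF g(2) Bt P(1) S(1) t(1) S'(1) oP,of ?s "axis k 1"])
    ((rule inj; assumption),(rule c1; assumption)+,(rule c3; assumption))
  show "coord_vec P (Inr j') p (M k i) = 0" unfolding M_def
   by (rule holomorphic_map_section(2)[OF g(2) Bt P(1) S(1) t(1) S'(1) oP,of ?s "axis k 1"])
    ((rule inj; assumption),(rule c1; assumption)+,(rule c3; assumption))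
 qed
 have quot: "sproj L (quot_frame L q) = q" if "fst q\<in>W" for q by (rule frames_sum(2)[OF A L W(1) that])
 have aq: "action L g (quot_frame L q) = quot_frame L (act g q)" if q: "q\<in>N" for q
 proof (rule sum_fibre_eq[OF A L W(1)])
  have qW: "fst q\<in>W" "fst (act g q)\<in>W" using Nq[OF q] by (auto simp: gW)
  note a = act_e[OF q quot[OF qW(1)]]
  note f = frames_sum[OF A L W(1) qW(1)] frames_sum[OF A L W(1) qW(2)]
  show "proj L (fst (action L g (quot_frame L q)))\<in>W"
   using arg_cong[OF a(1),of fst] qW(2) by simp
  show "sproj L (action L g (quot_frame L q)) = sproj L (quot_frame L (act g q))"
   using a(1) f(8) by (simp del: proj_sum_bundle)
  show "lift_triv T (action L g (quot_frame L q)) = lift_triv T (quot_frame L (act g q))"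
   using a(2,3) f by (simp add: vec2_eq_iff)
 qed
 have pin': "act g p\<in>(W\<times>\<Delta>)\<inter>V'" using S'(2) W(2) gz[OF z] gW[of p] by (cases "act g p") auto
 have pin: "p\<in>(W\<times>\<Delta>)\<inter>V" using pN unfolding N_def by blast
 have main: "S' (action L g ?b) $ i = \<mu> * S' ?b' $ i" for i
 proof -
  have td: "tdiff (times_disc A) p (%q. S (quot_frame L q) $ k)" "tdiff (times_disc A) p (M k i)" for k
   using smooth_fun_tdiff[OF Bt frames_smooth(3)[OF A L ext S(1) W(1)] pin] Mhol(1) by (auto simp: tdiff_def)
  have vM: "?v (M k i) = 0" for k by (rule tangent01_zero[OF v Mhol(2)])
  have "S' (action L g ?b) $ i = (\<Sum>k\<in>UNIV. S ?b $ k * M k i p)" by (rule lin[OF pN d(1)])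
  also have "... = (\<Sum>k\<in>UNIV. ?v (%q. S (quot_frame L q) $ k * M k i q))"
   using d(2)[OF S] tangent_times[OF Bt vs td] vM by simp
  also have "... = ?v (%q. \<Sum>k\<in>UNIV. S (quot_frame L q) $ k * M k i q)"
   using tangent_sum[OF vs,of UNIV "%k q. S (quot_frame L q) $ k * M k i q"] tdiff_mult[OF td] by simp
  also have "... = ?v (%q. S' (quot_frame L (act g q)) $ i)"
  proof (rule tangent_cong[OF Bt vs oN pN])
   fix q assume q: "q\<in>N"
   show "(\<Sum>k\<in>UNIV. S (quot_frame L q) $ k * M k i q) = S' (quot_frame L (act g q)) $ i"
    using lin[OF q quot[OF Nq(1)[OF q]],of i] aq[OF q] by simp
  qed
  also have "... = \<mu> * ?v' (%q. S' (quot_frame L q) $ i)"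
   by (rule \<mu>,rule smooth_fun_cdiff[OF Bt frames_smooth(3)[OF A L ext S'(1) W(1)] t(1) gt pin'])
  also have "... = \<mu> * S' ?b' $ i" using d'(2)[OF S'] by simp
  finally show ?thesis .
 qed
 have "lift_triv T (action L g ?b) $ 1 = \<mu> * lift_triv T ?b' $ 1"
  using K'[of "action L g ?b"] K'[of ?b'] act_e(1)[OF pN d(1)] d'(1) pin'
  by (simp add: vec_mult_sum main sum_distrib_left mult_ac del: proj_sum_bundle lift_triv_nth)
 then show ?thesis using act_e(2)[OF pN d(1)] by (simp add: second_form_def)
qed

end

definition su :: "complex => complex => complex^2^2" where
 "su a b = vector [vector [a,b],vector [cnj b,cnj a]]"

lemma su_nth [simp]: "su a b $ 1 $ 1 = a" "su a b $ 1 $ 2 = b" "su a b $ 2 $ 1 = cnj b" "su a b $ 2 $ 2 = cnj a"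
 by (simp_all add: su_def)

lemma su_in: "(cmod a)\<^sup>2 - (cmod b)\<^sup>2 = 1 ==> su a b\<in>SU11"
 unfolding SU11_def su_def by blast

lemma factor_minus2: "factor (- 2) g z = (g $ 2 $ 1 * z+g $ 2 $ 2)\<^sup>2"
 by (simp add: factor_def power_int_minus divide_inverse)

text \<open>The rotation by the angle \<open>\<pi>\<close> fixes the origin and acts on the fibre of \<open>L\<^sub>-\<^sub>2\<close> there by \<open>-1\<close>.\<close>

lemma half_turn: "su \<i> 0\<in>SU11" "moebius (su \<i> 0) 0 = 0" "factor (- 2) (su \<i> 0) 0 = - 1"
 by (simp_all add: su_in moebius_def factor_minus2)

text \<open>The element of \<open>SU(1,1)\<close> that moves the origin to \<open>z\<close> without rotation.\<close>

lemma translation: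
 assumes z: "cmod z < 1"
 defines "y == 1 - (cmod z)\<^sup>2"
 defines "g == su (of_real (1/sqrt y)) (z * of_real (1/sqrt y))"
 shows "y > 0" "g\<in>SU11" "moebius g 0 = z" "factor (- 2) g 0 = of_real (1/y)"
  "cnj (1/(g $ 2 $ 1 * 0+g $ 2 $ 2)\<^sup>2) = of_real y"
proof -
 show y: "y > 0" using z unfolding y_def by (simp add: abs_square_less_1)
 then have s: "sqrt y > 0" "(sqrt y)\<^sup>2 = y" by simp_all
 have "(cmod (of_real (1/sqrt y)))\<^sup>2 - (cmod (z * of_real (1/sqrt y)))\<^sup>2 = (1 - (cmod z)\<^sup>2)/y"
  using s by (simp add: norm_mult power_mult_distrib power_divide norm_divide diff_divide_distrib)
 also have "... = 1" using y unfolding y_def by simp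
 finally show "g\<in>SU11" unfolding g_def by (rule su_in)
 show "moebius g 0 = z" using s by (simp add: moebius_def g_def)
 have *: "(complex_of_real (sqrt y))\<^sup>2 = of_real y" using s(2) by (metis of_real_power)
 show "factor (- 2) g 0 = of_real (1/y)" by (simp add: factor_minus2 g_def power_divide *)
 show "cnj (1/(g $ 2 $ 1 * 0+g $ 2 $ 2)\<^sup>2) = of_real y" by (simp add: g_def power_divide *)
qed

context
 fixes A :: "('x,1) atlas" and L :: "('x,'l,1) vbundle" and H :: "('x\<times>complex,'l\<times>complex\<times>complex,2) vbundle"
 assumes A: "complex_atlas A" and L: "holomorphic_bundle A L" and ext: "holomorphic_extension A L H"
begin

text \<open>For the component along \<open>X\<close> the half turn gives \<open>b = - b\<close> over the origin. The other
 component transforms over the origin by \<open>-1\<close> on both sides and is free there; translation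
 determines it at the other points.\<close>

lemma second_form_invariant:
 assumes eq: "equivariant_holomorphic A L H" and W: "(W,T)\<in>triv L" "x\<in>W" and C: "C\<in>A" "x\<in>fst C" and z: "cmod z < 1"
 shows "second_form L H T (x,z) (dbar (pchart C) (x,z)) = 0"
  "second_form L H T (x,z) (coord_vec (pchart C) (Inr 2) (x,z)) =
   second_form L H T (x,0) (coord_vec (pchart C) (Inr 2) (x,0))/of_real ((1 - (cmod z)\<^sup>2)\<^sup>2)"
proof -
 have hm: "holomorphic_map (total_space (times_disc A) H) (total_space (times_disc A) H) (action L g)" if "g\<in>SU11" for g
  using eq that unfolding equivariant_holomorphic_def biholomorphic_def by blast
 have p0: "(x,0)\<in>points (times_disc A)" using C by (auto simp: points_times_disc points_iff)
 define B where "B = (%j z. second_form L H T (x,z) (coord_vec (pchart C) (Inr j) (x,z)))"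
 have e1: "1 * B 1 (moebius g 0) = factor (- 2) g 0 * B 1 0" if g: "g\<in>SU11" for g
  using second_form_equivariant[OF A L ext g hm[OF g] p0 W(1) _ C(1),of 1 1] W(2) C(2)
   act_chain(1)[OF A g C(1),of "(x,0)"] unfolding B_def by (simp add: act_def)
 have e2: "cnj (1/(g $ 2 $ 1 * 0+g $ 2 $ 2)\<^sup>2) * B 2 (moebius g 0) = factor (- 2) g 0 * B 2 0" if g: "g\<in>SU11" for g
  using second_form_equivariant[OF A L ext g hm[OF g] p0 W(1) _ C(1),of 2 "cnj (1/(g $ 2 $ 1 * 0+g $ 2 $ 2)\<^sup>2)"] W(2) C(2)
   act_chain(2)[OF A g C(1),of "(x,0)"] unfolding B_def by (simp add: act_def)
 note t = translation[OF z]
 have "B 1 0 = 0" using e1[OF half_turn(1)] half_turn(2,3) by simp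
 then have "B 1 z = 0" using e1[OF t(2)] t(3) by simp
 then show "second_form L H T (x,z) (dbar (pchart C) (x,z)) = 0" by (simp add: B_def)
 let ?y = "1 - (cmod z)\<^sup>2"
 have "of_real ?y * B 2 z = of_real (1/?y) * B 2 0" using e2[OF t(2)] unfolding t(3,4,5) .
 moreover define Y where "Y = complex_of_real ?y"
 ultimately have Y: "Y * B 2 z = (1/Y) * B 2 0" by simp
 have "Y ~= 0" using t(1) unfolding Y_def of_real_eq_0_iff by linarith
 then have "B 2 z = B 2 0/Y\<^sup>2" using Y by (simp add: field_simps power2_eq_square)
 then have "B 2 z = B 2 0/of_real (?y\<^sup>2)" by (simp only: Y_def of_real_power)
 then show "second_form L H T (x,z) (coord_vec (pchart C) (Inr 2) (x,z)) =
   second_form L H T (x,0) (coord_vec (pchart C) (Inr 2) (x,0))/of_real (?y\<^sup>2)" by (simp add: B_def)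
qed

text \<open>In a holomorphic trivialisation of the extension, the derivatives along both (0,1)-vectors of the coordinates
 of the frame commute. The component along \<open>X\<close> is zero and the sub frame is holomorphic, so the
 component along the disc is annihilated by the (0,1)-vector along \<open>X\<close>.\<close>

lemma second_form_holomorphic:
 assumes eq: "equivariant_holomorphic A L H" and W: "(W,T)\<in>triv L" "x\<in>W" and C: "C\<in>A" "x\<in>fst C"
 defines "F == %x. second_form L H T (x,0) (coord_vec (pchart C) (Inr 2) (x,0))"
 shows "cdiff C x F" "dbar C x F = 0"
proof -
 note Bt = atlas_times_disc[OF A]
 note E = ext_facts[OF A L ext]
 let ?t = "pchart C" and ?p = "(x,0 :: complex)"
 have t: "?t\<in>times_disc A" "?p\<in>fst ?t" using pchart_in[OF A C(1)] C(2) by auto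
 have p: "?p\<in>points (times_disc A)" using t unfolding points_iff by blast
 obtain V S where S: "(V,S)\<in>triv H" "?p\<in>V" using bundle_cover[OF E(6) p] .
 obtain G G' where G: "smooth_fun (times_disc A) ((W\<times>\<Delta>)\<inter>V) G'"
  "!!e. sproj L e\<in>(W\<times>\<Delta>)\<inter>V ==> lift_triv T e = G' (sproj L e) *v S e"
  using sum_transition[OF A L ext S(1) W(1)] by metis
 let ?M = "(W\<times>\<Delta>)\<inter>V" and ?N = "((W\<times>\<Delta>)\<inter>V)\<inter>fst (pchart C)"
 note fs = frames_smooth[OF A L ext S(1) W(1)]
 have oN: "open_in (times_disc A) ?N" using fs(1) openin_chart[OF Bt t(1)] by (rule openin_Int)
 have pM: "?p\<in>?M" using S W by auto
 have pN: "?p\<in>?N" using pM t(2) by blast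
 let ?c1 = "%i q. S (sub_frame L T q) $ i" and ?c2 = "%i q. S (quot_frame L q) $ i"
 let ?v = "%j q. coord_vec ?t (Inr j) q"
 define B where "B = (%j q. second_form L H T q (?v j q))"
 have Bq: "?v j q (?c2 i) = B j q * ?c1 i q" if q: "q\<in>?N" for q i j
  unfolding B_def
  by (rule second_form_quot[OF A L ext coord_in_tangent_space(3)[OF Bt t(1)] _ S(1) _ W(1)])
   (use q openin_subset_points[OF Bt fs(1)] in auto)
 have B1: "B 1 q = 0" if q: "q\<in>?N" for q
  using second_form_invariant(1)[OF eq W(1),of "fst q" C "snd q"] q C(1) unfolding B_def by auto
 have cd: "cdiff ?t ?p (%q. ?v 2 q (?c2 i))" "cdiff ?t ?p (?c1 i)" for i
  using cdiff_coord_vec[OF Bt fs(3) t(1) fs(1) pM t(2)] smooth_fun_cdiff[OF Bt fs(2) t pM] by auto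
 have B2: "B 2 q = (\<Sum>k\<in>UNIV. G' q $ 1 $ k * ?v 2 q (?c2 k))" if q: "q\<in>?N" for q
 proof -
  let ?b = "dolbeault H (quot_frame L) q (?v 2 q)"
  have v: "?v 2 q\<in>tangent01 (times_disc A) q" by (rule coord_in_tangent_space(3)[OF Bt t(1)]) (use q in auto)
  have qp: "q\<in>points (times_disc A)" using q openin_subset_points[OF Bt fs(1)] by blast
  note d = dolbeault_quot_frame[OF A L ext v qp]
  have "lift_triv T ?b $ 1 = (\<Sum>k\<in>UNIV. G' q $ 1 $ k * S ?b $ k)"
   using G(2)[of ?b] d(1) q by (simp add: vec_mult_sum del: proj_sum_bundle lift_triv_nth)
  then show ?thesis using d(2)[OF S(1)] q by (simp add: B_def second_form_def)
 qed
 have cdB: "cdiff ?t ?p (B 2)"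
 proof -
  have "smooth_fun (times_disc A) ?M (%q. G' q $ 1)" using G(1) by (simp add: smooth_fun_vec[OF Bt fs(1)])
  then have "smooth_fun (times_disc A) ?M (%q. G' q $ 1 $ k)" for k by (simp add: smooth_fun_vec[OF Bt fs(1)])
  from smooth_fun_cdiff[OF Bt this t pM] have g: "cdiff ?t ?p (%q. G' q $ 1 $ k)" for k .
  have "cdiff ?t ?p (%q. G' q $ 1 $ 1 * ?v 2 q (?c2 1)+G' q $ 1 $ 2 * ?v 2 q (?c2 2))"
   by (intro cdiff_add cdiff_mult g cd)
  then show ?thesis
   by (subst coord_vec_cong(2)[OF Bt t oN pN,where g = "%q. G' q $ 1 $ 1 * ?v 2 q (?c2 1)+G' q $ 1 $ 2 * ?v 2 q (?c2 2)"])
    (auto simp: B2 sum_2)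
 qed
 (* The commuting derivatives are taken of the coordinates of the frame of the splitting. *)
 have z: "?v 1 ?p (B 2) * ?c1 i ?p = 0" for i
 proof -
  have "?v 1 ?p (B 2) * ?c1 i ?p = ?v 1 ?p (%q. B 2 q * ?c1 i q)"
   using coord_vec_mult'[OF Bt t cdB cd(2)] sub_frame_holomorphic[OF A L ext S(1) W(1) t S(2)] W(2) by simp
  also have "... = ?v 1 ?p (%q. ?v 2 q (?c2 i))"
   by (rule coord_vec_cong(1)[OF Bt t oN pN]) (simp add: Bq)
  also have "... = ?v 2 ?p (%q. ?v 1 q (?c2 i))"
   by (rule coord_vec_commute[OF Bt fs(3) t(1) fs(1) pM t(2)])
  also have "... = ?v 2 ?p (%q. 0)"
   by (rule coord_vec_cong(1)[OF Bt t oN pN]) (use Bq[of _ 1 i] B1 in auto)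
  finally show ?thesis by simp
 qed
 have "\<exists>i. ?c1 i ?p ~= 0"
 proof (rule ccontr)
  assume "\<not> ?thesis"
  then have "lift_triv T (sub_frame L T ?p) $ 1 = 0"
   using G(2)[of "sub_frame L T ?p"] frames_sum(1)[OF A L W(1),of ?p] pM W(2)
   by (simp add: vec_mult_sum del: proj_sum_bundle lift_triv_nth)
  then show False using frames_sum(3)[OF A L W(1),of ?p] W(2) by simp
 qed
 then have "?v 1 ?p (B 2) = 0" using z by auto
 moreover have F: "F = (%x. B 2 (x,0))" by (simp add: F_def B_def)
 ultimately show "cdiff C x F" "dbar C x F = 0"
  unfolding F using cdiff_slice(1,3)[OF A C _ cdB] by simp_all
qed

lemma dolbeault_twisted:
 assumes N: "open_in (times_disc A) N" and p: "p\<in>N"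
  and s: "sum_section A L N s" and v: "v\<in>tangent01 (times_disc A) p"
  and W: "(W,T)\<in>triv L" "fst p\<in>W"
 defines "D == dolbeault (twisted L) (%q. case s q of (l,z,w) => (l,z)) p v"
 shows "proj L (fst D) = fst p" "T (fst D) $ 1 = v (%q. T (fst (s q)) $ 1)"
proof -
 note Bt = atlas_times_disc[OF A]
 let ?\<sigma> = "%q. case s q of (l,z,w) => (l,z)"
 have px: "fst p\<in>points A" "cmod (snd p) < 1"
  using openin_subset_points[OF Bt N] p by (auto simp: points_times_disc)
 have ps: "sproj L (s q) = q" if "q\<in>N" for q
  using s that unfolding smooth_section_def by blast
 note d = dolbeault_section[OF A L ext N p s v]
 have tw: "triv (twisted L) = {(W\<times>\<Delta>,%(l,z). T l) | W T. (W,T)\<in>triv L}" by (simp add: twisted_def)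
 have prt: "proj (twisted L) (?\<sigma> q) = q" if "q\<in>N" for q
  using ps[OF that] by (simp add: twisted_def prod_eq_iff case_prod_unfold)
 have pin: "p\<in>N\<inter>(W'\<times>\<Delta>)" if "fst p\<in>W'" for W' using p px that by (cases p) auto
 have tdt: "tdiff (times_disc A) p (%q. T' (?\<sigma> q) $ i)" if T': "(W',T')\<in>triv (twisted L)" "p\<in>W'" for W' T' i
 proof -
  obtain W0 T0 where W0: "(W0,T0)\<in>triv L" "W' = W0\<times>\<Delta>" "T' = (%(l,z). T0 l)" using T' unfolding tw by auto
  have "fst p\<in>W0" using T'(2) W0(2) by auto
  from smooth_fun_tdiff[OF Bt d(4)[OF W0(1) this] pin[OF this]]
  have "tdiff (times_disc A) p (%q. T0 (fst (s q)) $ 1)" .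
  moreover have i: "i = 1" by simp
  ultimately show ?thesis unfolding W0(3) i by (simp add: case_prod_unfold)
 qed
 note dt = dolbeault_trivialisation[OF Bt twisted_holomorphic[OF A L] N p prt tdt v]
 have twT: "(W'\<times>\<Delta>,%(l,z :: complex). T' l)\<in>triv (twisted L)" if "(W',T')\<in>triv L" for W' T'
  using that unfolding tw by blast
 have "proj (twisted L) D = p" unfolding D_def by (rule dt(1))
 then show "proj L (fst D) = fst p" by (cases D) (auto simp: twisted_def)
 have "p\<in>W\<times>\<Delta>" using pin[OF W(2)] by blast
 from dt(2)[OF _ _ _ twT[OF W(1)] this]
 show "T (fst D) $ 1 = v (%q. T (fst (s q)) $ 1)" unfolding D_def by (simp add: case_prod_unfold)
qed

text \<open>The section \<open>\<phi>\<close> is the second fundamental form on the vector along the disc over \<open>z =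
 0\<close>, divided by the constant in the displayed matrix.\<close>

theorem equivariant_extension_section:
 assumes eq: "equivariant_holomorphic A L H" and \<tau>: "\<tau> < 0"
 shows "\<exists>\<phi>. holomorphic_section A L \<phi>\<and>dolbeault_matrix_form \<tau> A L H \<phi>"
proof -
 note Bt = atlas_times_disc[OF A]
 note Lb = line_bundle_with[OF A L]
 define c where "c = complex_of_real (sqrt (- (1/\<tau>)))"
 have c: "c ~= 0" using \<tau> by (simp add: c_def)
 let ?v = "%C q. coord_vec (pchart C) (Inr 2) q"
 define b where "b = (%x. fst (dolbeault H (quot_frame L) (x,0) (?v (base_chart A x) (x,0))))"
 define \<phi> where "\<phi> = (%x. fibre_vec L x (%T. (1/c) *s T (b x)))"
 have \<phi>: "proj L (\<phi> x) = x" "T (\<phi> x) $ 1 = second_form L H T (x,0) (?v C (x,0))/c"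
  if C: "C\<in>A" "x\<in>fst C" and W: "(W,T)\<in>triv L" "x\<in>W" for C x W T
 proof -
  have xp: "x\<in>points A" using C unfolding points_iff by blast
  have B: "base_chart A x\<in>A" "x\<in>fst (base_chart A x)" using base_chart[OF xp] by auto
  have p: "(x,0)\<in>points (times_disc A)" using xp by (simp add: points_times_disc)
  have v: "?v (base_chart A x) (x,0)\<in>tangent01 (times_disc A) (x,0)"
   by (rule coord_in_tangent_space(3)[OF Bt pchart_in[OF A B(1)]]) (use B in simp)
  have pb: "proj L (b x) = x" using dolbeault_quot_frame(1)[OF A L ext v p] by (simp add: b_def)
  note fc = fibre_vec_combination[OF Lb W pb pb,of "%T. (1/c) *s T (b x)" "1/c" 0]
  show "proj L (\<phi> x) = x" unfolding \<phi>_def by (rule fc(1)) simp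
  have "T (\<phi> x) = (1/c) *s T (b x)" unfolding \<phi>_def by (rule fc(3)[OF _ W]) simp
  moreover have "?v (base_chart A x) (x,0) = ?v C (x,0)"
   by (rule HOL.ext) (rule coord_vec_2_independent[OF A C(1) _ B(1)],use C B in simp_all)
  ultimately show "T (\<phi> x) $ 1 = second_form L H T (x,0) (?v C (x,0))/c"
   by (simp add: b_def second_form_def)
 qed
 have "holomorphic_section A L \<phi>"
  unfolding holomorphic_section_def
 proof (intro conjI ballI)
  fix x assume "x\<in>points A"
  then obtain C where C: "C\<in>A" "x\<in>fst C" unfolding points_iff by blast
  obtain W T where "(W,T)\<in>triv L" "x\<in>W" using bundle_cover[OF Lb \<open>x\<in>points A\<close>] .
  from \<phi>(1)[OF C this] show "proj L (\<phi> x) = x" .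
 next
  fix t assume t: "t\<in>triv L"
  then obtain W T where W: "t = (W,T)" "(W,T)\<in>triv L" by (cases t) auto
  have o: "open_in A W" by (rule line_openin[OF A L W(2)])
  have "hol_on (snd C ` (fst C\<inter>W)) (%y. T (\<phi> (cinv C y)))" if C: "C\<in>A" for C
  proof (rule hol_onI)
   fix y and i j :: 1 assume "y\<in>snd C ` (fst C\<inter>W)"
   then obtain x where x: "x\<in>fst C" "x\<in>W" "y = snd C x" by auto
   let ?F = "%x. second_form L H T (x,0) (?v C (x,0))"
   have oC: "open_in A (W\<inter>fst C)" using o openin_chart[OF A C] by (rule openin_Int)
   have xin: "x\<in>W\<inter>fst C" using x by simp
   note hol = second_form_holomorphic[OF eq W(2) x(2) C x(1)]
   have e: "T (\<phi> q) $ 1 = (1/c) * ?F q" if "q\<in>W\<inter>fst C" for q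
    using \<phi>(2)[OF C _ W(2),of q] that by simp
   have cd: "cdiff C x (%q. T (\<phi> q) $ 1)"
   proof -
    have "cdiff C x (%q. (1/c) * ?F q)" by (intro cdiff_mult cdiff_const hol(1))
    then show ?thesis by (subst coord_vec_cong(2)[OF A C x(1) oC xin,of "%q. T (\<phi> q) $ 1" "%q. (1/c) * ?F q",OF e])
   qed
   have "dbar C x (%q. T (\<phi> q) $ 1) = dbar C x (%q. (1/c) * ?F q)"
    by (rule coord_vec_cong(1)[OF A C x(1) oC xin e])
   also have "... = 0" unfolding coord_vec_cmult[OF A C x(1) hol(1)] hol(2) by simp
   finally have z: "dbar C x (%q. T (\<phi> q) $ 1) = 0" .
   have ij: "i = 1" "j = 1" by simp_all
   show "(%y. T (\<phi> (cinv C y)) $ i) differentiable (at y)" using cd unfolding cdiff_def x(3) ij .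
   show "wirtinger (Inr j) (%y. T (\<phi> (cinv C y)) $ i) y = 0" using z unfolding coord_vec_eq x(3) ij .
  qed
  then show "case t of (W,T) => holomorphic_fun A W (%x. T (\<phi> x))" unfolding W(1) by (simp add: holomorphic_fun_iff)
 qed
 moreover have "dolbeault_matrix_form \<tau> A L H \<phi>"
  unfolding dolbeault_matrix_form_def Let_def
 proof (intro allI impI ballI,elim conjE)
  fix N s p v
  assume N: "open_in (times_disc A) N" and s: "sum_section A L N s"
   and p: "p\<in>N" and v: "v\<in>tangent01 (times_disc A) p"
  let ?\<sigma> = "%q. case s q of (l,z,w) => (l,z)" and ?f = "%q. case s q of (l,z,w) => w"
  have sf: "?\<sigma> = (%q. (fst (s q),fst (snd (s q))))" "?f = (%q. snd (snd (s q)))" by (auto simp: case_prod_unfold)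
  have pp: "p\<in>points (times_disc A)" using openin_subset_points[OF Bt N] p by blast
  then have px: "fst p\<in>points A" "cmod (snd p) < 1" by (auto simp: points_times_disc)
  have ps: "sproj L (s q) = q" if "q\<in>N" for q
   using s that unfolding smooth_section_def by blast
  obtain W T where W: "(W,T)\<in>triv L" "fst p\<in>W" using bundle_cover[OF Lb px(1)] .
  note d = dolbeault_section[OF A L ext N p s v]
  let ?D = "dolbeault (twisted L) ?\<sigma> p v"
  note Dv = dolbeault_twisted[OF N p s v W]
  have pin: "p\<in>W\<times>\<Delta>" using px W(2) by (cases p) auto
  obtain P a where P: "P\<in>times_disc A" "p\<in>fst P" "v = (%f. \<Sum>j\<in>UNIV. a j * coord_vec P (Inr j) p f)"
   using v unfolding tangent01_def by blast
  obtain C where C: "C\<in>A" "P = pchart C" using P(1) by (auto simp: times_disc_eq)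
  have Cx: "fst p\<in>fst C" using P(2) C(2) by simp
  have vv: "v = (%f. a 1 * dbar P p f+a 2 * coord_vec P (Inr 2) p f)" by (simp add: P(3) sum_2)
  have al: "alpha (snd p) (push snd v) = a 2/of_real ((1 - (cmod (snd p))\<^sup>2)\<^sup>2)"
   using coord_vec_snd(4,5)[OF A C(1) Cx px(2)] by (simp add: alpha_def push_def vv C(2) o_def)
  have sec: "second_form L H T p v = c * alpha (snd p) (push snd v) * T (\<phi> (fst p)) $ 1"
  proof -
   obtain V S where S: "(V,S)\<in>triv H" "p\<in>V" using bundle_cover[OF ext_facts(6)[OF A L ext] pp] .
   have cv: "coord_vec P (Inr j) p\<in>tangent01 (times_disc A) p" for j by (rule coord_in_tangent_space(3)[OF Bt P(1,2)])
   have sq: "u (%q. S (quot_frame L q) $ i) = second_form L H T p u * S (sub_frame L T p) $ i" if "u\<in>tangent01 (times_disc A) p" for u i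
    by (rule second_form_quot[OF A L ext that pp S W])
   have "second_form L H T p v * S (sub_frame L T p) $ i =
     (a 1 * second_form L H T p (dbar P p)+a 2 * second_form L H T p (coord_vec P (Inr 2) p)) * S (sub_frame L T p) $ i" for i
    using sq[OF v,of i] sq[OF cv[of 1],of i] sq[OF cv[of 2],of i] by (simp add: vv algebra_simps)
   moreover have "\<exists>i. S (sub_frame L T p) $ i ~= 0"
   proof (rule ccontr)
    assume n: "\<not> ?thesis"
    obtain G G' where G': "!!e. sproj L e\<in>(W\<times>\<Delta>)\<inter>V ==> lift_triv T e = G' (sproj L e) *v S e"
     using sum_transition[OF A L ext S(1) W(1)] by metis
    have "lift_triv T (sub_frame L T p) $ 1 = 0"
     using n G'[of "sub_frame L T p"] frames_sum(1)[OF A L W] pin S(2)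
     by (simp add: vec_mult_sum del: proj_sum_bundle lift_triv_nth)
    then show False using frames_sum(3)[OF A L W] by simp
   qed
   ultimately have "second_form L H T p v = a 1 * second_form L H T p (dbar P p)+a 2 * second_form L H T p (coord_vec P (Inr 2) p)"
    by auto
   then show ?thesis
    using second_form_invariant[OF eq W C(1) Cx px(2)] \<phi>(2)[OF C(1) Cx W] c by (simp add: al C(2))
  qed
  have p\<phi>: "proj L (\<phi> (fst p)) = fst p" by (rule \<phi>(1)[OF C(1) Cx W])
  let ?k = "of_real (sqrt (- (1/\<tau>))) * alpha (snd p) (push snd v) * ?f p"
  let ?R = "fibre_vec L (fst p) (%T. T (fst ?D)+?k *s T (\<phi> (fst p)))"
  note fc = fibre_vec_combination[OF Lb W Dv(1) p\<phi>,of "%T. T (fst ?D)+?k *s T (\<phi> (fst p))" 1 ?k]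
  have R: "proj L ?R = fst p" "T ?R = T (fst ?D)+?k *s T (\<phi> (fst p))"
   by (rule fc(1),simp) (rule fc(3)[OF _ W],simp)
  show "dolbeault H s p v = (?R,snd p,v ?f)"
  proof (rule sum_fibre_eq[OF A L W(1)])
   note dd = d[OF W]
   show "proj L (fst (dolbeault H s p v))\<in>W" using dd(1) W(2) by (metis fst_conv proj_sum_bundle)
   show "sproj L (dolbeault H s p v) = sproj L (?R,snd p,v ?f)"
    unfolding dd(1) using R(1) by simp
   show "lift_triv T (dolbeault H s p v) = lift_triv T (?R,snd p,v ?f)"
    unfolding vec2_eq_iff lift_triv_nth fst_conv snd_conv dd(2,3) R(2) sec
    by (simp add: Dv(2)[unfolded case_prod_unfold] c_def mult_ac case_prod_unfold)
  qed
 qed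
 ultimately show ?thesis by blast
qed

end

section \<open>Invariant pseudo-Hermitian metrics\<close>

context
 fixes A :: "('x,1) atlas" and L :: "('x,'l,1) vbundle" and H :: "('x\<times>complex,'l\<times>complex\<times>complex,2) vbundle"
 assumes A: "complex_atlas A" and L: "holomorphic_bundle A L" and hx: "holomorphic_extension A L H"
begin

lemma sum_bundle_with: "bundle_with (smooth_fun (times_disc A)) (times_disc A) (sum_bundle L)"
proof -
 let ?E = "sum_bundle L\<lparr>triv := triv (sum_bundle L) \<union> triv H\<rparr>"
 note E = ext_facts(3)[OF A L hx]
 have p: "proj ?E = sproj L" by simp
 have m: "t\<in>triv (sum_bundle L) ==> (fst t,snd t)\<in>triv ?E" for t by simp
 show ?thesis
  unfolding bundle_with_def case_prod_unfold
 proof (intro conjI ballI)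
  show "(\<Union>t\<in>triv (sum_bundle L). fst t) = points (times_disc A)"
  proof (intro equalityI subsetI)
   fix q assume "q\<in>(\<Union>t\<in>triv (sum_bundle L). fst t)"
   then show "q\<in>points (times_disc A)"
    using openin_subset_points[OF atlas_times_disc[OF A] bundle_openin[OF E m]] by blast
  next
   fix q assume "q\<in>points (times_disc A)"
   then have q: "fst q\<in>points A" "q\<in>UNIV\<times>\<Delta>" by (auto simp: points_times_disc)
   obtain W T where W: "(W,T)\<in>triv L" "fst q\<in>W" using bundle_cover[OF line_bundle_with[OF A L] q(1)] .
   then have "(W\<times>\<Delta>,lift_triv T)\<in>triv (sum_bundle L)" unfolding triv_sum_bundle by blast
   moreover have "q\<in>fst (W\<times>\<Delta>,lift_triv T)" using q(2) W(2) by (cases q) auto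
   ultimately show "q\<in>(\<Union>t\<in>triv (sum_bundle L). fst t)" by blast
  qed
  fix t assume t: "t\<in>triv (sum_bundle L)"
  show "open_in (times_disc A) (fst t)" by (rule bundle_openin[OF E m[OF t]])
  show "bij_betw (snd t) {e. sproj L e = x} UNIV" if "x\<in>fst t" for x
   using bundle_bij[OF E m[OF t] that] unfolding p .
  fix t' assume t': "t'\<in>triv (sum_bundle L)"
  obtain g where "smooth_fun (times_disc A) (fst t\<inter>fst t') g"
   "!!e. proj ?E e\<in>fst t\<inter>fst t' ==> snd t' e = g (proj ?E e) *v snd t e"
   using bundle_transition[OF E m[OF t] m[OF t']] by blast
  then show "\<exists>g. smooth_fun (times_disc A) (fst t\<inter>fst t') g \<and>
    (\<forall>e. sproj L e\<in>fst t\<inter>fst t' --> snd t' e = g (sproj L e) *v snd t e)"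
   unfolding p by blast
 qed
qed

lemma smooth_section_sumI:
 assumes V: "open_in (times_disc A) V" and p: "!!q. q\<in>V ==> sproj L (s q) = q"
  and s: "!!W T. (W,T)\<in>triv L ==> smooth_fun (times_disc A) (V\<inter>(W\<times>\<Delta>)) (%q. T (fst (s q)) $ 1)"
   "smooth_fun (times_disc A) V (%q. snd (snd (s q)))"
 shows "sum_section A L V s"
 unfolding smooth_section_def
proof (intro conjI ballI)
 note Bt = atlas_times_disc[OF A]
 show "sproj L (s q) = q" if "q\<in>V" for q by (rule p[OF that])
 fix t assume "t\<in>triv (sum_bundle L)"
 then obtain W T where W: "(W,T)\<in>triv L" "t = (W\<times>\<Delta>,lift_triv T)" unfolding triv_sum_bundle by blast
 have o: "open_in (times_disc A) (V\<inter>(W\<times>\<Delta>))"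
  using V openin_times_disc[OF A line_openin[OF A L W(1)] open_disc[OF A] subset_refl] by (rule openin_Int)
 have "smooth_fun (times_disc A) (V\<inter>(W\<times>\<Delta>)) (%q. lift_triv T (s q))"
  unfolding smooth_fun_vec[OF Bt o] forall_2 lift_triv_nth
  using s(1)[OF W(1)] smooth_fun_subset[OF Bt s(2)] by simp
 then show "case t of (W',T) => smooth_fun (times_disc A) (V\<inter>W') (%x. T (s x))" unfolding W(2) by simp
qed

lemma smooth_section_lift:
 assumes W: "open_in A W" and s: "smooth_section A L W s"
 shows "sum_section A L (W\<times>\<Delta>) (%q. (s (fst q),snd q,0))"
proof (rule smooth_section_sumI)
 note Bt = atlas_times_disc[OF A]
 show "open_in (times_disc A) (W\<times>\<Delta>)" by (rule openin_times_disc[OF A W open_disc[OF A] subset_refl])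
 have ps: "proj L (s x) = x" if "x\<in>W" for x
 proof -
  have "\<forall>x\<in>W. proj L (s x) = x" using s unfolding smooth_section_def by (rule conjunct1)
  then show ?thesis using that by blast
 qed
 show "sproj L (s (fst q),snd q,0) = q" if "q\<in>W\<times>\<Delta>" for q
  using that ps[of "fst q"] by auto
 show "smooth_fun (times_disc A) (W\<times>\<Delta>\<inter>W'\<times>\<Delta>) (%q. T (fst (s (fst q),snd q,0)) $ 1)" if T: "(W',T)\<in>triv L" for W' T
 proof -
  have "open_in A (W\<inter>W')" using W line_openin[OF A L T] by (rule openin_Int)
  from smooth_fun_fst[OF A this smooth_section_line(1)[OF A L s W T]]
  show ?thesis unfolding fst_conv by (rule smooth_fun_subset[OF Bt]) auto
 qed
 show "smooth_fun (times_disc A) (W\<times>\<Delta>) (%q. snd (snd (s (fst q),snd q,0)))"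
  using smooth_fun_const[OF Bt] by simp
qed

lemma smooth_section_quot_frame: "sum_section A L (points (times_disc A)) (quot_frame L)"
proof (rule smooth_section_sumI)
 note Bt = atlas_times_disc[OF A]
 show "open_in (times_disc A) (points (times_disc A))" by (rule openin_points[OF Bt])
 show "sproj L (quot_frame L q) = q" if "q\<in>points (times_disc A)" for q
 proof -
  have "fst q\<in>points A" using that by (auto simp: points_times_disc)
  then obtain W T where "(W,T)\<in>triv L" "fst q\<in>W" by (rule bundle_cover[OF line_bundle_with[OF A L]])
  from frames_sum(2)[OF A L this] show ?thesis .
 qed
 show "smooth_fun (times_disc A) (points (times_disc A)\<inter>W\<times>\<Delta>) (%q. T (fst (quot_frame L q)) $ 1)" if T: "(W,T)\<in>triv L" for W T
 proof (subst smooth_fun_cong[OF Bt,where g = "%_. 0"])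
  show "open_in (times_disc A) (points (times_disc A)\<inter>W\<times>\<Delta>)"
   using openin_points[OF Bt] openin_times_disc[OF A line_openin[OF A L T] open_disc[OF A] subset_refl] by (rule openin_Int)
  show "T (fst (quot_frame L q)) $ 1 = 0" if "q\<in>points (times_disc A)\<inter>W\<times>\<Delta>" for q
   by (rule frames_sum(4)[OF A L T]) (use that in auto)
 qed (rule smooth_fun_const[OF Bt])
 show "smooth_fun (times_disc A) (points (times_disc A)) (%q. snd (snd (quot_frame L q)))"
  using smooth_fun_const[OF Bt] by (simp add: quot_frame_def)
qed

text \<open>A Hermitian form is determined by its values on the frame of the splitting.\<close>

lemma sum_metric:
 assumes h: "hermitian_form (times_disc A) (sum_bundle L) h"
 shows "!!q u v. q\<in>points (times_disc A) ==> sproj L u = q ==> sproj L v = q ==> h v u = cnj (h u v)"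
  "!!V s t. open_in (times_disc A) V ==> sum_section A L V s ==>
   sum_section A L V t ==> smooth_fun (times_disc A) V (%x. h (s x) (t x))"
  "!!W T q u v. (W,T)\<in>triv L ==> fst q\<in>W ==> cmod (snd q) < 1 ==> sproj L u = q ==> sproj L v = q ==>
   h u v = T (fst u) $ 1 * cnj (T (fst v) $ 1) * h (sub_frame L T q) (sub_frame L T q)
   +T (fst u) $ 1 * cnj (snd (snd v)) * h (sub_frame L T q) (quot_frame L q)
   +snd (snd u) * cnj (T (fst v) $ 1) * cnj (h (sub_frame L T q) (quot_frame L q))
   +snd (snd u) * cnj (snd (snd v)) * h (quot_frame L q) (quot_frame L q)"
proof -
 note Bt = atlas_times_disc[OF A]
 have h1: "\<forall>x\<in>points (times_disc A). \<forall>u v w. sproj L u = x\<and>sproj L v = x\<and>sproj L w = x -->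
    h w u = cnj (h u w) \<and>
    (\<forall>a b. h (fibre_vec (sum_bundle L) x (%T. a *s T u+b *s T v)) w = a * h u w+b * h v w)"
  using h unfolding hermitian_form_def by (rule conjunct1)
 show herm: "h v u = cnj (h u v)" if "q\<in>points (times_disc A)" "sproj L u = q" "sproj L v = q" for q u v
  using mp[OF spec[OF spec[OF spec[OF bspec[OF h1 that(1)],of u],of v],of v]] that(2,3) by blast
 show "smooth_fun (times_disc A) V (%x. h (s x) (t x))" if "open_in (times_disc A) V"
  "sum_section A L V s" "sum_section A L V t" for V s t
  by (rule h[unfolded hermitian_form_def,THEN conjunct2,THEN spec,THEN spec,THEN spec,THEN mp]) (use that in blast)
 fix W T q u v
 assume W: "(W,T)\<in>triv L" "fst q\<in>W" and z: "cmod (snd q) < 1"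
  and u: "sproj L u = q" and v: "sproj L v = q"
 have q: "q\<in>points (times_disc A)"
  using openin_subset_points[OF A line_openin[OF A L W(1)]] W(2) z by (cases q) (auto simp: points_times_disc)
 note f = frames_sum[OF A L W]
 have tr: "(W\<times>\<Delta>,lift_triv T)\<in>triv (sum_bundle L)" "q\<in>W\<times>\<Delta>"
  using W z unfolding triv_sum_bundle by (auto,cases q,auto)
 have lin: "h u w = T (fst u) $ 1 * h (sub_frame L T q) w+snd (snd u) * h (quot_frame L q) w"
  if u: "sproj L u = q" and w: "sproj L w = q" for u w
 proof -
  let ?F = "%S. T (fst u) $ 1 *s S (sub_frame L T q)+snd (snd u) *s S (quot_frame L q)"
  note fc = fibre_vec_combination[OF sum_bundle_with tr f(1,2),of ?F "T (fst u) $ 1" "snd (snd u)",OF refl]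
  have "lift_triv T (fibre_vec (sum_bundle L) q ?F) = lift_triv T u"
   unfolding fc(3)[OF tr] by (simp add: vec2_eq_iff f)
  then have "fibre_vec (sum_bundle L) q ?F = u"
   by (rule frame(4)[OF sum_bundle_with tr fc(1) u])
  moreover have "h (fibre_vec (sum_bundle L) q ?F) w = T (fst u) $ 1 * h (sub_frame L T q) w+snd (snd u) * h (quot_frame L q) w"
   using mp[OF spec[OF spec[OF spec[OF bspec[OF h1 q],of "sub_frame L T q"],of "quot_frame L q"],of w]] f(1,2) w by blast
  ultimately show ?thesis by simp
 qed
 have 1: "h e v = cnj (T (fst v) $ 1) * h e (sub_frame L T q)+cnj (snd (snd v)) * h e (quot_frame L q)"
  if e: "sproj L e = q" for e
 proof -
  have "h e v = cnj (h v e)" by (rule herm[OF q v e])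
  also have "h v e = T (fst v) $ 1 * h (sub_frame L T q) e+snd (snd v) * h (quot_frame L q) e" by (rule lin[OF v e])
  also have "h (sub_frame L T q) e = cnj (h e (sub_frame L T q))" by (rule herm[OF q e f(1)])
  also have "h (quot_frame L q) e = cnj (h e (quot_frame L q))" by (rule herm[OF q e f(2)])
  finally show ?thesis by simp
 qed
 have 2: "h (quot_frame L q) (sub_frame L T q) = cnj (h (sub_frame L T q) (quot_frame L q))" by (rule herm[OF q f(1,2)])
 show "h u v = T (fst u) $ 1 * cnj (T (fst v) $ 1) * h (sub_frame L T q) (sub_frame L T q)
   +T (fst u) $ 1 * cnj (snd (snd v)) * h (sub_frame L T q) (quot_frame L q)
   +snd (snd u) * cnj (T (fst v) $ 1) * cnj (h (sub_frame L T q) (quot_frame L q))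
   +snd (snd u) * cnj (snd (snd v)) * h (quot_frame L q) (quot_frame L q)"
  unfolding lin[OF u v] 1[OF f(1)] 1[OF f(2)] 2 by (simp add: algebra_simps)
qed

text \<open>The half turn changes the sign of the mixed entry over the origin; translation carries the three entries to
 the other points, with the factor \<open>(1 - |z|\<^sup>2)\<^sup>2\<close> for the sub.\<close>

lemma invariant_metric:
 assumes h: "hermitian_form (times_disc A) (sum_bundle L) h" and inv: "invariant_form A L h"
  and W: "(W,T)\<in>triv L" "x\<in>W" and z: "cmod z < 1"
 shows "h (sub_frame L T (x,z)) (quot_frame L (x,z)) = 0"
  "h (sub_frame L T (x,z)) (sub_frame L T (x,z)) =
   of_real ((1 - (cmod z)\<^sup>2)\<^sup>2) * h (sub_frame L T (x,0)) (sub_frame L T (x,0))"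
  "h (quot_frame L (x,z)) (quot_frame L (x,z)) = h (quot_frame L (x,0)) (quot_frame L (x,0))"
proof -
 have xA: "x\<in>points A" using openin_subset_points[OF A line_openin[OF A L W(1)]] W(2) by blast
 define f where "f = (%g. factor (- 2) g 0)"
 let ?e = "%z. sub_frame L T (x,z)" and ?q = "%z. quot_frame L (x,z)"
 have F: "sproj L (?e z) = (x,z)" "sproj L (?q z) = (x,z)"
  "T (fst (?e z)) $ 1 = 1" "T (fst (?q z)) $ 1 = 0" "snd (snd (?e z)) = 0" "snd (snd (?q z)) = 1" for z
  using frames_sum[OF A L W(1),of "(x,z)"] W(2) by auto
 have tr: "f g * cnj (f g) * h (?e (moebius g 0)) (?e (moebius g 0)) = h (?e 0) (?e 0)"
  "f g * h (?e (moebius g 0)) (?q (moebius g 0)) = h (?e 0) (?q 0)"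
  "h (?q (moebius g 0)) (?q (moebius g 0)) = h (?q 0) (?q 0)" if g: "g\<in>SU11" for g
 proof -
  have m: "cmod (moebius g 0) < 1" by (rule moebius(2)[OF g]) simp
  have i: "h (action L g u) (action L g v) = h u v" if "sproj L u = (x,0)" "sproj L v = (x,0)" for u v
   using inv[unfolded invariant_form_def,THEN bspec[OF _ g],THEN spec[of _ u],THEN spec[of _ v],THEN mp] that xA
   by (simp add: points_times_disc del: proj_sum_bundle)
  have a: "sproj L (action L g u) = (x,moebius g 0)" "T (fst (action L g u)) $ 1 = f g * T (fst u) $ 1"
   "snd (snd (action L g u)) = snd (snd u)" if u: "sproj L u = (x,0)" for u
  proof -
   have u': "proj L (fst u) = x" "fst (snd u) = 0" using u by auto
   have "proj L (fst u)\<in>points A" using u'(1) xA by simp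
   note as = action_simps[OF A L this]
   show "sproj L (action L g u) = (x,moebius g 0)" "T (fst (action L g u)) $ 1 = f g * T (fst u) $ 1"
    "snd (snd (action L g u)) = snd (snd u)"
    using as(1)[of g] as(2)[OF W(1),of g] as(3)[of g] u u' W(2) by (simp_all add: act_def f_def)
  qed
  note ex = sum_metric(3)[OF h W(1),of "(x,moebius g 0)",simplified fst_conv snd_conv,OF W(2) m]
  show "f g * cnj (f g) * h (?e (moebius g 0)) (?e (moebius g 0)) = h (?e 0) (?e 0)"
   using i[OF F(1) F(1)] ex[OF a(1)[OF F(1)] a(1)[OF F(1)]] by (simp add: a(2,3)[OF F(1)] F)
  show "f g * h (?e (moebius g 0)) (?q (moebius g 0)) = h (?e 0) (?q 0)"
   using i[OF F(1) F(2)] ex[OF a(1)[OF F(1)] a(1)[OF F(2)]] by (simp add: a(2,3)[OF F(1)] a(2,3)[OF F(2)] F)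
  show "h (?q (moebius g 0)) (?q (moebius g 0)) = h (?q 0) (?q 0)"
   using i[OF F(2) F(2)] ex[OF a(1)[OF F(2)] a(1)[OF F(2)]] by (simp add: a(2,3)[OF F(2)] F)
 qed
 note t = translation[OF z]
 have 0: "h (?e 0) (?q 0) = 0" using tr(2)[OF half_turn(1)] half_turn(2,3) by (simp add: f_def)
 let ?y = "1 - (cmod z)\<^sup>2"
 have y0: "complex_of_real ?y ~= 0" using t(1) unfolding of_real_eq_0_iff by linarith
 show "h (?e z) (?q z) = 0" using tr(2)[OF t(2)] 0 y0 unfolding t(3) f_def t(4) by (simp del: of_real_diff)
 show "h (?q z) (?q z) = h (?q 0) (?q 0)" using tr(3)[OF t(2)] unfolding t(3) .
 have "of_real (1/?y) * cnj (of_real (1/?y)) * h (?e z) (?e z) = h (?e 0) (?e 0)"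
  using tr(1)[OF t(2)] unfolding t(3) f_def t(4) .
 moreover define Y where "Y = complex_of_real ?y"
 ultimately have "(1/Y) * (1/Y) * h (?e z) (?e z) = h (?e 0) (?e 0)" by simp
 then have "h (?e z) (?e z) = Y\<^sup>2 * h (?e 0) (?e 0)" using y0 unfolding Y_def[symmetric] by (simp add: field_simps power2_eq_square)
 then show "h (?e z) (?e z) = of_real (?y\<^sup>2) * h (?e 0) (?e 0)" by (simp only: Y_def of_real_power)
qed

lemma openin_positive:
 fixes r :: "'x => real"
 assumes "smooth_fun A (points A) r"
 shows "open_in A {x\<in>points A. r x > 0}"
 unfolding openin_atlas_topology[OF A] case_prod_unfold
proof (intro conjI ballI)
 fix C assume C: "C\<in>A"
 have sub: "fst C\<subseteq>points A" by (rule openin_subset_points[OF A openin_chart[OF A C]])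
 have o: "open (snd C ` fst C)" by (rule open_chart[OF A C])
 have "continuous_on (snd C ` (fst C\<inter>points A)) (%y. r (cinv C y))"
  using assms C smooth_on_continuous unfolding smooth_fun_iff by blast
 then have "continuous_on (snd C ` fst C) (%y. r (cinv C y))" using sub by (simp add: Int_absorb2)
 then have "open (snd C ` fst C\<inter>(%y. r (cinv C y)) -` {0<..})"
  using o by (simp add: continuous_on_open_vimage Int_commute)
 moreover have "snd C ` (fst C\<inter>{x\<in>points A. r x > 0}) = snd C ` fst C\<inter>(%y. r (cinv C y)) -` {0<..}"
  using sub C by (auto simp: cinv_chart[OF A])
 ultimately show "open (snd C ` (fst C\<inter>{x\<in>points A. r x > 0}))" by simp
qed auto

lemma nonvanishing_sign:
 fixes r :: "'x => real"
 assumes conn: "connected_space (atlas_topology A)" and r: "smooth_fun A (points A) r" and nz: "!!x. x\<in>points A ==> r x ~= 0"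
 shows "(\<forall>x\<in>points A. r x > 0) \<or> (\<forall>x\<in>points A. r x < 0)"
proof -
 have "smooth_fun A (points A) (%x. - r x)"
  by (rule smooth_fun_linear[OF A bounded_linear_minus[OF bounded_linear_ident] openin_points[OF A] r])
 from openin_positive[OF this] have o: "open_in A {x\<in>points A. r x < 0}" by simp
 have "topspace (atlas_topology A)\<subseteq>{x\<in>points A. r x > 0} \<union> {x\<in>points A. r x < 0}"
  using nz by (force simp: topspace_atlas[OF A])
 moreover have "{x\<in>points A. r x > 0}\<inter>{x\<in>points A. r x < 0} = {}" by auto
 ultimately have "{x\<in>points A. r x > 0} = {} \<or> {x\<in>points A. r x < 0} = {}"
  using conn openin_positive[OF r] o unfolding connected_space_def by blast
 then show ?thesis using nz by (metis (mono_tags,lifting) empty_Collect_eq linorder_neqE_linordered_idom)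
qed

text \<open>The metric \<open>h\<^sub>X\<close> is the absolute value of the entry of the trivial summand, and
 \<open>h\<^sub>L\<close> that of the other entry over \<open>z = 0\<close> divided by
 \<open>h\<^sub>X\<close>.\<close>

theorem invariant_metric_splitting:
 assumes conn: "connected_space (atlas_topology A)"
  and hE: "pseudo_hermitian_metric (1,1) (times_disc A) (sum_bundle L) h" and inv: "invariant_form A L h"
 shows "\<exists>hL hX C0 C1. hermitian_metric A L hL\<and>positive_function A hX \<and>
      (C0,C1)\<in>{(1,- 1),(- 1,1)}\<and>metric_matrix_form A L h hL hX C0 C1"
proof -
 note Bt = atlas_times_disc[OF A] and Lb = line_bundle_with[OF A L]
 have h: "hermitian_form (times_disc A) (sum_bundle L) h" using hE unfolding pseudo_hermitian_metric_def by (rule conjunct1)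
 note sm = sum_metric[OF h] and im = invariant_metric[OF h inv]
 define r where "r = (%x. Re (h (quot_frame L (x,0)) (quot_frame L (x,0))))"
 define m where "m = (%T x. Re (h (sub_frame L T (x,0)) (sub_frame L T (x,0))))"
 have p0: "(x,0)\<in>points (times_disc A)" if "x\<in>points A" for x using that by (simp add: points_times_disc)
 have WA: "x\<in>points A" if "(W,T)\<in>triv L" "x\<in>W" for W T x
  using openin_subset_points[OF A line_openin[OF A L that(1)]] that(2) by blast
 have real: "h e e = of_real (Re (h e e))" if "q\<in>points (times_disc A)" "sproj L e = q" for q e
  using sm(1)[OF that(1) that(2) that(2)] by (simp add: complex_eq_iff)
 have hr: "h (quot_frame L (x,0)) (quot_frame L (x,0)) = of_real (r x)"
  "h (sub_frame L T (x,0)) (sub_frame L T (x,0)) = of_real (m T x)" if W: "(W,T)\<in>triv L" "x\<in>W" for W T x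
  unfolding r_def m_def
  using real[OF p0[OF WA[OF W]] frames_sum(2)[OF A L W(1)]] real[OF p0[OF WA[OF W]] frames_sum(1)[OF A L W(1)]] W(2) by simp_all
 have form: "h u v = T (fst u) $ 1 * cnj (T (fst v) $ 1) * (of_real ((1 - (cmod z)\<^sup>2)\<^sup>2) * of_real (m T x))
  +snd (snd u) * cnj (snd (snd v)) * of_real (r x)"
  if W: "(W,T)\<in>triv L" "x\<in>W" and z: "cmod z < 1" and u: "sproj L u = (x,z)" and v: "sproj L v = (x,z)" for W T x z u v
  using sm(3)[OF W(1) _ _ u v] W(2) z by (simp add: im[OF W z] hr[OF W])
 have sign: "(r x > 0\<and>m T x < 0) \<or> (r x < 0\<and>m T x > 0)" if W: "(W,T)\<in>triv L" "x\<in>W" for W T x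
 proof -
  have "\<forall>x\<in>points (times_disc A). \<exists>(b :: 2 => _) P. (\<forall>i. sproj L (b i) = x) \<and>
    (card P,card (- P)) = (1,1)\<and>(\<forall>i j. h (b i) (b j) = (if i ~= j then 0 else if i\<in>P then 1 else - 1))"
   using hE unfolding pseudo_hermitian_metric_def by (rule conjunct2)
  from bspec[OF this p0[OF WA[OF W]]] obtain b :: "2 => _" and P where b: "!!i. sproj L (b i) = (x,0)"
   "card P = 1" "card (- P) = 1" "!!i j. h (b i) (b j) = (if i ~= j then 0 else if i\<in>P then 1 else - 1)" by auto
  obtain i j where ij: "i\<in>P" "j \<notin> P" using b(2,3) by (metis Compl_iff card.empty ex_in_conv zero_neq_one)
  have hh: "Re (h e e) = (cmod (T (fst e) $ 1))\<^sup>2 * m T x+(cmod (snd (snd e)))\<^sup>2 * r x" if "sproj L e = (x,0)" for e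
  proof -
   have "h e e = (T (fst e) $ 1 * cnj (T (fst e) $ 1)) * of_real (m T x)+(snd (snd e) * cnj (snd (snd e))) * of_real (r x)"
    using form[OF W _ that that] by simp
   also have "... = of_real ((cmod (T (fst e) $ 1))\<^sup>2 * m T x+(cmod (snd (snd e)))\<^sup>2 * r x)"
    unfolding complex_norm_square[symmetric] by simp
   finally show ?thesis by (simp only: Re_complex_of_real)
  qed
  have 1: "1 = (cmod (T (fst (b i)) $ 1))\<^sup>2 * m T x+(cmod (snd (snd (b i))))\<^sup>2 * r x"
   using hh[OF b(1)[of i]] b(4)[of i i] ij by simp
  have 2: "- 1 = (cmod (T (fst (b j)) $ 1))\<^sup>2 * m T x+(cmod (snd (snd (b j))))\<^sup>2 * r x"
   using hh[OF b(1)[of j]] b(4)[of j j] ij by simp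
  have "m T x > 0 \<or> r x > 0"
  proof (rule ccontr)
   assume "\<not> ?thesis"
   then have "(cmod (T (fst (b i)) $ 1))\<^sup>2 * m T x\<le>0" "(cmod (snd (snd (b i))))\<^sup>2 * r x\<le>0"
    by (auto intro: mult_nonneg_nonpos)
   with 1 show False by linarith
  qed
  moreover have "m T x < 0 \<or> r x < 0"
  proof (rule ccontr)
   assume "\<not> ?thesis"
   then have "(cmod (T (fst (b j)) $ 1))\<^sup>2 * m T x \<ge> 0" "(cmod (snd (snd (b j))))\<^sup>2 * r x \<ge> 0" by auto
   with 2 show False by linarith
  qed
  ultimately show ?thesis by auto
 qed
 have oP: "open_in A (points A)" by (rule openin_points[OF A])
 have smr: "smooth_fun A (points A) r"
 proof -
  have "smooth_fun (times_disc A) (points A\<times>\<Delta>) (%q. h (quot_frame L q) (quot_frame L q))"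
   using sm(2)[OF openin_points[OF Bt] smooth_section_quot_frame smooth_section_quot_frame] unfolding points_times_disc .
  then have "smooth_fun A (points A) (%x. h (quot_frame L (x,0)) (quot_frame L (x,0)))"
   by (rule smooth_fun_slice[OF A oP]) simp
  then show ?thesis unfolding r_def by (rule smooth_fun_linear[OF A bounded_linear_Re oP])
 qed
 have rnz: "r x ~= 0" if x: "x\<in>points A" for x
 proof -
  obtain W T where "(W,T)\<in>triv L" "x\<in>W" using bundle_cover[OF Lb x] .
  from sign[OF this] show ?thesis by auto
 qed
 obtain C1 :: real where C1: "C1 = 1 \<or> C1 = - 1" "!!x. x\<in>points A ==> C1 * r x > 0"
 proof (cases "\<forall>x\<in>points A. r x > 0")
  case True
  then show ?thesis using that[of 1] by simp
 next
  case False
  then have "\<forall>x\<in>points A. r x < 0" using nonvanishing_sign[OF conn smr rnz] by blast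
  then show ?thesis using that[of "- 1"] by simp
 qed
 have C1s: "C1 * C1 = 1" using C1(1) by auto
 define hX where "hX = (%x. C1 * r x)"
 define hL where "hL = (%l l'. complex_of_real (- C1 * inverse (hX (proj L l))) * h (l,0,0) (l',0,0))"
 have smX: "smooth_fun A (points A) hX"
  unfolding hX_def by (rule smooth_fun_mult[OF A oP smooth_fun_const[OF A] smr])
 have hLT: "hL l l' = T l $ 1 * cnj (T l' $ 1) * of_real (- C1 * inverse (hX x) * m T x)"
  if W: "(W,T)\<in>triv L" "x\<in>W" and l: "proj L l = x" "proj L l' = x" for W T x l l'
  using form[OF W,of 0 "(l,0,0)" "(l',0,0)"] l by (simp add: hL_def)
 have pos: "- C1 * inverse (hX x) * m T x > 0" if W: "(W,T)\<in>triv L" "x\<in>W" for W T x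
 proof -
  have "hX x > 0" using C1(2)[OF WA[OF W]] by (simp add: hX_def)
  moreover have "- C1 * m T x > 0" using C1(1)
  proof
   assume "C1 = 1" then show ?thesis using sign[OF W] C1(2)[OF WA[OF W]] by auto
  next
   assume "C1 = - 1" then show ?thesis using sign[OF W] C1(2)[OF WA[OF W]] by auto
  qed
  ultimately have "inverse (hX x) * (- C1 * m T x) > 0" using positive_imp_inverse_positive by (blast intro: mult_pos_pos)
  then show ?thesis by (simp add: mult_ac)
 qed
 have "hermitian_metric A L hL"
  unfolding hermitian_metric_def hermitian_form_def
 proof (intro conjI ballI allI impI; (elim conjE)?)
  fix x u v w assume x: "x\<in>points A" and uvw: "proj L u = x" "proj L v = x" "proj L w = x"
  obtain W T where W: "(W,T)\<in>triv L" "x\<in>W" using bundle_cover[OF Lb x] .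
  show "hL w u = cnj (hL u w)" unfolding hLT[OF W uvw(3,1)] hLT[OF W uvw(1,3)] by (simp add: mult_ac)
  fix a b
  note fc = fibre_vec_combination[OF Lb W uvw(1,2),of "%T. a *s T u+b *s T v" a b,OF refl]
  show "hL (fibre_vec L x (%T. a *s T u+b *s T v)) w = a * hL u w+b * hL v w"
   unfolding hLT[OF W fc(1) uvw(3)] hLT[OF W uvw(1,3)] hLT[OF W uvw(2,3)] fc(3)[OF W] by (simp add: algebra_simps)
 next
  fix W s t assume W: "open_in A W" and s: "smooth_section A L W s" and t: "smooth_section A L W t"
  have sub: "W\<subseteq>points A" by (rule openin_subset_points[OF A W])
  have ps: "proj L (s x) = x" if "x\<in>W" for x
  proof -
   have "\<forall>x\<in>W. proj L (s x) = x" using s unfolding smooth_section_def by (rule conjunct1)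
   then show ?thesis using that by blast
  qed
  have "smooth_fun (times_disc A) (W\<times>\<Delta>) (%q. h (s (fst q),snd q,0) (t (fst q),snd q,0))"
   by (rule sm(2)[OF openin_times_disc[OF A W open_disc[OF A] subset_refl] smooth_section_lift[OF W s] smooth_section_lift[OF W t]])
  from smooth_fun_slice[OF A W this,of 0]
  have 1: "smooth_fun A W (%x. h (s x,0,0) (t x,0,0))" by simp
  have "smooth_fun A W (%x. inverse (hX x))"
   by (rule smooth_fun_inverse[OF A W smooth_fun_subset[OF A smX sub]]) (use C1(2) sub in \<open>force simp: hX_def\<close>)
  then have "smooth_fun A W (%x. complex_of_real (- C1 * inverse (hX x)))"
   by (intro smooth_fun_linear[OF A bounded_linear_of_real W] smooth_fun_mult[OF A W smooth_fun_const[OF A]])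
  from smooth_fun_mult[OF A W this 1]
  show "smooth_fun A W (%x. hL (s x) (t x))"
   by (subst smooth_fun_cong[OF A W]) (auto simp: hL_def ps)
 next
  fix T0 assume T0: "T0\<in>triv L"
  then obtain W T where W: "T0 = (W,T)" "(W,T)\<in>triv L" by (cases T0) auto
  have "0 < Re (hL u u)" if u: "proj L u\<in>W" "T u ~= 0" for u
  proof -
   have "hL u u = of_real ((cmod (T u $ 1))\<^sup>2 * (- C1 * inverse (hX (proj L u)) * m T (proj L u)))"
    unfolding hLT[OF W(2) u(1) refl refl] complex_norm_square[symmetric] by simp
   moreover have "(cmod (T u $ 1))\<^sup>2 > 0" using u(2) by (simp add: vec1_eq_iff)
   ultimately show ?thesis using mult_pos_pos[OF _ pos[OF W(2) u(1)]] by (simp only: Re_complex_of_real)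
  qed
  then show "case T0 of (W,T) => \<forall>u. proj L u\<in>W\<and>T u ~= 0 --> 0 < Re (hL u u)" unfolding W(1) by simp
 qed
 moreover have "positive_function A hX" unfolding positive_function_def using smX C1(2) by (simp add: hX_def)
 moreover have "metric_matrix_form A L h hL hX (- C1) C1"
  unfolding metric_matrix_form_def
 proof (intro ballI allI impI,elim conjE)
  fix x z l l' and w w' :: complex assume x: "x\<in>points A" and z: "z\<in>\<Delta>" and l: "proj L l = x" "proj L l' = x"
  obtain W T where W: "(W,T)\<in>triv L" "x\<in>W" using bundle_cover[OF Lb x] .
  have hx: "hX x ~= 0" using C1(2)[OF x] by (auto simp: hX_def)
  have d: "disc_metric (- 2) z = (1 - (cmod z)\<^sup>2)\<^sup>2" by (simp add: disc_metric_def)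
  have c: "complex_of_real C1 * complex_of_real C1 = 1" using arg_cong[OF C1s,of complex_of_real] by simp
  have rx: "complex_of_real (r x) = of_real C1 * of_real (hX x)" using c by (simp add: hX_def mult.assoc[symmetric])
  have "of_real (- C1) * (of_real (hX x) * hL l l') = (of_real C1 * of_real C1) * (T l $ 1 * cnj (T l' $ 1) * of_real (m T x))"
   unfolding hLT[OF W l] using hx by (simp add: field_simps)
  then show "h (l,z,w) (l',z,w') =
    of_real (- C1) * (of_real (hX x) * hL l l') * of_real (disc_metric (- 2) z) +
    of_real C1 * of_real (hX x) * (w * cnj w')"
   using form[OF W,of z "(l,z,w)" "(l',z,w')"] z l by (simp add: c d rx mult_ac)
 qed
 moreover have "(- C1,C1)\<in>{(1,- 1),(- 1,1)}" using C1(1) by auto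
 ultimately show ?thesis by blast
qed

end

section \<open>The Chern connection of an invariant metric\<close>

lemma matrix_inv_diagonal:
 fixes d :: "'n::finite => 'a::field"
 assumes d: "!!i. d i ~= 0"
 shows "matrix_inv (\<chi> i j. if i = j then d i else 0) = (\<chi> i j. if i = j then 1/d i else 0)"
  (is "matrix_inv ?M = ?N")
proof -
 have MN: "?M ** ?N = mat 1" "?N ** ?M = mat 1"
  using d by (simp_all add: matrix_matrix_mult_def mat_def vec_eq_iff if_distrib[of "%x. x * _"] cong: if_cong)
 then have "matrix_inv ?M ** ?M = mat 1"
  unfolding matrix_inv_def by (rule someI2[of _ ?N,OF conjI]) blast
 then have "(matrix_inv ?M ** ?M) ** ?N = ?N" by (simp add: matrix_mul_lid)
 then show ?thesis by (simp add: matrix_mul_assoc[symmetric] MN(1) matrix_mul_rid)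
qed

text \<open>The function \<open>1 - |z|\<^sup>2\<close>, written as a sum of products to which the rules for derivations
 apply.\<close>

definition disc_gap :: "'x\<times>complex => complex" where
 "disc_gap q = 1+(- 1) * (snd q * cnj (snd q))"

lemma disc_gap_eq: "disc_gap q = of_real (1 - (cmod (snd q))\<^sup>2)"
 using complex_norm_square[of "snd q"] by (simp add: disc_gap_def)

lemma disc_gap_nonzero: "cmod (snd q) < 1 ==> disc_gap q ~= 0"
 unfolding disc_gap_eq of_real_eq_0_iff using power_strict_mono[of "cmod (snd q)" 1 2] by simp

text \<open>The logarithm of a positive function, with complex values.\<close>

definition log_weight :: "('x => real) => 'x => complex" where
 "log_weight f x = of_real (ln (f x))"

text \<open>The square length of the sub frame, up to sign, for a metric with weight \<open>u\<close> along
 \<open>X\<close>.\<close>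

definition sub_weight :: "('x => complex) => 'x\<times>complex => complex" where
 "sub_weight u q = exp (u (fst q)) * (disc_gap q * disc_gap q)"

context
 fixes A :: "('x,1) atlas"
 assumes A: "complex_atlas A"
begin

lemma disc_gap_derivative:
 assumes C: "C\<in>A" "fst p\<in>fst C" and z: "cmod (snd p) < 1"
 shows "cdiff (pchart C) p disc_gap" "dz (pchart C) p disc_gap = 0"
  "coord_vec (pchart C) (Inl 2) p disc_gap = - cnj (snd p)"
  "dbar (pchart C) p disc_gap = 0"
  "coord_vec (pchart C) (Inr 2) p disc_gap = - snd p"
proof -
 note Bt = atlas_times_disc[OF A] and sn = coord_vec_snd[OF A C z]
 have P: "pchart C\<in>times_disc A" "p\<in>fst (pchart C)" using pchart_in[OF A C(1)] C z by simp_all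
 have e: "disc_gap = (%q :: 'x\<times>complex. 1+(- 1) * (snd q * cnj (snd q)))" by (rule HOL.ext) (simp add: disc_gap_def)
 have c: "cdiff (pchart C) p (%q. cnj (snd q))" by (rule cdiff_cnj[OF sn(7)])
 have m: "cdiff (pchart C) p (%q. snd q * cnj (snd q))" by (rule cdiff_mult[OF sn(7) c])
 have m': "cdiff (pchart C) p (%q. (- 1) * (snd q * cnj (snd q)))" by (rule cdiff_mult[OF cdiff_const m])
 show "cdiff (pchart C) p disc_gap" unfolding e by (rule cdiff_add[OF cdiff_const m'])
 have k: "coord_vec (pchart C) k p disc_gap =
   - (coord_vec (pchart C) k p snd * cnj (snd p)+snd p * coord_vec (pchart C) k p (%q. cnj (snd q)))" for k
  unfolding e coord_vec_add[OF cdiff_const m'] coord_vec_cmult[OF Bt P m] coord_vec_mult'[OF Bt P sn(7) c] by simp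
 show "dz (pchart C) p disc_gap = 0" "coord_vec (pchart C) (Inl 2) p disc_gap = - cnj (snd p)"
  "dbar (pchart C) p disc_gap = 0" "coord_vec (pchart C) (Inr 2) p disc_gap = - snd p"
  unfolding k by (simp_all add: sn)
qed

lemma sub_weight_derivative:
 assumes C: "C\<in>A" "fst p\<in>fst C" and z: "cmod (snd p) < 1" and u: "cdiff C (fst p) u"
 shows "cdiff (pchart C) p (sub_weight u)" "sub_weight u p ~= 0"
  "dz (pchart C) p (sub_weight u)/sub_weight u p = dz C (fst p) u"
  "coord_vec (pchart C) (Inl 2) p (sub_weight u)/sub_weight u p = - 2 * (cnj (snd p) * inverse (disc_gap p))"
proof -
 note Bt = atlas_times_disc[OF A] and g = disc_gap_derivative[OF C z] and ft = coord_vec_fst[OF A C z]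
 have P: "pchart C\<in>times_disc A" "p\<in>fst (pchart C)" using pchart_in[OF A C(1)] C z by simp_all
 have e: "sub_weight u = (%q. exp (u (fst q)) * (disc_gap q * disc_gap q))" by (rule HOL.ext) (simp add: sub_weight_def)
 note c = ft(5)[OF u]
 have gg: "cdiff (pchart C) p (%q. disc_gap q * disc_gap q)" by (rule cdiff_mult[OF g(1) g(1)])
 show "cdiff (pchart C) p (sub_weight u)" unfolding e by (rule cdiff_mult[OF cdiff_exp[OF c] gg])
 have n: "disc_gap p ~= 0" by (rule disc_gap_nonzero[OF z])
 then show n': "sub_weight u p ~= 0" by (simp add: sub_weight_def)
 have k: "coord_vec (pchart C) k p (sub_weight u) = sub_weight u p *
   (coord_vec (pchart C) k p (%q. u (fst q))+2 * coord_vec (pchart C) k p disc_gap * inverse (disc_gap p))" for k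
  unfolding e coord_vec_mult'[OF Bt P cdiff_exp[OF c] gg] coord_vec_mult'[OF Bt P g(1) g(1)] coord_vec_exp[OF c]
   cinv_chart[OF Bt P] using n by (simp add: field_simps)
 show "dz (pchart C) p (sub_weight u)/sub_weight u p = dz C (fst p) u"
  "coord_vec (pchart C) (Inl 2) p (sub_weight u)/sub_weight u p = - 2 * (cnj (snd p) * inverse (disc_gap p))"
  unfolding k using n' by (simp_all add: ft g)
qed

end

context
 fixes A :: "('x,1) atlas" and L :: "('x,'l,1) vbundle" and H :: "('x\<times>complex,'l\<times>complex\<times>complex,2) vbundle"
 assumes A: "complex_atlas A" and L: "holomorphic_bundle A L" and hx: "holomorphic_extension A L H"
begin

lemma smooth_section_sub_frame:
 assumes "(W,T)\<in>triv L"
 shows "sum_section A L (W\<times>\<Delta>) (sub_frame L T)"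
proof -
 have "sub_frame L T = (%q. (frame L T (fst q) 1,snd q,0))" by (rule HOL.ext) (simp add: sub_frame_def)
 then show ?thesis
  using smooth_section_lift[OF A L hx line_openin[OF A L assms] smooth_section_frame[OF A L assms]] by simp
qed

lemma second_form_matrix:
 assumes dm: "dolbeault_matrix_form \<tau> A L H \<phi>" and \<phi>: "holomorphic_section A L \<phi>"
  and v: "v\<in>tangent01 (times_disc A) p" and p: "p\<in>points (times_disc A)" and W: "(W,T)\<in>triv L" "fst p\<in>W"
 shows "second_form L H T p v = of_real (sqrt (- (1/\<tau>))) * alpha (snd p) (push snd v) * T (\<phi> (fst p)) $ 1"
proof -
 note Bt = atlas_times_disc[OF A] and sq = smooth_section_quot_frame[OF A L hx]
 note oP = openin_points[OF Bt]
 have px: "fst p\<in>points A" "cmod (snd p) < 1" using p by (auto simp: points_times_disc)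
 have p\<phi>: "proj L (\<phi> (fst p)) = fst p" using \<phi> px unfolding holomorphic_section_def by blast
 note Dv = dolbeault_twisted[OF A L hx oP p sq v W]
 let ?D = "dolbeault (twisted L) (%q. case quot_frame L q of (l,z,w) => (l,z)) p v"
 let ?k = "of_real (sqrt (- (1/\<tau>))) * alpha (snd p) (push snd v) * 1"
 let ?F = "%T. T (fst ?D)+?k *s T (\<phi> (fst p))"
 have e: "dolbeault H (quot_frame L) p v = (fibre_vec L (fst p) ?F,snd p,v (%q. 1))"
  using dm[unfolded dolbeault_matrix_form_def Let_def,THEN spec,THEN spec,THEN mp[OF _ conjI[OF oP sq]],THEN bspec[OF _ p],THEN bspec[OF _ v]]
  by (simp add: quot_frame_def)
 note fc = fibre_vec_combination[OF line_bundle_with[OF A L] W Dv(1) p\<phi>,of ?F 1 ?k]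
 have "v (%q. T (fst (quot_frame L q)) $ 1) = v (%q. 0)"
 proof (rule tangent_cong[OF Bt tangent01_subset[OF Bt v]])
  show "open_in (times_disc A) (W\<times>\<Delta>)"
   by (rule openin_times_disc[OF A line_openin[OF A L W(1)] open_disc[OF A] subset_refl])
  show "p\<in>W\<times>\<Delta>" using W px by (cases p) auto
  show "T (fst (quot_frame L q)) $ 1 = 0" if "q\<in>W\<times>\<Delta>" for q
   using frames_sum(4)[OF A L W(1),of q] that by auto
 qed
 also have "... = 0" by (rule tangent_const[OF Bt tangent01_subset[OF Bt v]])
 finally have "T (fst ?D) $ 1 = 0" using Dv(2) by simp
 moreover have "T (fibre_vec L (fst p) ?F) = ?F T" by (rule fc(3)[OF _ W]) simp
 ultimately show ?thesis unfolding second_form_def e by simp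
qed


context
 fixes hE hL hX and C1 :: real
 assumes hL: "hermitian_metric A L hL" and hX: "positive_function A hX"
  and C1: "C1 ~= 0" and mm: "metric_matrix_form A L hE hL hX (- C1) C1"
begin

abbreviation (input) metric_weight :: "('l => complex^1) => 'x => complex" where
 "metric_weight T == (%x. log_weight hX x+log_metric L hL T x)"

lemma hX_positive: "x\<in>points A ==> 0 < hX x" and hX_smooth: "smooth_fun A (points A) hX"
 using hX unfolding positive_function_def by blast+

lemma log_weight_smooth: "smooth_fun A (points A) (log_weight hX)"
proof -
 have "smooth_fun A (points A) (%x. ln (hX x))"
  by (rule smooth_fun_compose[OF A openin_points[OF A] hX_smooth smooth_on_ln]) (use hX_positive in auto)
 then have "smooth_fun A (points A) (%x. complex_of_real (ln (hX x)))"
  by (rule smooth_fun_linear[OF A bounded_linear_of_real openin_points[OF A]])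
 then show ?thesis by (subst smooth_fun_cong[OF A openin_points[OF A]]) (simp_all add: log_weight_def)
qed

lemma metric_weight_smooth:
 assumes W: "(W,T)\<in>triv L"
 shows "smooth_fun A W (metric_weight T)"
proof -
 note o = line_openin[OF A L W]
 show ?thesis
  by (rule smooth_fun_add[OF A o smooth_fun_subset[OF A log_weight_smooth openin_subset_points[OF A o]] log_metric_smooth[OF A L hL W]])
qed

lemma metric_components:
 assumes W: "(W,T)\<in>triv L" "fst p\<in>W" and z: "cmod (snd p) < 1"
  and u: "sproj L u = p" "sproj L v = p"
 shows "hE u v = of_real (- C1) * sub_weight (metric_weight T) p * (T (fst u) $ 1 * cnj (T (fst v) $ 1))
  + of_real C1 * exp (log_weight hX (fst p)) * (snd (snd u) * cnj (snd (snd v)))"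
proof -
 have x: "fst p\<in>points A" using openin_subset_points[OF A line_openin[OF A L W(1)]] W(2) by blast
 have u': "u = (fst u,snd p,snd (snd u))" "v = (fst v,snd p,snd (snd v))" "proj L (fst u) = fst p" "proj L (fst v) = fst p"
  using u by (auto simp: prod_eq_iff)
 have e: "exp (log_weight hX (fst p)) = of_real (hX (fst p))"
  unfolding log_weight_def using hX_positive[OF x] by (simp add: exp_of_real)
 have d: "complex_of_real (disc_metric (- 2) (snd p)) = disc_gap p * disc_gap p"
  by (simp add: disc_metric_def disc_gap_eq power2_eq_square)
 have "hE (fst u,snd p,snd (snd u)) (fst v,snd p,snd (snd v)) =
   of_real (- C1) * (of_real (hX (fst p)) * hL (fst u) (fst v)) * of_real (disc_metric (- 2) (snd p)) +
   of_real C1 * of_real (hX (fst p)) * (snd (snd u) * cnj (snd (snd v)))"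
  using mm x z u'(3,4) unfolding metric_matrix_form_def by blast
 then have "hE u v = of_real (- C1) * (of_real (hX (fst p)) * hL (fst u) (fst v)) * of_real (disc_metric (- 2) (snd p)) +
   of_real C1 * of_real (hX (fst p)) * (snd (snd u) * cnj (snd (snd v)))" using u'(1,2) by simp
 then show ?thesis
  unfolding metric_local[OF A L hL W u'(3,4)] d sub_weight_def exp_add e by (simp add: mult_ac)
qed

text \<open>The (0,1)-part is the Dolbeault operator. The (1,0)-part is read off from its products with the two frames.
 The last term is the adjoint of the second fundamental form; its sign differs from the definite case because
 \<open>h\<close> has opposite signs on the summands.\<close>

lemma chern_local_sum:
 assumes D: "chern_connection (times_disc A) (sum_bundle L) H hE D"
  and N: "open_in (times_disc A) N" "p\<in>N" and s: "sum_section A L N s"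
  and W: "(W,T)\<in>triv L" "fst p\<in>W" and C: "C\<in>A" "fst p\<in>fst C" and z: "cmod (snd p) < 1"
 defines "f == %q. T (fst (s q)) $ 1" and "g == %q. snd (snd (s q))"
  and "S == sub_weight (metric_weight T)" and "Q == %q :: 'x\<times>complex. exp (log_weight hX (fst q))"
 shows "sproj L (D s p (coord_vec (pchart C) k p)) = p"
  "T (fst (D s p (coord_vec (pchart C) (Inr j) p))) $ 1 =
   coord_vec (pchart C) (Inr j) p f+g p * second_form L H T p (coord_vec (pchart C) (Inr j) p)"
  "snd (snd (D s p (coord_vec (pchart C) (Inr j) p))) = coord_vec (pchart C) (Inr j) p g"
  "T (fst (D s p (coord_vec (pchart C) (Inl j) p))) $ 1 =
   coord_vec (pchart C) (Inl j) p f+f p * (coord_vec (pchart C) (Inl j) p S/S p)"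
  "snd (snd (D s p (coord_vec (pchart C) (Inl j) p))) =
   coord_vec (pchart C) (Inl j) p g+g p * coord_vec (pchart C) (Inl j) p (%q. log_weight hX (fst q))
  +f p * cnj (second_form L H T p (coord_vec (pchart C) (Inr j) p)) * (S p/Q p)"
proof -
 note Bt = atlas_times_disc[OF A] and Ch = chern_connectionD[OF D]
 let ?P = "pchart C" and ?B = "times_disc A" and ?E = "sum_bundle L"
 let ?v = "coord_vec ?P (Inl j) p" and ?w = "coord_vec ?P (Inr j) p"
 have P: "?P\<in>?B" "p\<in>fst ?P" using pchart_in[OF A C(1)] C z by simp_all
 have x: "fst p\<in>points A" using openin_subset_points[OF A line_openin[OF A L W(1)]] W(2) by blast
 note ct = coord_in_tangent_space[OF Bt P]
 show "proj ?E (D s p (coord_vec ?P k p)) = p" for k by (rule connectionD(1)[OF Ch(1) N(1) s N(2) ct(1)])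
 note pv = this
 define M where "M = N\<inter>(W\<times>\<Delta>)"
 have oW: "open_in ?B (W\<times>\<Delta>)"
  by (rule openin_times_disc[OF A line_openin[OF A L W(1)] open_disc[OF A] subset_refl])
 have M: "open_in ?B M" "p\<in>M" unfolding M_def using N oW W z by (auto intro: openin_Int) (cases p,auto)
 have Mq: "q\<in>N" "fst q\<in>W" "cmod (snd q) < 1" if "q\<in>M" for q using that by (auto simp: M_def)
 have sM: "smooth_section ?B ?E M s" by (rule smooth_section_subset[OF Bt s]) (auto simp: M_def)
 have e1: "smooth_section ?B ?E M (sub_frame L T)"
  by (rule smooth_section_subset[OF Bt smooth_section_sub_frame[OF W(1)]]) (auto simp: M_def)
 have e2: "smooth_section ?B ?E M (quot_frame L)"
  by (rule smooth_section_subset[OF Bt smooth_section_quot_frame[OF A L hx] openin_subset_points[OF Bt M(1)]])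
 have db: "T (fst (D t p ?w)) $ 1 = ?w (%q. T (fst (t q)) $ 1)+snd (snd (t p)) * second_form L H T p ?w"
  "snd (snd (D t p ?w)) = ?w (%q. snd (snd (t q)))" if t: "smooth_section ?B ?E M t" for t
  unfolding Ch(3)[OF M(1) t M(2) ct(3)] using dolbeault_section(2,3)[OF A L hx M t ct(3) W] by simp_all
 show "T (fst (D s p ?w)) $ 1 = ?w f+g p * second_form L H T p ?w" "snd (snd (D s p ?w)) = ?w g"
  unfolding f_def g_def by (rule db[OF sM])+
 have fr: "T (fst (sub_frame L T q)) $ 1 = 1" "T (fst (quot_frame L q)) $ 1 = 0"
  "snd (snd (sub_frame L T q)) = 0" "snd (snd (quot_frame L q)) = 1"
  "proj ?E (sub_frame L T q) = q" "proj ?E (quot_frame L q) = q" "proj ?E (s q) = q" if q: "q\<in>M" for q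
  using frames_sum[OF A L W(1) Mq(2)[OF q]] s Mq(1)[OF q] unfolding smooth_section_def by blast+
 have zero: "u F = a" if "u = ?v \<or> u = ?w" "!!q. q\<in>M ==> F q = b" "a = 0" for u F a b
  using that coord_vec_cong(1)[OF Bt P M,of F "%q. b"] by auto
 (* The (0,1)-derivatives of the two frames enter the compatibility below through the conjugate vector. *)
 have d1: "T (fst (D (sub_frame L T) p ?w)) $ 1 = 0" "snd (snd (D (sub_frame L T) p ?w)) = 0"
  unfolding db[OF e1] by (simp_all add: fr[OF M(2)] zero[of ?w _ 1] zero[of ?w _ 0] fr)
 have d2: "T (fst (D (quot_frame L) p ?w)) $ 1 = second_form L H T p ?w" "snd (snd (D (quot_frame L) p ?w)) = 0"
  unfolding db[OF e2] by (simp_all add: fr[OF M(2)] zero[of ?w _ 1] zero[of ?w _ 0] fr)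
 have pw: "proj ?E (D t p ?w) = p" if "smooth_section ?B ?E M t" for t
  by (rule connectionD(1)[OF Ch(1) M(1) that M(2) ct(1)])
 have mc: "hE a b = of_real (- C1) * S q * (T (fst a) $ 1 * cnj (T (fst b) $ 1)) + of_real C1 * Q q * (snd (snd a) * cnj (snd (snd b)))"
  if "q\<in>M" "proj ?E a = q" "proj ?E b = q" for q a b
  unfolding S_def Q_def using metric_components[OF W(1) Mq(2,3)[OF that(1)] that(2,3)] .
 have co: "conj_vec ?v = ?w" by (simp add: bar_conj_vec)
 have cu: "cdiff C (fst p) (metric_weight T)"
  by (rule smooth_fun_cdiff[OF A metric_weight_smooth[OF W(1)] C W(2)])
 note sw = sub_weight_derivative[OF A C z cu,folded S_def]
 have cl: "cdiff C (fst p) (log_weight hX)" by (rule smooth_fun_cdiff[OF A log_weight_smooth C x])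
 note cl' = coord_vec_fst(5)[OF A C z cl]
 have cQ: "cdiff ?P p Q" unfolding Q_def by (rule cdiff_exp[OF cl'])
 have dQ: "?v Q = Q p * ?v (%q. log_weight hX (fst q))"
  unfolding Q_def coord_vec_exp[OF cl'] cinv_chart[OF Bt P] ..
 have Qn: "Q p ~= 0" by (simp add: Q_def)
 have cf: "cdiff ?P p f" "cdiff ?P p g"
  using dolbeault_section(4,5)[OF A L hx N s ct(3) W,folded f_def g_def] smooth_fun_cdiff[OF Bt _ P,of "N\<inter>(W\<times>\<Delta>)"] M(2)
  unfolding M_def by blast+
 have "?v (%q. hE (s q) (sub_frame L T q)) = hE (D s p ?v) (sub_frame L T p)+hE (s p) (D (sub_frame L T) p ?w)"
  using compatibleD[OF Ch(2) M(1) sM e1 M(2) ct(1),of "Inl j"] unfolding co .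
 moreover have "?v (%q. hE (s q) (sub_frame L T q)) = ?v (%q. of_real (- C1) * (f q * S q))"
 proof (rule coord_vec_cong(1)[OF Bt P M])
  fix q assume q: "q\<in>M"
  show "hE (s q) (sub_frame L T q) = of_real (- C1) * (f q * S q)"
   unfolding mc[OF q fr(7)[OF q] fr(5)[OF q]] fr[OF q] by (simp add: f_def mult_ac)
 qed
 moreover have "... = of_real (- C1) * (?v f * S p+f p * ?v S)"
  unfolding coord_vec_cmult[OF Bt P cdiff_mult[OF cf(1) sw(1)]] coord_vec_mult'[OF Bt P cf(1) sw(1)] ..
 moreover have "hE (D s p ?v) (sub_frame L T p) = of_real (- C1) * S p * T (fst (D s p ?v)) $ 1"
  unfolding mc[OF M(2) pv fr(5)[OF M(2)]] fr[OF M(2)] by simp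
 moreover have "hE (s p) (D (sub_frame L T) p ?w) = 0"
  unfolding mc[OF M(2) fr(7)[OF M(2)] pw[OF e1]] d1 by simp
 ultimately have "of_real (- C1) * (?v f * S p+f p * ?v S) = of_real (- C1) * (S p * T (fst (D s p ?v)) $ 1)" using C1 by auto
 then have "?v f * S p+f p * ?v S = S p * T (fst (D s p ?v)) $ 1" using C1 by simp
 then show "T (fst (D s p ?v)) $ 1 = ?v f+f p * (?v S/S p)" using sw(2) by (simp add: field_simps)
 have "?v (%q. hE (s q) (quot_frame L q)) = hE (D s p ?v) (quot_frame L p)+hE (s p) (D (quot_frame L) p ?w)"
  using compatibleD[OF Ch(2) M(1) sM e2 M(2) ct(1),of "Inl j"] unfolding co .
 moreover have "?v (%q. hE (s q) (quot_frame L q)) = ?v (%q. of_real C1 * (g q * Q q))"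
 proof (rule coord_vec_cong(1)[OF Bt P M])
  fix q assume q: "q\<in>M"
  show "hE (s q) (quot_frame L q) = of_real C1 * (g q * Q q)"
   unfolding mc[OF q fr(7)[OF q] fr(6)[OF q]] fr[OF q] by (simp add: g_def mult_ac)
 qed
 moreover have "... = of_real C1 * (?v g * Q p+g p * ?v Q)"
  unfolding coord_vec_cmult[OF Bt P cdiff_mult[OF cf(2) cQ]] coord_vec_mult'[OF Bt P cf(2) cQ] ..
 moreover have "hE (D s p ?v) (quot_frame L p) = of_real C1 * (Q p * snd (snd (D s p ?v)))"
  unfolding mc[OF M(2) pv fr(6)[OF M(2)]] fr[OF M(2)] by simp
 moreover have "hE (s p) (D (quot_frame L) p ?w) = of_real C1 * (- (S p * (f p * cnj (second_form L H T p ?w))))"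
  unfolding mc[OF M(2) fr(7)[OF M(2)] pw[OF e2]] d2 f_def by simp
 ultimately have "of_real C1 * (?v g * Q p+g p * ?v Q) =
   of_real C1 * (Q p * snd (snd (D s p ?v)) - S p * (f p * cnj (second_form L H T p ?w)))" by (simp add: algebra_simps)
 then have "?v g * Q p+g p * ?v Q = Q p * snd (snd (D s p ?v)) - S p * (f p * cnj (second_form L H T p ?w))" using C1 by simp
 then show "snd (snd (D s p ?v)) = ?v g+g p * ?v (%q. log_weight hX (fst q))+f p * cnj (second_form L H T p ?w) * (S p/Q p)"
  unfolding dQ using Qn by (simp add: field_simps)
qed

end

end

section \<open>Curvature on the two frames\<close>

lemma kahler_coeff:
 assumes A: "complex_atlas A" and \<omega>: "kahler_form A \<omega>" and C: "C\<in>A" "x\<in>fst C"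
 obtains r :: real where "0 < r" "form_coeff \<omega> C x = \<i> * of_real r"
proof -
 have x: "x\<in>points A" using C unfolding points_iff by blast
 have "dz C x ~= (%_. 0)"
  using coord_vec_coordinate(1)[OF A C,of 1 1] by auto
 then have "\<exists>r::real. 0 < r\<and>\<omega> x (dz C x) (conj_vec (dz C x)) = \<i> * of_real r"
  by (rule \<omega>[unfolded kahler_form_def,THEN conjunct2,THEN conjunct2,THEN bspec[OF _ x],THEN conjunct2,THEN conjunct2,
   THEN bspec[OF _ coord_in_tangent_space(2)[OF A C]],THEN mp])
 then show ?thesis using that unfolding form_coeff_def bar_conj_vec bar_simps by blast
qed

text \<open>Both forms are pulled back from the factors, so the matrix is diagonal; \<open>2\<i>\<close> is the
 coefficient of the Poincare form at the origin.\<close>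

lemma contraction_matrix_Omega:
 assumes A: "complex_atlas A" and \<tau>: "\<tau> ~= 0" and \<omega>: "kahler_form A \<omega>" and C: "C\<in>A" "x\<in>fst C"
 shows "contraction_matrix (Omega \<tau> \<omega>) (pchart C) (x,0) =
  (\<chi> i j. if i = j then if i = 1 then 1/(of_real (- \<tau>/2) * form_coeff \<omega> C x) else 1/(2 * \<i>) else 0)"
proof -
 have xA: "x\<in>points A" using C unfolding points_iff by blast
 have C': "fst (x,0 :: complex)\<in>fst C" "cmod (snd (x,0 :: complex)) < 1" using C by simp_all
 note sn = coord_vec_snd[OF A C(1) C'] and ft = coord_vec_fst[OF A C(1) C']
 have pf: "push fst (dz (pchart C) (x,0)) = dz C x"
  "push fst (dbar (pchart C) (x,0)) = dbar C x"
  "push fst (coord_vec (pchart C) (Inl 2) (x,0)) = (%_. 0)"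
  "push fst (coord_vec (pchart C) (Inr 2) (x,0)) = (%_. 0)"
  by (rule HOL.ext,simp add: push_def o_def ft)+
 have tf: "two_form A \<omega>" using \<omega> unfolding kahler_form_def by (rule conjunct1)
 have z0: "(%_. 0)\<in>tangent_space A x" unfolding tangent_space_def using C by (auto intro!: bexI[of _ C] exI[of _ "%_. 0"])
 have t: "\<omega> x v w = - \<omega> x w v" "\<omega> x (%f. a * u f+b * v f) w = a * \<omega> x u w+b * \<omega> x v w"
  if "u\<in>tangent_space A x" "v\<in>tangent_space A x" "w\<in>tangent_space A x" for u v w a b
  using tf[unfolded two_form_def,THEN conjunct1,THEN bspec[OF _ xA],THEN bspec[OF _ that(1)],THEN bspec[OF _ that(2)],THEN bspec[OF _ that(3)]]
  by simp_all
 have zl: "\<omega> x (%_. 0) w = 0" "\<omega> x w (%_. 0) = 0" if "w\<in>tangent_space A x" for w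
 proof -
  show "\<omega> x (%_. 0) w = 0" using t(2)[OF z0 z0 that,of 0 0] by simp
  then show "\<omega> x w (%_. 0) = 0" using t(1)[OF z0 z0 that] by simp
 qed
 note ct = coord_in_tangent_space(1)[OF A C]
 have ps: "push snd v (%z. z) = v snd" "push snd v cnj = v (%q. cnj (snd q))" for v :: "('x\<times>complex) tangent"
  by (simp_all add: push_def o_def)
 obtain r where r: "0 < r" "form_coeff \<omega> C x = \<i> * of_real r" using kahler_coeff[OF A \<omega> C] .
 have "(\<chi> j k. Omega \<tau> \<omega> (x,0) (coord_vec (pchart C) (Inl j) (x,0)) (coord_vec (pchart C) (Inr k) (x,0))) =
   ((\<chi> i j. if i = j then if i = 1 then of_real (- \<tau>/2) * form_coeff \<omega> C x else 2 * \<i> else 0) :: complex^2^2)"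
  unfolding vec_eq_iff forall_2
  by (simp add: Omega_def pf zl ct z0 poincare_form_def ps sn form_coeff_def)
 then show ?thesis
  unfolding contraction_matrix_def using r \<tau>
  by (simp only:) (subst matrix_inv_diagonal,auto simp: vec_eq_iff)
qed

context
 fixes A :: "('x,1) atlas" and L :: "('x,'l,1) vbundle" and H :: "('x\<times>complex,'l\<times>complex\<times>complex,2) vbundle"
  and hE hL hX and C1 :: real
 assumes A: "complex_atlas A" and L: "holomorphic_bundle A L" and hx: "holomorphic_extension A L H"
  and hL: "hermitian_metric A L hL" and hX: "positive_function A hX"
  and C1: "C1 ~= 0" and mm: "metric_matrix_form A L hE hL hX (- C1) C1"
begin

lemmas chern_sum = chern_local_sum[OF A L hx hL hX C1 mm]

lemma chern_sum_unique:
 assumes D: "chern_connection (times_disc A) (sum_bundle L) H hE D" "chern_connection (times_disc A) (sum_bundle L) H hE D'"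
  and N: "open_in (times_disc A) N" "p\<in>N" and s: "sum_section A L N s"
  and P: "P\<in>times_disc A" "p\<in>fst P"
 shows "D s p (coord_vec P k p) = D' s p (coord_vec P k p)"
proof -
 obtain C where C: "C\<in>A" "P = pchart C" using P(1) by (auto simp: times_disc_eq)
 have Cx: "fst p\<in>fst C" "cmod (snd p) < 1" using P(2) C(2) by simp_all
 then have "fst p\<in>points A" using C(1) unfolding points_iff by blast
 then obtain W T where W: "(W,T)\<in>triv L" "fst p\<in>W" by (rule bundle_cover[OF line_bundle_with[OF A L]])
 note a = chern_sum[OF D(1) N s W C(1) Cx] and b = chern_sum[OF D(2) N s W C(1) Cx]
 show ?thesis
 proof (rule sum_fibre_eq[OF A L W(1)])
  show "proj L (fst (D s p (coord_vec P k p)))\<in>W" using a(1)[of k] W(2) unfolding C(2) by (auto simp: prod_eq_iff)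
  show "sproj L (D s p (coord_vec P k p)) = sproj L (D' s p (coord_vec P k p))"
   unfolding C(2) a(1) b(1) ..
  show "lift_triv T (D s p (coord_vec P k p)) = lift_triv T (D' s p (coord_vec P k p))"
   unfolding vec2_eq_iff lift_triv_nth C(2) by (cases k) (simp_all only: a(2-5) b(2-5))
 qed
qed

text \<open>The Chern connection is unique on coordinate vectors, and only these enter the curvature; so the Einstein
 condition for some Chern connection is that for a given one.\<close>

lemma einstein_equation_unique:
 assumes D: "chern_connection (times_disc A) (sum_bundle L) H hE D" "chern_connection (times_disc A) (sum_bundle L) H hE D'"
  and e: "einstein_equation (times_disc A) (sum_bundle L) \<omega> D lam"
 shows "einstein_equation (times_disc A) (sum_bundle L) \<omega> D' lam"
proof -
 note Bt = atlas_times_disc[OF A]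
 have c: "curvature (sum_bundle L) D P k l s p = curvature (sum_bundle L) D' P k l s p"
  if N: "open_in (times_disc A) N" and s: "sum_section A L N s"
   and P: "P\<in>times_disc A" and p: "p\<in>N\<inter>fst P" for N s P k l p
 proof -
  have o: "open_in (times_disc A) (N\<inter>fst P)" using N openin_chart[OF Bt P] by (rule openin_Int)
  have pP: "p\<in>fst P" using p by blast
  have "D (%q. D s q (coord_vec P l q)) p (coord_vec P k p) = D' (%q. D' s q (coord_vec P l q)) p (coord_vec P k p)" for k l
  proof -
   have "D (%q. D s q (coord_vec P l q)) p (coord_vec P k p) = D' (%q. D s q (coord_vec P l q)) p (coord_vec P k p)"
    by (rule chern_sum_unique[OF D o p connectionD(2)[OF chern_connectionD(1)[OF D(1)] N s P] P pP])
   also have "... = D' (%q. D' s q (coord_vec P l q)) p (coord_vec P k p)"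
    by (rule connectionD(3)[OF chern_connectionD(1)[OF D(2)] o connectionD(2)[OF chern_connectionD(1)[OF D(2)] N s P] o subset_refl
       chern_sum_unique[OF D N _ s P] p coord_in_tangent_space(1)[OF Bt P pP]]) blast+
   finally show ?thesis .
  qed
  then show ?thesis unfolding curvature_def by simp
 qed
 show ?thesis
  unfolding einstein_equation_def
 proof (intro ballI allI impI,elim conjE)
  fix P N s p
  assume P: "P\<in>times_disc A" and N: "open_in (times_disc A) N"
   and s: "sum_section A L N s" and p: "p\<in>N\<inter>fst P"
  show "fibre_vec (sum_bundle L) p (%T. \<Sum>j\<in>UNIV. \<Sum>k\<in>UNIV.
     (\<i> * contraction_matrix \<omega> P p $ k $ j) *s T (curvature (sum_bundle L) D' P (Inl j) (Inr k) s p)) =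
    fibre_vec (sum_bundle L) p (%T. lam *s T (s p))"
   using e[unfolded einstein_equation_def,THEN bspec[OF _ P],THEN spec,THEN spec,THEN mp[OF _ conjI[OF N s]],THEN bspec[OF _ p]]
   unfolding c[OF N s P p] .
 qed
qed

context
 fixes D
 assumes D: "chern_connection (times_disc A) (sum_bundle L) H hE D"
begin

lemma curvature_components:
 fixes k l :: "2+2"
 assumes N: "open_in (times_disc A) N" "p\<in>N" and s: "sum_section A L N s"
  and W: "(W,T)\<in>triv L" "fst p\<in>W" and C: "C\<in>A" "fst p\<in>fst C" and z: "cmod (snd p) < 1"
 defines "R == %k l. D (%q. D s q (coord_vec (pchart C) l q)) p (coord_vec (pchart C) k p)"
  and "F == curvature (sum_bundle L) D (pchart C) k l s p"
 shows "sproj L F = p" "T (fst F) $ 1 = T (fst (R k l)) $ 1 - T (fst (R l k)) $ 1"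
  "snd (snd F) = snd (snd (R k l)) - snd (snd (R l k))"
proof -
 note Bt = atlas_times_disc[OF A] and cn = chern_connectionD(1)[OF D]
 have P: "pchart C\<in>times_disc A" "p\<in>fst (pchart C)" using pchart_in[OF A C(1)] C z by simp_all
 have o: "open_in (times_disc A) (N\<inter>fst (pchart C))" using N(1) openin_chart[OF Bt P(1)] by (rule openin_Int)
 have pR: "sproj L (R k l) = p" for k l
  unfolding R_def by (rule connectionD(1)[OF cn o connectionD(2)[OF cn N(1) s P(1)] _ coord_in_tangent_space(1)[OF Bt P]]) (use N(2) P(2) in blast)
 have tr: "(W\<times>\<Delta>,lift_triv T)\<in>triv (sum_bundle L)" "p\<in>W\<times>\<Delta>"
  using W z unfolding triv_sum_bundle by (auto,cases p,auto)
 note fc = fibre_vec_combination[OF sum_bundle_with[OF A L hx] tr pR[of k l] pR[of l k],of "%T. T (R k l) - T (R l k)" 1 "- 1"]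
 have F: "F = fibre_vec (sum_bundle L) p (%T. T (R k l) - T (R l k))" unfolding F_def curvature_def R_def ..
 show "sproj L F = p" unfolding F by (rule fc(1)) (simp add: vec_eq_iff)
 have "lift_triv T F = lift_triv T (R k l) - lift_triv T (R l k)"
  unfolding F by (rule fc(3)[OF _ tr]) (simp add: vec_eq_iff)
 then show "T (fst F) $ 1 = T (fst (R k l)) $ 1 - T (fst (R l k)) $ 1" "snd (snd F) = snd (snd (R k l)) - snd (snd (R l k))"
  unfolding vec2_eq_iff vector_minus_component lift_triv_nth by blast+
qed

text \<open>The two terms are the curvature of the summand and the product of the second fundamental form with its
 adjoint; again the latter has the sign opposite to the definite case.\<close>

lemma curvature_frames:
 assumes W: "(W,T)\<in>triv L" "fst p\<in>W" and C: "C\<in>A" "fst p\<in>fst C" and z: "cmod (snd p) < 1"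
 defines "S == sub_weight (%x. log_weight hX x+log_metric L hL T x)" and "P == pchart C"
  and "G == %q :: 'x\<times>complex. log_weight hX (fst q)"
  and "\<beta> == %j. second_form L H T p (coord_vec (pchart C) (Inr j) p)"
 shows "T (fst (curvature (sum_bundle L) D P (Inl j) (Inr j) (sub_frame L T) p)) $ 1 =
   - coord_vec P (Inr j) p (%q. coord_vec P (Inl j) q S/S q) - \<beta> j * cnj (\<beta> j) * (S p/exp (G p))"
  "snd (snd (curvature (sum_bundle L) D P (Inl j) (Inr j) (quot_frame L) p)) =
   \<beta> j * cnj (\<beta> j) * (S p/exp (G p)) - coord_vec P (Inr j) p (%q. coord_vec P (Inl j) q G)"
proof -
 note Bt = atlas_times_disc[OF A] and cn = chern_connectionD(1)[OF D]
 have P: "P\<in>times_disc A" "p\<in>fst P" using pchart_in[OF A C(1)] C z by (simp_all add: P_def)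
 define M where "M = (W\<times>\<Delta>)\<inter>fst P"
 have oW: "open_in (times_disc A) (W\<times>\<Delta>)"
  by (rule openin_times_disc[OF A line_openin[OF A L W(1)] open_disc[OF A] subset_refl])
 have pW: "p\<in>W\<times>\<Delta>" using W z by (cases p) auto
 have M: "open_in (times_disc A) M" "p\<in>M"
  unfolding M_def using openin_Int[OF oW openin_chart[OF Bt P(1)]] pW P(2) by blast+
 have Mq: "q\<in>W\<times>\<Delta>" "fst q\<in>W" "fst q\<in>fst C" "cmod (snd q) < 1" if "q\<in>M" for q using that by (auto simp: M_def P_def)
 have z0: "coord_vec P k p F = 0" if "!!q. q\<in>M ==> F q = b" for k F b
  using coord_vec_cong(1)[OF Bt P M,of F "%q. b"] that by simp
 have z1: "coord_vec P k q F = 0" if "q\<in>M" "!!q. q\<in>M ==> F q = b" for k q F b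
  using coord_vec_cong(1)[OF Bt P(1) _ M(1) that(1),of F "%q. b"] that unfolding M_def by auto
 have fr: "T (fst (sub_frame L T q)) $ 1 = 1" "T (fst (quot_frame L q)) $ 1 = 0"
  "snd (snd (sub_frame L T q)) = 0" "snd (snd (quot_frame L q)) = 1" if q: "q\<in>M" for q
  using frames_sum(3-6)[OF A L W(1) Mq(2)[OF q]] .
 note sf = smooth_section_sub_frame[OF A L hx W(1)]
  and qf = smooth_section_subset[OF Bt smooth_section_quot_frame[OF A L hx] openin_subset_points[OF Bt oW]]
 have sm: "sum_section A L M (%q. D s q (coord_vec P k q))"
  if "sum_section A L (W\<times>\<Delta>) s" for s k
  unfolding M_def by (rule connectionD(2)[OF cn oW that P(1)])
 note cs = chern_sum[OF D oW Mq(1) _ W(1) Mq(2) C(1) Mq(3,4),folded P_def S_def G_def]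
 note cp = chern_sum[OF D M _ W C z,folded P_def S_def G_def]
 have e: "T (fst (D (sub_frame L T) q (coord_vec P (Inr j) q))) $ 1 = 0" "snd (snd (D (sub_frame L T) q (coord_vec P (Inr j) q))) = 0"
  "T (fst (D (sub_frame L T) q (coord_vec P (Inl j) q))) $ 1 = coord_vec P (Inl j) q S/S q" if q: "q\<in>M" for q
  using cs(2-4)[OF q sf q q q,of j] z1[OF q,of "%q. T (fst (sub_frame L T q)) $ 1" 1] z1[OF q,of "%q. snd (snd (sub_frame L T q))" 0]
  by (simp_all add: fr[OF q] fr)
 have e': "snd (snd (D (sub_frame L T) p (coord_vec P (Inl j) p))) = cnj (\<beta> j) * (S p/exp (G p))"
  using cs(5)[OF M(2) sf M(2) M(2) M(2),of j] z0[of "%q. snd (snd (sub_frame L T q))" 0]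
  by (simp add: fr[OF M(2)] fr \<beta>_def P_def G_def)
 have q: "snd (snd (D (quot_frame L) q (coord_vec P (Inr j) q))) = 0"
  "T (fst (D (quot_frame L) q (coord_vec P (Inl j) q))) $ 1 = 0"
  "snd (snd (D (quot_frame L) q (coord_vec P (Inl j) q))) = coord_vec P (Inl j) q G" if q: "q\<in>M" for q
  using cs(3-5)[OF q qf q q q,of j] z1[OF q,of "%q. T (fst (quot_frame L q)) $ 1" 0] z1[OF q,of "%q. snd (snd (quot_frame L q))" 1]
  by (simp_all add: fr[OF q] fr G_def)
 have q': "T (fst (D (quot_frame L) p (coord_vec P (Inr j) p))) $ 1 = \<beta> j"
  using cs(2)[OF M(2) qf M(2) M(2) M(2),of j] z0[of "%q. T (fst (quot_frame L q)) $ 1" 0]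
  by (simp add: fr[OF M(2)] fr \<beta>_def P_def G_def)
 note r = curvature_components[OF oW pW _ W C z,folded P_def]
 have s1: "coord_vec P k p (%q. T (fst (D (sub_frame L T) q (coord_vec P (Inl j) q))) $ 1) = coord_vec P k p (%q. coord_vec P (Inl j) q S/S q)" for k
  by (rule coord_vec_cong(1)[OF Bt P M e(3)])
 have s2: "coord_vec P k p (%q. snd (snd (D (quot_frame L) q (coord_vec P (Inl j) q)))) = coord_vec P k p (%q. coord_vec P (Inl j) q G)" for k
  by (rule coord_vec_cong(1)[OF Bt P M q(3)])
 have t1: "coord_vec P k p (%q. T (fst (D (sub_frame L T) q (coord_vec P (Inr j) q))) $ 1) = 0" for k by (rule z0[OF e(1)])
 have t2: "coord_vec P k p (%q. snd (snd (D (quot_frame L) q (coord_vec P (Inr j) q)))) = 0" for k by (rule z0[OF q(1)])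
 show "T (fst (curvature (sum_bundle L) D P (Inl j) (Inr j) (sub_frame L T) p)) $ 1 =
   - coord_vec P (Inr j) p (%q. coord_vec P (Inl j) q S/S q) - \<beta> j * cnj (\<beta> j) * (S p/exp (G p))"
  unfolding r(2)[OF sf] cp(2)[OF sm[OF sf]] cp(4)[OF sm[OF sf]] s1 e' t1 e(1)[OF M(2)]
  by (simp add: \<beta>_def P_def)
 show "snd (snd (curvature (sum_bundle L) D P (Inl j) (Inr j) (quot_frame L) p)) =
   \<beta> j * cnj (\<beta> j) * (S p/exp (G p)) - coord_vec P (Inr j) p (%q. coord_vec P (Inl j) q G)"
  unfolding r(3)[OF qf] cp(3)[OF sm[OF qf]] cp(5)[OF sm[OF qf]] s2 q' t2 q(1)[OF M(2)]
  by (simp add: \<beta>_def P_def G_def)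
qed

end

end

section \<open>The Einstein equation\<close>

lemma lap_add:
 assumes A: "complex_atlas A" and W: "open_in A W" and u: "smooth_fun A W u" "smooth_fun A W v"
  and C: "C\<in>A" "x\<in>fst C" and x: "x\<in>W"
 shows "lap C (%q. u q+v q) x = lap C u x+lap C v x"
proof -
 have o: "open_in A (W\<inter>fst C)" using W openin_chart[OF A C(1)] by (rule openin_Int)
 have xo: "x\<in>W\<inter>fst C" using x C by blast
 have e: "dz C q (%q. u q+v q) = dz C q u+dz C q v" if "q\<in>W\<inter>fst C" for q
  using that by (intro coord_vec_add smooth_fun_cdiff[OF A u(1) C(1)] smooth_fun_cdiff[OF A u(2) C(1)]) auto
 have "lap C (%q. u q+v q) x = dbar C x (%q. dz C q u+dz C q v)"
  unfolding lap_def by (rule coord_vec_cong(1)[OF A C o xo e])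
 also have "... = lap C u x+lap C v x"
  unfolding lap_def
  by (rule coord_vec_add[OF cdiff_coord_vec[OF A u(1) C(1) W x C(2)] cdiff_coord_vec[OF A u(2) C(1) W x C(2)]])
 finally show ?thesis .
qed

lemma lap_real:
 assumes A: "complex_atlas A" and W: "open_in A W" and u: "smooth_fun A W u" "!!q. cnj (u q) = u q"
  and C: "C\<in>A" "x\<in>fst C" and x: "x\<in>W"
 shows "cnj (lap C u x) = lap C u x"
proof -
 have b: "cnj (dz C q u) = dbar C q u" for q
  using coord_vec_cnj[of C "Inr 1" q u] by (simp add: u(2))
 have "cnj (lap C u x) = dz C x (%q. cnj (dz C q u))"
  unfolding lap_def using coord_vec_cnj[of C "Inl 1" x "%q. dz C q u"] by simp
 also have "... = lap C u x" unfolding b lap_def by (rule coord_vec_commute[OF A u(1) C(1) W x C(2)])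
 finally show ?thesis .
qed

lemma contraction_dim1:
 assumes "form_coeff \<omega> C x ~= 0"
 shows "contraction \<omega> F C x = form_coeff F C x/form_coeff \<omega> C x"
proof -
 have "(\<chi> j k. \<omega> x (coord_vec C (Inl j) x) (coord_vec C (Inr k) x)) = ((\<chi> i j. if i = j then form_coeff \<omega> C x else 0) :: complex^1^1)"
  by (simp add: vec_eq_iff form_coeff_def)
 then have "contraction_matrix \<omega> C x = (\<chi> i j. if i = j then 1/form_coeff \<omega> C x else 0)"
  unfolding contraction_matrix_def by (simp only: matrix_inv_diagonal[OF assms])
 then show ?thesis unfolding contraction_def by (simp add: form_coeff_def)
qed

context
 fixes A :: "('x,1) atlas" and L :: "('x,'l,1) vbundle" and H :: "('x\<times>complex,'l\<times>complex\<times>complex,2) vbundle"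
  and hE hL hX and C1 :: real and D
 assumes A: "complex_atlas A" and L: "holomorphic_bundle A L" and hx: "holomorphic_extension A L H"
  and hL: "hermitian_metric A L hL" and hX: "positive_function A hX"
  and C1: "C1 ~= 0" and mm: "metric_matrix_form A L hE hL hX (- C1) C1"
  and D: "chern_connection (times_disc A) (sum_bundle L) H hE D"
begin

lemmas lw_smooth = log_weight_smooth[OF A L hx hL hX C1 mm]

lemma lw_smooth_on: "open_in A W ==> smooth_fun A W (log_weight hX)"
 by (rule smooth_fun_subset[OF A lw_smooth openin_subset_points[OF A]])

lemma einstein_components:
 assumes e: "einstein_equation (times_disc A) (sum_bundle L) \<Omega> D lam"
  and N: "open_in (times_disc A) N" "p\<in>N" and s: "sum_section A L N s"
  and W: "(W,T)\<in>triv L" "fst p\<in>W" and C: "C\<in>A" "fst p\<in>fst C" and z: "cmod (snd p) < 1"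
  and m: "contraction_matrix \<Omega> (pchart C) p = (\<chi> i j. if i = j then m i else 0)"
 defines "F == %j. curvature (sum_bundle L) D (pchart C) (Inl j) (Inr j) s p"
 shows "lam * T (fst (s p)) $ 1 = \<i> * m 1 * T (fst (F 1)) $ 1+\<i> * m 2 * T (fst (F 2)) $ 1"
  "lam * snd (snd (s p)) = \<i> * m 1 * snd (snd (F 1))+\<i> * m 2 * snd (snd (F 2))"
proof -
 have P: "pchart C\<in>times_disc A" "p\<in>N\<inter>fst (pchart C)" using pchart_in[OF A C(1)] C z N(2) by simp_all
 have ps: "sproj L (s p) = p" using s N(2) unfolding smooth_section_def by blast
 have pF: "sproj L (F j) = p" for j
  unfolding F_def by (rule curvature_components(1)[OF A L hx hL hX C1 mm D N s W C z])
 have tr: "(W\<times>\<Delta>,lift_triv T)\<in>triv (sum_bundle L)" "p\<in>W\<times>\<Delta>"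
  using W z unfolding triv_sum_bundle by (auto,cases p,auto)
 let ?F = "%T. \<Sum>j\<in>UNIV. \<Sum>k\<in>UNIV. (\<i> * contraction_matrix \<Omega> (pchart C) p $ k $ j) *s
   T (curvature (sum_bundle L) D (pchart C) (Inl j) (Inr k) s p)"
 have F: "?F = (%T :: _ => complex^2. (\<i> * m 1) *s T (F 1)+(\<i> * m 2) *s T (F 2))"
  by (rule HOL.ext) (simp add: m sum_2 F_def)
 have "fibre_vec (sum_bundle L) p ?F = fibre_vec (sum_bundle L) p (%T. lam *s T (s p))"
  by (rule e[unfolded einstein_equation_def,THEN bspec[OF _ P(1)],THEN spec,THEN spec,THEN mp[OF _ conjI[OF N(1) s]],THEN bspec[OF _ P(2)]])
 moreover have "lift_triv T (fibre_vec (sum_bundle L) p ?F) = (\<i> * m 1) *s lift_triv T (F 1)+(\<i> * m 2) *s lift_triv T (F 2)"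
  unfolding F by (rule fibre_vec_combination(3)[OF sum_bundle_with[OF A L hx] tr pF pF refl tr])
 moreover have "lift_triv T (fibre_vec (sum_bundle L) p (%T. lam *s T (s p))) = lam *s lift_triv T (s p)"
  by (rule fibre_vec_combination(3)[OF sum_bundle_with[OF A L hx] tr ps ps _ tr,of _ lam 0]) simp
 ultimately have "lam *s lift_triv T (s p) = (\<i> * m 1) *s lift_triv T (F 1)+(\<i> * m 2) *s lift_triv T (F 2)" by simp
 then show "lam * T (fst (s p)) $ 1 = \<i> * m 1 * T (fst (F 1)) $ 1+\<i> * m 2 * T (fst (F 2)) $ 1"
  "lam * snd (snd (s p)) = \<i> * m 1 * snd (snd (F 1))+\<i> * m 2 * snd (snd (F 2))"
  unfolding vec2_eq_iff vector_add_component vector_smult_component lift_triv_nth by blast+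
qed

text \<open>The Einstein equation over \<open>(x, 0)\<close>, on the sub frame and on the frame of the trivial summand.
 The number \<open>1\<close> is the curvature of \<open>L\<^sub>-\<^sub>2\<close> contracted with the Poincare
 form.\<close>

lemma einstein_local:
 assumes \<tau>: "\<tau> < 0" and \<omega>: "kahler_form A \<omega>" and dm: "dolbeault_matrix_form \<tau> A L H \<phi>" and \<phi>: "holomorphic_section A L \<phi>"
  and e: "einstein_equation (times_disc A) (sum_bundle L) (Omega \<tau> \<omega>) D lam"
  and W: "(W,T)\<in>triv L" "x\<in>W" and C: "C\<in>A" "x\<in>fst C"
 defines "m == 1/(of_real (- \<tau>/2) * form_coeff \<omega> C x)" and "n == hL (\<phi> x) (\<phi> x)"
 shows "lam = - (\<i> * m) * (lap C (log_weight hX) x+lap C (log_metric L hL T) x)+1+n/of_real (2 * \<tau>)"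
  "lam = - (\<i> * m) * lap C (log_weight hX) x - n/of_real (2 * \<tau>)"
proof -
 note Bt = atlas_times_disc[OF A]
 let ?P = "pchart C" and ?p = "(x,0 :: complex)"
 let ?U = "%x. log_weight hX x+log_metric L hL T x" and ?G = "%q :: 'x\<times>complex. log_weight hX (fst q)"
 let ?S = "sub_weight ?U"
 have xA: "x\<in>points A" using C unfolding points_iff by blast
 have W': "fst ?p\<in>W" and C': "fst ?p\<in>fst C" and z: "cmod (snd ?p) < 1" using W C by simp_all
 have P: "?P\<in>times_disc A" "?p\<in>fst ?P" using pchart_in[OF A C(1)] C by simp_all
 have pp: "?p\<in>points (times_disc A)" using xA by (simp add: points_times_disc)
 have oW: "open_in (times_disc A) (W\<times>\<Delta>)"
  by (rule openin_times_disc[OF A line_openin[OF A L W(1)] open_disc[OF A] subset_refl])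
 have pW: "?p\<in>W\<times>\<Delta>" using W by simp
 define M where "M = (W\<times>\<Delta>)\<inter>fst ?P"
 have M: "open_in (times_disc A) M" "?p\<in>M"
  unfolding M_def using openin_Int[OF oW openin_chart[OF Bt P(1)]] pW P(2) by blast+
 have Mq: "fst q\<in>W" "fst q\<in>fst C" "cmod (snd q) < 1" if "q\<in>M" for q using that by (auto simp: M_def)
 define \<beta> where "\<beta> = (%j. second_form L H T ?p (coord_vec ?P (Inr j) ?p))"
 have U: "smooth_fun A W ?U" by (rule metric_weight_smooth[OF A L hx hL hX C1 mm W(1)])
 have lapU: "lap C ?U x = lap C (log_weight hX) x+lap C (log_metric L hL T) x"
  by (rule lap_add[OF A line_openin[OF A L W(1)] lw_smooth_on[OF line_openin[OF A L W(1)]] log_metric_smooth[OF A L hL W(1)] C W(2)])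
 have sd: "dz ?P q ?S/?S q = dz C (fst q) ?U"
  "coord_vec ?P (Inl 2) q ?S/?S q = - 2 * (cnj (snd q) * inverse (disc_gap q))" if "q\<in>M" for q
  using sub_weight_derivative(3,4)[OF A C(1) Mq(2)[OF that] Mq(3)[OF that] smooth_fun_cdiff[OF A U C(1) Mq(2,1)[OF that]]] .
 note ft = coord_vec_fst[OF A C(1)] and sn = coord_vec_snd[OF A C(1) C' z] and dg = disc_gap_derivative[OF A C(1) C' z]
 have S1: "dbar ?P ?p (%q. dz ?P q ?S/?S q) = lap C ?U x"
 proof -
  have "dbar ?P ?p (%q. dz ?P q ?S/?S q) = dbar ?P ?p (%q. dz C (fst q) ?U)"
   by (rule coord_vec_cong(1)[OF Bt P M sd(1)])
  then show ?thesis using ft(2)[OF C' z,of "%y. dz C y ?U"] by (simp add: lap_def)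
 qed
 have g: "disc_gap ?p = 1" by (simp add: disc_gap_def)
 have c1: "cdiff ?P ?p (%q. cnj (snd q))" by (rule cdiff_cnj[OF sn(7)])
 have c2: "cdiff ?P ?p (%q. inverse (disc_gap q))" 
  using differentiable_inverse[OF dg(1)[unfolded cdiff_def]] g unfolding cdiff_def cinv_chart[OF Bt P] by simp
 (* Over the origin only the derivative of the conjugate of z survives. *)
 have S2: "coord_vec ?P (Inr 2) ?p (%q. coord_vec ?P (Inl 2) q ?S/?S q) = - 2"
 proof -
  have "coord_vec ?P (Inr 2) ?p (%q. coord_vec ?P (Inl 2) q ?S/?S q) =
    coord_vec ?P (Inr 2) ?p (%q. - 2 * (cnj (snd q) * inverse (disc_gap q)))"
   by (rule coord_vec_cong(1)[OF Bt P M sd(2)])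
  then show ?thesis
   unfolding coord_vec_cmult[OF Bt P cdiff_mult[OF c1 c2]] coord_vec_mult'[OF Bt P c1 c2] sn g by simp
 qed
 have G1: "dbar ?P ?p (%q. dz ?P q ?G) = lap C (log_weight hX) x"
 proof -
  have "dbar ?P ?p (%q. dz ?P q ?G) = dbar ?P ?p (%q. dz C (fst q) (log_weight hX))"
   by (rule coord_vec_cong(1)[OF Bt P M]) (rule ft(1)[OF Mq(2,3)])
  then show ?thesis using ft(2)[OF C' z,of "%y. dz C y (log_weight hX)"] by (simp add: lap_def)
 qed
 have G2: "coord_vec ?P (Inr 2) ?p (%q. coord_vec ?P (Inl 2) q ?G) = 0"
  using coord_vec_cong(1)[OF Bt P M,of "%q. coord_vec ?P (Inl 2) q ?G" "%q. 0"] ft(3)[OF Mq(2,3)] by simp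
 have \<beta>: "\<beta> 1 = 0" "\<beta> 2 = of_real (sqrt (- (1/\<tau>))) * T (\<phi> x) $ 1"
  unfolding \<beta>_def using second_form_matrix[OF A L hx dm \<phi> coord_in_tangent_space(3)[OF Bt P] pp W(1) W'] sn
  by (simp_all add: alpha_def push_def o_def)
 have p\<phi>: "proj L (\<phi> x) = x" using \<phi> xA unfolding holomorphic_section_def by blast
 have ratio: "?S ?p/exp (?G ?p) = exp (log_metric L hL T x)"
  by (simp add: sub_weight_def g exp_add)
 have c: "complex_of_real (sqrt (- (1/\<tau>))) * of_real (sqrt (- (1/\<tau>))) = - (1/of_real \<tau>)"
  using \<tau> by (simp flip: of_real_mult add: field_simps)
 have n: "\<beta> 2 * cnj (\<beta> 2) * (?S ?p/exp (?G ?p)) = - (n/of_real \<tau>)"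
  unfolding ratio n_def metric_local[OF A L hL W p\<phi> p\<phi>] \<beta>(2) using c by (simp add: mult_ac field_simps)
 note cf = curvature_frames[OF A L hx hL hX C1 mm D W(1) W' C(1) C' z]
 have bj: "second_form L H T ?p (coord_vec ?P (Inr j) ?p) = \<beta> j" for j by (simp add: \<beta>_def)
 have cm: "contraction_matrix (Omega \<tau> \<omega>) ?P ?p = (\<chi> i j. if i = j then if i = 1 then m else 1/(2 * \<i>) else 0)"
  unfolding m_def by (rule contraction_matrix_Omega[OF A _ \<omega> C]) (use \<tau> in simp)
 note fr = frames_sum[OF A L W(1) W']
 have "lam = \<i> * m * (- lap C ?U x)+1/2 * (2+n/of_real \<tau>)"
  using einstein_components(1)[OF e oW pW smooth_section_sub_frame[OF A L hx W(1)] W(1) W' C(1) C' z cm]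
  unfolding cf(1) bj S1 S2 n \<beta>(1) fr by simp
 also have "1/2 * (2+n/of_real \<tau>) = 1+n/of_real (2 * \<tau>)" by (simp add: add_divide_distrib)
 finally show "lam = - (\<i> * m) * (lap C (log_weight hX) x+lap C (log_metric L hL T) x)+1+n/of_real (2 * \<tau>)"
  unfolding lapU by (simp add: algebra_simps)
 have sq: "sum_section A L (W\<times>\<Delta>) (quot_frame L)"
  by (rule smooth_section_subset[OF Bt smooth_section_quot_frame[OF A L hx] openin_subset_points[OF Bt oW]])
 have "lam = \<i> * m * (- lap C (log_weight hX) x)+1/2 * (- (n/of_real \<tau>))"
  using einstein_components(2)[OF e oW pW sq W(1) W' C(1) C' z cm]
  unfolding cf(2) bj G1 G2 n \<beta>(1) fr by simp
 also have "1/2 * (- (n/of_real \<tau>)) = - (n/of_real (2 * \<tau>))" by simp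
 finally show "lam = - (\<i> * m) * lap C (log_weight hX) x - n/of_real (2 * \<tau>)" by simp
qed

text \<open>The metric \<open>h\<^sub>X\<close> cancels in the difference of the two equations.\<close>

lemma einstein_vortex:
 assumes \<tau>: "\<tau> < 0" and \<omega>: "kahler_form A \<omega>" and dm: "dolbeault_matrix_form \<tau> A L H \<phi>" and \<phi>: "holomorphic_section A L \<phi>"
  and e: "einstein_equation (times_disc A) (sum_bundle L) (Omega \<tau> \<omega>) D lam"
 shows "exotic_vortex \<tau> A \<omega> L \<phi> hL"
 unfolding exotic_vortex_def
proof (intro exI conjI ballI)
 show "chern_connection A L L hL (line_connection A L hL)" by (rule line_connection_chern[OF A L hL])
 show "curvature_form A L (line_connection A L hL) (line_curvature A L hL)" by (rule line_curvature_form[OF A L hL])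
 fix C x assume C: "C\<in>A" "x\<in>fst C"
 then have "x\<in>points A" unfolding points_iff by blast
 then obtain W T where W: "(W,T)\<in>triv L" "x\<in>W" by (rule bundle_cover[OF line_bundle_with[OF A L]])
 obtain r where r: "0 < r" "form_coeff \<omega> C x = \<i> * of_real r" using kahler_coeff[OF A \<omega> C] .
 define w where "w = form_coeff \<omega> C x"
 define l where "l = lap C (log_metric L hL T) x"
 define n where "n = hL (\<phi> x) (\<phi> x)"
 define t where "t = complex_of_real \<tau>"
 have w: "w ~= 0" "t ~= 0" using r \<tau> by (auto simp: w_def t_def)
 have "contraction \<omega> (line_curvature A L hL) C x = - l/w"
  using contraction_dim1[of \<omega> C x "line_curvature A L hL"] w line_curvature_coord(1)[OF A L hL C W]
  by (simp add: form_coeff_def w_def l_def)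
 moreover have "\<i> * (- l/w) - 1/2 * n - t/2 = 0"
 proof -
  define k where "k = lap C (log_weight hX) x"
  define m where "m = \<i> * (1/(- t/2 * w))"
  have "lam = - m * (k+l)+1+n/(2 * t)" "lam = - m * k - n/(2 * t)"
   using einstein_local[OF \<tau> \<omega> dm \<phi> e W C] by (simp_all add: m_def w_def l_def n_def t_def k_def)
  from arg_cong2[OF this,of "%a b. a - b"]
  have "0 = - m * l+1+n/t" by (simp add: algebra_simps)
  then have "0 = - (\<i> * (1/(- t/2 * w))) * l+1+n/t" unfolding m_def .
  then have "0 = (- t/2) * (- (\<i> * (1/(- t/2 * w))) * l+1+n/t)" by simp
  also have "... = \<i> * (- l/w) - 1/2 * n - t/2" using w by (simp add: field_simps)
  finally show ?thesis ..
 qed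
 ultimately show "\<i> * contraction \<omega> (line_curvature A L hL) C x - 1/2 * hL (\<phi> x) (\<phi> x) - complex_of_real \<tau>/2 = 0"
  unfolding n_def t_def by simp
qed

text \<open>Eliminating \<open>|\<phi>|\<^sup>2\<close> expresses the curvature of \<open>L\<close> by \<open>lam\<close>,
 \<open>\<omega>\<close> and the form of \<open>log h\<^sub>X\<close>, which is exact on the surface. The
 degree is real by definition, so \<open>lam\<close> has to be real beforehand; this is visible in the second
 equation.\<close>

lemma einstein_constant:
 assumes \<tau>: "\<tau> < 0" and \<omega>: "kahler_form A \<omega>" and dm: "dolbeault_matrix_form \<tau> A L H \<phi>" and \<phi>: "holomorphic_section A L \<phi>"
  and e: "einstein_equation (times_disc A) (sum_bundle L) (Omega \<tau> \<omega>) D lam"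
  and compact: "compact_space (atlas_topology A)" and haus: "Hausdorff_space (atlas_topology A)"
  and ne: "points A ~= {}" and vol: "surface_integral A \<omega> = 1"
 shows "lam = of_real (1/2 * (1 - 4 * pi/\<tau> * bundle_degree A L))"
proof -
 define t where "t = complex_of_real \<tau>"
 have t: "t ~= 0" using \<tau> by (simp add: t_def)
 have tf: "two_form A \<omega>" using \<omega> unfolding kahler_form_def by (rule conjunct1)
 let ?F = "line_curvature A L hL"
 have cf: "curvature_form A L (line_connection A L hL) ?F" by (rule line_curvature_form[OF A L hL])
 then have tF: "two_form A ?F" unfolding curvature_form_def by (rule conjunct1)
 (* The left-hand side of the definition of the degree is a real number. *)
 have real: "cnj lam = lam"
 proof -
  obtain x where x: "x\<in>points A" using ne by blast
  then obtain C where C: "C\<in>A" "x\<in>fst C" unfolding points_iff by blast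
  obtain W T where W: "(W,T)\<in>triv L" "x\<in>W" using bundle_cover[OF line_bundle_with[OF A L] x] .
  obtain r where r: "0 < r" "form_coeff \<omega> C x = \<i> * of_real r" using kahler_coeff[OF A \<omega> C] .
  have l: "cnj (lap C (log_weight hX) x) = lap C (log_weight hX) x"
   by (rule lap_real[OF A openin_points[OF A] lw_smooth _ C x]) (simp add: log_weight_def)
  have p\<phi>: "proj L (\<phi> x) = x" using \<phi> x unfolding holomorphic_section_def by blast
  have n: "cnj (hL (\<phi> x) (\<phi> x)) = hL (\<phi> x) (\<phi> x)" using metric_linear(1)[OF A L hL x p\<phi> p\<phi> p\<phi>] ..
  show ?thesis unfolding einstein_local(2)[OF \<tau> \<omega> dm \<phi> e W C] r by (simp add: l n)
 qed
 have co: "form_coeff ?F C x = - (\<i> * t * (1/2 - lam)) * form_coeff \<omega> C x+2 * lap C (log_weight hX) x"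
  if C: "C\<in>A" "x\<in>fst C" for C x
 proof -
  have "x\<in>points A" using C unfolding points_iff by blast
  then obtain W T where W: "(W,T)\<in>triv L" "x\<in>W" by (rule bundle_cover[OF line_bundle_with[OF A L]])
  obtain r where r: "0 < r" "form_coeff \<omega> C x = \<i> * of_real r" using kahler_coeff[OF A \<omega> C] .
  define w where "w = form_coeff \<omega> C x"
  define l where "l = lap C (log_metric L hL T) x"
  define k where "k = lap C (log_weight hX) x"
  define n where "n = hL (\<phi> x) (\<phi> x)/of_real (2 * \<tau>)"
  have w: "w ~= 0" using r by (auto simp: w_def)
  have fl: "form_coeff ?F C x = - l"
   unfolding form_coeff_def l_def by (rule line_curvature_coord(1)[OF A L hL C W])
  define m where "m = \<i> * (1/(- t/2 * w))"
  have "lam = - m * (k+l)+1+n" "lam = - m * k - n"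
   using einstein_local[OF \<tau> \<omega> dm \<phi> e W C] by (simp_all add: m_def w_def l_def n_def t_def k_def)
  from arg_cong2[OF this,of "%a b. a+b"]
  have "2 * lam = - m * (2 * k+l)+1" by (simp add: algebra_simps)
  then have "m * (- l) = 2 * lam - 1+2 * (m * k)" by (simp add: algebra_simps)
  moreover have "m * (- (\<i> * t * (1/2 - lam)) * w+2 * k) = 2 * lam - 1+2 * (m * k)"
   using w t by (simp add: m_def field_simps)
  moreover have "m ~= 0" using w t by (simp add: m_def)
  ultimately have "- l = - (\<i> * t * (1/2 - lam)) * w+2 * k" by (metis mult_left_cancel)
  then show ?thesis unfolding fl w_def k_def .
 qed
 obtain K rho where P: "partition_of_unity A K rho" using partition_of_unity_exists[OF A compact haus] by blast
 have lin: "partition_integral K rho (form_coeff ?F) =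
   - (\<i> * t * (1/2 - lam)) * partition_integral K rho (form_coeff \<omega>)+2 * partition_integral K rho (%C. lap C (log_weight hX))"
  by (rule partition_integral_linear[OF A compact haus density_coeff[OF A compact haus tf] density_lap[OF A compact lw_smooth] P co])
 have stokes: "partition_integral K rho (%C. lap C (log_weight hX)) = 0"
  by (rule partition_integral_lap[OF A compact lw_smooth P])
 have unit: "- 2 * \<i> * partition_integral K rho (form_coeff \<omega>) = 1"
  using surface_integral_eq[OF A compact haus tf P] vol by simp
 have "surface_integral A ?F = - 2 * \<i> * partition_integral K rho (form_coeff ?F)"
  by (rule surface_integral_eq[OF A compact haus tF P])
 also have "... = - (\<i> * t * (1/2 - lam)) * (- 2 * \<i> * partition_integral K rho (form_coeff \<omega>))"
  unfolding lin stokes by (simp only: mult_zero_left mult_zero_right add_0_right mult_ac)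
 finally have I: "surface_integral A ?F = - (\<i> * t * (1/2 - lam))" unfolding unit by simp
 have lr: "lam = of_real (Re lam)" using real by (simp add: complex_eq_iff)
 define d where "d = \<tau> * (1/2 - Re lam)/(2 * pi)"
 have "complex_of_real d = t * (1/2 - lam)/(2 * of_real pi)"
  by (subst lr) (simp add: d_def t_def)
 then have "complex_of_real d = \<i>/(2 * of_real pi) * surface_integral A ?F" unfolding I by (simp flip: mult.assoc)
 then have "bundle_degree A L = d"
  by (rule bundle_degree_eq[OF A compact haus L hL line_connection_chern[OF A L hL] cf])
 then have "1/2 * (1 - 4 * pi/\<tau> * bundle_degree A L) = Re lam" using \<tau> by (simp add: d_def field_simps)
 then show ?thesis using lr by simp
qed

end

section \<open>Invariant bundles on the product with the disc\<close>

theorem theorem3p4: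
  fixes \<tau> :: real
    and A :: "('x, 1) atlas"
    and \<omega>X :: "'x form2"
    and L :: "('x, 'l, 1) vbundle"
    and H :: "('x \<times> complex, 'l \<times> complex \<times> complex, 2) vbundle"
  assumes "\<tau> < 0"
    and "compact_connected_riemann_surface A"
    and "kahler_form A \<omega>X"
    and "surface_integral A \<omega>X = 1"
    and "holomorphic_bundle A L"
    and "holomorphic_extension A L H"
  shows
    "(equivariant_holomorphic A L H \<longrightarrow>
        (\<exists>\<phi>. holomorphic_section A L \<phi> \<and> dolbeault_matrix_form \<tau> A L H \<phi>)) \<and>
     (\<forall>hE. pseudo_hermitian_metric (1, 1) (times_disc A) (sum_bundle L) hE \<and> invariant_form A L hE \<longrightarrow>
        (\<exists>hL hX C0 C1. hermitian_metric A L hL \<and> positive_function A hX \<and>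
           (C0, C1) \<in> {(1, - 1), (- 1, 1)} \<and> metric_matrix_form A L hE hL hX C0 C1)) \<and>
     (\<forall>hE \<phi> hL hX C0 C1 D.
        equivariant_holomorphic A L H \<and>
        pseudo_hermitian_metric (1, 1) (times_disc A) (sum_bundle L) hE \<and> invariant_form A L hE \<and>
        holomorphic_section A L \<phi> \<and> dolbeault_matrix_form \<tau> A L H \<phi> \<and>
        hermitian_metric A L hL \<and> positive_function A hX \<and>
        (C0, C1) \<in> {(1, - 1), (- 1, 1)} \<and> metric_matrix_form A L hE hL hX C0 C1 \<and>
        chern_connection (times_disc A) (sum_bundle L) H hE D \<longrightarrow>
        (pseudo_hermitian_einstein (times_disc A) (sum_bundle L) H (Omega \<tau> \<omega>X) hE \<longleftrightarrow>
           pseudo_hermitian_yang_mills (times_disc A) (sum_bundle L) (Omega \<tau> \<omega>X) D) \<and>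
        (pseudo_hermitian_einstein (times_disc A) (sum_bundle L) H (Omega \<tau> \<omega>X) hE \<longrightarrow>
           exotic_vortex \<tau> A \<omega>X L \<phi> hL \<and>
           (\<forall>lam. einstein_equation (times_disc A) (sum_bundle L) (Omega \<tau> \<omega>X) D lam \<longrightarrow>
              lam = of_real (1 / 2 * (1 - 4 * pi / \<tau> * bundle_degree A L)))))"
proof -
 have \<tau>: "\<tau> < 0" and cc: "compact_connected_riemann_surface A" and \<omega>: "kahler_form A \<omega>X"
  and vol: "surface_integral A \<omega>X = 1" and L: "holomorphic_bundle A L" and hx: "holomorphic_extension A L H"
  using assms by simp_all
 have A: "complex_atlas A" and haus: "Hausdorff_space (atlas_topology A)" and ne: "points A ~= {}"
  and compact: "compact_space (atlas_topology A)" and conn: "connected_space (atlas_topology A)"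
  using cc unfolding compact_connected_riemann_surface_def complex_manifold_def by blast+
 have iii: "(pseudo_hermitian_einstein (times_disc A) (sum_bundle L) H (Omega \<tau> \<omega>X) hE \<longleftrightarrow>
      pseudo_hermitian_yang_mills (times_disc A) (sum_bundle L) (Omega \<tau> \<omega>X) D) \<and>
    (pseudo_hermitian_einstein (times_disc A) (sum_bundle L) H (Omega \<tau> \<omega>X) hE -->
      exotic_vortex \<tau> A \<omega>X L \<phi> hL \<and>
      (\<forall>lam. einstein_equation (times_disc A) (sum_bundle L) (Omega \<tau> \<omega>X) D lam -->
       lam = of_real (1/2 * (1 - 4 * pi/\<tau> * bundle_degree A L))))"
  if \<phi>: "holomorphic_section A L \<phi>" and dm: "dolbeault_matrix_form \<tau> A L H \<phi>"
   and hL: "hermitian_metric A L hL" and hX: "positive_function A hX" and C: "(C0,C1)\<in>{(1,- 1),(- 1,1)}"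
   and mm: "metric_matrix_form A L hE hL hX C0 C1" and D: "chern_connection (times_disc A) (sum_bundle L) H hE D"
  for hE \<phi> hL hX C0 C1 D
 proof -
  have C1: "C1 ~= 0" and C0: "C0 = - C1" using C by auto
  note mm' = mm[unfolded C0]
  have eq: "pseudo_hermitian_einstein (times_disc A) (sum_bundle L) H (Omega \<tau> \<omega>X) hE \<longleftrightarrow>
    (\<exists>lam. einstein_equation (times_disc A) (sum_bundle L) (Omega \<tau> \<omega>X) D lam)"
   unfolding pseudo_hermitian_einstein_def
   using einstein_equation_unique[OF A L hx hL hX C1 mm' _ D] D by blast
  show ?thesis
   unfolding eq pseudo_hermitian_yang_mills_def
   using einstein_vortex[OF A L hx hL hX C1 mm' D \<tau> \<omega> dm \<phi>]
    einstein_constant[OF A L hx hL hX C1 mm' D \<tau> \<omega> dm \<phi> _ compact haus ne vol] by blast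
 qed
 show ?thesis
 proof (intro conjI impI allI; (elim conjE)?)
  assume "equivariant_holomorphic A L H"
  then show "\<exists>\<phi>. holomorphic_section A L \<phi>\<and>dolbeault_matrix_form \<tau> A L H \<phi>"
   by (rule equivariant_extension_section[OF A L hx _ \<tau>])
 next
  fix hE assume "pseudo_hermitian_metric (1,1) (times_disc A) (sum_bundle L) hE" "invariant_form A L hE"
  then show "\<exists>hL hX C0 C1. hermitian_metric A L hL\<and>positive_function A hX \<and>
      (C0,C1)\<in>{(1,- 1),(- 1,1)}\<and>metric_matrix_form A L hE hL hX C0 C1"
   by (rule invariant_metric_splitting[OF A L hx conn])
 qed (use iii in blast)+
qed

end
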